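(* Let $w$ be a majorant satisfying $\log\frac{1}{w(t)} \asymp \log\frac{1}{w(t^2)}$ for $0<t<1$, and suppose that $\mu$ is a positive finite singular Borel measure on $\partial\mathbb{D}$, decomposed as $\mu=\mu_P+\mu_C$ with respect to sets of finite $w$-entropy. Then for any $H^\infty$-function $f$ with Herglotz–Nevanlinna factorization $f=\mathcal{O}_f S_\mu B_\Lambda$ the following dichotomy holds: (i) The inner function $\Theta_0:=B_\Lambda S_{\mu_P}$ generates a proper $M_z$-invariant subspace of $\mathcal{G}_w$ satisfying the permanence property $$[\Theta_0]_{\mathcal{G}_w}\cap\mathcal{N}_+\subseteq\Theta_0\,\mathcal{N}_+ .$$ (ii) $\mathcal{O}_f S_{\mu_C}$ is cyclic in $\mathcal{G}_w$. Moreover, the shift invariant subspace generated by $f$ is completely determined by the corresponding pair $(\Lambda,\mu_P)$ and equals $[B_\Lambda S_{\mu_P}]_{\mathcal{G}_w}$.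
   Context: $\mathbb{D}$ is the open unit disc, $\partial\mathbb{D}$ the unit circle, $m$ the normalized Lebesgue measure on $\partial\mathbb{D}$. "Singular" for measures means singular with respect to $m$. $A\asymp B$ means $c^{-1}B\le A\le cB$ for some constant $c>0$ (here independent of $t$). $H^\infty$ is the algebra of bounded analytic functions in $\mathbb{D}$. $M_z$ denotes multiplication by $z$ (the shift operator); a closed subspace is shift invariant, or $M_z$-invariant, if $M_z$ maps it into itself. A modulus of continuity is a continuous, non-decreasing, sub-additive function on $[0,1]$ vanishing at $0$. A majorant is a continuous non-decreasing function $w$ on $[0,1]$ with $w(0)=0$ such that $w^\lambda$ is a modulus of continuity for some $\lambda>0$. $\mathcal{G}_w$ is the Banach space of analytic functions $g$ in $\mathbb{D}$ with $\lim_{|z|\to1-}w(1-|z|)g(z)=0$, with norm $\|g\|_{\mathcal{G}_w}=\sup_{z\in\mathbb{D}}w(1-|z|)|g(z)|$. $[g]_{\mathcal{G}_w}$ is the smallest closed $M_z$-invariant subspace of $\mathcal{G}_w$ containing $g$, called the shift invariant subspace generated by $g$; $g$ is cyclic in $\mathcal{G}_w$ if $[g]_{\mathcal{G}_w}=\mathcal{G}_w$. $\mathcal{N}$ is the Nevanlinna class: analytic $f$ in $\mathbb{D}$ with $\sup_{0<r<1}\int_{\partial\mathbb{D}}\log^+|f(r\zeta)|\,dm(\zeta)<\infty$. Functions $f\in\mathcal{N}$ have a unique Herglotz–Nevanlinna factorization $f=\mathcal{O}_f(S_{\mu_1}/S_{\mu_2})B_\Lambda$, where $\mathcal{O}_f(z)=\exp\big(\int_{\partial\mathbb{D}}\frac{\zeta+z}{\zeta-z}\log|f(\zeta)|\,dm(\zeta)\big)$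 is the outer factor; $S_\sigma(z)=\exp\big(-\int_{\partial\mathbb{D}}\frac{\zeta+z}{\zeta-z}\,d\sigma(\zeta)\big)$ is the singular inner function of a positive finite singular Borel measure $\sigma$; $\mu_1,\mu_2$ are mutually singular positive finite singular Borel measures; $B_\Lambda$ is the Blaschke product, including a unimodular constant factor, with zero sequence $\Lambda$ (the zeros of $f$ in $\mathbb{D}$). The Smirnov class $\mathcal{N}_+$ consists of the functions in $\mathcal{N}$ with factorization of the form $\mathcal{O}_f S_\sigma B_\Lambda$ (no singular inner factor in the denominator). A closed set $E\subset\partial\mathbb{D}$ of Lebesgue measure zero has finite $w$-entropy if $\int_{\partial\mathbb{D}}\log w(\mathrm{dist}(\zeta,E))\,dm(\zeta)>-\infty$, where $\mathrm{dist}$ is the unit-normalized distance along $\partial\mathbb{D}$. Each positive finite singular Borel measure $\mu$ on $\partial\mathbb{D}$ decomposes uniquely (up to $\mu$-null sets) as $\mu=\mu_P+\mu_C$, where $\mu_P$ is concentrated on a countable union of sets of finite $w$-entropy and $\mu_C$ does not charge any set of finite $w$-entropy.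
   Formalization: In (i), the subspace generated by Θ_0 is claimed to be proper only when Θ_0 is nonconstant; if Λ is empty and μ_P = 0 (e.g. f = 1), Θ_0 is constant and generates all of G_w, so the literal claim fails. *)

theory Defs
  imports "HOL-Complex_Analysis.Complex_Analysis"
begin

text \<open>
  Functions on the open unit disc are represented by total functions
  \<^typ>\<open>complex \<Rightarrow> complex\<close>; their values off the disc are irrelevant. All classes of
  functions below are invariant under changing values off the disc; for closed subspaces of
  \<open>growth_space w\<close> this holds because the norm does not see those values.
\<close>

abbreviation unit_disc :: "complex set" where
  "unit_disc \<equiv> ball 0 1"

abbreviation unit_circle :: "complex set" where
  "unit_circle \<equiv> sphere 0 1"

definition circle_borel :: "complex measure" where
  "circle_borel = restrict_space borel unit_circle"

definition circle_measure :: "complex measure" where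
  "circle_measure = distr (uniform_measure lborel {0..<2 * pi}) circle_borel cis"

definition mutually_singular :: "'a measure \<Rightarrow> 'a measure \<Rightarrow> bool" where
  "mutually_singular M N \<longleftrightarrow>
     (\<exists>A\<in>sets M \<inter> sets N. emeasure M A = 0 \<and> emeasure N (space N - A) = 0)"

definition singular_circle_measure :: "complex measure \<Rightarrow> bool" where
  "singular_circle_measure \<mu> \<longleftrightarrow>
     finite_measure \<mu> \<and> sets \<mu> = sets circle_borel \<and> mutually_singular circle_measure \<mu>"


definition modulus_of_continuity :: "(real \<Rightarrow> real) \<Rightarrow> bool" where
  "modulus_of_continuity \<omega> \<longleftrightarrow>
     continuous_on {0..1} \<omega> \<and> mono_on {0..1} \<omega> \<and> \<omega> 0 = 0 \<and>
     (\<forall>s t. 0 \<le> s \<longrightarrow> 0 \<le> t \<longrightarrow> s + t \<le> 1 \<longrightarrow> \<omega> (s + t) \<le> \<omega> s + \<omega> t)"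

definition majorant :: "(real \<Rightarrow> real) \<Rightarrow> bool" where
  "majorant w \<longleftrightarrow>
     continuous_on {0..1} w \<and> mono_on {0..1} w \<and> w 0 = 0 \<and>
     (\<exists>p>0. modulus_of_continuity (\<lambda>t. w t powr p))"

text \<open>
  The positivity clause makes the logarithms meaningful (in HOL, \<^term>\<open>ln 0 = (0::real)\<close>).
  For a majorant it only excludes \<open>w = 0\<close> on the whole interval, for which the
  expression defining the norm of \<open>growth_space w\<close> is not a norm.
\<close>

definition log_square_comparable :: "(real \<Rightarrow> real) \<Rightarrow> bool" where
  "log_square_comparable w \<longleftrightarrow>
     (\<forall>t\<in>{0<..1}. 0 < w t) \<and>
     (\<exists>c>0. \<forall>t\<in>{0<..<1}.
        inverse c * ln (1 / w (t\<^sup>2)) \<le> ln (1 / w t) \<and>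
        ln (1 / w t) \<le> c * ln (1 / w (t\<^sup>2)))"


definition growth_space :: "(real \<Rightarrow> real) \<Rightarrow> (complex \<Rightarrow> complex) set" where
  "growth_space w = {g. g holomorphic_on unit_disc \<and>
     ((\<lambda>z. complex_of_real (w (1 - norm z)) * g z) \<longlongrightarrow> 0) (filtercomap norm (at_left 1))}"

definition growth_norm :: "(real \<Rightarrow> real) \<Rightarrow> (complex \<Rightarrow> complex) \<Rightarrow> real" where
  "growth_norm w g = (SUP z\<in>unit_disc. w (1 - norm z) * norm (g z))"

definition closed_shift_invariant ::
  "(real \<Rightarrow> real) \<Rightarrow> (complex \<Rightarrow> complex) set \<Rightarrow> bool" where
  "closed_shift_invariant w S \<longleftrightarrow>
     S \<subseteq> growth_space w \<and>
     (\<lambda>z. 0) \<in> S \<and>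
     (\<forall>g\<in>S. \<forall>h\<in>S. (\<lambda>z. g z + h z) \<in> S) \<and>
     (\<forall>a. \<forall>g\<in>S. (\<lambda>z. a * g z) \<in> S) \<and>
     (\<forall>g\<in>growth_space w. (\<forall>e>0. \<exists>h\<in>S. growth_norm w (\<lambda>z. g z - h z) < e) \<longrightarrow> g \<in> S) \<and>
     (\<forall>g\<in>S. (\<lambda>z. z * g z) \<in> S)"

definition generated_subspace ::
  "(real \<Rightarrow> real) \<Rightarrow> (complex \<Rightarrow> complex) \<Rightarrow> (complex \<Rightarrow> complex) set" where
  "generated_subspace w g = closed_shift_invariant w hull {g}"

definition cyclic_in_growth_space :: "(real \<Rightarrow> real) \<Rightarrow> (complex \<Rightarrow> complex) \<Rightarrow> bool" where
  "cyclic_in_growth_space w g \<longleftrightarrow> g \<in> growth_space w \<and> generated_subspace w g = growth_space w"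


definition H_infinity :: "(complex \<Rightarrow> complex) set" where
  "H_infinity = {f. f holomorphic_on unit_disc \<and> bounded (f ` unit_disc)}"

definition nevanlinna_class :: "(complex \<Rightarrow> complex) set" where
  "nevanlinna_class = {f. f holomorphic_on unit_disc \<and>
     bdd_above ((\<lambda>r. \<integral>\<zeta>. max 0 (ln (norm (f (of_real r * \<zeta>)))) \<partial>circle_measure) ` {0<..<1})}"

text \<open>Radial limits; for functions in the Nevanlinna class they exist almost everywhere.\<close>

definition boundary_value :: "(complex \<Rightarrow> complex) \<Rightarrow> complex \<Rightarrow> complex" where
  "boundary_value f \<zeta> = Lim (at_left 1) (\<lambda>r. f (complex_of_real r * \<zeta>))"

definition outer_factor :: "(complex \<Rightarrow> complex) \<Rightarrow> complex \<Rightarrow> complex" where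
  "outer_factor f z =
     exp (\<integral>\<zeta>. (\<zeta> + z) / (\<zeta> - z) * complex_of_real (ln (norm (boundary_value f \<zeta>))) \<partial>circle_measure)"

definition singular_inner :: "complex measure \<Rightarrow> complex \<Rightarrow> complex" where
  "singular_inner \<sigma> z = exp (- (\<integral>\<zeta>. (\<zeta> + z) / (\<zeta> - z) \<partial>\<sigma>))"

text \<open>
  A finite or infinite zero sequence, repeated according to multiplicity, is a family \<open>\<Lambda>\<close>
  indexed by a set \<open>I\<close> of natural numbers; \<open>c\<close> is the unimodular constant factor.
\<close>

definition blaschke_sequence :: "nat set \<Rightarrow> (nat \<Rightarrow> complex) \<Rightarrow> bool" where
  "blaschke_sequence I \<Lambda> \<longleftrightarrow>
     (\<forall>n\<in>I. \<Lambda> n \<in> unit_disc) \<and> (\<lambda>n. 1 - norm (\<Lambda> n)) summable_on I"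

definition blaschke_factor :: "complex \<Rightarrow> complex \<Rightarrow> complex" where
  "blaschke_factor a z =
     (if a = 0 then z else of_real (norm a) / a * ((a - z) / (1 - cnj a * z)))"

definition blaschke_product :: "complex \<Rightarrow> nat set \<Rightarrow> (nat \<Rightarrow> complex) \<Rightarrow> complex \<Rightarrow> complex" where
  "blaschke_product c I \<Lambda> z = c * (\<Prod>n. if n \<in> I then blaschke_factor (\<Lambda> n) z else 1)"

text \<open>The factorization \<open>f = O\<^sub>f S\<^sub>\<sigma> B\<^sub>\<Lambda>\<close>, without singular inner factor in the denominator.\<close>

definition has_smirnov_factorization ::
  "(complex \<Rightarrow> complex) \<Rightarrow> complex measure \<Rightarrow> complex \<Rightarrow> nat set \<Rightarrow> (nat \<Rightarrow> complex) \<Rightarrow> bool" where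
  "has_smirnov_factorization f \<sigma> c I \<Lambda> \<longleftrightarrow>
     integrable circle_measure (\<lambda>\<zeta>. ln (norm (boundary_value f \<zeta>))) \<and>
     singular_circle_measure \<sigma> \<and> norm c = 1 \<and> blaschke_sequence I \<Lambda> \<and>
     (\<forall>z\<in>unit_disc. f z = outer_factor f z * singular_inner \<sigma> z * blaschke_product c I \<Lambda> z)"

text \<open>The zero function has no factorization but belongs to the class by convention.\<close>

definition smirnov_class :: "(complex \<Rightarrow> complex) set" where
  "smirnov_class = {f \<in> nevanlinna_class.
     (\<forall>z\<in>unit_disc. f z = 0) \<or> (\<exists>\<sigma> c I \<Lambda>. has_smirnov_factorization f \<sigma> c I \<Lambda>)}"


text \<open>Arc length, normalized so that the whole circle has length 1.\<close>

definition arc_dist :: "complex \<Rightarrow> complex \<Rightarrow> real" where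
  "arc_dist \<zeta> \<xi> = \<bar>Arg (\<zeta> / \<xi>)\<bar> / (2 * pi)"

definition arc_setdist :: "complex \<Rightarrow> complex set \<Rightarrow> real" where
  "arc_setdist \<zeta> E = (INF \<xi>\<in>E. arc_dist \<zeta> \<xi>)"

text \<open>
  The integrand \<open>log w(dist(\<zeta>, E))\<close> is bounded above, so its integral exceeds
  \<open>-\<infinity>\<close> if and only if it is integrable. The set \<open>E\<close> is taken to be nonempty because
  the distance to the empty set is undefined; no measure charges the empty set.
\<close>

definition finite_entropy :: "(real \<Rightarrow> real) \<Rightarrow> complex set \<Rightarrow> bool" where
  "finite_entropy w E \<longleftrightarrow>
     closed E \<and> E \<subseteq> unit_circle \<and> E \<noteq> {} \<and> emeasure circle_measure E = 0 \<and>
     integrable circle_measure (\<lambda>\<zeta>. ln (w (arc_setdist \<zeta> E)))"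

definition entropy_decomposition ::
  "(real \<Rightarrow> real) \<Rightarrow> complex measure \<Rightarrow> complex measure \<Rightarrow> complex measure \<Rightarrow> bool" where
  "entropy_decomposition w \<mu> \<mu>P \<mu>C \<longleftrightarrow>
     sets \<mu>P = sets \<mu> \<and> sets \<mu>C = sets \<mu> \<and>
     (\<forall>A\<in>sets \<mu>. emeasure \<mu> A = emeasure \<mu>P A + emeasure \<mu>C A) \<and>
     (\<exists>\<E>. countable \<E> \<and> (\<forall>E\<in>\<E>. finite_entropy w E) \<and> emeasure \<mu>P (space \<mu>P - \<Union>\<E>) = 0) \<and>
     (\<forall>E. finite_entropy w E \<longrightarrow> emeasure \<mu>C E = 0)"

end

theory Submission
  imports Defs
begin

text \<open>
  Cyclicity and permanence are two halves of one comparison between \<open>w\<close> and entropy.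

  If \<open>\<mu>\<^sub>C\<close> charges no set of finite \<open>w\<close>-entropy, Roberts' grating writes it as a sum of measures
  \<open>\<nu>\<^sub>k\<close>, each spread evenly over the dyadic arcs of length \<open>2\<^sup>-\<^sup>n\<close>, \<open>n = n\<^sub>k\<close>, plus a remainder
  whose mass tends to zero: what survives every step is carried by a set of finite entropy. If \<open>S\<close>
  is the singular inner function of \<open>\<nu>\<^sub>k\<close>, then \<open>1 / S(\<rho> z)\<close>, \<open>\<rho> = 1 - 2\<^sup>-\<^sup>n\<close>, is a bounded
  approximate inverse of \<open>S\<close>, and the errors are summable when \<open>log (1 / w(2\<^sup>-\<^sup>n))\<close> grows
  geometrically in \<open>k\<close>. The outer factor is inverted by truncating its logarithm. Multiplying \<open>f\<close> by
  approximate inverses of its cyclic factor recovers \<open>\<Theta>\<^sub>0\<close> as a limit.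

  Conversely let \<open>E\<close> have finite entropy, let \<open>V\<close> be the Herglotz integral of
  \<open>- log w(dist(\<zeta>, E))\<close>, and let \<open>S\<^sub>E\<close> be the singular inner function of the part of \<open>\<mu>\<close> on \<open>E\<close>.
  Where \<open>dist(z, E)\<^sup>2 \<le> 1 - |z|\<close>, the comparability of \<open>w(t)\<close> and \<open>w(t\<^sup>2)\<close> gives
  \<open>- log w(1 - |z|) \<le> K Re V(z)\<close>; on the rest of the disc \<open>|S\<^sub>E|\<close> is bounded below. By the maximum
  principle, a limit \<open>h\<close> of multiples of \<open>\<Theta>\<^sub>0\<close> satisfies \<open>|h| \<le> M |S\<^sub>E| exp (K Re V)\<close> on the first
  region. Since \<open>V\<close> comes from an absolutely continuous measure, comparing
  Poisson integrals shows that the part of \<open>\<mu>\<close> on \<open>E\<close> is dominated by the singular measure of \<open>h\<close>.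
\<close>

section \<open>Normalized Lebesgue measure on the circle\<close>

text \<open>Two obstacles shape the permanence half. The multipliers \<open>p\<close> that
  approximate an element of the generated subspace have no common bound; only \<open>w\<close> times
  their product with the inner function is bounded uniformly. The maximum principle is therefore
  applied to that product divided by \<open>S_E\<close>: on the separating curve \<open>S_E\<close>
  is bounded below and the bound is uniform, while the bound that depends on \<open>p\<close> is
  needed only near the circle, where an arbitrarily small power of the entropy outer function
  suppresses it. Moreover the Smirnov class is defined through radial boundary values, so the
  quotient of \<open>h\<close> by the inner function must be shown to have the outer factor of
  \<open>h\<close>. This rests on unimodular radial limits of inner functions, which a weak type
  maximal inequality supplies. Properness in (i) is permanence for the constant function 1: a
  divisor of 1 has neither zeros nor singular mass. In the cyclicity half the product of the
  approximate inverses grows from step to step; the constants are such that this growth uses up only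
  half of the gain from the weight.\<close>

lemma space_circle_borel [simp]: "space circle_borel = unit_circle"
  by (simp add: circle_borel_def space_restrict_space)

lemma sets_circle_measure [simp, measurable_cong]: "sets circle_measure = sets circle_borel"
  by (simp add: circle_measure_def)

lemma space_circle_measure [simp]: "space circle_measure = unit_circle"
  by (simp add: circle_measure_def)

lemma sets_circle_borel_iff: "A \<in> sets circle_borel \<longleftrightarrow> A \<in> sets borel \<and> A \<subseteq> unit_circle"
  unfolding circle_borel_def by (subst sets_restrict_space_iff) (auto simp: borel_closed)

lemma measurable_cis [measurable]: "cis \<in> borel \<rightarrow>\<^sub>M circle_borel"
  unfolding circle_borel_def
  by (intro measurable_restrict_space2 borel_measurable_continuous_onI continuous_intros) (auto simp: norm_cis)

lemma measurable_circle_borel_borel [measurable]: "(\<lambda>z. z) \<in> circle_borel \<rightarrow>\<^sub>M borel"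
  unfolding circle_borel_def by (simp add: measurable_restrict_space1)

lemma measurable_circle_continuous:
  fixes f :: "complex \<Rightarrow> 'b::topological_space"
  assumes "continuous_on unit_circle f"
  shows "f \<in> borel_measurable circle_borel"
  unfolding circle_borel_def by (rule borel_measurable_continuous_on_restrict[OF assms])

lemma emeasure_circle_measure:
  assumes "A \<in> sets circle_borel"
  shows "emeasure circle_measure A = emeasure lborel {x \<in> {0..<2*pi}. cis x \<in> A} / ennreal (2*pi)"
proof -
  have [measurable]: "cis -` A \<in> sets borel"
    using measurable_sets[OF measurable_cis assms] by simp
  have "emeasure circle_measure A = emeasure (uniform_measure lborel {0..<2*pi}) (cis -` A)"
    unfolding circle_measure_def using assms by (subst emeasure_distr) auto
  also have "\<dots> = emeasure lborel ({0..<2*pi} \<inter> cis -` A) / emeasure lborel {0..<2*pi}"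
    by (subst emeasure_uniform_measure) auto
  also have "{0..<2*pi} \<inter> cis -` A = {x \<in> {0..<2*pi}. cis x \<in> A}" by auto
  finally show ?thesis by simp
qed

lemma emeasure_lborel_shift:
  assumes "A \<in> sets (borel :: real measure)"
  shows "emeasure lborel {x. x + c \<in> A} = emeasure lborel A"
proof -
  have "emeasure lborel A = emeasure (distr lborel borel ((+) c)) A"
    by (simp add: lborel_distr_plus)
  also have "\<dots> = emeasure lborel ((+) c -` A)"
    using assms by (subst emeasure_distr) auto
  also have "(+) c -` A = {x. x + c \<in> A}" by (auto simp: add.commute)
  finally show ?thesis ..
qed

lemma cis_add_2pi_int: "cis (x + 2 * pi * of_int k) = cis x"
  by (metis cis_mult cis_multiple_2pi Ints_of_int mult.right_neutral)

text \<open>Lets angles be centred at any point, away from the cut at 0. The window is moved by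
  whole turns to one that starts in \<open>{0..<2 * pi}\<close>, and the part of it beyond
  \<open>2 * pi\<close> is moved back by one turn.\<close>

lemma emeasure_circle_measure_window:
  assumes A: "A \<in> sets circle_borel"
  shows "emeasure circle_measure A = emeasure lborel {x \<in> {a..<a+2*pi}. cis x \<in> A} / ennreal (2*pi)"
proof -
  have mA [measurable]: "{x. cis x \<in> A} \<in> sets borel"
    using measurable_sets[OF measurable_cis A] by (simp add: vimage_def)
  define k where "k = \<lfloor>a / (2*pi)\<rfloor>"
  define b where "b = a - 2 * pi * of_int k"
  have b: "0 \<le> b" "b < 2*pi"
  proof -
    have "of_int k \<le> a / (2*pi)" "a / (2*pi) < of_int k + 1" unfolding k_def by linarith+
    then show "0 \<le> b" "b < 2*pi" unfolding b_def by (auto simp: field_simps)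
  qed
  let ?S = "\<lambda>u v. {x \<in> {u..<v}. cis x \<in> A}"
  have mS [measurable]: "?S u v \<in> sets borel" for u v
  proof -
    have "?S u v = {u..<v} \<inter> {x. cis x \<in> A}" by auto
    then show ?thesis using mA by auto
  qed
  have shift: "emeasure lborel (?S (u + 2 * pi * of_int j) (v + 2 * pi * of_int j)) = emeasure lborel (?S u v)" for u v j
  proof -
    have *: "?S u v = {x. x + 2 * pi * of_int j \<in> ?S (u + 2 * pi * of_int j) (v + 2 * pi * of_int j)}"
      by (auto simp: cis_add_2pi_int)
    show ?thesis
      by (rule trans[OF emeasure_lborel_shift[OF mS, symmetric] arg_cong[OF *[symmetric], of "emeasure lborel"]])
  qed
  have split: "emeasure lborel (?S u v) + emeasure lborel (?S v t) = emeasure lborel (?S u t)"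
    if "u \<le> v" "v \<le> t" for u v t
  proof -
    have "?S u t = ?S u v \<union> ?S v t" "?S u v \<inter> ?S v t = {}" using that by auto
    then show ?thesis using mS by (simp add: plus_emeasure)
  qed
  have "emeasure lborel (?S a (a+2*pi)) = emeasure lborel (?S b (b+2*pi))"
    using shift[of b k "b+2*pi"] by (simp add: b_def algebra_simps)
  also have "\<dots> = emeasure lborel (?S b (2*pi)) + emeasure lborel (?S (2*pi) (b+2*pi))"
    using b by (subst split) auto
  also have "emeasure lborel (?S (2*pi) (b+2*pi)) = emeasure lborel (?S 0 b)"
    using shift[of 0 1 b] by simp
  also have "emeasure lborel (?S b (2*pi)) + emeasure lborel (?S 0 b) = emeasure lborel (?S 0 (2*pi))"
    using b split[of 0 b "2*pi"] by (simp add: add.commute)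
  finally show ?thesis using emeasure_circle_measure[OF A] by simp
qed

lemma emeasure_circle_measure_UNIV: "emeasure circle_measure unit_circle = 1"
proof -
  have "emeasure circle_measure unit_circle = emeasure lborel {x \<in> {0..<2*pi}. cis x \<in> unit_circle} / ennreal (2*pi)"
    by (rule emeasure_circle_measure) (metis sets.top space_circle_borel)
  also have "{x \<in> {0..<2*pi}. cis x \<in> unit_circle} = {0..<2*pi}" by (auto simp: norm_cis)
  also have "emeasure lborel {0..<2*pi} / ennreal (2*pi) = 1"
    by (simp add: divide_ennreal)
  finally show ?thesis .
qed

interpretation circle: finite_measure circle_measure
  by standard (simp add: emeasure_circle_measure_UNIV)

lemma measure_circle_measure_UNIV [simp]: "measure circle_measure unit_circle = 1"
  by (simp add: measure_def emeasure_circle_measure_UNIV)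

lemma measurable_rotate: "(\<lambda>\<zeta>. cis a * \<zeta>) \<in> circle_borel \<rightarrow>\<^sub>M circle_borel"
  unfolding circle_borel_def
  by (intro measurable_restrict_space2 borel_measurable_continuous_on_restrict continuous_intros)
     (auto simp: norm_mult norm_cis space_restrict_space)

lemma distr_circle_measure_rotate: "distr circle_measure circle_borel (\<lambda>\<zeta>. cis a * \<zeta>) = circle_measure"
proof (rule measure_eqI)
  fix A assume "A \<in> sets (distr circle_measure circle_borel (\<lambda>\<zeta>. cis a * \<zeta>))"
  then have A: "A \<in> sets circle_borel" by simp
  let ?B = "(\<lambda>\<zeta>. cis a * \<zeta>) -` A \<inter> unit_circle"
  have mB: "?B \<in> sets circle_borel" using measurable_sets[OF measurable_rotate A] by simp
  have mA: "{x. cis x \<in> A} \<in> sets borel"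
    using measurable_sets[OF measurable_cis A] by (simp add: vimage_def)
  have "emeasure (distr circle_measure circle_borel (\<lambda>\<zeta>. cis a * \<zeta>)) A = emeasure circle_measure ?B"
    using A measurable_rotate by (subst emeasure_distr) (auto simp: measurable_cong_sets[OF sets_circle_measure refl])
  also have "\<dots> = emeasure lborel {x \<in> {0..<2*pi}. cis x \<in> ?B} / ennreal (2*pi)"
    by (rule emeasure_circle_measure[OF mB])
  also have "{x \<in> {0..<2*pi}. cis x \<in> ?B} = {x. x + a \<in> {x \<in> {a..<a+2*pi}. cis x \<in> A}}"
    by (auto simp: cis_mult norm_cis add.commute)
  also have "emeasure lborel \<dots> = emeasure lborel {x \<in> {a..<a+2*pi}. cis x \<in> A}"
  proof (rule emeasure_lborel_shift)
    have "{x \<in> {a..<a+2*pi}. cis x \<in> A} = {a..<a+2*pi} \<inter> {x. cis x \<in> A}" by auto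
    then show "{x \<in> {a..<a+2*pi}. cis x \<in> A} \<in> sets borel" using mA by auto
  qed
  also have "\<dots> / ennreal (2*pi) = emeasure circle_measure A"
    using emeasure_circle_measure_window[OF A] by simp
  finally show "emeasure (distr circle_measure circle_borel (\<lambda>\<zeta>. cis a * \<zeta>)) A = emeasure circle_measure A" .
qed simp

section \<open>Finite Borel measures on the circle\<close>

definition circle_finite :: "complex measure \<Rightarrow> bool" where
  "circle_finite \<nu> \<longleftrightarrow> finite_measure \<nu> \<and> sets \<nu> = sets circle_borel"

lemma circle_finiteD:
  assumes "circle_finite \<nu>"
  shows "finite_measure \<nu>" "sets \<nu> = sets circle_borel" "space \<nu> = unit_circle"
  using assms sets_eq_imp_space_eq[of \<nu> circle_borel] by (auto simp: circle_finite_def)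

lemma circle_finite_circle_measure [simp]: "circle_finite circle_measure"
  by (simp add: circle_finite_def circle.finite_measure_axioms)

lemma borel_measurable_circle_finite:
  "circle_finite \<nu> \<Longrightarrow> borel_measurable \<nu> = borel_measurable circle_borel"
  by (intro measurable_cong_sets) (auto simp: circle_finite_def)

lemma integrable_bounded_circle:
  fixes f :: "complex \<Rightarrow> 'b::{banach, second_countable_topology}"
  assumes \<nu>: "circle_finite \<nu>" and f: "f \<in> borel_measurable circle_borel"
    and B: "\<And>\<zeta>. \<zeta> \<in> unit_circle \<Longrightarrow> norm (f \<zeta>) \<le> B"
  shows "integrable \<nu> f"
proof -
  interpret finite_measure \<nu> using circle_finiteD[OF \<nu>] by simp
  show ?thesis
    using f B borel_measurable_circle_finite[OF \<nu>]
    by (intro integrable_const_bound[where B=B]) (auto simp: circle_finiteD[OF \<nu>])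
qed

lemma integrable_continuous_circle:
  fixes f :: "complex \<Rightarrow> 'b::{banach, second_countable_topology}"
  assumes \<nu>: "circle_finite \<nu>" and f: "continuous_on unit_circle f"
  shows "integrable \<nu> f"
proof -
  have "compact (f ` unit_circle)" by (intro compact_continuous_image f) auto
  then obtain B where "\<And>\<zeta>. \<zeta> \<in> unit_circle \<Longrightarrow> norm (f \<zeta>) \<le> B"
    using compact_imp_bounded bounded_iff by (metis imageI)
  then show ?thesis by (intro integrable_bounded_circle[OF \<nu> measurable_circle_continuous[OF f]])
qed

section \<open>Moments, coefficient formula and mean value\<close>

lemma circle_measure_moment:
  assumes "n > 0"
  shows "(\<integral>\<zeta>. \<zeta> ^ n \<partial>circle_measure) = 0"
proof -
  \<comment> \<open>Rotation by \<open>pi / n\<close> preserves the measure and multiplies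
    \<open>\<zeta> ^ n\<close> by -1.\<close>
  let ?I = "\<integral>\<zeta>. \<zeta> ^ n \<partial>circle_measure" and ?a = "pi / real n"
  have meas: "(\<lambda>\<zeta>. \<zeta> ^ n) \<in> borel_measurable circle_borel"
    by (intro measurable_circle_continuous continuous_intros)
  have "?I = (\<integral>\<zeta>. \<zeta> ^ n \<partial>(distr circle_measure circle_borel (\<lambda>\<zeta>. cis ?a * \<zeta>)))"
    by (simp add: distr_circle_measure_rotate)
  also have "\<dots> = (\<integral>\<zeta>. (cis ?a * \<zeta>) ^ n \<partial>circle_measure)"
    using meas measurable_rotate by (intro integral_distr) (auto simp: measurable_cong_sets[OF sets_circle_measure refl])
  also have "\<dots> = (\<integral>\<zeta>. - (\<zeta> ^ n) \<partial>circle_measure)"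
  proof -
    have "cis ?a ^ n = cis (real n * ?a)" by (rule Complex.DeMoivre)
    then have "cis ?a ^ n = -1" using assms by simp
    then show ?thesis by (simp add: power_mult_distrib)
  qed
  also have "\<dots> = - ?I" by simp
  finally show ?thesis by simp
qed

text \<open>Since \<open>R > 1\<close>, the power series converges absolutely on the closed unit
  disc and can be integrated term by term; by orthogonality of the monomials only the term
  \<open>n = j\<close> survives.\<close>

lemma circle_integral_power_series:
  fixes k :: "complex \<Rightarrow> complex"
  assumes hol: "k holomorphic_on ball 0 R" and R: "R > 1"
  shows "(\<integral>\<zeta>. k \<zeta> * inverse (\<zeta> ^ j) \<partial>circle_measure) = (deriv ^^ j) k 0 / fact j"
    and "summable (\<lambda>n. norm ((deriv ^^ n) k 0 / fact n))"
proof -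
  define a where "a n = (deriv ^^ n) k 0 / fact n" for n
  have ser: "(\<lambda>n. a n * z ^ n) sums k z" if "norm z < R" for z
    using holomorphic_power_series[OF hol, of z] that by (simp add: a_def)
  obtain r where r: "1 < r" "r < R" using R dense by blast
  have "summable (\<lambda>n. a n * of_real r ^ n)" using ser[of "of_real r"] r by (auto simp: sums_iff)
  then have sa: "summable (\<lambda>n. norm (a n * 1 ^ n))"
    by (rule powser_insidea) (use r in auto)
  then show "summable (\<lambda>n. norm ((deriv ^^ n) k 0 / fact n))" by (simp add: a_def)
  have int: "integrable circle_measure (\<lambda>\<zeta>. a n * \<zeta> ^ n * inverse (\<zeta> ^ j))" for n
    by (intro integrable_continuous_circle continuous_intros) auto
  have val: "(\<integral>\<zeta>. a n * \<zeta> ^ n * inverse (\<zeta> ^ j) \<partial>circle_measure) = (if n = j then a j else 0)" for n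
  proof -
    have "(\<integral>\<zeta>. \<zeta> ^ n * inverse (\<zeta> ^ j) \<partial>circle_measure) = (if n = j then 1 else 0)"
    proof (cases n j rule: linorder_cases)
      case equal
      have "(\<integral>\<zeta>. \<zeta> ^ n * inverse (\<zeta> ^ j) \<partial>circle_measure) = (\<integral>\<zeta>. 1 \<partial>circle_measure)"
        by (intro Bochner_Integration.integral_cong refl) (use equal in \<open>auto intro!: right_inverse\<close>)
      then show ?thesis using equal by simp
    next
      case greater
      have "(\<integral>\<zeta>. \<zeta> ^ n * inverse (\<zeta> ^ j) \<partial>circle_measure) = (\<integral>\<zeta>. \<zeta> ^ (n - j) \<partial>circle_measure)"
      proof (intro Bochner_Integration.integral_cong refl)
        fix \<zeta> assume "\<zeta> \<in> space circle_measure"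
        then have "\<zeta> \<noteq> 0" by auto
        then show "\<zeta> ^ n * inverse (\<zeta> ^ j) = \<zeta> ^ (n - j)"
          using greater by (simp add: power_diff divide_inverse)
      qed
      also have "\<dots> = 0" using greater by (intro circle_measure_moment) simp
      finally show ?thesis using greater by simp
    next
      \<comment> \<open>On the circle the inverse is the conjugate, so negative moments are
        conjugates of positive ones.\<close>
      case less
      have "(\<integral>\<zeta>. \<zeta> ^ n * inverse (\<zeta> ^ j) \<partial>circle_measure) = (\<integral>\<zeta>. cnj (\<zeta> ^ (j - n)) \<partial>circle_measure)"
      proof (intro Bochner_Integration.integral_cong refl)
        fix \<zeta> assume "\<zeta> \<in> space circle_measure"
        then have nz: "norm \<zeta> = 1" "\<zeta> \<noteq> 0" by auto
        then have "\<zeta> * cnj \<zeta> = 1" by (metis complex_norm_square of_real_1 power_one)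
        then have "cnj \<zeta> = inverse \<zeta>" by (metis inverse_unique)
        moreover have "\<zeta> ^ j = \<zeta> ^ n * \<zeta> ^ (j - n)"
          using less by (simp flip: power_add)
        ultimately show "\<zeta> ^ n * inverse (\<zeta> ^ j) = cnj (\<zeta> ^ (j - n))"
          using nz(2) by (simp add: power_inverse)
      qed
      also have "\<dots> = cnj (\<integral>\<zeta>. \<zeta> ^ (j - n) \<partial>circle_measure)" by (rule Bochner_Integration.integral_cnj)
      also have "(\<integral>\<zeta>. \<zeta> ^ (j - n) \<partial>circle_measure) = 0"
        using less by (intro circle_measure_moment) simp
      finally show ?thesis using less by simp
    qed
    then show ?thesis by (simp add: mult.assoc)
  qed
  have "(\<lambda>n. \<integral>\<zeta>. a n * \<zeta> ^ n * inverse (\<zeta> ^ j) \<partial>circle_measure) sums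
      (\<integral>\<zeta>. (\<Sum>n. a n * \<zeta> ^ n * inverse (\<zeta> ^ j)) \<partial>circle_measure)"
  proof (rule sums_integral[OF int])
    show "AE \<zeta> in circle_measure. summable (\<lambda>n. norm (a n * \<zeta> ^ n * inverse (\<zeta> ^ j)))"
    proof (intro AE_I2)
      fix \<zeta> :: complex assume "\<zeta> \<in> space circle_measure"
      then have "norm (a n * \<zeta> ^ n * inverse (\<zeta> ^ j)) = norm (a n)" for n
        by (simp add: norm_mult norm_power norm_inverse)
      then show "summable (\<lambda>n. norm (a n * \<zeta> ^ n * inverse (\<zeta> ^ j)))" using sa by simp
    qed
    show "summable (\<lambda>n. \<integral>\<zeta>. norm (a n * \<zeta> ^ n * inverse (\<zeta> ^ j)) \<partial>circle_measure)"
    proof -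
      have "(\<integral>\<zeta>. norm (a n * \<zeta> ^ n * inverse (\<zeta> ^ j)) \<partial>circle_measure) = (\<integral>\<zeta>. norm (a n) \<partial>circle_measure)" for n
        by (intro Bochner_Integration.integral_cong refl) (simp add: norm_mult norm_power norm_inverse)
      also have "(\<integral>\<zeta>. norm (a n) \<partial>circle_measure) = norm (a n)" for n by simp
      finally show ?thesis using sa by simp
    qed
  qed
  moreover have "(\<integral>\<zeta>. (\<Sum>n. a n * \<zeta> ^ n * inverse (\<zeta> ^ j)) \<partial>circle_measure) = (\<integral>\<zeta>. k \<zeta> * inverse (\<zeta> ^ j) \<partial>circle_measure)"
  proof (intro Bochner_Integration.integral_cong refl)
    fix \<zeta> assume "\<zeta> \<in> space circle_measure"
    then have "(\<lambda>n. a n * \<zeta> ^ n) sums k \<zeta>" using R ser by auto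
    from sums_mult2[OF this, of "inverse (\<zeta> ^ j)"]
    show "(\<Sum>n. a n * \<zeta> ^ n * inverse (\<zeta> ^ j)) = k \<zeta> * inverse (\<zeta> ^ j)" by (simp add: sums_iff)
  qed
  ultimately have "(\<lambda>n. if n = j then a j else 0) sums (\<integral>\<zeta>. k \<zeta> * inverse (\<zeta> ^ j) \<partial>circle_measure)"
    by (simp only: val)
  moreover have "(\<lambda>n. if n = j then a j else 0) sums a j" using sums_single[of j "\<lambda>_. a j"] by simp
  ultimately have "(\<integral>\<zeta>. k \<zeta> * inverse (\<zeta> ^ j) \<partial>circle_measure) = a j" by (rule sums_unique2)
  then show "(\<integral>\<zeta>. k \<zeta> * inverse (\<zeta> ^ j) \<partial>circle_measure) = (deriv ^^ j) k 0 / fact j"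
    by (simp only: a_def)
qed

lemma circle_mean_value:
  assumes "k holomorphic_on ball 0 R" "R > 1"
  shows "(\<integral>\<zeta>. k \<zeta> \<partial>circle_measure) = k 0"
proof -
  have "(\<integral>\<zeta>. k \<zeta> * inverse (\<zeta> ^ 0) \<partial>circle_measure) = (deriv ^^ 0) k 0 / fact 0"
    by (rule circle_integral_power_series(1)[OF assms])
  then show ?thesis by simp
qed

lemma holomorphic_on_dilate:
  assumes "f holomorphic_on unit_disc" "0 < r" "r < 1"
  shows "(\<lambda>z. f (of_real r * z)) holomorphic_on ball 0 (1/r)"
proof -
  have sub: "(\<lambda>z. of_real r * z) ` ball 0 (1/r) \<subseteq> unit_disc"
    using assms(2) by (auto simp: norm_mult pos_less_divide_eq mult.commute)
  have "(f \<circ> (\<lambda>z. of_real r * z)) holomorphic_on ball 0 (1/r)"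
    by (intro holomorphic_on_compose_gen[OF _ assms(1) sub] holomorphic_intros)
  then show ?thesis by (simp only: o_def)
qed

lemma circle_mean_value_disc:
  assumes "f holomorphic_on unit_disc" "0 < r" "r < 1"
  shows "(\<integral>\<zeta>. f (of_real r * \<zeta>) \<partial>circle_measure) = f 0"
proof -
  have "1 < 1 / r" using assms by simp
  from circle_mean_value[OF holomorphic_on_dilate[OF assms] this] show ?thesis by simp
qed

section \<open>Herglotz integrals\<close>

definition herglotz :: "complex measure \<Rightarrow> complex \<Rightarrow> complex" where
  "herglotz \<nu> z = (\<integral>\<zeta>. (\<zeta> + z) / (\<zeta> - z) \<partial>\<nu>)"

definition poisson_kernel :: "complex \<Rightarrow> complex \<Rightarrow> real" where
  "poisson_kernel z \<zeta> = (1 - (norm z)\<^sup>2) / (norm (\<zeta> - z))\<^sup>2"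

lemma singular_inner_herglotz: "singular_inner \<nu> z = exp (- herglotz \<nu> z)"
  by (simp add: singular_inner_def herglotz_def)

lemma circle_disc_dist: "norm \<zeta> = 1 \<Longrightarrow> norm z < 1 \<Longrightarrow> 0 < 1 - norm z \<and> 1 - norm z \<le> norm (\<zeta> - z)"
  using norm_triangle_ineq2[of \<zeta> z] by auto

lemma continuous_on_herglotz_kernel [continuous_intros]:
  "norm z < 1 \<Longrightarrow> continuous_on unit_circle (\<lambda>\<zeta>. (\<zeta> + z) / (\<zeta> - z))"
  by (intro continuous_intros) auto

lemma continuous_on_poisson_kernel [continuous_intros]:
  "norm z < 1 \<Longrightarrow> continuous_on unit_circle (poisson_kernel z)"
  unfolding poisson_kernel_def by (intro continuous_intros) auto

lemma poisson_kernel_pos: "norm \<zeta> = 1 \<Longrightarrow> norm z < 1 \<Longrightarrow> poisson_kernel z \<zeta> > 0"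
  unfolding poisson_kernel_def
  by (intro divide_pos_pos) (auto simp: abs_square_less_1)

lemma Re_herglotz_kernel:
  assumes "norm \<zeta> = 1" "norm z < 1"
  shows "Re ((\<zeta> + z) / (\<zeta> - z)) = poisson_kernel z \<zeta>"
proof -
  have "Re ((\<zeta> + z) / (\<zeta> - z)) = Re ((\<zeta> + z) * cnj (\<zeta> - z)) / (norm (\<zeta> - z))\<^sup>2"
    by (subst complex_div_cnj) (simp add: Re_divide_of_real flip: of_real_power)
  also have "Re ((\<zeta> + z) * cnj (\<zeta> - z)) = (norm \<zeta>)\<^sup>2 - (norm z)\<^sup>2"
    by (simp only: cmod_power2) (simp add: algebra_simps power2_eq_square)
  finally show ?thesis using assms by (simp add: poisson_kernel_def)
qed

lemma integrable_herglotz_kernel: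
  "circle_finite \<nu> \<Longrightarrow> norm z < 1 \<Longrightarrow> integrable \<nu> (\<lambda>\<zeta>. (\<zeta> + z) / (\<zeta> - z))"
  by (intro integrable_continuous_circle continuous_intros)

lemma integrable_poisson_kernel:
  "circle_finite \<nu> \<Longrightarrow> norm z < 1 \<Longrightarrow> integrable \<nu> (poisson_kernel z)"
  by (intro integrable_continuous_circle continuous_intros)

lemma Re_herglotz:
  assumes "circle_finite \<nu>" "norm z < 1"
  shows "Re (herglotz \<nu> z) = (\<integral>\<zeta>. poisson_kernel z \<zeta> \<partial>\<nu>)"
proof -
  have "Re (herglotz \<nu> z) = (\<integral>\<zeta>. Re ((\<zeta> + z) / (\<zeta> - z)) \<partial>\<nu>)"
    unfolding herglotz_def using integrable_herglotz_kernel[OF assms] by (rule integral_Re[symmetric])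
  also have "\<dots> = (\<integral>\<zeta>. poisson_kernel z \<zeta> \<partial>\<nu>)"
    using assms Re_herglotz_kernel by (intro Bochner_Integration.integral_cong) (auto simp: circle_finiteD)
  finally show ?thesis .
qed

lemma Re_herglotz_nonneg:
  assumes "circle_finite \<nu>" "norm z < 1"
  shows "Re (herglotz \<nu> z) \<ge> 0"
  unfolding Re_herglotz[OF assms]
  using assms poisson_kernel_pos by (intro Bochner_Integration.integral_nonneg_AE AE_I2) (auto simp: circle_finiteD less_imp_le)

lemma herglotz_0: "circle_finite \<nu> \<Longrightarrow> herglotz \<nu> 0 = of_real (measure \<nu> unit_circle)"
proof -
  assume \<nu>: "circle_finite \<nu>"
  have "herglotz \<nu> 0 = (\<integral>\<zeta>. 1 \<partial>\<nu>)"
    unfolding herglotz_def by (intro Bochner_Integration.integral_cong) (auto simp: circle_finiteD[OF \<nu>])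
  then show ?thesis by (simp add: circle_finiteD[OF \<nu>] scaleR_conv_of_real)
qed

lemma norm_circle_integral_le:
  fixes f :: "complex \<Rightarrow> 'b::{banach, second_countable_topology}"
  assumes \<nu>: "circle_finite \<nu>" and B: "\<And>\<zeta>. norm \<zeta> = 1 \<Longrightarrow> norm (f \<zeta>) \<le> B"
    and f: "f \<in> borel_measurable circle_borel"
  shows "norm (\<integral>\<zeta>. f \<zeta> \<partial>\<nu>) \<le> B * measure \<nu> unit_circle"
proof -
  interpret finite_measure \<nu> using circle_finiteD[OF \<nu>] by simp
  have int: "integrable \<nu> f" by (rule integrable_bounded_circle[OF \<nu> f, of B]) (use B in auto)
  have "norm (\<integral>\<zeta>. f \<zeta> \<partial>\<nu>) \<le> (\<integral>\<zeta>. norm (f \<zeta>) \<partial>\<nu>)" by (rule integral_norm_bound)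
  also have "\<dots> \<le> (\<integral>\<zeta>. B \<partial>\<nu>)"
    using int B by (intro integral_mono) (auto simp: circle_finiteD[OF \<nu>])
  also have "\<dots> = B * measure \<nu> unit_circle" by (simp add: circle_finiteD[OF \<nu>])
  finally show ?thesis .
qed

text \<open>The difference of the two kernels is
  \<open>2 * \<zeta> * (z - z') / ((\<zeta> - z) * (\<zeta> - z'))\<close>, and both factors of the
  denominator have modulus at least \<open>\<delta>\<close>. The bound controls the dilation error
  in \<open>one_step_inverse\<close>.\<close>

lemma herglotz_diff_bound:
  assumes \<nu>: "circle_finite \<nu>" and z: "norm z \<le> 1 - \<delta>" "norm z' \<le> 1 - \<delta>" and \<delta>: "0 < \<delta>"
  shows "norm (herglotz \<nu> z - herglotz \<nu> z') \<le> 2 * norm (z - z') / \<delta>\<^sup>2 * measure \<nu> unit_circle"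
proof -
  have z1: "norm z < 1" "norm z' < 1" using assms by auto
  have "herglotz \<nu> z - herglotz \<nu> z' = (\<integral>\<zeta>. (\<zeta> + z) / (\<zeta> - z) - (\<zeta> + z') / (\<zeta> - z') \<partial>\<nu>)"
    unfolding herglotz_def
    using integrable_herglotz_kernel[OF \<nu> z1(1)] integrable_herglotz_kernel[OF \<nu> z1(2)] by simp
  also have "norm \<dots> \<le> 2 * norm (z - z') / \<delta>\<^sup>2 * measure \<nu> unit_circle"
  proof (rule norm_circle_integral_le[OF \<nu>])
    show "(\<lambda>\<zeta>. (\<zeta> + z) / (\<zeta> - z) - (\<zeta> + z') / (\<zeta> - z')) \<in> borel_measurable circle_borel"
      using z1 by (intro measurable_circle_continuous continuous_intros) auto
  next
    fix \<zeta> :: complex assume \<zeta>: "norm \<zeta> = 1"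
    have nz: "\<zeta> - z \<noteq> 0" "\<zeta> - z' \<noteq> 0" using \<zeta> z1 by auto
    have d: "\<delta> \<le> norm (\<zeta> - z)" "\<delta> \<le> norm (\<zeta> - z')"
      using circle_disc_dist[OF \<zeta> z1(1)] circle_disc_dist[OF \<zeta> z1(2)] z by auto
    have "(\<zeta> + z) / (\<zeta> - z) - (\<zeta> + z') / (\<zeta> - z') = 2 * \<zeta> * (z - z') / ((\<zeta> - z) * (\<zeta> - z'))"
      using nz by (simp add: divide_simps) (simp add: algebra_simps)
    then have "norm ((\<zeta> + z) / (\<zeta> - z) - (\<zeta> + z') / (\<zeta> - z')) = 2 * norm (z - z') / (norm (\<zeta> - z) * norm (\<zeta> - z'))"
      using \<zeta> by (simp add: norm_mult norm_divide)
    also have "\<dots> \<le> 2 * norm (z - z') / \<delta>\<^sup>2"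
      unfolding power2_eq_square using d \<delta> by (intro divide_left_mono mult_mono mult_pos_pos) auto
    finally show "norm ((\<zeta> + z) / (\<zeta> - z) - (\<zeta> + z') / (\<zeta> - z')) \<le> 2 * norm (z - z') / \<delta>\<^sup>2" .
  qed
  finally show ?thesis .
qed

text \<open>For \<open>\<zeta>\<close> on the circle the kernel is 1 plus twice the geometric series
  of \<open>z / \<zeta>\<close> without its first term. Integration term by term therefore produces
  a power series in \<open>z\<close>; the functions \<open>b n\<close> are its coefficients before
  integration.\<close>

lemma herglotz_holomorphic:
  assumes \<nu>: "circle_finite \<nu>"
  shows "herglotz \<nu> holomorphic_on unit_disc"
proof -
  interpret finite_measure \<nu> using circle_finiteD[OF \<nu>] by simp
  define b where "b n \<zeta> = (if n = 0 then 1 else 2 * inverse (\<zeta> ^ n))" for n :: nat and \<zeta> :: complex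
  have int: "integrable \<nu> (\<lambda>\<zeta>. b n \<zeta> * z ^ n)" for n z
    unfolding b_def by (cases "n = 0") (auto intro!: integrable_continuous_circle[OF \<nu>] continuous_intros)
  have sums: "(\<lambda>n. (\<integral>\<zeta>. b n \<zeta> \<partial>\<nu>) * z ^ n) sums herglotz \<nu> z" if z: "norm z < 1" for z
  proof -
    have ptw: "(\<lambda>n. b n \<zeta> * z ^ n) sums ((\<zeta> + z) / (\<zeta> - z))" if \<zeta>: "norm \<zeta> = 1" for \<zeta>
    proof -
      have nz: "\<zeta> \<noteq> 0" "\<zeta> - z \<noteq> 0" using \<zeta> z by auto
      have "norm (z / \<zeta>) < 1" using \<zeta> z by (simp add: norm_divide)
      from geometric_sums[OF this] have "(\<lambda>n. 2 * (z / \<zeta>) ^ n) sums (2 * (1 / (1 - z / \<zeta>)))"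
        by (rule sums_mult)
      from sums_diff[OF this sums_single[of 0 "\<lambda>_. 1"]]
      have "(\<lambda>n. 2 * (z / \<zeta>) ^ n - (if n = 0 then 1 else 0)) sums (2 * (1 / (1 - z / \<zeta>)) - 1)" by simp
      moreover have "2 * (z / \<zeta>) ^ n - (if n = 0 then 1 else 0) = b n \<zeta> * z ^ n" for n
        by (simp add: b_def divide_inverse power_mult_distrib power_inverse)
      moreover have "2 * (1 / (1 - z / \<zeta>)) - 1 = (\<zeta> + z) / (\<zeta> - z)"
        using nz by (simp add: divide_simps)
      ultimately show ?thesis by simp
    qed
    have nb: "norm (b n \<zeta> * z ^ n) \<le> 2 * norm z ^ n" if "norm \<zeta> = 1" for n \<zeta>
      using that by (auto simp: b_def norm_mult norm_power norm_inverse)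
    have sm: "summable (\<lambda>n. 2 * norm z ^ n)" using z by (intro summable_mult summable_geometric) auto
    have "(\<lambda>n. \<integral>\<zeta>. b n \<zeta> * z ^ n \<partial>\<nu>) sums (\<integral>\<zeta>. (\<Sum>n. b n \<zeta> * z ^ n) \<partial>\<nu>)"
    proof (rule sums_integral[OF int])
      show "AE \<zeta> in \<nu>. summable (\<lambda>n. norm (b n \<zeta> * z ^ n))"
      proof (intro AE_I2)
        fix \<zeta> assume "\<zeta> \<in> space \<nu>"
        then have \<zeta>: "norm \<zeta> = 1" by (simp add: circle_finiteD[OF \<nu>])
        show "summable (\<lambda>n. norm (b n \<zeta> * z ^ n))"
          by (rule summable_comparison_test'[OF sm, of 0]) (use nb[OF \<zeta>] in simp)
      qed
      have "(\<integral>\<zeta>. norm (b n \<zeta> * z ^ n) \<partial>\<nu>) \<le> (\<integral>\<zeta>. 2 * norm z ^ n \<partial>\<nu>)" for n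
        using nb by (intro integral_mono integrable_norm int) (auto simp: circle_finiteD[OF \<nu>])
      then have "(\<integral>\<zeta>. norm (b n \<zeta> * z ^ n) \<partial>\<nu>) \<le> measure \<nu> unit_circle * (2 * norm z ^ n)" for n
        by (simp add: circle_finiteD[OF \<nu>] mult.assoc)
      then show "summable (\<lambda>n. \<integral>\<zeta>. norm (b n \<zeta> * z ^ n) \<partial>\<nu>)"
        by (intro summable_comparison_test'[OF summable_mult[OF sm], of 0]) auto
    qed
    moreover have "(\<integral>\<zeta>. (\<Sum>n. b n \<zeta> * z ^ n) \<partial>\<nu>) = herglotz \<nu> z"
      unfolding herglotz_def
      by (intro Bochner_Integration.integral_cong refl) (use ptw in \<open>auto simp: circle_finiteD[OF \<nu>] sums_iff\<close>)
    ultimately show ?thesis by simp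
  qed
  show ?thesis
    by (rule power_series_holomorphic[of 0 1 "\<lambda>n. (\<integral>\<zeta>. b n \<zeta> \<partial>\<nu>)"]) (use sums in auto)
qed

lemma singular_inner_holomorphic: "circle_finite \<nu> \<Longrightarrow> singular_inner \<nu> holomorphic_on unit_disc"
proof -
  assume "circle_finite \<nu>"
  then have "(\<lambda>z. exp (- herglotz \<nu> z)) holomorphic_on unit_disc"
    by (intro holomorphic_intros herglotz_holomorphic)
  then show ?thesis by (simp add: singular_inner_herglotz[abs_def])
qed

lemma norm_singular_inner: "norm (singular_inner \<nu> z) = exp (- Re (herglotz \<nu> z))"
  by (simp add: singular_inner_herglotz)

lemma norm_singular_inner_le: "circle_finite \<nu> \<Longrightarrow> norm z < 1 \<Longrightarrow> norm (singular_inner \<nu> z) \<le> 1"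
  using Re_herglotz_nonneg by (simp add: norm_singular_inner)

lemma singular_inner_nonzero [simp]: "singular_inner \<nu> z \<noteq> 0"
  by (simp add: singular_inner_herglotz)

section \<open>Sums and densities of measures\<close>

lemma nn_integral_add_measure:
  assumes s: "sets \<alpha> = sets \<mu>" "sets \<beta> = sets \<mu>"
    and add: "\<And>A. A \<in> sets \<mu> \<Longrightarrow> emeasure \<mu> A = emeasure \<alpha> A + emeasure \<beta> A"
    and f: "f \<in> borel_measurable \<mu>"
  shows "(\<integral>\<^sup>+x. f x \<partial>\<mu>) = (\<integral>\<^sup>+x. f x \<partial>\<alpha>) + (\<integral>\<^sup>+x. f x \<partial>\<beta>)"
proof -
  have mm: "borel_measurable \<alpha> = (borel_measurable \<mu> :: (_ \<Rightarrow> ennreal) set)"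
    "borel_measurable \<beta> = (borel_measurable \<mu> :: (_ \<Rightarrow> ennreal) set)"
    using s by (auto intro!: measurable_cong_sets)
  have sp: "space \<alpha> = space \<mu>" "space \<beta> = space \<mu>" using s by (auto dest: sets_eq_imp_space_eq)
  show ?thesis using f
  proof (induct rule: borel_measurable_induct)
    case (cong f g)
    then show ?case by (simp add: sp cong: nn_integral_cong_simp)
  next
    case (set A)
    then show ?case using s add by simp
  next
    case (mult u v)
    then have "(\<integral>\<^sup>+x. v * u x \<partial>M) = v * (\<integral>\<^sup>+x. u x \<partial>M)"
      if "borel_measurable M = (borel_measurable \<mu> :: (_ \<Rightarrow> ennreal) set)" for M
      using that by (intro nn_integral_cmult) simp
    then show ?case using mm mult by (simp add: distrib_left)
  next
    case (add u v)
    then show ?case using mm by (simp add: nn_integral_add ac_simps)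
  next
    case (seq U)
    have inc: "incseq (\<lambda>i. \<integral>\<^sup>+x. U i x \<partial>M)" for M :: "'a measure"
      using \<open>incseq U\<close> by (auto simp: incseq_def le_fun_def intro!: nn_integral_mono)
    have "(\<integral>\<^sup>+x. (SUP i. U i) x \<partial>M) = (SUP i. \<integral>\<^sup>+x. U i x \<partial>M)"
      if "borel_measurable M = (borel_measurable \<mu> :: (_ \<Rightarrow> ennreal) set)" for M
      using seq that by (subst SUP_apply, intro nn_integral_monotone_convergence_SUP) auto
    then show ?case
      using mm seq ennreal_SUP_add[OF inc inc, of \<alpha> \<beta>] by simp
  qed
qed

lemma circle_continuous_bounded:
  fixes f :: "complex \<Rightarrow> 'b::real_normed_vector"
  assumes "continuous_on unit_circle f"
  shows "\<exists>B. \<forall>\<zeta>. norm \<zeta> = 1 \<longrightarrow> norm (f \<zeta>) \<le> B"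
proof -
  have "compact (f ` unit_circle)" by (intro compact_continuous_image assms) auto
  then have "bounded (f ` unit_circle)" by (rule compact_imp_bounded)
  then obtain B where "\<forall>x\<in>unit_circle. norm (f x) \<le> B" by (auto simp: bounded_iff)
  then show ?thesis by (intro exI[of _ B]) simp
qed

lemma integral_add_measure:
  fixes f :: "complex \<Rightarrow> complex"
  assumes \<nu>: "circle_finite \<mu>" "circle_finite \<alpha>" "circle_finite \<beta>"
    and add: "\<And>A. A \<in> sets circle_borel \<Longrightarrow> emeasure \<mu> A = emeasure \<alpha> A + emeasure \<beta> A"
    and f: "f \<in> borel_measurable circle_borel" and B: "\<And>\<zeta>. norm \<zeta> = 1 \<Longrightarrow> norm (f \<zeta>) \<le> B"
  shows "(\<integral>x. f x \<partial>\<mu>) = (\<integral>x. f x \<partial>\<alpha>) + (\<integral>x. f x \<partial>\<beta>)"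
proof -
  have nn: "(\<integral>\<^sup>+x. g x \<partial>\<mu>) = (\<integral>\<^sup>+x. g x \<partial>\<alpha>) + (\<integral>\<^sup>+x. g x \<partial>\<beta>)" if "g \<in> borel_measurable circle_borel" for g
    using that circle_finiteD(2)[OF \<nu>(1)] circle_finiteD(2)[OF \<nu>(2)] circle_finiteD(2)[OF \<nu>(3)] add
      borel_measurable_circle_finite[OF \<nu>(1)]
    by (intro nn_integral_add_measure) auto
  have re: "(\<integral>x. g x \<partial>\<mu>) = (\<integral>x. g x \<partial>\<alpha>) + (\<integral>x. g x \<partial>\<beta>)"
    if g: "g \<in> borel_measurable circle_borel" and gB: "\<And>\<zeta>. norm \<zeta> = 1 \<Longrightarrow> norm (g \<zeta>) \<le> B" for g :: "complex \<Rightarrow> real"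
  proof -
    have i: "integrable M g" if "circle_finite M" for M
      by (rule integrable_bounded_circle[OF that g, of B]) (use gB in auto)
    have nfin: "(\<integral>\<^sup>+x. ennreal (norm (g x)) \<partial>M) < \<infinity>" if "circle_finite M" for M
      using i[OF that] by (simp add: integrable_iff_bounded)
    have fin: "(\<integral>\<^sup>+x. ennreal (g x) \<partial>M) < \<infinity>" "(\<integral>\<^sup>+x. ennreal (- g x) \<partial>M) < \<infinity>" if "circle_finite M" for M
      by (rule le_less_trans[OF nn_integral_mono nfin[OF that]], rule ennreal_leI, simp)+
    show ?thesis
      using i[OF \<nu>(1)] i[OF \<nu>(2)] i[OF \<nu>(3)] fin[OF \<nu>(2)] fin[OF \<nu>(3)] g
      by (simp add: real_lebesgue_integral_def nn enn2real_plus)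
  qed
  have i: "integrable M f" if "circle_finite M" for M
    by (rule integrable_bounded_circle[OF that f, of B]) (use B in auto)
  show ?thesis
  proof (rule complex_eqI)
    have "(\<integral>x. Re (f x) \<partial>\<mu>) = (\<integral>x. Re (f x) \<partial>\<alpha>) + (\<integral>x. Re (f x) \<partial>\<beta>)"
      using f B abs_Re_le_cmod order_trans by (intro re) (auto, blast)
    then show "Re (\<integral>x. f x \<partial>\<mu>) = Re ((\<integral>x. f x \<partial>\<alpha>) + (\<integral>x. f x \<partial>\<beta>))"
      using i \<nu> by simp
    have "(\<integral>x. Im (f x) \<partial>\<mu>) = (\<integral>x. Im (f x) \<partial>\<alpha>) + (\<integral>x. Im (f x) \<partial>\<beta>)"
      using f B abs_Im_le_cmod order_trans by (intro re) (auto, blast)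
    then show "Im (\<integral>x. f x \<partial>\<mu>) = Im ((\<integral>x. f x \<partial>\<alpha>) + (\<integral>x. f x \<partial>\<beta>))"
      using i \<nu> by simp
  qed
qed

lemma herglotz_add:
  assumes "circle_finite \<mu>" "circle_finite \<alpha>" "circle_finite \<beta>"
    and "\<And>A. A \<in> sets circle_borel \<Longrightarrow> emeasure \<mu> A = emeasure \<alpha> A + emeasure \<beta> A"
    and z: "norm z < 1"
  shows "herglotz \<mu> z = herglotz \<alpha> z + herglotz \<beta> z"
proof -
  have c: "continuous_on unit_circle (\<lambda>\<zeta>. (\<zeta> + z) / (\<zeta> - z))" using z by (rule continuous_on_herglotz_kernel)
  obtain B where "\<And>\<zeta>. norm \<zeta> = 1 \<Longrightarrow> norm ((\<zeta> + z) / (\<zeta> - z)) \<le> B"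
    using circle_continuous_bounded[OF c] by blast
  then show ?thesis
    unfolding herglotz_def using assms measurable_circle_continuous[OF c] by (intro integral_add_measure[of _ _ _ _ B]) auto
qed

lemma singular_inner_add:
  assumes "circle_finite \<mu>" "circle_finite \<alpha>" "circle_finite \<beta>"
    and "\<And>A. A \<in> sets circle_borel \<Longrightarrow> emeasure \<mu> A = emeasure \<alpha> A + emeasure \<beta> A"
    and z: "norm z < 1"
  shows "singular_inner \<mu> z = singular_inner \<alpha> z * singular_inner \<beta> z"
  using herglotz_add[OF assms] by (simp add: singular_inner_herglotz exp_diff exp_minus divide_inverse)

lemma circle_finite_density:
  assumes \<nu>: "circle_finite \<nu>" and g: "integrable \<nu> g" "\<And>\<zeta>. norm \<zeta> = 1 \<Longrightarrow> 0 \<le> g \<zeta>"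
  shows "circle_finite (density \<nu> (\<lambda>\<zeta>. ennreal (g \<zeta>)))"
proof -
  have "emeasure (density \<nu> (\<lambda>\<zeta>. ennreal (g \<zeta>))) (space \<nu>) = (\<integral>\<^sup>+\<zeta>. ennreal (g \<zeta>) \<partial>\<nu>)"
    using g by (subst emeasure_density) (auto intro!: nn_integral_cong)
  also have "\<dots> \<noteq> \<infinity>" using g by (subst nn_integral_eq_integral) (auto simp: circle_finiteD[OF \<nu>])
  finally show ?thesis
    using circle_finiteD[OF \<nu>] by (auto simp: circle_finite_def intro!: finite_measureI)
qed

lemma herglotz_density:
  assumes \<nu>: "circle_finite \<nu>" and g: "integrable \<nu> g" "\<And>\<zeta>. norm \<zeta> = 1 \<Longrightarrow> 0 \<le> g \<zeta>" and z: "norm z < 1"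
  shows "herglotz (density \<nu> (\<lambda>\<zeta>. ennreal (g \<zeta>))) z = (\<integral>\<zeta>. (\<zeta> + z) / (\<zeta> - z) * of_real (g \<zeta>) \<partial>\<nu>)"
proof -
  have "herglotz (density \<nu> (\<lambda>\<zeta>. ennreal (g \<zeta>))) z = (\<integral>\<zeta>. g \<zeta> *\<^sub>R ((\<zeta> + z) / (\<zeta> - z)) \<partial>\<nu>)"
    unfolding herglotz_def
    using g z integrable_herglotz_kernel[OF \<nu> z]
    by (intro integral_density) (auto simp: circle_finiteD[OF \<nu>])
  then show ?thesis by (simp add: scaleR_conv_of_real mult.commute)
qed

section \<open>Poisson integrals and domination of measures\<close>

text \<open>Expanding \<open>\<zeta> / (\<zeta> - z)\<close> in powers of \<open>z / \<zeta>\<close>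
  turns the integral into the Taylor series of \<open>k\<close> at 0, coefficient by
  coefficient.\<close>

lemma circle_cauchy:
  assumes hol: "k holomorphic_on ball 0 R" and R: "R > 1" and z: "norm z < 1"
  shows "(\<integral>\<zeta>. k \<zeta> * (\<zeta> / (\<zeta> - z)) \<partial>circle_measure) = k z"
proof -
  have kc: "continuous_on unit_circle k"
    using holomorphic_on_imp_continuous_on[OF hol] by (rule continuous_on_subset) (use R in auto)
  obtain B where B: "\<And>\<zeta>. norm \<zeta> = 1 \<Longrightarrow> norm (k \<zeta>) \<le> B"
    using circle_continuous_bounded[OF kc] by blast
  define t where "t j \<zeta> = k \<zeta> * inverse (\<zeta> ^ j) * z ^ j" for j \<zeta>
  have int: "integrable circle_measure (t j)" for j
    unfolding t_def by (intro integrable_continuous_circle continuous_intros kc) auto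
  have nb: "norm (t j \<zeta>) \<le> B * norm z ^ j" if "norm \<zeta> = 1" for j \<zeta>
    using that B[OF that] by (simp add: t_def norm_mult norm_power norm_inverse mult_right_mono)
  have sm: "summable (\<lambda>j. B * norm z ^ j)" using z by (intro summable_mult summable_geometric) auto
  have "(\<lambda>j. \<integral>\<zeta>. t j \<zeta> \<partial>circle_measure) sums (\<integral>\<zeta>. (\<Sum>j. t j \<zeta>) \<partial>circle_measure)"
  proof (rule sums_integral[OF int])
    show "AE \<zeta> in circle_measure. summable (\<lambda>j. norm (t j \<zeta>))"
    proof (intro AE_I2)
      fix \<zeta> :: complex assume "\<zeta> \<in> space circle_measure"
      then have \<zeta>: "norm \<zeta> = 1" by simp
      show "summable (\<lambda>j. norm (t j \<zeta>))"
        by (rule summable_comparison_test'[OF sm, of 0]) (use nb[OF \<zeta>] in simp)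
    qed
    have "(\<integral>\<zeta>. norm (t j \<zeta>) \<partial>circle_measure) \<le> (\<integral>\<zeta>. B * norm z ^ j \<partial>circle_measure)" for j
      using nb by (intro integral_mono integrable_norm int) auto
    then have "(\<integral>\<zeta>. norm (t j \<zeta>) \<partial>circle_measure) \<le> B * norm z ^ j" for j by simp
    then show "summable (\<lambda>j. \<integral>\<zeta>. norm (t j \<zeta>) \<partial>circle_measure)"
      by (intro summable_comparison_test'[OF sm, of 0]) auto
  qed
  moreover have "(\<integral>\<zeta>. t j \<zeta> \<partial>circle_measure) = (deriv ^^ j) k 0 / fact j * z ^ j" for j
    unfolding t_def using circle_integral_power_series(1)[OF hol R, of j] by simp
  moreover have "(\<integral>\<zeta>. (\<Sum>j. t j \<zeta>) \<partial>circle_measure) = (\<integral>\<zeta>. k \<zeta> * (\<zeta> / (\<zeta> - z)) \<partial>circle_measure)"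
  proof (intro Bochner_Integration.integral_cong refl)
    fix \<zeta> :: complex assume "\<zeta> \<in> space circle_measure"
    then have \<zeta>: "norm \<zeta> = 1" by simp
    then have nz: "\<zeta> \<noteq> 0" "\<zeta> - z \<noteq> 0" using z by auto
    have "norm (z / \<zeta>) < 1" using \<zeta> z by (simp add: norm_divide)
    from sums_mult[OF geometric_sums[OF \<open>norm (z / \<zeta>) < 1\<close>], of "k \<zeta>"]
    have "(\<lambda>j. t j \<zeta>) sums (k \<zeta> * (1 / (1 - z / \<zeta>)))"
      by (simp add: t_def power_divide divide_inverse power_mult_distrib power_inverse mult_ac)
    moreover have "1 / (1 - z / \<zeta>) = \<zeta> / (\<zeta> - z)" using nz by (simp add: field_simps)
    ultimately show "(\<Sum>j. t j \<zeta>) = k \<zeta> * (\<zeta> / (\<zeta> - z))" by (simp add: sums_iff)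
  qed
  ultimately have "(\<lambda>j. (deriv ^^ j) k 0 / fact j * z ^ j) sums (\<integral>\<zeta>. k \<zeta> * (\<zeta> / (\<zeta> - z)) \<partial>circle_measure)" by simp
  moreover have "(\<lambda>j. (deriv ^^ j) k 0 / fact j * z ^ j) sums k z"
    using holomorphic_power_series[OF hol, of z] z R by simp
  ultimately show ?thesis by (rule sums_unique2)
qed

text \<open>On the circle the Poisson kernel is \<open>\<zeta> / (\<zeta> - z)\<close> times
  \<open>(1 - (norm z)\<^sup>2) / (1 - cnj z * \<zeta>)\<close>. The second factor is holomorphic
  and takes the value 1 at \<open>\<zeta> = z\<close>, so the Cauchy formula is applied to its
  product with \<open>k\<close>.\<close>

lemma circle_poisson_formula:
  assumes hol: "k holomorphic_on ball 0 R" and R: "R > 1" and z: "norm z < 1"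
  shows "(\<integral>\<zeta>. of_real (poisson_kernel z \<zeta>) * k \<zeta> \<partial>circle_measure) = k z"
proof -
  \<comment> \<open>The second factor has its pole at distance \<open>1 / norm z\<close> from the
    origin; the radius is cut down to stay below it.\<close>
  define R' where "R' = min R (if z = 0 then R else 1 / norm z)"
  have R': "R' > 1" using R z by (auto simp: R'_def)
  have nz: "1 - cnj z * u \<noteq> 0" if "norm u < R'" for u
  proof
    assume "1 - cnj z * u = 0"
    then have "norm (cnj z * u) = 1" by simp
    then have *: "norm z * norm u = 1" by (simp add: norm_mult)
    then have "z \<noteq> 0" by auto
    then have "norm u < 1 / norm z" using that by (simp add: R'_def)
    then show False using * \<open>z \<noteq> 0\<close> by (simp add: field_simps)
  qed
  define h where "h u = k u * (1 - of_real ((norm z)\<^sup>2)) / (1 - cnj z * u)" for u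
  have "k holomorphic_on ball 0 R'" using hol by (rule holomorphic_on_subset) (auto simp: R'_def)
  then have hh: "h holomorphic_on ball 0 R'"
    unfolding h_def using nz by (intro holomorphic_intros) auto
  have "(\<integral>\<zeta>. of_real (poisson_kernel z \<zeta>) * k \<zeta> \<partial>circle_measure) = (\<integral>\<zeta>. h \<zeta> * (\<zeta> / (\<zeta> - z)) \<partial>circle_measure)"
  proof (intro Bochner_Integration.integral_cong refl)
    fix \<zeta> :: complex assume "\<zeta> \<in> space circle_measure"
    then have \<zeta>: "norm \<zeta> = 1" by simp
    have n1: "1 - cnj z * \<zeta> \<noteq> 0" "\<zeta> - z \<noteq> 0" using nz[of \<zeta>] \<zeta> R' z by auto
    have "\<zeta> * cnj \<zeta> = 1" using \<zeta> by (metis complex_norm_square of_real_1 power_one)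
    then have "\<zeta> * cnj (\<zeta> - z) = 1 - cnj z * \<zeta>" by (simp add: algebra_simps)
    moreover have "of_real ((norm (\<zeta> - z))\<^sup>2) * \<zeta> = (\<zeta> - z) * (\<zeta> * cnj (\<zeta> - z))"
      by (simp only: complex_norm_square mult_ac)
    ultimately have "of_real ((norm (\<zeta> - z))\<^sup>2) * \<zeta> = (\<zeta> - z) * (1 - cnj z * \<zeta>)" by simp
    moreover have "\<zeta> \<noteq> 0" using \<zeta> by auto
    ultimately have "of_real ((norm (\<zeta> - z))\<^sup>2) = (\<zeta> - z) * (1 - cnj z * \<zeta>) / \<zeta>"
      by (simp add: field_simps)
    then have "complex_of_real (poisson_kernel z \<zeta>) = (1 - of_real ((norm z)\<^sup>2)) / ((\<zeta> - z) * (1 - cnj z * \<zeta>) / \<zeta>)"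
      unfolding poisson_kernel_def of_real_divide by simp
    then show "of_real (poisson_kernel z \<zeta>) * k \<zeta> = h \<zeta> * (\<zeta> / (\<zeta> - z))"
      using n1 by (simp add: h_def mult_ac)
  qed
  also have "\<dots> = h z" by (rule circle_cauchy[OF hh R' z])
  also have "\<dots> = k z"
  proof -
    have "cnj z * z = of_real ((norm z)\<^sup>2)" by (simp only: complex_norm_square mult_ac)
    moreover have "1 - of_real ((norm z)\<^sup>2) \<noteq> (0::complex)"
      using nz[of z] z R' calculation by auto
    ultimately show ?thesis by (simp add: h_def)
  qed
  finally show ?thesis .
qed

lemma integral_poisson_kernel:
  assumes "norm z < 1"
  shows "(\<integral>\<zeta>. poisson_kernel z \<zeta> \<partial>circle_measure) = 1"
proof -
  have "(\<integral>\<zeta>. complex_of_real (poisson_kernel z \<zeta>) * 1 \<partial>circle_measure) = 1"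
    by (rule circle_poisson_formula[of _ 2]) (use assms in auto)
  then show ?thesis by simp
qed

lemma poisson_kernel_swap:
  assumes "norm \<zeta> = 1" "norm \<xi> = 1"
  shows "poisson_kernel (of_real r * \<zeta>) \<xi> = poisson_kernel (of_real r * \<xi>) \<zeta>"
proof -
  have "(norm (\<xi> - of_real r * \<zeta>))\<^sup>2 = (norm (\<zeta> - of_real r * \<xi>))\<^sup>2"
  proof -
    have "(Re \<zeta>)\<^sup>2 + (Im \<zeta>)\<^sup>2 = 1" "(Re \<xi>)\<^sup>2 + (Im \<xi>)\<^sup>2 = 1"
      using assms by (metis cmod_power2 power_one)+
    then have "((Re \<zeta>)\<^sup>2 + (Im \<zeta>)\<^sup>2) * (1 - r\<^sup>2) = ((Re \<xi>)\<^sup>2 + (Im \<xi>)\<^sup>2) * (1 - r\<^sup>2)" by simp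
    then show ?thesis unfolding cmod_power2 by (simp add: algebra_simps power2_eq_square)
  qed
  then show ?thesis using assms by (simp add: poisson_kernel_def norm_mult)
qed

text \<open>Tonelli together with the symmetry \<open>poisson_kernel_swap\<close>: the Poisson
  integral is moved from the measure to the test function. In this form both sides of an inequality
  between Poisson integrals can be tested on a circle of radius \<open>r\<close>.\<close>

lemma Re_herglotz_test:
  assumes \<alpha>: "circle_finite \<alpha>" and r: "0 < r" "r < 1"
    and \<phi>: "continuous_on unit_circle \<phi>" "\<And>\<zeta>. norm \<zeta> = 1 \<Longrightarrow> 0 \<le> \<phi> \<zeta>"
  shows "(\<integral>\<^sup>+\<zeta>. ennreal (\<phi> \<zeta> * Re (herglotz \<alpha> (of_real r * \<zeta>))) \<partial>circle_measure) =
    (\<integral>\<^sup>+\<xi>. ennreal (\<integral>\<zeta>. \<phi> \<zeta> * poisson_kernel (of_real r * \<xi>) \<zeta> \<partial>circle_measure) \<partial>\<alpha>)"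
proof -
  interpret a: finite_measure \<alpha> using circle_finiteD[OF \<alpha>] by simp
  interpret pair_sigma_finite circle_measure \<alpha> ..
  have rz: "norm (of_real r * \<zeta>) < 1" if "norm \<zeta> = 1" for \<zeta> :: complex
    using that r by (simp add: norm_mult)
  have sal: "sets \<alpha> = sets circle_borel" by (rule circle_finiteD[OF \<alpha>])
  have m1: "(\<lambda>x. fst x) \<in> circle_measure \<Otimes>\<^sub>M \<alpha> \<rightarrow>\<^sub>M borel"
    by (intro measurable_compose[OF measurable_fst]) (simp add: measurable_cong_sets[OF sets_circle_measure refl])
  have m2: "(\<lambda>x. snd x) \<in> circle_measure \<Otimes>\<^sub>M \<alpha> \<rightarrow>\<^sub>M borel"
    by (intro measurable_compose[OF measurable_snd]) (simp add: measurable_cong_sets[OF sal refl])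
  have m3: "(\<lambda>x. \<phi> (fst x)) \<in> borel_measurable (circle_measure \<Otimes>\<^sub>M \<alpha>)"
    by (intro measurable_compose[OF measurable_fst])
       (use measurable_circle_continuous[OF \<phi>(1)] in \<open>simp add: measurable_cong_sets[OF sets_circle_measure refl]\<close>)
  have m: "(\<lambda>x. ennreal (\<phi> (fst x) * poisson_kernel (of_real r * fst x) (snd x))) \<in> borel_measurable (circle_measure \<Otimes>\<^sub>M \<alpha>)"
    unfolding poisson_kernel_def using m1 m2 m3 by measurable
  have pk: "0 \<le> poisson_kernel (of_real r * \<zeta>) \<xi>" if "norm \<zeta> = 1" "norm \<xi> = 1" for \<zeta> \<xi>
    using poisson_kernel_pos[OF that(2) rz[OF that(1)]] by simp
  have "(\<integral>\<^sup>+\<zeta>. ennreal (\<phi> \<zeta> * Re (herglotz \<alpha> (of_real r * \<zeta>))) \<partial>circle_measure) =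
     (\<integral>\<^sup>+\<zeta>. \<integral>\<^sup>+\<xi>. ennreal (\<phi> \<zeta> * poisson_kernel (of_real r * \<zeta>) \<xi>) \<partial>\<alpha> \<partial>circle_measure)"
  proof (intro nn_integral_cong)
    fix \<zeta> :: complex assume "\<zeta> \<in> space circle_measure"
    then have \<zeta>: "norm \<zeta> = 1" by simp
    have "(\<integral>\<^sup>+\<xi>. ennreal (\<phi> \<zeta> * poisson_kernel (of_real r * \<zeta>) \<xi>) \<partial>\<alpha>) = ennreal (\<integral>\<xi>. \<phi> \<zeta> * poisson_kernel (of_real r * \<zeta>) \<xi> \<partial>\<alpha>)"
      using integrable_poisson_kernel[OF \<alpha> rz[OF \<zeta>]] \<phi>(2)[OF \<zeta>] pk[OF \<zeta>]
      by (intro nn_integral_eq_integral) (auto simp: circle_finiteD[OF \<alpha>])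
    then show "ennreal (\<phi> \<zeta> * Re (herglotz \<alpha> (of_real r * \<zeta>))) = (\<integral>\<^sup>+\<xi>. ennreal (\<phi> \<zeta> * poisson_kernel (of_real r * \<zeta>) \<xi>) \<partial>\<alpha>)"
      by (simp add: Re_herglotz[OF \<alpha> rz[OF \<zeta>]])
  qed
  also have "\<dots> = (\<integral>\<^sup>+\<xi>. \<integral>\<^sup>+\<zeta>. ennreal (\<phi> \<zeta> * poisson_kernel (of_real r * \<zeta>) \<xi>) \<partial>circle_measure \<partial>\<alpha>)"
    using Fubini'[of "\<lambda>\<zeta> \<xi>. ennreal (\<phi> \<zeta> * poisson_kernel (of_real r * \<zeta>) \<xi>)"] m by (simp add: case_prod_beta)
  also have "\<dots> = (\<integral>\<^sup>+\<xi>. ennreal (\<integral>\<zeta>. \<phi> \<zeta> * poisson_kernel (of_real r * \<xi>) \<zeta> \<partial>circle_measure) \<partial>\<alpha>)"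
  proof (intro nn_integral_cong)
    fix \<xi> assume "\<xi> \<in> space \<alpha>"
    then have \<xi>: "norm \<xi> = 1" by (simp add: circle_finiteD[OF \<alpha>])
    have "(\<integral>\<^sup>+\<zeta>. ennreal (\<phi> \<zeta> * poisson_kernel (of_real r * \<zeta>) \<xi>) \<partial>circle_measure) =
       (\<integral>\<^sup>+\<zeta>. ennreal (\<phi> \<zeta> * poisson_kernel (of_real r * \<xi>) \<zeta>) \<partial>circle_measure)"
      by (intro nn_integral_cong) (simp add: poisson_kernel_swap[OF _ \<xi>])
    also have "\<dots> = ennreal (\<integral>\<zeta>. \<phi> \<zeta> * poisson_kernel (of_real r * \<xi>) \<zeta> \<partial>circle_measure)"
      using rz[OF \<xi>] pk[OF \<xi>] \<phi>
      by (intro nn_integral_eq_integral integrable_continuous_circle continuous_intros) auto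
    finally show "(\<integral>\<^sup>+\<zeta>. ennreal (\<phi> \<zeta> * poisson_kernel (of_real r * \<zeta>) \<xi>) \<partial>circle_measure) =
       ennreal (\<integral>\<zeta>. \<phi> \<zeta> * poisson_kernel (of_real r * \<xi>) \<zeta> \<partial>circle_measure)" .
  qed
  finally show ?thesis .
qed

lemma poisson_integral_tendsto:
  fixes \<phi> :: "complex \<Rightarrow> real"
  assumes \<phi>: "continuous_on unit_circle \<phi>" "\<And>\<zeta>. norm \<zeta> = 1 \<Longrightarrow> 0 \<le> \<phi> \<zeta> \<and> \<phi> \<zeta> \<le> 1" and \<xi>: "norm \<xi> = 1"
  shows "((\<lambda>r. \<integral>\<zeta>. \<phi> \<zeta> * poisson_kernel (of_real r * \<xi>) \<zeta> \<partial>circle_measure) \<longlongrightarrow> \<phi> \<xi>) (at_left 1)"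
proof (rule tendstoI)
  fix e :: real assume e: "e > 0"
  have "continuous (at \<xi> within unit_circle) \<phi>" using \<phi>(1) \<xi> by (simp add: continuous_on_eq_continuous_within)
  then obtain \<delta> where \<delta>: "\<delta> > 0" "\<And>\<zeta>. norm \<zeta> = 1 \<Longrightarrow> norm (\<zeta> - \<xi>) < \<delta> \<Longrightarrow> \<bar>\<phi> \<zeta> - \<phi> \<xi>\<bar> < e/2"
    using e unfolding continuous_within_eps_delta by (auto simp: dist_norm dest: spec[of _ "e/2"])
  \<comment> \<open>\<open>\<delta> / 2\<close> keeps points at distance \<open>\<delta>\<close>
    from \<open>\<xi>\<close> at distance \<open>\<delta> / 2\<close> from \<open>r \<xi>\<close>, 1
    keeps \<open>r\<close> positive, and the last term makes
    \<open>8 * (1 - r) / \<delta>\<^sup>2\<close> smaller than \<open>e / 2\<close>.\<close>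
  define s where "s = min (min (\<delta>/2) 1) (e * \<delta>\<^sup>2 / 16)"
  have s: "s > 0" using \<delta> e by (simp add: s_def)
  have "eventually (\<lambda>r. r \<in> {1 - s<..<1}) (at_left (1::real))"
    using s by (intro eventually_at_left_real) auto
  then show "eventually (\<lambda>r. dist (\<integral>\<zeta>. \<phi> \<zeta> * poisson_kernel (of_real r * \<xi>) \<zeta> \<partial>circle_measure) (\<phi> \<xi>) < e) (at_left 1)"
  proof eventually_elim
    case (elim r)
    then have r: "0 < r" "r < 1" "1 - r < s" by (auto simp: s_def)
    have rz: "norm (of_real r * \<xi>) < 1" using \<xi> r by (simp add: norm_mult)
    have nr: "norm (of_real r * \<xi>) = r" using \<xi> r by (simp add: norm_mult)
    have ci: "integrable circle_measure (\<lambda>\<zeta>. \<phi> \<zeta> * poisson_kernel (of_real r * \<xi>) \<zeta>)"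
      "integrable circle_measure (\<lambda>\<zeta>. \<phi> \<xi> * poisson_kernel (of_real r * \<xi>) \<zeta>)"
      "integrable circle_measure (\<lambda>\<zeta>. e/2 * poisson_kernel (of_real r * \<xi>) \<zeta> + 8 * (1 - r) / \<delta>\<^sup>2)"
      using rz by (intro integrable_continuous_circle continuous_intros \<phi>; simp)+
    have "(\<integral>\<zeta>. \<phi> \<zeta> * poisson_kernel (of_real r * \<xi>) \<zeta> \<partial>circle_measure) - \<phi> \<xi> =
       (\<integral>\<zeta>. \<phi> \<zeta> * poisson_kernel (of_real r * \<xi>) \<zeta> - \<phi> \<xi> * poisson_kernel (of_real r * \<xi>) \<zeta> \<partial>circle_measure)"
      using ci integral_poisson_kernel[OF rz] by simp
    also have "\<bar>\<dots>\<bar> \<le> (\<integral>\<zeta>. e/2 * poisson_kernel (of_real r * \<xi>) \<zeta> + 8 * (1 - r) / \<delta>\<^sup>2 \<partial>circle_measure)"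
    proof (rule integral_abs_bound_integral)
      fix \<zeta> :: complex assume "\<zeta> \<in> space circle_measure"
      then have \<zeta>: "norm \<zeta> = 1" by simp
      let ?p = "poisson_kernel (of_real r * \<xi>) \<zeta>"
      have p: "?p > 0" by (rule poisson_kernel_pos[OF \<zeta> rz])
      have eq: "\<bar>\<phi> \<zeta> * ?p - \<phi> \<xi> * ?p\<bar> = \<bar>\<phi> \<zeta> - \<phi> \<xi>\<bar> * ?p"
        using p by (simp add: abs_mult flip: left_diff_distrib)
      show "\<bar>\<phi> \<zeta> * ?p - \<phi> \<xi> * ?p\<bar> \<le> e/2 * ?p + 8 * (1 - r) / \<delta>\<^sup>2"
      proof (cases "norm (\<zeta> - \<xi>) < \<delta>")
        case True
        have "\<bar>\<phi> \<zeta> - \<phi> \<xi>\<bar> * ?p \<le> e/2 * ?p"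
          using \<delta>(2)[OF \<zeta> True] p by (intro mult_right_mono) auto
        moreover have "0 \<le> 8 * (1 - r) / \<delta>\<^sup>2" using r by simp
        ultimately show ?thesis unfolding eq by linarith
      next
        case False
        have "\<zeta> - \<xi> = (\<zeta> - of_real r * \<xi>) - (1 - of_real r) * \<xi>" by (simp add: algebra_simps)
        then have "norm (\<zeta> - \<xi>) \<le> norm (\<zeta> - of_real r * \<xi>) + norm ((1 - of_real r) * \<xi>)"
          by (metis norm_triangle_ineq4)
        also have "norm ((1 - of_real r) * \<xi>) = 1 - r"
          using r \<xi> by (simp add: norm_mult) (metis abs_of_pos diff_gt_0_iff_gt norm_of_real of_real_1 of_real_diff)
        finally have "\<delta>/2 \<le> norm (\<zeta> - of_real r * \<xi>)" using False r by (auto simp: s_def)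
        then have "(\<delta>/2)\<^sup>2 \<le> (norm (\<zeta> - of_real r * \<xi>))\<^sup>2" using \<delta> by (intro power_mono) auto
        moreover have "0 \<le> 1 - r\<^sup>2" using r by (simp add: power_le_one)
        ultimately have "?p \<le> (1 - r\<^sup>2) / (\<delta>/2)\<^sup>2"
          unfolding poisson_kernel_def nr using \<delta> \<zeta> rz by (intro divide_left_mono mult_pos_pos) auto
        also have "\<dots> = 4 * ((1 - r) * (1 + r)) / \<delta>\<^sup>2" by (simp add: power2_eq_square algebra_simps)
        also have "\<dots> \<le> 4 * ((1 - r) * 2) / \<delta>\<^sup>2"
          using r by (intro divide_right_mono mult_left_mono) auto
        finally have "?p \<le> 8 * (1 - r) / \<delta>\<^sup>2" by (simp add: algebra_simps)
        moreover have "\<bar>\<phi> \<zeta> - \<phi> \<xi>\<bar> * ?p \<le> 1 * ?p"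
          using \<phi>(2)[OF \<zeta>] \<phi>(2)[OF \<xi>] p by (intro mult_right_mono) auto
        moreover have "0 \<le> e/2 * ?p" using e p by simp
        ultimately show ?thesis unfolding eq by linarith
      qed
    qed (use ci in auto)
    also have "\<dots> = e/2 + 8 * (1 - r) / \<delta>\<^sup>2"
    proof -
      have "integrable circle_measure (poisson_kernel (of_real r * \<xi>))"
        by (rule integrable_poisson_kernel[OF _ rz]) simp
      then show ?thesis using integral_poisson_kernel[OF rz] by simp
    qed
    also have "\<dots> < e"
    proof -
      have "1 - r < e * \<delta>\<^sup>2 / 16" using r by (simp add: s_def)
      moreover have "0 < \<delta>\<^sup>2" using \<delta> by simp
      ultimately have "8 * (1 - r) / \<delta>\<^sup>2 < e / 2" by (simp add: field_simps)
      then show ?thesis by linarith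
    qed
    finally show ?case by (simp add: dist_real_def)
  qed
qed

text \<open>Tested against continuous functions on circles of radius \<open>r\<close>, the inequality passes to
  the measures as \<open>r\<close> tends to \<open>1\<close>.\<close>

lemma poisson_domination:
  assumes \<alpha>: "circle_finite \<alpha>" and \<beta>: "circle_finite \<beta>"
    and le: "\<And>z. norm z < 1 \<Longrightarrow> Re (herglotz \<alpha> z) \<le> Re (herglotz \<beta> z)"
    and A: "A \<in> sets circle_borel"
  shows "emeasure \<alpha> A \<le> emeasure \<beta> A"
proof -
  interpret a: finite_measure \<alpha> using circle_finiteD[OF \<alpha>] by simp
  interpret b: finite_measure \<beta> using circle_finiteD[OF \<beta>] by simp
  have test: "(\<integral>\<zeta>. \<phi> \<zeta> \<partial>\<alpha>) \<le> (\<integral>\<zeta>. \<phi> \<zeta> \<partial>\<beta>)"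
    if \<phi>: "continuous_on unit_circle \<phi>" "\<And>\<zeta>. norm \<zeta> = 1 \<Longrightarrow> 0 \<le> \<phi> \<zeta> \<and> \<phi> \<zeta> \<le> 1" for \<phi> :: "complex \<Rightarrow> real"
  proof -
    define r where "r n = 1 - 1 / (real n + 2)" for n
    have r: "0 < r n" "r n < 1" for n by (auto simp: r_def field_simps)
    have rlim: "filterlim r (at_left 1) sequentially"
      unfolding filterlim_at
    proof
      show "r \<longlonglongrightarrow> 1" unfolding r_def by real_asymp
    qed (use r in \<open>auto simp: less_imp_neq\<close>)
    define P where "P n \<xi> = (\<integral>\<zeta>. \<phi> \<zeta> * poisson_kernel (of_real (r n) * \<xi>) \<zeta> \<partial>circle_measure)" for n \<xi>
    have rz: "norm (of_real (r n) * \<zeta>) < 1" if "norm \<zeta> = 1" for \<zeta> :: complex and n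
      using that r[of n] by (simp add: norm_mult)
    have P01: "0 \<le> P n \<xi>" "P n \<xi> \<le> 1" if \<xi>: "norm \<xi> = 1" for n \<xi>
    proof -
      show "0 \<le> P n \<xi>" unfolding P_def
        using \<phi>(2) poisson_kernel_pos rz[OF \<xi>] by (intro Bochner_Integration.integral_nonneg_AE AE_I2) (auto simp: less_imp_le)
      have "P n \<xi> \<le> (\<integral>\<zeta>. poisson_kernel (of_real (r n) * \<xi>) \<zeta> \<partial>circle_measure)" unfolding P_def
      proof (intro integral_mono)
        show "integrable circle_measure (\<lambda>\<zeta>. \<phi> \<zeta> * poisson_kernel (of_real (r n) * \<xi>) \<zeta>)"
          using rz[OF \<xi>] by (intro integrable_continuous_circle continuous_intros \<phi>) auto
        show "integrable circle_measure (poisson_kernel (of_real (r n) * \<xi>))"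
          using rz[OF \<xi>] by (intro integrable_poisson_kernel) auto
        fix \<zeta> :: complex assume "\<zeta> \<in> space circle_measure"
        then show "\<phi> \<zeta> * poisson_kernel (of_real (r n) * \<xi>) \<zeta> \<le> poisson_kernel (of_real (r n) * \<xi>) \<zeta>"
          using \<phi>(2)[of \<zeta>] poisson_kernel_pos[of \<zeta> "of_real (r n) * \<xi>"] rz[OF \<xi>] by (simp add: mult_left_le_one_le)
      qed
      also have "\<dots> = 1" by (rule integral_poisson_kernel[OF rz[OF \<xi>]])
      finally show "P n \<xi> \<le> 1" .
    qed
    have Pm: "P n \<in> borel_measurable circle_borel" for n
    proof -
      let ?N = "circle_borel \<Otimes>\<^sub>M circle_measure"
      have [measurable]: "(\<lambda>x. fst x) \<in> ?N \<rightarrow>\<^sub>M borel" "(\<lambda>x. snd x) \<in> ?N \<rightarrow>\<^sub>M borel"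
        by (rule measurable_compose[OF measurable_fst measurable_circle_borel_borel])
           (rule measurable_compose[OF measurable_snd],
            simp add: measurable_cong_sets[OF sets_circle_measure refl])
      have [measurable]: "(\<lambda>x. \<phi> (snd x)) \<in> borel_measurable ?N"
        by (intro measurable_compose[OF measurable_snd])
           (use measurable_circle_continuous[OF \<phi>(1)] in \<open>simp add: measurable_cong_sets[OF sets_circle_measure refl]\<close>)
      have "(\<lambda>x. \<phi> (snd x) * poisson_kernel (of_real (r n) * fst x) (snd x)) \<in> borel_measurable ?N"
        unfolding poisson_kernel_def by measurable
      then have "(\<lambda>(\<xi>, \<zeta>). \<phi> \<zeta> * poisson_kernel (of_real (r n) * \<xi>) \<zeta>) \<in> borel_measurable ?N"
        by (simp add: case_prod_beta')
      then show ?thesis unfolding P_def by (rule circle.borel_measurable_lebesgue_integral)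
    qed
    have lim: "(\<lambda>n. \<integral>\<xi>. P n \<xi> \<partial>M) \<longlonglongrightarrow> (\<integral>\<xi>. \<phi> \<xi> \<partial>M)" if M: "circle_finite M" for M
    proof (rule integral_dominated_convergence[where w="\<lambda>_. 1"])
      interpret finite_measure M using circle_finiteD[OF M] by simp
      show "integrable M (\<lambda>_. 1::real)" by simp
      show "\<phi> \<in> borel_measurable M"
        using measurable_circle_continuous[OF \<phi>(1)] by (simp add: borel_measurable_circle_finite[OF M])
      show "P n \<in> borel_measurable M" for n using Pm by (simp add: borel_measurable_circle_finite[OF M])
      show "AE \<xi> in M. (\<lambda>n. P n \<xi>) \<longlonglongrightarrow> \<phi> \<xi>"
      proof (intro AE_I2)
        fix \<xi> assume "\<xi> \<in> space M"
        then have "norm \<xi> = 1" using circle_finiteD[OF M] by simp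
        from filterlim_compose[OF poisson_integral_tendsto[OF \<phi> this] rlim]
        show "(\<lambda>n. P n \<xi>) \<longlonglongrightarrow> \<phi> \<xi>" by (simp add: P_def)
      qed
      show "AE \<xi> in M. norm (P n \<xi>) \<le> 1" for n
        using P01 by (intro AE_I2) (auto simp: circle_finiteD[OF M])
    qed
    have le_n: "(\<integral>\<xi>. P n \<xi> \<partial>\<alpha>) \<le> (\<integral>\<xi>. P n \<xi> \<partial>\<beta>)" for n
    proof -
      have e: "ennreal (\<integral>\<xi>. P n \<xi> \<partial>M) = (\<integral>\<^sup>+\<zeta>. ennreal (\<phi> \<zeta> * Re (herglotz M (of_real (r n) * \<zeta>))) \<partial>circle_measure)"
        if M: "circle_finite M" for M
      proof -
        have "(\<integral>\<^sup>+\<xi>. ennreal (P n \<xi>) \<partial>M) = ennreal (\<integral>\<xi>. P n \<xi> \<partial>M)"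
          using P01 by (intro nn_integral_eq_integral integrable_bounded_circle[OF M Pm, of _ 1]) (auto simp: circle_finiteD[OF M])
        then show ?thesis unfolding P_def using Re_herglotz_test[OF M r \<phi>(1)] \<phi>(2) by simp
      qed
      have "ennreal (\<integral>\<xi>. P n \<xi> \<partial>\<alpha>) \<le> ennreal (\<integral>\<xi>. P n \<xi> \<partial>\<beta>)"
        unfolding e[OF \<alpha>] e[OF \<beta>]
        using rz \<phi>(2) le by (intro nn_integral_mono ennreal_leI mult_left_mono) auto
      moreover have "0 \<le> (\<integral>\<xi>. P n \<xi> \<partial>\<beta>)"
        using P01 by (intro Bochner_Integration.integral_nonneg_AE AE_I2) (auto simp: circle_finiteD[OF \<beta>])
      ultimately show ?thesis by (simp add: ennreal_le_iff)
    qed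
    show ?thesis by (rule LIMSEQ_le[OF lim[OF \<alpha>] lim[OF \<beta>]]) (use le_n in auto)
  qed
  \<comment> \<open>Closed sets first: the tent functions \<open>\<phi> n\<close> are continuous and
    converge pointwise to the indicator of \<open>F\<close>.\<close>
  have closed_le: "emeasure \<alpha> F \<le> emeasure \<beta> F" if F: "closed F" "F \<subseteq> unit_circle" "F \<noteq> {}" for F
  proof -
    have FS: "F \<in> sets circle_borel" using F by (simp add: sets_circle_borel_iff)
    define \<phi> where "\<phi> n \<zeta> = max 0 (1 - real n * infdist \<zeta> F)" for n and \<zeta> :: complex
    have \<phi>c: "continuous_on unit_circle (\<phi> n)" for n
      unfolding \<phi>_def by (intro continuous_intros)
    have \<phi>01: "0 \<le> \<phi> n \<zeta> \<and> \<phi> n \<zeta> \<le> 1" for n \<zeta> unfolding \<phi>_def using infdist_nonneg[of \<zeta> F] by auto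
    have \<phi>lim: "(\<lambda>n. \<phi> n \<zeta>) \<longlonglongrightarrow> indicator F \<zeta>" for \<zeta>
    proof (cases "\<zeta> \<in> F")
      case True
      then show ?thesis by (simp add: \<phi>_def)
    next
      case False
      then have d: "infdist \<zeta> F > 0" using in_closed_iff_infdist_zero[OF F(1,3)] infdist_nonneg[of \<zeta> F] by (metis less_le)
      obtain N where N: "1 < real N * infdist \<zeta> F" using reals_Archimedean3[OF d] by metis
      have "eventually (\<lambda>n. \<phi> n \<zeta> = 0) sequentially"
        using eventually_ge_at_top[of N]
      proof eventually_elim
        case (elim n)
        then have "real N * infdist \<zeta> F \<le> real n * infdist \<zeta> F" using d by (intro mult_right_mono) auto
        then show ?case using N by (simp add: \<phi>_def)
      qed
      then show ?thesis using False by (simp add: tendsto_eventually)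
    qed
    have lim: "(\<lambda>n. \<integral>\<xi>. \<phi> n \<xi> \<partial>M) \<longlonglongrightarrow> measure M F" if M: "circle_finite M" for M
    proof -
      interpret finite_measure M using circle_finiteD[OF M] by simp
      have FM: "F \<in> sets M" using FS circle_finiteD[OF M] by simp
      have "(\<lambda>n. \<integral>\<xi>. \<phi> n \<xi> \<partial>M) \<longlonglongrightarrow> (\<integral>\<xi>. indicator F \<xi> \<partial>M)"
      proof (rule integral_dominated_convergence[where w="\<lambda>_. 1"])
        show "integrable M (\<lambda>_. 1::real)" by simp
        show "\<phi> n \<in> borel_measurable M" for n
          using measurable_circle_continuous[OF \<phi>c] by (simp add: borel_measurable_circle_finite[OF M])
        show "(indicator F :: complex \<Rightarrow> real) \<in> borel_measurable M" using FM by simp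
      qed (use \<phi>lim \<phi>01 in auto)
      then show ?thesis using FM by (simp add: emeasure_eq_measure)
    qed
    have "measure \<alpha> F \<le> measure \<beta> F"
      by (rule LIMSEQ_le[OF lim[OF \<alpha>] lim[OF \<beta>]]) (use test[OF \<phi>c] \<phi>01 in auto)
    then show ?thesis by (simp add: a.emeasure_eq_measure b.emeasure_eq_measure)
  qed
  \<comment> \<open>Pushed forward to the plane, the measure is inner regular by compact sets, which
    reduces a Borel set to the closed sets already treated.\<close>
  define Ma where "Ma = distr \<alpha> borel (\<lambda>\<zeta>. \<zeta>)"
  have idm: "(\<lambda>\<zeta>. \<zeta>) \<in> \<alpha> \<rightarrow>\<^sub>M borel"
    using measurable_circle_borel_borel by (simp add: borel_measurable_circle_finite[OF \<alpha>])
  have eMa: "emeasure Ma B = emeasure \<alpha> (B \<inter> unit_circle)" if "B \<in> sets borel" for B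
    unfolding Ma_def using idm that by (subst emeasure_distr) (auto simp: circle_finiteD[OF \<alpha>])
  have AB: "A \<in> sets borel" "A \<subseteq> unit_circle" using A by (auto simp: sets_circle_borel_iff)
  have "emeasure Ma A = (SUP K \<in> {K. K \<subseteq> A \<and> compact K}. emeasure Ma K)"
  proof (rule inner_regular)
    show "sets Ma = sets borel" by (simp add: Ma_def)
    show "emeasure Ma (space Ma) \<noteq> \<infinity>" using eMa[of "space Ma"] by (simp add: Ma_def a.emeasure_finite)
  qed (rule AB)
  also have "\<dots> \<le> emeasure \<beta> A"
  proof (rule SUP_least)
    fix K assume "K \<in> {K. K \<subseteq> A \<and> compact K}"
    then have K: "K \<subseteq> A" "closed K" "K \<in> sets borel" by (auto simp: compact_imp_closed)
    have KU: "K \<inter> unit_circle = K" using K AB by auto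
    have "emeasure \<alpha> K \<le> emeasure \<beta> K" using closed_le[OF K(2)] K AB by (cases "K = {}") auto
    also have "\<dots> \<le> emeasure \<beta> A" using K A by (intro emeasure_mono) (auto simp: circle_finiteD[OF \<beta>])
    finally show "emeasure Ma K \<le> emeasure \<beta> A" by (simp add: eMa[OF K(3)] KU)
  qed
  finally show ?thesis using eMa[OF AB(1)] AB(2) by (simp add: Int_absorb2)
qed

section \<open>Radial maximal function and unimodular limits\<close>

lemma norm_cis_diff: "norm (cis s - cis t) = 2 * \<bar>sin ((s - t) / 2)\<bar>"
proof -
  have "cis s - cis t = cis ((s + t) / 2) * (cis ((s - t) / 2) - cis (- ((s - t) / 2)))"
    by (simp add: right_diff_distrib cis_mult diff_divide_distrib add_divide_distrib)
  also have "cis ((s - t) / 2) - cis (- ((s - t) / 2)) = of_real (2 * sin ((s - t) / 2)) * \<i>"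
    by (simp add: complex_eq_iff)
  finally show ?thesis by (simp add: norm_mult)
qed

lemma norm_cis_diff_le: "norm (cis s - cis t) \<le> \<bar>s - t\<bar>"
  using abs_sin_x_le_abs_x[of "(s - t) / 2"] by (simp add: norm_cis_diff)

lemma norm_cis_diff_ge:
  assumes "\<bar>s - t\<bar> \<le> pi"
  shows "\<bar>s - t\<bar> / 2 \<le> norm (cis s - cis t)"
proof -
  define x where "x = \<bar>s - t\<bar> / 2"
  \<comment> \<open>1.6 exceeds \<open>pi / 2\<close>, and its square is below 3; this gives
    \<open>x ^ 3 / 6 \<le> x / 2\<close>, hence \<open>sin x \<ge> x / 2\<close>.\<close>
  have x: "0 \<le> x" "x \<le> 1.6" using assms pi_less_4 pi_approx by (auto simp: x_def)
  have "\<bar>sin x - (\<Sum>m<3. sin_coeff m * x ^ m)\<bar> \<le> inverse (fact 3) * \<bar>x\<bar> ^ 3" by (rule Maclaurin_sin_bound)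
  moreover have "(\<Sum>m<3. sin_coeff m * x ^ m) = x" by (simp add: sin_coeff_def lessThan_nat_numeral)
  moreover have "inverse (fact 3) * \<bar>x\<bar> ^ 3 = x ^ 3 / 6" using x by (simp add: fact_numeral)
  ultimately have "\<bar>sin x - x\<bar> \<le> x ^ 3 / 6" by (simp only:)
  moreover have "x ^ 3 / 6 \<le> x / 2"
  proof -
    have "x * x \<le> 1.6 * 1.6" using x by (intro mult_mono) auto
    then have "x * (x * x) \<le> x * 3" using x by (intro mult_left_mono) auto
    then show ?thesis by (simp add: power3_eq_cube mult.assoc)
  qed
  ultimately have "x / 2 \<le> sin x" by linarith
  moreover have "\<bar>sin ((s - t) / 2)\<bar> = \<bar>sin x\<bar>" 
  proof -
    have "\<bar>sin y\<bar> = \<bar>sin \<bar>y\<bar>\<bar>" for y :: real by (simp add: abs_if)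
    moreover have "\<bar>(s - t) / 2\<bar> = x" by (simp add: x_def)
    ultimately show ?thesis by metis
  qed
  ultimately show ?thesis unfolding norm_cis_diff by (simp add: x_def)
qed

lemma circle_cis: "norm \<zeta> = 1 \<Longrightarrow> \<exists>\<theta>. \<zeta> = cis \<theta>"
  using cis_Arg[of \<zeta>] by (metis norm_zero sgn_eq div_by_1 of_real_1 zero_neq_one)

lemma circle_ball_borel: "cball \<zeta> \<rho> \<inter> unit_circle \<in> sets circle_borel"
  by (simp add: sets_circle_borel_iff)

text \<open>A chord is at least half of its angle, so the angles of the points in the disc fill an
  interval of length at most \<open>4 * \<rho>\<close> out of \<open>2 * pi\<close>.\<close>

lemma emeasure_circle_cball_le:
  assumes "norm \<zeta> = 1" "\<rho> \<ge> 0"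
  shows "emeasure circle_measure (cball \<zeta> \<rho> \<inter> unit_circle) \<le> ennreal \<rho>"
proof -
  obtain \<theta> where \<theta>: "\<zeta> = cis \<theta>" using circle_cis assms by blast
  have "{x \<in> {\<theta> - pi..<\<theta> - pi + 2*pi}. cis x \<in> cball \<zeta> \<rho> \<inter> unit_circle} \<subseteq> {\<theta> - 2 * \<rho>..\<theta> + 2 * \<rho>}"
  proof
    fix x assume x: "x \<in> {x \<in> {\<theta> - pi..<\<theta> - pi + 2*pi}. cis x \<in> cball \<zeta> \<rho> \<inter> unit_circle}"
    then have "\<bar>\<theta> - x\<bar> \<le> pi" "norm (cis \<theta> - cis x) \<le> \<rho>" by (auto simp: \<theta> dist_norm)
    then show "x \<in> {\<theta> - 2 * \<rho>..\<theta> + 2 * \<rho>}" using norm_cis_diff_ge[of \<theta> x] by auto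
  qed
  then have "emeasure lborel {x \<in> {\<theta> - pi..<\<theta> - pi + 2*pi}. cis x \<in> cball \<zeta> \<rho> \<inter> unit_circle} \<le> emeasure lborel {\<theta> - 2 * \<rho>..\<theta> + 2 * \<rho>}"
    by (intro emeasure_mono) auto
  also have "\<dots> = ennreal (4 * \<rho>)" using assms by simp
  finally have "emeasure circle_measure (cball \<zeta> \<rho> \<inter> unit_circle) \<le> ennreal (4 * \<rho>) / ennreal (2*pi)"
    unfolding emeasure_circle_measure_window[OF circle_ball_borel, of \<zeta> \<rho> "\<theta> - pi"] by (rule divide_right_mono_ennreal)
  also have "\<dots> = ennreal (4 * \<rho> / (2*pi))" using assms by (intro divide_ennreal) auto
  also have "\<dots> \<le> ennreal \<rho>" using assms pi_gt3 mult_right_mono[of 2 pi \<rho>] by (intro ennreal_leI) (simp add: field_simps)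
  finally show ?thesis .
qed

lemma emeasure_circle_cball_ge:
  assumes "norm \<zeta> = 1" "0 \<le> \<rho>" "\<rho> \<le> pi"
  shows "emeasure circle_measure (cball \<zeta> \<rho> \<inter> unit_circle) \<ge> ennreal (\<rho> / pi)"
proof -
  obtain \<theta> where \<theta>: "\<zeta> = cis \<theta>" using circle_cis assms by blast
  have mA: "{x. cis x \<in> cball \<zeta> \<rho> \<inter> unit_circle} \<in> sets borel"
    using measurable_sets[OF measurable_cis circle_ball_borel] by (simp add: vimage_def)
  have "{\<theta> - \<rho>..<\<theta> + \<rho>} \<subseteq> {x \<in> {\<theta> - pi..<\<theta> - pi + 2*pi}. cis x \<in> cball \<zeta> \<rho> \<inter> unit_circle}"
  proof
    fix x assume x: "x \<in> {\<theta> - \<rho>..<\<theta> + \<rho>}"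
    then have "norm (cis \<theta> - cis x) \<le> \<rho>" using norm_cis_diff_le[of \<theta> x] by auto
    then show "x \<in> {x \<in> {\<theta> - pi..<\<theta> - pi + 2*pi}. cis x \<in> cball \<zeta> \<rho> \<inter> unit_circle}"
      using x assms by (auto simp: \<theta> dist_norm)
  qed
  moreover have "{x \<in> {\<theta> - pi..<\<theta> - pi + 2*pi}. cis x \<in> cball \<zeta> \<rho> \<inter> unit_circle} = {\<theta> - pi..<\<theta> - pi + 2*pi} \<inter> {x. cis x \<in> cball \<zeta> \<rho> \<inter> unit_circle}" by auto
  ultimately have "emeasure lborel {\<theta> - \<rho>..<\<theta> + \<rho>} \<le> emeasure lborel {x \<in> {\<theta> - pi..<\<theta> - pi + 2*pi}. cis x \<in> cball \<zeta> \<rho> \<inter> unit_circle}"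
    using mA by (intro emeasure_mono) auto
  then have "ennreal (2 * \<rho>) \<le> emeasure lborel {x \<in> {\<theta> - pi..<\<theta> - pi + 2*pi}. cis x \<in> cball \<zeta> \<rho> \<inter> unit_circle}"
    using assms by simp
  then have "ennreal (2 * \<rho>) / ennreal (2*pi) \<le> emeasure circle_measure (cball \<zeta> \<rho> \<inter> unit_circle)"
    unfolding emeasure_circle_measure_window[OF circle_ball_borel, of \<zeta> \<rho> "\<theta> - pi"] by (rule divide_right_mono_ennreal)
  moreover have "ennreal (2 * \<rho>) / ennreal (2*pi) = ennreal (\<rho> / pi)" using assms by (subst divide_ennreal) auto
  ultimately show ?thesis by simp
qed

section \<open>The maximal inequality\<close>

lemma poisson_kernel_le:
  assumes z: "norm z < 1" and \<xi>: "norm \<xi> = 1" and d: "0 < d" "d \<le> norm (\<xi> - z)"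
  shows "poisson_kernel z \<xi> \<le> 2 * (1 - norm z) / d\<^sup>2"
proof -
  have "1 - (norm z)\<^sup>2 = (1 - norm z) * (1 + norm z)" by (simp add: power2_eq_square algebra_simps)
  also have "\<dots> \<le> (1 - norm z) * 2" using z by (intro mult_left_mono) auto
  finally have n: "1 - (norm z)\<^sup>2 \<le> 2 * (1 - norm z)" by simp
  have "d\<^sup>2 \<le> (norm (\<xi> - z))\<^sup>2" using d by (intro power_mono) auto
  then show ?thesis unfolding poisson_kernel_def
    using n d z by (intro frac_le) (auto simp: power_le_one)
qed

text \<open>The Poisson kernel is dominated by a series of normalized indicators of concentric discs.\<close>

lemma poisson_kernel_layers:
  assumes \<zeta>: "norm \<zeta> = 1" and \<xi>: "norm \<xi> = 1" and r: "0 < r" "r < 1"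
  obtains k :: nat where "\<xi> \<in> cball \<zeta> (2 ^ k * (1 - r))"
    "poisson_kernel (of_real r * \<zeta>) \<xi> \<le> 32 / (1 - r) * (1/4) ^ k"
proof -
  define s where "s = 1 - r"
  have s: "0 < s" "s < 1" using r by (auto simp: s_def)
  have nz: "norm (of_real r * \<zeta>) = r" using \<zeta> r by (simp add: norm_mult)
  have d1: "s \<le> norm (\<xi> - of_real r * \<zeta>)" using circle_disc_dist[OF \<xi>, of "of_real r * \<zeta>"] nz r by (simp add: s_def)
  have d2: "norm (\<xi> - \<zeta>) \<le> norm (\<xi> - of_real r * \<zeta>) + s"
  proof -
    have "\<xi> - \<zeta> = (\<xi> - of_real r * \<zeta>) - of_real s * \<zeta>" by (simp add: s_def algebra_simps)
    then have "norm (\<xi> - \<zeta>) \<le> norm (\<xi> - of_real r * \<zeta>) + norm (of_real s * \<zeta>)" by (metis norm_triangle_ineq4)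
    then show ?thesis using \<zeta> s by (simp add: norm_mult)
  qed
  obtain n where "norm (\<xi> - \<zeta>) / s < 2 ^ n" using real_arch_pow[of 2] by auto
  then have ex: "norm (\<xi> - \<zeta>) \<le> 2 ^ n * s" using s by (simp add: field_simps)
  \<comment> \<open>\<open>k\<close> is the first layer that reaches \<open>\<xi>\<close>.
    Minimality together with \<open>d1\<close> and \<open>d2\<close> keeps \<open>\<xi>\<close> at
    distance at least \<open>2 ^ k * s / 4\<close> from \<open>r \<zeta>\<close>, and 32 is 2 times
    the square of 4.\<close>
  define k where "k = (LEAST k. norm (\<xi> - \<zeta>) \<le> 2 ^ k * s)"
  have k: "norm (\<xi> - \<zeta>) \<le> 2 ^ k * s" unfolding k_def by (rule LeastI[of "\<lambda>k. norm (\<xi> - \<zeta>) \<le> 2 ^ k * s", OF ex])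
  have "2 ^ k * s / 4 \<le> norm (\<xi> - of_real r * \<zeta>)"
  proof (cases k)
    case 0
    then show ?thesis using d1 s by auto
  next
    case (Suc j)
    then have "\<not> norm (\<xi> - \<zeta>) \<le> 2 ^ j * s" using not_less_Least[of j "\<lambda>k. norm (\<xi> - \<zeta>) \<le> 2 ^ k * s"] by (simp add: k_def)
    then have "2 ^ k * s / 2 < norm (\<xi> - \<zeta>)" using Suc by simp
    then show ?thesis using d1 d2 by linarith
  qed
  then have "poisson_kernel (of_real r * \<zeta>) \<xi> \<le> 2 * (1 - norm (of_real r * \<zeta>)) / (2 ^ k * s / 4)\<^sup>2"
    using \<xi> nz r s by (intro poisson_kernel_le) auto
  also have "\<dots> = 2 * s / (2 ^ k * s / 4)\<^sup>2" using nz by (simp add: s_def)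
  also have "\<dots> = 32 / s * (1 / (2 ^ k * 2 ^ k))" using s by (simp add: power2_eq_square field_simps)
  also have "2 ^ k * 2 ^ k = (4::real) ^ k" by (simp flip: power_mult_distrib)
  finally have "poisson_kernel (of_real r * \<zeta>) \<xi> \<le> 32 / s * (1/4) ^ k" by (simp add: power_divide)
  moreover have "\<xi> \<in> cball \<zeta> (2 ^ k * s)" using k by (simp add: dist_norm norm_minus_commute)
  ultimately show ?thesis using that by (simp add: s_def)
qed

text \<open>If every disc about \<open>\<zeta>\<close> had mass at most
  \<open>\<kappa> * \<rho>\<close>, then the layer of radius \<open>2 ^ k * (1 - r)\<close> would
  contribute at most \<open>32 * \<kappa> / 2 ^ k\<close> to the Poisson integral. These terms add
  up to \<open>64 * \<kappa>\<close>.\<close>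

lemma poisson_maximal_ball:
  fixes u :: "complex \<Rightarrow> real"
  assumes u: "continuous_on unit_circle u" "\<And>\<xi>. norm \<xi> = 1 \<Longrightarrow> 0 \<le> u \<xi>"
    and \<zeta>: "norm \<zeta> = 1" and r: "0 < r" "r < 1" and \<kappa>: "\<kappa> > 0"
    and gt: "(\<integral>\<xi>. poisson_kernel (of_real r * \<zeta>) \<xi> * u \<xi> \<partial>circle_measure) > 64 * \<kappa>"
  shows "\<exists>\<rho>>0. ennreal (\<kappa> * \<rho>) < emeasure (density circle_measure u) (cball \<zeta> \<rho> \<inter> unit_circle)"
proof (rule ccontr)
  assume neg: "\<not> ?thesis"
  have um: "u \<in> borel_measurable circle_measure"
    using measurable_circle_continuous[OF u(1)] by (simp add: borel_measurable_circle_finite)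
  let ?B = "\<lambda>k::nat. cball \<zeta> (2 ^ k * (1 - r)) \<inter> unit_circle"
  have bB: "?B k \<in> sets circle_measure" for k using circle_ball_borel by simp
  have le: "emeasure (density circle_measure u) (?B k) \<le> ennreal (\<kappa> * (2 ^ k * (1 - r)))" for k
    using neg r by (metis linorder_not_less mult_pos_pos diff_gt_0_iff_gt zero_less_numeral zero_less_power)
  have rz: "norm (of_real r * \<zeta>) < 1" using \<zeta> r by (simp add: norm_mult)
  have "ennreal (\<integral>\<xi>. poisson_kernel (of_real r * \<zeta>) \<xi> * u \<xi> \<partial>circle_measure) =
      (\<integral>\<^sup>+\<xi>. ennreal (poisson_kernel (of_real r * \<zeta>) \<xi> * u \<xi>) \<partial>circle_measure)"
    using rz u less_imp_le[OF poisson_kernel_pos[OF _ rz]]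
    by (intro nn_integral_eq_integral[symmetric] integrable_continuous_circle continuous_intros) (auto intro!: AE_I2 mult_nonneg_nonneg)
  also have "\<dots> \<le> (\<integral>\<^sup>+\<xi>. (\<Sum>k. ennreal (32 / (1 - r) * (1/4) ^ k) * (ennreal (u \<xi>) * indicator (?B k) \<xi>)) \<partial>circle_measure)"
  proof (intro nn_integral_mono)
    fix \<xi> :: complex assume "\<xi> \<in> space circle_measure"
    then have \<xi>: "norm \<xi> = 1" by simp
    obtain k where k: "\<xi> \<in> cball \<zeta> (2 ^ k * (1 - r))" "poisson_kernel (of_real r * \<zeta>) \<xi> \<le> 32 / (1 - r) * (1/4) ^ k"
      using poisson_kernel_layers[OF \<zeta> \<xi> r] by blast
    let ?f = "\<lambda>k. ennreal (32 / (1 - r) * (1/4) ^ k) * (ennreal (u \<xi>) * indicator (?B k) \<xi>)"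
    have "ennreal (poisson_kernel (of_real r * \<zeta>) \<xi> * u \<xi>) \<le> ennreal (32 / (1 - r) * (1/4) ^ k * u \<xi>)"
      using k u(2)[OF \<xi>] by (intro ennreal_leI mult_right_mono) auto
    also have "\<dots> = ?f k" using k \<xi> r u(2)[OF \<xi>] by (subst ennreal_mult) auto
    also have "\<dots> = (\<Sum>k\<in>{k}. ?f k)" by simp
    also have "\<dots> \<le> (\<Sum>k. ?f k)" by (intro sum_le_suminf) auto
    finally show "ennreal (poisson_kernel (of_real r * \<zeta>) \<xi> * u \<xi>) \<le> (\<Sum>k. ?f k)" .
  qed
  also have "\<dots> = (\<Sum>k. ennreal (32 / (1 - r) * (1/4) ^ k) * (\<integral>\<^sup>+\<xi>. ennreal (u \<xi>) * indicator (?B k) \<xi> \<partial>circle_measure))"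
    using um bB by (subst nn_integral_suminf) (auto simp: nn_integral_cmult)
  also have "\<dots> = (\<Sum>k. ennreal (32 / (1 - r) * (1/4) ^ k) * emeasure (density circle_measure u) (?B k))"
    using um bB by (simp add: emeasure_density)
  also have "\<dots> \<le> (\<Sum>k. ennreal (32 / (1 - r) * (1/4) ^ k) * ennreal (\<kappa> * (2 ^ k * (1 - r))))"
    by (intro suminf_le mult_left_mono le) auto
  also have "\<dots> = (\<Sum>k. ennreal (32 * \<kappa> * (1/2) ^ k))"
  proof (intro suminf_cong)
    fix k :: nat
    have "32 / (1 - r) * (1/4) ^ k * (\<kappa> * (2 ^ k * (1 - r))) = 32 * \<kappa> * ((1/4) ^ k * 2 ^ k)" using r by simp
    also have "(1/4) ^ k * 2 ^ k = (1/2 :: real) ^ k" by (simp flip: power_mult_distrib)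
    finally show "ennreal (32 / (1 - r) * (1/4) ^ k) * ennreal (\<kappa> * (2 ^ k * (1 - r))) = ennreal (32 * \<kappa> * (1/2) ^ k)"
      using r \<kappa> by (simp flip: ennreal_mult)
  qed
  also have "\<dots> = ennreal (64 * \<kappa>)"
  proof (rule suminf_ennreal_eq)
    show "(\<lambda>k. 32 * \<kappa> * (1/2) ^ k) sums (64 * \<kappa>)"
      using sums_mult[OF geometric_sums[of "1/2::real"], of "32 * \<kappa>"] by simp
  qed (use \<kappa> in auto)
  finally show False using gt \<kappa> by (simp add: ennreal_le_iff)
qed

text \<open>Every point of \<open>S\<close> is the centre of a disc whose mass exceeds
  \<open>\<kappa>\<close> times its radius. By Vitali's covering lemma a disjoint subfamily has
  fivefold enlargements that cover \<open>S\<close>; the total mass of the subfamily is at most the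
  integral of \<open>u\<close>, which gives the constant 5.\<close>

lemma circle_maximal_weak_type:
  fixes u :: "complex \<Rightarrow> real"
  assumes u: "continuous_on unit_circle u" "\<And>\<xi>. norm \<xi> = 1 \<Longrightarrow> 0 \<le> u \<xi>" and \<kappa>: "\<kappa> > 0"
    and S: "S \<in> sets circle_borel"
    and gt: "\<And>\<zeta>. \<zeta> \<in> S \<Longrightarrow> \<exists>r. 0 < r \<and> r < 1 \<and> (\<integral>\<xi>. poisson_kernel (of_real r * \<zeta>) \<xi> * u \<xi> \<partial>circle_measure) > 64 * \<kappa>"
  shows "measure circle_measure S \<le> 5 / \<kappa> * (\<integral>\<xi>. u \<xi> \<partial>circle_measure)"
proof -
  define U where "U = (\<integral>\<xi>. u \<xi> \<partial>circle_measure)"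
  let ?M = "density circle_measure u"
  have um: "u \<in> borel_measurable circle_measure"
    using measurable_circle_continuous[OF u(1)] by (simp add: borel_measurable_circle_finite)
  have ui: "integrable circle_measure u" using u by (intro integrable_continuous_circle) auto
  have U: "emeasure ?M unit_circle = ennreal U" 
  proof -
    have "emeasure ?M unit_circle = (\<integral>\<^sup>+\<xi>. ennreal (u \<xi>) \<partial>circle_measure)"
      using um by (subst emeasure_density) (auto simp: sets_circle_borel_iff intro!: nn_integral_cong)
    also have "\<dots> = ennreal U" unfolding U_def using ui u by (intro nn_integral_eq_integral) auto
    finally show ?thesis .
  qed
  have U0: "U \<ge> 0" unfolding U_def using u by (intro Bochner_Integration.integral_nonneg_AE AE_I2) auto
  have SU: "S \<subseteq> unit_circle" using S by (simp add: sets_circle_borel_iff)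
  have "\<exists>\<rho>>0. ennreal (\<kappa> * \<rho>) < emeasure ?M (cball \<zeta> \<rho> \<inter> unit_circle)" if "\<zeta> \<in> S" for \<zeta>
  proof -
    have "norm \<zeta> = 1" using that SU by auto
    then show ?thesis using gt[OF that] poisson_maximal_ball[OF u _ _ _ \<kappa>] by blast
  qed
  then obtain \<rho> where \<rho>: "\<And>\<zeta>. \<zeta> \<in> S \<Longrightarrow> \<rho> \<zeta> > 0"
    "\<And>\<zeta>. \<zeta> \<in> S \<Longrightarrow> ennreal (\<kappa> * \<rho> \<zeta>) < emeasure ?M (cball \<zeta> (\<rho> \<zeta>) \<inter> unit_circle)" by metis
  have \<rho>B: "0 < \<rho> \<zeta> \<and> \<rho> \<zeta> \<le> U / \<kappa>" if "\<zeta> \<in> S" for \<zeta>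
  proof -
    have "emeasure ?M (cball \<zeta> (\<rho> \<zeta>) \<inter> unit_circle) \<le> emeasure ?M unit_circle"
      by (intro emeasure_mono) (auto simp: sets_circle_borel_iff)
    then have "ennreal (\<kappa> * \<rho> \<zeta>) \<le> ennreal U" using \<rho>(2)[OF that] U by (metis less_le order_trans)
    then have "\<kappa> * \<rho> \<zeta> \<le> U" using U0 by (simp add: ennreal_le_iff)
    then show ?thesis using \<rho>(1)[OF that] \<kappa> by (simp add: field_simps)
  qed
  have "S \<subseteq> (\<Union>\<zeta>\<in>S. cball \<zeta> (\<rho> \<zeta>))" using \<rho>(1) by force
  then obtain C where C: "countable C" "C \<subseteq> S"
    "pairwise (\<lambda>i j. disjnt (cball i (\<rho> i)) (cball j (\<rho> j))) C" "S \<subseteq> (\<Union>i\<in>C. cball i (5 * \<rho> i))"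
    by (rule Vitali_covering_lemma_cballs[where r = \<rho> and B = "U / \<kappa>"]) (use \<rho>B in auto)
  let ?I = "to_nat_on C ` C"
  \<comment> \<open>The countable Vitali family, indexed by natural numbers and padded with empty
    sets. The factor \<open>t\<close> enlarges the discs: they are disjoint for \<open>t = 1\<close>
    and cover \<open>S\<close> for \<open>t = 5\<close>.\<close>
  define X where "X t n = (if n \<in> ?I then cball (from_nat_into C n) (t * \<rho> (from_nat_into C n)) \<inter> unit_circle else {})" for t n
  have fI: "from_nat_into C n \<in> C" "to_nat_on C (from_nat_into C n) = n" if "n \<in> ?I" for n
    using that C(1) by auto
  have X5: "S \<subseteq> (\<Union>n. X 5 n)"
  proof
    fix \<zeta> assume z: "\<zeta> \<in> S"
    then obtain i where i: "i \<in> C" "\<zeta> \<in> cball i (5 * \<rho> i)" using C(4) by blast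
    then have "\<zeta> \<in> X 5 (to_nat_on C i)" using z SU C(1) by (auto simp: X_def)
    then show "\<zeta> \<in> (\<Union>n. X 5 n)" by blast
  qed
  have Xm: "X t n \<in> sets circle_borel" for t n by (auto simp: X_def circle_ball_borel)
  have dis: "disjoint_family (X 1)"
    unfolding disjoint_family_on_def
  proof (intro ballI impI)
    fix m n :: nat assume "m \<noteq> n"
    show "X 1 m \<inter> X 1 n = {}"
    proof (cases "m \<in> ?I \<and> n \<in> ?I")
      case True
      then have "from_nat_into C m \<noteq> from_nat_into C n" using \<open>m \<noteq> n\<close> fI(2) by metis
      then have "disjnt (cball (from_nat_into C m) (\<rho> (from_nat_into C m))) (cball (from_nat_into C n) (\<rho> (from_nat_into C n)))"
        using C(3) fI(1) True by (auto simp: pairwise_def)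
      then show ?thesis by (auto simp: X_def disjnt_def)
    qed (auto simp: X_def)
  qed
  have step: "emeasure circle_measure (X 5 n) \<le> ennreal (5 / \<kappa>) * emeasure ?M (X 1 n)" for n
  proof (cases "n \<in> ?I")
    case True
    let ?i = "from_nat_into C n"
    have i: "?i \<in> S" "norm ?i = 1" using fI(1)[OF True] C(2) SU by auto
    have "emeasure circle_measure (X 5 n) \<le> ennreal (5 * \<rho> ?i)"
      using True emeasure_circle_cball_le[OF i(2), of "5 * \<rho> ?i"] \<rho>(1)[OF i(1)] by (simp add: X_def)
    also have "\<dots> = ennreal (5 / \<kappa>) * ennreal (\<kappa> * \<rho> ?i)"
      using \<kappa> \<rho>(1)[OF i(1)] by (simp flip: ennreal_mult)
    also have "\<dots> \<le> ennreal (5 / \<kappa>) * emeasure ?M (X 1 n)"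
      using True \<rho>(2)[OF i(1)] by (intro mult_left_mono) (auto simp: X_def)
    finally show ?thesis .
  qed (simp add: X_def)
  have "emeasure circle_measure S \<le> emeasure circle_measure (\<Union>n. X 5 n)"
    using X5 Xm by (intro emeasure_mono) auto
  also have "\<dots> \<le> (\<Sum>n. emeasure circle_measure (X 5 n))"
    using Xm by (intro emeasure_subadditive_countably) auto
  also have "\<dots> \<le> (\<Sum>n. ennreal (5 / \<kappa>) * emeasure ?M (X 1 n))"
    by (intro suminf_le step) auto
  also have "\<dots> = ennreal (5 / \<kappa>) * (\<Sum>n. emeasure ?M (X 1 n))" by simp
  also have "(\<Sum>n. emeasure ?M (X 1 n)) = emeasure ?M (\<Union>n. X 1 n)"
    using Xm dis by (intro suminf_emeasure) auto
  also have "\<dots> \<le> ennreal U" unfolding U[symmetric]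
    by (intro emeasure_mono) (auto simp: X_def sets_circle_borel_iff)
  finally have "emeasure circle_measure S \<le> ennreal (5 / \<kappa>) * ennreal U" by (simp add: mult_left_mono)
  also have "\<dots> = ennreal (5 / \<kappa> * U)" using \<kappa> U0 by (simp flip: ennreal_mult)
  finally show ?thesis using \<kappa> U0 by (simp add: circle.emeasure_eq_measure U_def)
qed

text \<open>Each single radius imposes an open condition on \<open>\<zeta>\<close>, so the
  uncountable union over \<open>r\<close> is open and hence Borel.\<close>

lemma circle_open_borel:
  assumes "g holomorphic_on unit_disc" "\<rho> \<le> 1"
  shows "{\<zeta> \<in> unit_circle. \<exists>r. 0 < r \<and> r < \<rho> \<and> norm (g (of_real r * \<zeta>)) > l} \<in> sets circle_borel"
proof -
  have op: "open {\<zeta> \<in> ball 0 (1/r). norm (g (of_real r * \<zeta>)) > l}" if r: "0 < r" "r < 1" for r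
  proof -
    have "continuous_on (ball 0 (1/r)) (\<lambda>z. norm (g (of_real r * z)))"
      by (intro continuous_on_norm holomorphic_on_imp_continuous_on holomorphic_on_dilate assms r)
    then have "open (ball 0 (1/r) \<inter> (\<lambda>z. norm (g (of_real r * z))) -` {l<..})"
      by (rule continuous_open_preimage) auto
    moreover have "ball 0 (1/r) \<inter> (\<lambda>z. norm (g (of_real r * z))) -` {l<..} = {\<zeta> \<in> ball 0 (1/r). norm (g (of_real r * \<zeta>)) > l}" by auto
    ultimately show ?thesis by simp
  qed
  let ?U = "\<Union>r\<in>{0<..<\<rho>}. {\<zeta> \<in> ball 0 (1/r). norm (g (of_real r * \<zeta>)) > l}"
  have "open ?U" using op assms(2) by (intro open_UN) auto
  moreover have "{\<zeta> \<in> unit_circle. \<exists>r. 0 < r \<and> r < \<rho> \<and> norm (g (of_real r * \<zeta>)) > l} = ?U \<inter> unit_circle"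
    using assms(2) by (auto simp: less_divide_eq)
  ultimately show ?thesis by (simp add: sets_circle_borel_iff)
qed

text \<open>The square of \<open>g\<close> is holomorphic, so on the circle of radius
  \<open>R n\<close> its modulus dominates that of \<open>g\<^sup>2\<close> inside through the
  Poisson formula. The weak type bound with \<open>\<kappa> = l\<^sup>2 / 64\<close> gives 5 * 64 =
  320, uniformly in \<open>n\<close>, and the exceptional sets increase with
  \<open>n\<close>.\<close>

lemma radial_maximal:
  assumes g: "g holomorphic_on unit_disc" and l: "l > 0"
    and Q: "\<And>r. 0 < r \<Longrightarrow> r < 1 \<Longrightarrow> (\<integral>\<zeta>. (norm (g (of_real r * \<zeta>)))\<^sup>2 \<partial>circle_measure) \<le> Q"
  shows "measure circle_measure {\<zeta> \<in> unit_circle. \<exists>r. 0 < r \<and> r < 1 \<and> norm (g (of_real r * \<zeta>)) > l} \<le> 320 * Q / l\<^sup>2"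
proof -
  define R where "R n = 1 - 1 / (real n + 2)" for n
  have R: "0 < R n" "R n < 1" for n by (auto simp: R_def field_simps)
  define A where "A n = {\<zeta> \<in> unit_circle. \<exists>r. 0 < r \<and> r < R n \<and> norm (g (of_real r * \<zeta>)) > l}" for n
  have Am: "A n \<in> sets circle_borel" for n unfolding A_def using R[of n] by (intro circle_open_borel g) auto
  have Rinc: "m \<le> n \<Longrightarrow> R m \<le> R n" for m n by (auto simp: R_def intro!: divide_left_mono)
  have "incseq A" unfolding incseq_def A_def using Rinc by fastforce
  moreover have "(\<Union>n. A n) = {\<zeta> \<in> unit_circle. \<exists>r. 0 < r \<and> r < 1 \<and> norm (g (of_real r * \<zeta>)) > l}"
  proof (intro set_eqI iffI)
    fix \<zeta> assume "\<zeta> \<in> {\<zeta> \<in> unit_circle. \<exists>r. 0 < r \<and> r < 1 \<and> norm (g (of_real r * \<zeta>)) > l}"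
    then obtain r where r: "\<zeta> \<in> unit_circle" "0 < r" "r < 1" "norm (g (of_real r * \<zeta>)) > l" by auto
    have "R \<longlonglongrightarrow> 1" unfolding R_def by real_asymp
    then obtain n where "r < R n" using order_tendstoD(1)[of R 1 sequentially r] r(3) by (auto simp: eventually_sequentially)
    then show "\<zeta> \<in> (\<Union>n. A n)" using r by (auto simp: A_def)
  qed (use R in \<open>auto simp: A_def intro: less_trans\<close>)
  ultimately have lim: "(\<lambda>n. measure circle_measure (A n)) \<longlonglongrightarrow> measure circle_measure {\<zeta> \<in> unit_circle. \<exists>r. 0 < r \<and> r < 1 \<and> norm (g (of_real r * \<zeta>)) > l}"
    using circle.finite_Lim_measure_incseq[of A] Am by auto
  have "measure circle_measure (A n) \<le> 320 * Q / l\<^sup>2" for n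
  proof -
    define u where "u \<xi> = (norm (g (of_real (R n) * \<xi>)))\<^sup>2" for \<xi>
    have hol: "(\<lambda>z. g (of_real (R n) * z)) holomorphic_on ball 0 (1 / R n)" by (rule holomorphic_on_dilate[OF g R])
    have R1: "1 < 1 / R n" using R[of n] by simp
    have gc: "continuous_on unit_circle (\<lambda>z. g (of_real (R n) * z))"
      using holomorphic_on_imp_continuous_on[OF hol] by (rule continuous_on_subset) (use R1 in auto)
    have uc: "continuous_on unit_circle u" unfolding u_def by (intro continuous_intros gc)
    have "measure circle_measure (A n) \<le> 5 / (l\<^sup>2 / 64) * (\<integral>\<xi>. u \<xi> \<partial>circle_measure)"
    proof (rule circle_maximal_weak_type[OF uc _ _ Am])
      fix \<zeta> assume "\<zeta> \<in> A n"
      then obtain r where r: "norm \<zeta> = 1" "0 < r" "r < R n" "norm (g (of_real r * \<zeta>)) > l" by (auto simp: A_def)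
      define s where "s = r / R n"
      have s: "0 < s" "s < 1" using r R[of n] by (auto simp: s_def)
      have sz: "norm (of_real s * \<zeta>) < 1" using s r by (simp add: norm_mult)
      have rs: "of_real r * \<zeta> = of_real (R n) * (of_real s * \<zeta>)"
        using R[of n] by (simp add: s_def)
      have "(\<integral>\<xi>. of_real (poisson_kernel (of_real s * \<zeta>) \<xi>) * (g (of_real (R n) * \<xi>))\<^sup>2 \<partial>circle_measure) = (g (of_real (R n) * (of_real s * \<zeta>)))\<^sup>2"
        by (rule circle_poisson_formula[OF _ R1 sz]) (intro holomorphic_intros hol)
      then have "(norm (g (of_real r * \<zeta>)))\<^sup>2 = norm (\<integral>\<xi>. of_real (poisson_kernel (of_real s * \<zeta>) \<xi>) * (g (of_real (R n) * \<xi>))\<^sup>2 \<partial>circle_measure)"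
        by (simp add: rs norm_power)
      also have "\<dots> \<le> (\<integral>\<xi>. norm (of_real (poisson_kernel (of_real s * \<zeta>) \<xi>) * (g (of_real (R n) * \<xi>))\<^sup>2) \<partial>circle_measure)"
        by (rule integral_norm_bound)
      also have "\<dots> = (\<integral>\<xi>. poisson_kernel (of_real s * \<zeta>) \<xi> * u \<xi> \<partial>circle_measure)"
        using poisson_kernel_pos[OF _ sz]
        by (intro Bochner_Integration.integral_cong refl) (auto simp: norm_mult norm_power u_def less_imp_le)
      finally have "(norm (g (of_real r * \<zeta>)))\<^sup>2 \<le> (\<integral>\<xi>. poisson_kernel (of_real s * \<zeta>) \<xi> * u \<xi> \<partial>circle_measure)" .
      moreover have "l\<^sup>2 < (norm (g (of_real r * \<zeta>)))\<^sup>2" using r l by (intro power_strict_mono) auto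
      ultimately show "\<exists>r. 0 < r \<and> r < 1 \<and> (\<integral>\<xi>. poisson_kernel (of_real r * \<zeta>) \<xi> * u \<xi> \<partial>circle_measure) > 64 * (l\<^sup>2 / 64)"
        using s by (intro exI[of _ s]) auto
    qed (use l in \<open>auto simp: u_def\<close>)
    also have "\<dots> \<le> 5 / (l\<^sup>2 / 64) * Q" using Q[OF R] l unfolding u_def by (intro mult_left_mono) auto
    finally show ?thesis by simp
  qed
  then show ?thesis by (intro LIMSEQ_le_const2[OF lim]) auto
qed

text \<open>The limit is quantified instead of being taken as \<open>boundary_value\<close>, whose
  value says nothing at points where no radial limit exists.\<close>

definition radially_unimodular :: "(complex \<Rightarrow> complex) \<Rightarrow> bool" where
  "radially_unimodular f \<longleftrightarrow>
     (AE \<zeta> in circle_measure. \<exists>l. norm l = 1 \<and> ((\<lambda>r. f (of_real r * \<zeta>)) \<longlongrightarrow> l) (at_left 1))"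

lemma radially_unimodular_mult:
  assumes "radially_unimodular f" "radially_unimodular g"
  shows "radially_unimodular (\<lambda>z. f z * g z)"
  using assms unfolding radially_unimodular_def
proof eventually_elim
  case (elim \<zeta>)
  then obtain l m where "norm l = 1" "((\<lambda>r. f (of_real r * \<zeta>)) \<longlongrightarrow> l) (at_left 1)"
    "norm m = 1" "((\<lambda>r. g (of_real r * \<zeta>)) \<longlongrightarrow> m) (at_left 1)" by blast
  then show ?case by (intro exI[of _ "l * m"]) (auto simp: norm_mult intro: tendsto_mult)
qed

lemma radial_in_disc: "norm \<zeta> = 1 \<Longrightarrow> 0 < r \<Longrightarrow> r < 1 \<Longrightarrow> norm (of_real r * \<zeta> :: complex) < 1"
  by (simp add: norm_mult)

text \<open>A bounded function whose unimodular divisors leave cofactors arbitrarily close to \<open>1\<close> at the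
  origin is unimodular: the maximal inequality makes the cofactors uniformly close to \<open>1\<close> on most radii.\<close>

lemma radially_unimodular_limit:
  assumes ap: "\<And>e. e > 0 \<Longrightarrow> \<exists>f g. (\<forall>z. norm z < 1 \<longrightarrow> \<Theta> z = f z * g z \<and> norm (f z) \<le> 1 \<and> norm (g z) \<le> 1) \<and>
      radially_unimodular f \<and> g holomorphic_on unit_disc \<and> Re (g 0) \<ge> 1 - e"
  shows "radially_unimodular \<Theta>"
proof -
  define l where "l n = (1/2 :: real) ^ n" for n
  have l: "l n > 0" for n by (simp add: l_def)
  \<comment> \<open>Chosen so that \<open>radial_maximal\<close> with \<open>Q = 2 * e n\<close>
    bounds the exceptional set by \<open>320 * (2 * e n) / (l n)\<^sup>2 = l n\<close>, which is
    summable.\<close>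
  define e where "e n = (l n) ^ 3 / 640" for n
  have "\<forall>n. \<exists>f g. (\<forall>z. norm z < 1 \<longrightarrow> \<Theta> z = f z * g z \<and> norm (f z) \<le> 1 \<and> norm (g z) \<le> 1) \<and>
      radially_unimodular f \<and> g holomorphic_on unit_disc \<and> Re (g 0) \<ge> 1 - e n"
    using ap l by (simp add: e_def)
  then obtain f g where fg: "\<And>n z. norm z < 1 \<Longrightarrow> \<Theta> z = f n z * g n z"
    and f1: "\<And>n z. norm z < 1 \<Longrightarrow> norm (f n z) \<le> 1" and g1: "\<And>n z. norm z < 1 \<Longrightarrow> norm (g n z) \<le> 1"
    and fu: "\<And>n. radially_unimodular (f n)" and gh: "\<And>n. g n holomorphic_on unit_disc"
    and g0: "\<And>n. Re (g n 0) \<ge> 1 - e n" by metis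
  define A where "A n = {\<zeta> \<in> unit_circle. \<exists>r. 0 < r \<and> r < 1 \<and> norm (1 - g n (of_real r * \<zeta>)) > l n}" for n
  have hol: "(\<lambda>z. 1 - g n z) holomorphic_on unit_disc" for n by (intro holomorphic_intros gh)
  have Am: "A n \<in> sets circle_borel" for n unfolding A_def using circle_open_borel[OF hol, of 1] by simp
  have mA: "measure circle_measure (A n) \<le> l n" for n
  proof -
    have "measure circle_measure (A n) \<le> 320 * (2 * e n) / (l n)\<^sup>2" unfolding A_def
    proof (rule radial_maximal[OF hol l])
      fix r :: real assume r: "0 < r" "r < 1"
      have gc: "continuous_on unit_circle (\<lambda>\<zeta>. g n (of_real r * \<zeta>))"
        by (rule continuous_on_subset[OF holomorphic_on_imp_continuous_on[OF holomorphic_on_dilate[OF gh r]]])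
           (use r in auto)
      have gi: "integrable circle_measure (\<lambda>\<zeta>. g n (of_real r * \<zeta>))" by (intro integrable_continuous_circle gc) auto
      \<comment> \<open>For a number \<open>a\<close> of modulus at most 1 the square of
        \<open>norm (1 - a)\<close> is at most \<open>2 - 2 * Re a\<close>; the mean of the right
        side is its value at the origin.\<close>
      have "(\<integral>\<zeta>. (norm (1 - g n (of_real r * \<zeta>)))\<^sup>2 \<partial>circle_measure) \<le> (\<integral>\<zeta>. 2 - 2 * Re (g n (of_real r * \<zeta>)) \<partial>circle_measure)"
      proof (rule integral_mono)
        show "integrable circle_measure (\<lambda>\<zeta>. (norm (1 - g n (of_real r * \<zeta>)))\<^sup>2)"
          by (intro integrable_continuous_circle continuous_intros gc) auto
        show "integrable circle_measure (\<lambda>\<zeta>. 2 - 2 * Re (g n (of_real r * \<zeta>)))"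
          by (intro integrable_continuous_circle continuous_intros gc) auto
        fix \<zeta> :: complex assume "\<zeta> \<in> space circle_measure"
        then have "norm (g n (of_real r * \<zeta>)) \<le> 1" using g1 radial_in_disc r by simp
        then have "(norm (g n (of_real r * \<zeta>)))\<^sup>2 \<le> 1" by (simp add: power_le_one)
        then show "(norm (1 - g n (of_real r * \<zeta>)))\<^sup>2 \<le> 2 - 2 * Re (g n (of_real r * \<zeta>))"
          unfolding cmod_power2 by (simp add: power2_eq_square algebra_simps)
      qed
      also have "\<dots> = 2 - 2 * Re (\<integral>\<zeta>. g n (of_real r * \<zeta>) \<partial>circle_measure)"
        using gi by simp
      also have "\<dots> = 2 - 2 * Re (g n 0)" by (simp add: circle_mean_value_disc[OF gh r])
      also have "\<dots> \<le> 2 * e n" using g0[of n] by simp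
      finally show "(\<integral>\<zeta>. (norm (1 - g n (of_real r * \<zeta>)))\<^sup>2 \<partial>circle_measure) \<le> 2 * e n" .
    qed
    also have "\<dots> = l n" using l[of n] by (simp add: e_def power2_eq_square power3_eq_cube)
    finally show ?thesis .
  qed
  \<comment> \<open>By Borel-Cantelli almost every radius avoids all but finitely many exceptional
    sets, and along it \<open>\<Theta>\<close> is within \<open>l n\<close> of \<open>f n\<close>
    for all large \<open>n\<close>. The limits \<open>c n\<close> of the \<open>f n\<close> are then
    Cauchy.\<close>
  have "AE \<zeta> in circle_measure. eventually (\<lambda>n. \<zeta> \<in> space circle_measure - A n) sequentially"
  proof (rule borel_cantelli_AE1)
    show "summable (\<lambda>n. measure circle_measure (A n))"
    proof (rule summable_comparison_test'[of l 0])
      show "summable l" unfolding l_def by (intro summable_geometric) simp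
    qed (use mA in simp)
  qed (use Am in \<open>auto simp: circle.emeasure_eq_measure\<close>)
  moreover have "AE \<zeta> in circle_measure. \<forall>n. \<exists>c. norm c = 1 \<and> ((\<lambda>r. f n (of_real r * \<zeta>)) \<longlongrightarrow> c) (at_left 1)"
    using fu unfolding radially_unimodular_def by (simp add: AE_all_countable)
  ultimately show ?thesis unfolding radially_unimodular_def
  proof eventually_elim
    case (elim \<zeta>)
    then obtain N where N: "\<And>n. n \<ge> N \<Longrightarrow> \<zeta> \<in> unit_circle - A n" by (auto simp: eventually_sequentially)
    have \<zeta>: "norm \<zeta> = 1" using N[of N] by auto
    obtain c where c: "\<And>n. norm (c n) = 1" "\<And>n. ((\<lambda>r. f n (of_real r * \<zeta>)) \<longlongrightarrow> c n) (at_left 1)" using elim(2) by metis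
    have close: "norm (\<Theta> (of_real r * \<zeta>) - f n (of_real r * \<zeta>)) \<le> l n" if "n \<ge> N" "0 < r" "r < 1" for n r
    proof -
      let ?z = "of_real r * \<zeta>"
      have z: "norm ?z < 1" using that \<zeta> by (intro radial_in_disc)
      have "norm (1 - g n ?z) \<le> l n"
        using N[OF that(1)] that(2,3) \<zeta> by (simp add: A_def) (meson not_less)
      moreover have "\<Theta> ?z - f n ?z = - (f n ?z * (1 - g n ?z))" using fg[OF z] by (simp add: algebra_simps)
      ultimately show ?thesis using mult_mono[OF f1[OF z] \<open>norm (1 - g n ?z) \<le> l n\<close>] by (simp add: norm_mult)
    qed
    have ev01: "eventually (\<lambda>r. r \<in> {0<..<1}) (at_left (1::real))" by (rule eventually_at_left_real) simp
    have evc: "eventually (\<lambda>r. norm (\<Theta> (of_real r * \<zeta>) - c n) \<le> 2 * l n) (at_left 1)" if "n \<ge> N" for n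
      using tendstoD[OF c(2) l, of n n] ev01
    proof eventually_elim
      case (elim r)
      have "norm (\<Theta> (of_real r * \<zeta>) - c n) \<le> norm (\<Theta> (of_real r * \<zeta>) - f n (of_real r * \<zeta>)) + norm (f n (of_real r * \<zeta>) - c n)"
        by (metis norm_triangle_ineq diff_add_cancel add_diff_eq)
      then show ?case using close[OF that, of r] elim by (auto simp: dist_norm)
    qed
    have cc: "norm (c m - c n) \<le> 2 * l m + 2 * l n" if "m \<ge> N" "n \<ge> N" for m n
    proof -
      have "eventually (\<lambda>r. norm (c m - c n) \<le> 2 * l m + 2 * l n) (at_left (1::real))"
        using evc[OF that(1)] evc[OF that(2)]
      proof eventually_elim
        case (elim r)
        have "norm (c m - c n) \<le> norm (\<Theta> (of_real r * \<zeta>) - c n) + norm (\<Theta> (of_real r * \<zeta>) - c m)"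
          by (metis norm_triangle_ineq4 diff_diff_eq2 diff_add_cancel add_diff_cancel_left' diff_add_eq)
        then show ?case using elim by linarith
      qed
      then show ?thesis by (simp add: eventually_const_iff)
    qed
    have llim: "l \<longlonglongrightarrow> 0" unfolding l_def by (rule LIMSEQ_power_zero) simp
    have "Cauchy c"
    proof (rule metric_CauchyI)
      fix \<epsilon> :: real assume "\<epsilon> > 0"
      then obtain M where M: "\<And>n. n \<ge> M \<Longrightarrow> l n < \<epsilon> / 4"
        using order_tendstoD(2)[OF llim, of "\<epsilon>/4"] by (auto simp: eventually_sequentially)
      show "\<exists>M. \<forall>m\<ge>M. \<forall>n\<ge>M. dist (c m) (c n) < \<epsilon>"
      proof (intro exI[of _ "max M N"] allI impI)
        fix m n assume "max M N \<le> m" "max M N \<le> n"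
        then show "dist (c m) (c n) < \<epsilon>" using cc[of m n] M[of m] M[of n] by (simp add: dist_norm)
      qed
    qed
    then obtain L where L: "c \<longlonglongrightarrow> L" using Cauchy_convergent_iff convergent_def by blast
    have "(\<lambda>n. norm (c n)) \<longlonglongrightarrow> norm L" by (intro tendsto_intros L)
    then have nL: "norm L = 1" using c(1) by (simp add: LIMSEQ_const_iff)
    have "((\<lambda>r. \<Theta> (of_real r * \<zeta>)) \<longlongrightarrow> L) (at_left 1)"
    proof (rule tendstoI)
      fix \<epsilon> :: real assume \<epsilon>: "\<epsilon> > 0"
      have "eventually (\<lambda>n. l n < \<epsilon> / 4 \<and> dist (c n) L < \<epsilon> / 2 \<and> n \<ge> N) sequentially"
        using \<epsilon> by (intro eventually_conj order_tendstoD(2)[OF llim] tendstoD[OF L] eventually_ge_at_top) auto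
      then obtain n where n: "l n < \<epsilon> / 4" "dist (c n) L < \<epsilon> / 2" "n \<ge> N" using eventually_happens by force
      show "eventually (\<lambda>r. dist (\<Theta> (of_real r * \<zeta>)) L < \<epsilon>) (at_left 1)"
        using evc[OF n(3)]
      proof eventually_elim
        case (elim r)
        then have "dist (\<Theta> (of_real r * \<zeta>)) (c n) < \<epsilon> / 2" using n by (simp add: dist_norm)
        then show ?case using n(2) dist_triangle_half_l[of _ "c n" \<epsilon> L] by (metis dist_commute dist_triangle_half_r)
      qed
    qed
    then show ?case using nL by blast
  qed
qed

section \<open>Weighted growth spaces\<close>

text \<open>The bound \<open>w 1 \<le> 1\<close> is not part of a majorant; it follows from the
  comparability hypothesis in \<open>majorant_entropy_weight\<close>. With it every uniform bound is
  at once a bound for the weighted modulus.\<close>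

locale growth_weight =
  fixes w :: "real \<Rightarrow> real"
  assumes w_cont: "continuous_on {0..1} w" and w_mono: "mono_on {0..1} w"
    and w_0: "w 0 = 0" and w_pos: "\<And>t. 0 < t \<Longrightarrow> t \<le> 1 \<Longrightarrow> 0 < w t" and w_1: "w 1 \<le> 1"
begin

lemma w_le: "0 \<le> s \<Longrightarrow> s \<le> t \<Longrightarrow> t \<le> 1 \<Longrightarrow> w s \<le> w t"
  using w_mono by (auto simp: mono_on_def)

lemma w_bounds: "0 \<le> t \<Longrightarrow> t \<le> 1 \<Longrightarrow> 0 \<le> w t \<and> w t \<le> 1"
  using w_le[of 0 t] w_le[of t 1] w_0 w_1 by auto

lemma w_disc: "norm z < 1 \<Longrightarrow> 0 < w (1 - norm z) \<and> w (1 - norm z) \<le> 1"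
  using w_pos[of "1 - norm z"] w_bounds[of "1 - norm z"] by auto

lemma w_small:
  assumes "e > 0"
  obtains \<delta> where "0 < \<delta>" "\<delta> < 1" "\<And>t. 0 \<le> t \<Longrightarrow> t \<le> \<delta> \<Longrightarrow> w t < e"
proof -
  have "continuous (at 0 within {0..1}) w" using w_cont by (simp add: continuous_on_eq_continuous_within)
  then obtain d where d: "d > 0" "\<And>t. t \<in> {0..1} \<Longrightarrow> dist t 0 < d \<Longrightarrow> dist (w t) (w 0) < e"
    using assms unfolding continuous_within_eps_delta by blast
  show ?thesis
  proof (rule that[of "min (d/2) (1/2)"])
    fix t assume "0 \<le> t" "t \<le> min (d/2) (1/2)"
    then show "w t < e" using d(2)[of t] d(1) w_0 by (auto simp: dist_real_def)
  qed (use d in auto)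
qed

lemma growth_space_iff:
  "g \<in> growth_space w \<longleftrightarrow> g holomorphic_on unit_disc \<and>
     (\<forall>e>0. \<exists>d<1. \<forall>z. d < norm z \<longrightarrow> norm z < 1 \<longrightarrow> w (1 - norm z) * norm (g z) < e)"
proof -
  have ev: "eventually P (filtercomap norm (at_left 1)) \<longleftrightarrow> (\<exists>d<1. \<forall>z. d < norm z \<longrightarrow> norm z < 1 \<longrightarrow> P z)"
    for P :: "complex \<Rightarrow> bool"
  proof
    assume "\<exists>d<1. \<forall>z. d < norm z \<longrightarrow> norm z < 1 \<longrightarrow> P z"
    then obtain d where "d < 1" "\<forall>z. d < norm z \<longrightarrow> norm z < 1 \<longrightarrow> P z" by blast
    then show "eventually P (filtercomap norm (at_left 1))"
      unfolding eventually_filtercomap eventually_at_left_field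
      by (intro exI[of _ "\<lambda>y. d < y \<and> y < 1"]) auto
  next
    assume "eventually P (filtercomap norm (at_left 1))"
    then show "\<exists>d<1. \<forall>z. d < norm z \<longrightarrow> norm z < 1 \<longrightarrow> P z"
      unfolding eventually_filtercomap eventually_at_left_field by blast
  qed
  have "norm (complex_of_real (w (1 - norm z)) * g z) = w (1 - norm z) * norm (g z)" if "norm z < 1" for z
    using w_disc[OF that] by (simp add: norm_mult)
  then show ?thesis
    unfolding growth_space_def tendsto_iff ev by (auto simp: dist_norm)
qed

lemma growth_space_small:
  assumes "g \<in> growth_space w" "e > 0"
  obtains d where "d < 1" "\<And>z. d < norm z \<Longrightarrow> norm z < 1 \<Longrightarrow> w (1 - norm z) * norm (g z) < e"
proof -
  have "\<exists>d<1. \<forall>z. d < norm z \<longrightarrow> norm z < 1 \<longrightarrow> w (1 - norm z) * norm (g z) < e"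
    using assms by (simp add: growth_space_iff)
  then show ?thesis using that by blast
qed

lemma growth_space_bounded:
  assumes "g \<in> growth_space w"
  obtains M where "M > 0" "\<And>z. norm z < 1 \<Longrightarrow> w (1 - norm z) * norm (g z) \<le> M"
proof -
  obtain d where d: "d < 1" "\<And>z. d < norm z \<Longrightarrow> norm z < 1 \<Longrightarrow> w (1 - norm z) * norm (g z) < 1"
    using growth_space_small[OF assms, of 1] by auto
  have hol: "g holomorphic_on unit_disc" using assms by (simp add: growth_space_iff)
  have "continuous_on (cball 0 d) g"
    using holomorphic_on_imp_continuous_on[OF hol] by (rule continuous_on_subset) (use d in auto)
  then have "bounded (g ` cball 0 d)" by (intro compact_imp_bounded compact_continuous_image) auto
  then obtain B where "\<forall>x\<in>cball 0 d. norm (g x) \<le> B" by (auto simp: bounded_iff)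
  then have B: "norm (g z) \<le> B" if "norm z \<le> d" for z using that by auto
  show ?thesis
  proof (rule that[of "max B 1"])
    fix z :: complex assume z: "norm z < 1"
    show "w (1 - norm z) * norm (g z) \<le> max B 1"
    proof (cases "norm z \<le> d")
      case True
      have "w (1 - norm z) * norm (g z) \<le> 1 * norm (g z)" using w_disc[OF z] by (intro mult_right_mono) auto
      then show ?thesis using B[OF True] by auto
    next
      case False
      then show ?thesis using d(2)[of z] z by auto
    qed
  qed auto
qed

lemma growth_norm_le: "(\<And>z. norm z < 1 \<Longrightarrow> w (1 - norm z) * norm (g z) \<le> e) \<Longrightarrow> growth_norm w g \<le> e"
  unfolding growth_norm_def by (rule cSUP_least) auto

lemma growth_norm_ge:
  assumes "g \<in> growth_space w" "norm z < 1"
  shows "w (1 - norm z) * norm (g z) \<le> growth_norm w g"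
proof -
  obtain M where "\<And>z. norm z < 1 \<Longrightarrow> w (1 - norm z) * norm (g z) \<le> M"
    using growth_space_bounded[OF assms(1)] by blast
  then have "bdd_above ((\<lambda>z. w (1 - norm z) * norm (g z)) ` unit_disc)"
    by (auto simp: bdd_above_def intro!: exI[of _ M])
  then show ?thesis unfolding growth_norm_def by (rule cSUP_upper[rotated]) (use assms in auto)
qed

lemma H_infinity_iff: "h \<in> H_infinity \<longleftrightarrow> h holomorphic_on unit_disc \<and> (\<exists>B>0. \<forall>z. norm z < 1 \<longrightarrow> norm (h z) \<le> B)"
proof
  assume "h \<in> H_infinity"
  then have "h holomorphic_on unit_disc" "bounded (h ` unit_disc)" by (auto simp: H_infinity_def)
  then show "h holomorphic_on unit_disc \<and> (\<exists>B>0. \<forall>z. norm z < 1 \<longrightarrow> norm (h z) \<le> B)"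
    by (auto simp: bounded_pos)
next
  assume *: "h holomorphic_on unit_disc \<and> (\<exists>B>0. \<forall>z. norm z < 1 \<longrightarrow> norm (h z) \<le> B)"
  then obtain B where "\<And>z. norm z < 1 \<Longrightarrow> norm (h z) \<le> B" by blast
  then have "bounded (h ` unit_disc)" by (auto simp: bounded_iff intro!: exI[of _ B])
  then show "h \<in> H_infinity" using * by (simp add: H_infinity_def)
qed

lemma growth_space_add:
  assumes "g \<in> growth_space w" "h \<in> growth_space w"
  shows "(\<lambda>z. g z + h z) \<in> growth_space w"
proof -
  have hol: "(\<lambda>z. g z + h z) holomorphic_on unit_disc"
    using assms by (intro holomorphic_intros) (auto simp: growth_space_def)
  have "\<exists>d<1. \<forall>z. d < norm z \<longrightarrow> norm z < 1 \<longrightarrow> w (1 - norm z) * norm (g z + h z) < e" if e: "e > 0" for e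
  proof -
    obtain d1 where d1: "d1 < 1" "\<And>z. d1 < norm z \<Longrightarrow> norm z < 1 \<Longrightarrow> w (1 - norm z) * norm (g z) < e/2"
      using growth_space_small[OF assms(1) half_gt_zero[OF e]] by blast
    obtain d2 where d2: "d2 < 1" "\<And>z. d2 < norm z \<Longrightarrow> norm z < 1 \<Longrightarrow> w (1 - norm z) * norm (h z) < e/2"
      using growth_space_small[OF assms(2) half_gt_zero[OF e]] by blast
    show ?thesis
    proof (intro exI[of _ "max d1 d2"] conjI allI impI)
      fix z :: complex assume z: "max d1 d2 < norm z" "norm z < 1"
      have "w (1 - norm z) * norm (g z + h z) \<le> w (1 - norm z) * (norm (g z) + norm (h z))"
        using w_disc[OF z(2)] by (intro mult_left_mono norm_triangle_ineq) auto
      also have "\<dots> < e" using d1(2)[of z] d2(2)[of z] z by (simp add: distrib_left)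
      finally show "w (1 - norm z) * norm (g z + h z) < e" .
    qed (use d1 d2 in auto)
  qed
  then show ?thesis using hol unfolding growth_space_iff by blast
qed

lemma growth_space_mult:
  assumes "h \<in> H_infinity" "g \<in> growth_space w"
  shows "(\<lambda>z. h z * g z) \<in> growth_space w"
proof -
  from assms(1) obtain B where B: "B > 0" "\<And>z. norm z < 1 \<Longrightarrow> norm (h z) \<le> B" and hh: "h holomorphic_on unit_disc"
    unfolding H_infinity_iff by blast
  have hol: "(\<lambda>z. h z * g z) holomorphic_on unit_disc"
    using assms hh by (intro holomorphic_intros) (auto simp: growth_space_def)
  have "\<exists>d<1. \<forall>z. d < norm z \<longrightarrow> norm z < 1 \<longrightarrow> w (1 - norm z) * norm (h z * g z) < e" if e: "e > 0" for e
  proof -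
    have "e / B > 0" using e B by simp
    then obtain d where d: "d < 1" "\<And>z. d < norm z \<Longrightarrow> norm z < 1 \<Longrightarrow> w (1 - norm z) * norm (g z) < e/B"
      using growth_space_small[OF assms(2)] by blast
    show ?thesis
    proof (intro exI[of _ d] conjI allI impI)
      fix z :: complex assume z: "d < norm z" "norm z < 1"
      have "w (1 - norm z) * norm (h z * g z) = norm (h z) * (w (1 - norm z) * norm (g z))" by (simp add: norm_mult)
      also have "\<dots> \<le> B * (w (1 - norm z) * norm (g z))" using B w_disc[OF z(2)] z by (intro mult_right_mono) auto
      also have "\<dots> < e" using d(2)[OF z] B by (simp add: field_simps)
      finally show "w (1 - norm z) * norm (h z * g z) < e" .
    qed (use d in auto)
  qed
  then show ?thesis using hol unfolding growth_space_iff by blast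
qed

lemma H_infinity_mult: "g \<in> H_infinity \<Longrightarrow> h \<in> H_infinity \<Longrightarrow> (\<lambda>z. g z * h z) \<in> H_infinity"
proof -
  assume "g \<in> H_infinity" "h \<in> H_infinity"
  then obtain A B where g: "g holomorphic_on unit_disc" "A > 0" "\<And>z. norm z < 1 \<Longrightarrow> norm (g z) \<le> A"
    and h: "h holomorphic_on unit_disc" "B > 0" "\<And>z. norm z < 1 \<Longrightarrow> norm (h z) \<le> B"
    unfolding H_infinity_iff by blast
  have "norm (g z * h z) \<le> A * B" if "norm z < 1" for z
    using g(2,3) h(2,3) that by (auto simp: norm_mult intro!: mult_mono)
  moreover have "(\<lambda>z. g z * h z) holomorphic_on unit_disc" using g h by (intro holomorphic_intros)
  ultimately show ?thesis unfolding H_infinity_iff using g h by (auto intro!: exI[of _ "A * B"])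
qed

lemma H_infinity_add: "g \<in> H_infinity \<Longrightarrow> h \<in> H_infinity \<Longrightarrow> (\<lambda>z. g z + h z) \<in> H_infinity"
proof -
  assume "g \<in> H_infinity" "h \<in> H_infinity"
  then obtain A B where g: "g holomorphic_on unit_disc" "A > 0" "\<And>z. norm z < 1 \<Longrightarrow> norm (g z) \<le> A"
    and h: "h holomorphic_on unit_disc" "B > 0" "\<And>z. norm z < 1 \<Longrightarrow> norm (h z) \<le> B"
    unfolding H_infinity_iff by blast
  have "norm (g z + h z) \<le> A + B" if "norm z < 1" for z
    by (rule order_trans[OF norm_triangle_ineq add_mono]) (use g(3) h(3) that in auto)
  moreover have "(\<lambda>z. g z + h z) holomorphic_on unit_disc" using g h by (intro holomorphic_intros)
  ultimately show ?thesis unfolding H_infinity_iff using g h by (auto intro!: exI[of _ "A + B"])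
qed

lemma H_infinity_const [simp]: "(\<lambda>z. c) \<in> H_infinity"
  unfolding H_infinity_iff by (auto intro!: exI[of _ "norm c + 1"] add_nonneg_pos)

lemma H_infinity_id [simp]: "(\<lambda>z. z) \<in> H_infinity"
  unfolding H_infinity_iff by (auto intro!: exI[of _ 1])

lemma const_in_growth_space: "(\<lambda>z. c) \<in> growth_space w"
  unfolding growth_space_iff
proof (intro conjI allI impI)
  fix e :: real assume e: "e > 0"
  then have "e / (norm c + 1) > 0" by (intro divide_pos_pos add_nonneg_pos) auto
  then obtain \<delta> where \<delta>: "0 < \<delta>" "\<And>t. 0 \<le> t \<Longrightarrow> t \<le> \<delta> \<Longrightarrow> w t < e / (norm c + 1)" using w_small by metis
  show "\<exists>d<1. \<forall>z::complex. d < norm z \<longrightarrow> norm z < 1 \<longrightarrow> w (1 - norm z) * norm c < e"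
  proof (intro exI[of _ "1 - \<delta>"] conjI allI impI)
    fix z :: complex assume z: "1 - \<delta> < norm z" "norm z < 1"
    have "norm c + 1 > 0" by (intro add_nonneg_pos) auto
    then have "w (1 - norm z) * (norm c + 1) < e"
      using \<delta>(2)[of "1 - norm z"] z by (simp add: pos_less_divide_eq)
    moreover have "w (1 - norm z) * norm c \<le> w (1 - norm z) * (norm c + 1)"
      using w_disc[OF z(2)] by (intro mult_left_mono) auto
    ultimately show "w (1 - norm z) * norm c < e" by linarith
  qed (use \<delta> in auto)
qed auto

lemma H_infinity_subset: "h \<in> H_infinity \<Longrightarrow> h \<in> growth_space w"
  using growth_space_mult[of h "\<lambda>_. 1"] const_in_growth_space[of 1] by simp

lemma growth_space_scale: "g \<in> growth_space w \<Longrightarrow> (\<lambda>z. a * g z) \<in> growth_space w"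
  by (rule growth_space_mult[OF H_infinity_const])

lemma growth_space_diff: "g \<in> growth_space w \<Longrightarrow> h \<in> growth_space w \<Longrightarrow> (\<lambda>z. g z - h z) \<in> growth_space w"
  using growth_space_add[of g "\<lambda>z. (-1) * h z"] growth_space_scale[of h "-1"] by simp

section \<open>Closed shift invariant subspaces\<close>

lemma closed_shift_invariant_growth_space: "closed_shift_invariant w (growth_space w)"
  unfolding closed_shift_invariant_def
  using growth_space_add growth_space_scale const_in_growth_space[of 0] growth_space_mult[OF H_infinity_id] by blast

text \<open>The hull is the intersection of all closed shift invariant sets containing
  \<open>g\<close>, and each defining property, norm closedness included, passes to
  intersections.\<close>

lemma closed_shift_invariant_generated:
  assumes g: "g \<in> growth_space w"
  shows "closed_shift_invariant w (generated_subspace w g)" "g \<in> generated_subspace w g"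
    "generated_subspace w g \<subseteq> growth_space w"
proof -
  show *: "generated_subspace w g \<subseteq> growth_space w"
    unfolding generated_subspace_def by (rule hull_minimal) (use g closed_shift_invariant_growth_space in auto)
  show "g \<in> generated_subspace w g" unfolding generated_subspace_def by (rule hull_inc) simp
  let ?T = "{t. closed_shift_invariant w t \<and> {g} \<subseteq> t}"
  have eq: "generated_subspace w g = \<Inter>?T" by (simp add: generated_subspace_def hull_def)
  show "closed_shift_invariant w (generated_subspace w g)"
    unfolding closed_shift_invariant_def
  proof (intro conjI ballI allI impI *)
    show "(\<lambda>z. 0) \<in> generated_subspace w g" unfolding eq by (auto simp: closed_shift_invariant_def)
    fix h assume h: "h \<in> generated_subspace w g"
    show "(\<lambda>z. a * h z) \<in> generated_subspace w g" for a
      using h unfolding eq by (auto simp: closed_shift_invariant_def)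
    show "(\<lambda>z. z * h z) \<in> generated_subspace w g"
      using h unfolding eq by (auto simp: closed_shift_invariant_def)
    show "(\<lambda>z. h z + k z) \<in> generated_subspace w g" if "k \<in> generated_subspace w g" for k
      using h that unfolding eq by (auto simp: closed_shift_invariant_def)
  next
    fix h assume h: "h \<in> growth_space w"
      and ap: "\<forall>e>0. \<exists>k\<in>generated_subspace w g. growth_norm w (\<lambda>z. h z - k z) < e"
    show "h \<in> generated_subspace w g" unfolding eq
    proof
      fix t assume t: "t \<in> ?T"
      then have "generated_subspace w g \<subseteq> t" unfolding eq by auto
      then have "\<forall>e>0. \<exists>k\<in>t. growth_norm w (\<lambda>z. h z - k z) < e" using ap by blast
      then show "h \<in> t" using t h by (simp add: closed_shift_invariant_def)
    qed
  qed
qed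

lemma generated_subspace_mono:
  assumes "g \<in> growth_space w" "f \<in> generated_subspace w g"
  shows "generated_subspace w f \<subseteq> generated_subspace w g"
  unfolding generated_subspace_def[of w f]
  by (rule hull_minimal) (use closed_shift_invariant_generated[OF assms(1)] assms(2) in auto)

lemma closed_shift_invariant_limit:
  assumes S: "closed_shift_invariant w S" and g: "g \<in> growth_space w"
    and ap: "\<And>e. e > 0 \<Longrightarrow> \<exists>h\<in>S. \<forall>z. norm z < 1 \<longrightarrow> w (1 - norm z) * norm (g z - h z) \<le> e"
  shows "g \<in> S"
proof -
  have "\<exists>h\<in>S. growth_norm w (\<lambda>z. g z - h z) < e" if e: "e > 0" for e
  proof -
    obtain h where h: "h \<in> S" "\<And>z. norm z < 1 \<Longrightarrow> w (1 - norm z) * norm (g z - h z) \<le> e/2"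
      using ap[of "e/2"] e by auto
    have "growth_norm w (\<lambda>z. g z - h z) \<le> e/2" by (rule growth_norm_le[OF h(2)])
    then show ?thesis using h e by (intro bexI[of _ h]) auto
  qed
  then show ?thesis using S g unfolding closed_shift_invariant_def by blast
qed

lemma closed_shift_invariant_poly:
  assumes S: "closed_shift_invariant w S" and g: "g \<in> S"
  shows "(\<lambda>z. (\<Sum>k<n. a k * z ^ k) * g z) \<in> S"
proof -
  have pw: "(\<lambda>z. z ^ k * g z) \<in> S" for k
  proof (induction k)
    case 0
    then show ?case using g by simp
  next
    case (Suc k)
    then have "(\<lambda>z. z * (z ^ k * g z)) \<in> S" using S by (auto simp: closed_shift_invariant_def)
    then show ?case by (simp add: mult.assoc)
  qed
  show ?thesis
  proof (induction n)
    case 0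
    then show ?case using S by (simp add: closed_shift_invariant_def)
  next
    case (Suc n)
    have "(\<lambda>z. a n * (z ^ n * g z)) \<in> S" using S pw by (auto simp: closed_shift_invariant_def)
    then have "(\<lambda>z. (\<Sum>k<n. a k * z ^ k) * g z + a n * (z ^ n * g z)) \<in> S"
      using S Suc by (auto simp: closed_shift_invariant_def)
    then show ?case by (simp add: distrib_right mult.assoc)
  qed
qed

lemma holomorphic_poly_approx:
  assumes hol: "k holomorphic_on ball 0 R" and R: "R > 1" and e: "e > 0"
  obtains a and n :: nat where "\<And>z. norm z \<le> 1 \<Longrightarrow> norm (k z - (\<Sum>j<n. a j * z ^ j)) \<le> (e::real)"
proof -
  define a where "a n = (deriv ^^ n) k 0 / fact n" for n
  have sm: "summable (\<lambda>n. norm (a n))" using circle_integral_power_series(2)[OF hol R] by (simp add: a_def)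
  obtain n where n: "(\<Sum>i. norm (a (i + n))) < e" using suminf_exist_split[OF e sm] by (metis abs_le_D1 le_less_trans order_refl real_norm_def)
  show ?thesis
  proof (rule that[of a n])
    fix z :: complex assume z: "norm z \<le> 1"
    have s: "(\<lambda>j. a j * z ^ j) sums k z"
      using holomorphic_power_series[OF hol, of z] z R by (simp add: a_def)
    have le: "norm (a j * z ^ j) \<le> norm (a j)" for j
      using z by (simp add: norm_mult norm_power mult_left_le power_le_one)
    have "(\<lambda>j. a (j + n) * z ^ (j + n)) sums (k z - (\<Sum>j<n. a j * z ^ j))"
      using sums_iff_shift[of "\<lambda>j. a j * z ^ j" n] s by simp
    then have "norm (k z - (\<Sum>j<n. a j * z ^ j)) = norm (\<Sum>j. a (j + n) * z ^ (j + n))" by (simp add: sums_iff)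
    also have "\<dots> \<le> (\<Sum>j. norm (a (j + n)))"
      by (rule norm_suminf_le[OF le]) (use summable_ignore_initial_segment[OF sm] in simp)
    finally show "norm (k z - (\<Sum>j<n. a j * z ^ j)) \<le> e" using n by simp
  qed
qed

lemma closed_shift_invariant_dilate:
  assumes S: "closed_shift_invariant w S" and g: "g \<in> S"
    and k: "k holomorphic_on ball 0 R" "R > 1"
  shows "(\<lambda>z. k z * g z) \<in> S"
proof (rule closed_shift_invariant_limit[OF S])
  have gG: "g \<in> growth_space w" using S g by (auto simp: closed_shift_invariant_def)
  have kc: "continuous_on (cball 0 1) k"
    using holomorphic_on_imp_continuous_on[OF k(1)] by (rule continuous_on_subset) (use k in auto)
  have "bounded (k ` cball 0 1)" by (intro compact_imp_bounded compact_continuous_image kc) auto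
  then have "bounded (k ` unit_disc)" by (rule bounded_subset) auto
  moreover have "k holomorphic_on unit_disc" using k(1) by (rule holomorphic_on_subset) (use k in auto)
  ultimately show "(\<lambda>z. k z * g z) \<in> growth_space w"
    by (intro growth_space_mult gG) (simp add: H_infinity_def)
  fix e :: real assume e: "e > 0"
  obtain M where M: "M > 0" "\<And>z. norm z < 1 \<Longrightarrow> w (1 - norm z) * norm (g z) \<le> M"
    using growth_space_bounded[OF gG] by blast
  have "e / M > 0" using e M by simp
  then obtain a n where a: "\<And>z. norm z \<le> 1 \<Longrightarrow> norm (k z - (\<Sum>j<n. a j * z ^ j)) \<le> e / M"
    using holomorphic_poly_approx[OF k] by metis
  show "\<exists>h\<in>S. \<forall>z. norm z < 1 \<longrightarrow> w (1 - norm z) * norm (k z * g z - h z) \<le> e"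
  proof (intro bexI[OF _ closed_shift_invariant_poly[OF S g, of a n]] allI impI)
    fix z :: complex assume z: "norm z < 1"
    have "w (1 - norm z) * norm (k z * g z - (\<Sum>j<n. a j * z ^ j) * g z) =
       norm (k z - (\<Sum>j<n. a j * z ^ j)) * (w (1 - norm z) * norm (g z))"
      by (simp add: norm_mult flip: left_diff_distrib)
    also have "\<dots> \<le> e / M * M" using a[of z] M z e w_disc[OF z] by (intro mult_mono) auto
    finally show "w (1 - norm z) * norm (k z * g z - (\<Sum>j<n. a j * z ^ j) * g z) \<le> e" using M by simp
  qed
qed

lemma dilate_uniform:
  assumes "h holomorphic_on unit_disc" "d < 1" "e > 0"
  obtains s where "s < 1" "\<And>r z. s < r \<Longrightarrow> r < 1 \<Longrightarrow> norm z \<le> d \<Longrightarrow> norm (h (of_real r * z) - h z) < (e::real)"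
proof -
  have "continuous_on (cball 0 d) h"
    using holomorphic_on_imp_continuous_on[OF assms(1)] by (rule continuous_on_subset) (use assms in auto)
  then have "uniformly_continuous_on (cball 0 d) h" by (intro compact_uniformly_continuous) auto
  then obtain \<delta> where \<delta>: "\<delta> > 0" "\<And>x y. norm x \<le> d \<Longrightarrow> norm y \<le> d \<Longrightarrow> norm (y - x) < \<delta> \<Longrightarrow> norm (h y - h x) < e"
    using assms(3) unfolding uniformly_continuous_on_def by (auto simp: dist_norm)
  show ?thesis
  proof (rule that[of "max 0 (1 - \<delta>)"])
    fix r and z :: complex assume r: "max 0 (1 - \<delta>) < r" "r < 1" and z: "norm z \<le> d"
    have "norm (of_real r * z - z) = norm (of_real (r - 1) * z)" by (simp add: algebra_simps)
    also have "\<dots> = (1 - r) * norm z" using r by (simp add: norm_mult del: of_real_diff)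
    also have "\<dots> \<le> (1 - r) * 1" using r z assms by (intro mult_left_mono) auto
    finally have "norm (of_real r * z - z) < \<delta>" using r by auto
    moreover have "norm (of_real r * z) \<le> d"
      using mult_right_mono[of r 1 "norm z"] r z by (auto simp: norm_mult)
    ultimately show "norm (h (of_real r * z) - h z) < e" using \<delta>(2)[of z "of_real r * z"] z by auto
  qed (use \<delta> in auto)
qed

text \<open>Dilates of \<open>h\<close> are admissible by
  \<open>closed_shift_invariant_dilate\<close>. They converge to \<open>h\<close> uniformly on
  compact sets, and near the circle the decay of \<open>w * |g|\<close> absorbs the bounded
  difference.\<close>

lemma closed_shift_invariant_mult:
  assumes S: "closed_shift_invariant w S" and g: "g \<in> S" and h: "h \<in> H_infinity"
  shows "(\<lambda>z. h z * g z) \<in> S"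
proof (rule closed_shift_invariant_limit[OF S])
  have gG: "g \<in> growth_space w" using S g by (auto simp: closed_shift_invariant_def)
  then show "(\<lambda>z. h z * g z) \<in> growth_space w" by (rule growth_space_mult[OF h])
  from h obtain B where B: "B > 0" "\<And>z. norm z < 1 \<Longrightarrow> norm (h z) \<le> B" and hh: "h holomorphic_on unit_disc"
    unfolding H_infinity_iff by blast
  obtain M where M: "M > 0" "\<And>z. norm z < 1 \<Longrightarrow> w (1 - norm z) * norm (g z) \<le> M"
    using growth_space_bounded[OF gG] by blast
  fix e :: real assume e: "e > 0"
  have "e / (2*B) > 0" "e / M > 0" using e B M by auto
  obtain d where d: "d < 1" "\<And>z. d < norm z \<Longrightarrow> norm z < 1 \<Longrightarrow> w (1 - norm z) * norm (g z) < e / (2*B)"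
    using growth_space_small[OF gG \<open>e / (2*B) > 0\<close>] by blast
  obtain s where s: "s < 1" "\<And>r z. s < r \<Longrightarrow> r < 1 \<Longrightarrow> norm z \<le> d \<Longrightarrow> norm (h (of_real r * z) - h z) < e / M"
    using dilate_uniform[OF hh d(1) \<open>e / M > 0\<close>] by blast
  obtain r where "max s 0 < r" "r < 1" using s dense[of "max s 0" 1] by auto
  then have r: "0 < r" "r < 1" "s < r" by auto
  have R: "1 / r > 1" using r by simp
  show "\<exists>k\<in>S. \<forall>z. norm z < 1 \<longrightarrow> w (1 - norm z) * norm (h z * g z - k z) \<le> e"
  proof (intro bexI[OF _ closed_shift_invariant_dilate[OF S g holomorphic_on_dilate[OF hh r(1,2)] R]] allI impI)
    fix z :: complex assume z: "norm z < 1"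
    have rz: "norm (of_real r * z) < 1"
      using mult_strict_mono[of r 1 "norm z" 1] r z by (simp add: norm_mult)
    have eq: "w (1 - norm z) * norm (h z * g z - h (of_real r * z) * g z) =
       norm (h (of_real r * z) - h z) * (w (1 - norm z) * norm (g z))"
      by (simp add: norm_mult norm_minus_commute flip: left_diff_distrib)
    show "w (1 - norm z) * norm (h z * g z - h (of_real r * z) * g z) \<le> e"
    proof (cases "norm z \<le> d")
      case True
      have "norm (h (of_real r * z) - h z) * (w (1 - norm z) * norm (g z)) \<le> e / M * M"
        using s(2)[OF r(3,2) True] M(2)[OF z] e M(1) w_disc[OF z] by (intro mult_mono) auto
      then show ?thesis unfolding eq using M by simp
    next
      case False
      have "norm (h (of_real r * z) - h z) \<le> norm (h (of_real r * z)) + norm (h z)" by (rule norm_triangle_ineq4)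
      also have "\<dots> \<le> 2 * B" using B(2)[OF rz] B(2)[OF z] by simp
      finally have "norm (h (of_real r * z) - h z) * (w (1 - norm z) * norm (g z)) \<le> (2 * B) * (e / (2*B))"
        using d(2)[of z] False z B w_disc[OF z] by (intro mult_mono) auto
      then show ?thesis unfolding eq using B by simp
    qed
  qed
qed

text \<open>The functions that can be approximated by bounded multiples of \<open>g\<close> form a
  closed shift invariant set containing \<open>g\<close>, so the hull lies inside it. Both
  permanence arguments, for singular mass and for zeros, start from this description.\<close>

lemma generated_subspace_approx:
  assumes g: "g \<in> growth_space w" and h: "h \<in> generated_subspace w g" and e: "e > 0"
  obtains p where "p \<in> H_infinity" "\<And>z. norm z < 1 \<Longrightarrow> w (1 - norm z) * norm (h z - p z * g z) \<le> e"
proof -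
  define T where "T = {h \<in> growth_space w. \<forall>e>0. \<exists>p\<in>H_infinity. \<forall>z. norm z < 1 \<longrightarrow> w (1 - norm z) * norm (h z - p z * g z) \<le> e}"
  have TI: "h \<in> T" if "h \<in> growth_space w"
    "\<And>e. e > 0 \<Longrightarrow> \<exists>p\<in>H_infinity. \<forall>z. norm z < 1 \<longrightarrow> w (1 - norm z) * norm (h z - p z * g z) \<le> e" for h
    using that by (auto simp: T_def)
  have TD: "\<exists>p\<in>H_infinity. \<forall>z. norm z < 1 \<longrightarrow> w (1 - norm z) * norm (h z - p z * g z) \<le> e" if "h \<in> T" "e > 0" for h e
    using that by (auto simp: T_def)
  have wle: "w (1 - norm z) * norm (a + b) \<le> w (1 - norm z) * norm a + w (1 - norm z) * norm b" if "norm z < 1" for a b z :: complex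
    using w_disc[OF that] norm_triangle_ineq[of a b] mult_left_mono[of "norm (a + b)" "norm a + norm b" "w (1 - norm z)"]
    by (simp add: distrib_left)
  have "closed_shift_invariant w T"
    unfolding closed_shift_invariant_def
  proof (intro conjI ballI allI impI)
    show "T \<subseteq> growth_space w" by (auto simp: T_def)
    show "(\<lambda>z. 0) \<in> T"
      by (intro TI const_in_growth_space bexI[of _ "\<lambda>_. 0"]) auto
  next
    fix h k assume hk: "h \<in> T" "k \<in> T"
    show "(\<lambda>z. h z + k z) \<in> T"
    proof (rule TI)
      show "(\<lambda>z. h z + k z) \<in> growth_space w" using hk by (intro growth_space_add) (auto simp: T_def)
      fix e :: real assume "e > 0"
      then obtain p q where p: "p \<in> H_infinity" "\<And>z. norm z < 1 \<Longrightarrow> w (1 - norm z) * norm (h z - p z * g z) \<le> e/2"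
        and q: "q \<in> H_infinity" "\<And>z. norm z < 1 \<Longrightarrow> w (1 - norm z) * norm (k z - q z * g z) \<le> e/2"
        using TD[OF hk(1), of "e/2"] TD[OF hk(2), of "e/2"] by auto
      show "\<exists>p\<in>H_infinity. \<forall>z. norm z < 1 \<longrightarrow> w (1 - norm z) * norm (h z + k z - p z * g z) \<le> e"
      proof (intro bexI[OF _ H_infinity_add[OF p(1) q(1)]] allI impI)
        fix z :: complex assume z: "norm z < 1"
        have "h z + k z - (p z + q z) * g z = (h z - p z * g z) + (k z - q z * g z)" by (simp add: algebra_simps)
        then show "w (1 - norm z) * norm (h z + k z - (p z + q z) * g z) \<le> e"
          using wle[OF z, of "h z - p z * g z" "k z - q z * g z"] p(2)[OF z] q(2)[OF z] by (simp only:)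
      qed
    qed
  next
    fix a h assume h: "h \<in> T"
    show "(\<lambda>z. a * h z) \<in> T"
    proof (rule TI)
      show "(\<lambda>z. a * h z) \<in> growth_space w" using h by (intro growth_space_scale) (auto simp: T_def)
      fix e :: real assume e: "e > 0"
      then have "e / (norm a + 1) > 0" by (intro divide_pos_pos add_nonneg_pos) auto
      then obtain p where p: "p \<in> H_infinity" "\<And>z. norm z < 1 \<Longrightarrow> w (1 - norm z) * norm (h z - p z * g z) \<le> e / (norm a + 1)"
        using TD[OF h] by blast
      show "\<exists>p\<in>H_infinity. \<forall>z. norm z < 1 \<longrightarrow> w (1 - norm z) * norm (a * h z - p z * g z) \<le> e"
      proof (intro bexI[OF _ H_infinity_mult[OF H_infinity_const p(1)]] allI impI)
        fix z :: complex assume z: "norm z < 1"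
        have "a * h z - a * p z * g z = a * (h z - p z * g z)" by (simp add: algebra_simps)
        then have "w (1 - norm z) * norm (a * h z - a * p z * g z) = norm a * (w (1 - norm z) * norm (h z - p z * g z))"
          by (simp add: norm_mult)
        also have "\<dots> \<le> (norm a + 1) * (e / (norm a + 1))"
          using p(2)[OF z] w_disc[OF z] by (intro mult_mono) auto
        also have "\<dots> = e"
        proof -
          have "norm a + 1 > 0" by (intro add_nonneg_pos) auto
          then show ?thesis by simp
        qed
        finally show "w (1 - norm z) * norm (a * h z - a * p z * g z) \<le> e" .
      qed
    qed
  next
    fix h assume h: "h \<in> growth_space w" and ap: "\<forall>e>0. \<exists>k\<in>T. growth_norm w (\<lambda>z. h z - k z) < e"
    show "h \<in> T"
    proof (rule TI[OF h])
      fix e :: real assume e: "e > 0"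
      then obtain k where k: "k \<in> T" "growth_norm w (\<lambda>z. h z - k z) < e/2" using ap half_gt_zero by blast
      obtain p where p: "p \<in> H_infinity" "\<And>z. norm z < 1 \<Longrightarrow> w (1 - norm z) * norm (k z - p z * g z) \<le> e/2"
        using TD[OF k(1), of "e/2"] e by auto
      have "(\<lambda>z. h z - k z) \<in> growth_space w" using h k by (intro growth_space_diff) (auto simp: T_def)
      from growth_norm_ge[OF this] have hk: "w (1 - norm z) * norm (h z - k z) \<le> e/2" if "norm z < 1" for z
        using that k(2) by force
      show "\<exists>p\<in>H_infinity. \<forall>z. norm z < 1 \<longrightarrow> w (1 - norm z) * norm (h z - p z * g z) \<le> e"
      proof (intro bexI[OF _ p(1)] allI impI)
        fix z :: complex assume z: "norm z < 1"
        show "w (1 - norm z) * norm (h z - p z * g z) \<le> e"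
          using wle[OF z, of "h z - k z" "k z - p z * g z"] hk[OF z] p(2)[OF z] by simp
      qed
    qed
  next
    fix h assume h: "h \<in> T"
    show "(\<lambda>z. z * h z) \<in> T"
    proof (rule TI)
      show "(\<lambda>z. z * h z) \<in> growth_space w" using h by (intro growth_space_mult) (auto simp: T_def)
      fix e :: real assume e: "e > 0"
      then obtain p where p: "p \<in> H_infinity" "\<And>z. norm z < 1 \<Longrightarrow> w (1 - norm z) * norm (h z - p z * g z) \<le> e"
        using TD[OF h] by blast
      show "\<exists>p\<in>H_infinity. \<forall>z. norm z < 1 \<longrightarrow> w (1 - norm z) * norm (z * h z - p z * g z) \<le> e"
      proof (intro bexI[OF _ H_infinity_mult[OF H_infinity_id p(1)]] allI impI)
        fix z :: complex assume z: "norm z < 1"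
        have "z * h z - z * p z * g z = z * (h z - p z * g z)" by (simp add: algebra_simps)
        then have "w (1 - norm z) * norm (z * h z - z * p z * g z) = norm z * (w (1 - norm z) * norm (h z - p z * g z))"
          by (simp add: norm_mult)
        also have "\<dots> \<le> 1 * e"
          using p(2)[OF z] w_disc[OF z] z by (intro mult_mono) auto
        finally show "w (1 - norm z) * norm (z * h z - z * p z * g z) \<le> e" by simp
      qed
    qed
  qed
  moreover have "g \<in> T" by (intro TI g bexI[of _ "\<lambda>_. 1"]) auto
  ultimately have "generated_subspace w g \<subseteq> T"
    unfolding generated_subspace_def by (intro hull_minimal) auto
  then show ?thesis using TD[OF _ e] h that by blast
qed

lemma growth_space_dilate_approx:
  assumes f: "f \<in> growth_space w" and e: "e > 0"
  obtains r where "0 < r" "r < 1" "\<And>z. norm z < 1 \<Longrightarrow> w (1 - norm z) * norm (f z - f (of_real r * z)) \<le> e"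
proof -
  from f have ff: "f holomorphic_on unit_disc" by (simp add: growth_space_def)
  obtain d where d: "d < 1" "\<And>z. d < norm z \<Longrightarrow> norm z < 1 \<Longrightarrow> w (1 - norm z) * norm (f z) < e/2"
    using growth_space_small[OF f half_gt_zero[OF e]] by blast
  \<comment> \<open>With \<open>r > d / d'\<close>, a point beyond radius \<open>d'\<close> is moved
    by the dilation to a point still beyond radius \<open>d\<close>, where \<open>w * |f|\<close> is
    small; monotonicity of \<open>w\<close> carries the bound back.\<close>
  define d' where "d' = (1 + max d 0) / 2"
  have d': "d' < 1" "max d 0 < d'" using d by (auto simp: d'_def)
  obtain s where s: "s < 1" "\<And>r z. s < r \<Longrightarrow> r < 1 \<Longrightarrow> norm z \<le> d' \<Longrightarrow> norm (f (of_real r * z) - f z) < e"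
    using dilate_uniform[OF ff d'(1) e] by blast
  have "max (max s 0) (d / d') < 1" using s d' by auto
  then obtain r where r: "max (max s 0) (d / d') < r" "r < 1" using dense by blast
  show ?thesis
  proof (rule that[of r])
    fix z :: complex assume z: "norm z < 1"
    have rz: "norm (of_real r * z) \<le> norm z" using r z mult_right_mono[of r 1 "norm z"] by (auto simp: norm_mult)
    show "w (1 - norm z) * norm (f z - f (of_real r * z)) \<le> e"
    proof (cases "norm z \<le> d'")
      case True
      have "norm (f z - f (of_real r * z)) \<le> e" using s(2)[OF _ _ True, of r] r by (simp add: norm_minus_commute)
      then have "w (1 - norm z) * norm (f z - f (of_real r * z)) \<le> 1 * e"
        using w_disc[OF z] by (intro mult_mono) auto
      then show ?thesis by simp
    next
      case False
      then have "d < norm z" using d' by auto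
      then have 1: "w (1 - norm z) * norm (f z) < e/2" using d(2) z by blast
      have "d < r * d'" using r d' by (auto simp: field_simps)
      also have "\<dots> \<le> norm (of_real r * z)" using False r by (auto simp: norm_mult intro!: mult_left_mono)
      finally have "w (1 - norm (of_real r * z)) * norm (f (of_real r * z)) < e/2" using d(2) rz z by (meson order.strict_trans1)
      moreover have "w (1 - norm z) * norm (f (of_real r * z)) \<le> w (1 - norm (of_real r * z)) * norm (f (of_real r * z))"
        using rz z by (intro mult_right_mono w_le) auto
      ultimately have 2: "w (1 - norm z) * norm (f (of_real r * z)) < e/2" by linarith
      have "w (1 - norm z) * norm (f z - f (of_real r * z)) \<le> w (1 - norm z) * (norm (f z) + norm (f (of_real r * z)))"
        using w_disc[OF z] by (intro mult_left_mono norm_triangle_ineq4) auto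
      then show ?thesis using 1 2 by (simp add: distrib_left)
    qed
  qed (use r in auto)
qed

text \<open>The hypothesis puts the constant 1 into the subspace. Then every function holomorphic on
  a larger disc belongs to it, and the dilates of an arbitrary \<open>f\<close> approximate
  \<open>f\<close>.\<close>

lemma cyclic_criterion:
  assumes g: "g \<in> H_infinity"
    and ap: "\<And>e. e > 0 \<Longrightarrow> \<exists>h\<in>H_infinity. \<forall>z. norm z < 1 \<longrightarrow> w (1 - norm z) * norm (1 - h z * g z) \<le> e"
  shows "cyclic_in_growth_space w g"
proof -
  have gG: "g \<in> growth_space w" using g by (rule H_infinity_subset)
  note csi = closed_shift_invariant_generated[OF gG]
  have one: "(\<lambda>z. 1) \<in> generated_subspace w g"
  proof (rule closed_shift_invariant_limit[OF csi(1) const_in_growth_space])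
    fix e :: real assume "e > 0"
    then obtain h where h: "h \<in> H_infinity" "\<forall>z. norm z < 1 \<longrightarrow> w (1 - norm z) * norm (1 - h z * g z) \<le> e" using ap by blast
    then show "\<exists>k\<in>generated_subspace w g. \<forall>z. norm z < 1 \<longrightarrow> w (1 - norm z) * norm (1 - k z) \<le> e"
      by (intro bexI[OF _ closed_shift_invariant_mult[OF csi(1,2) h(1)]])
  qed
  have "f \<in> generated_subspace w g" if f: "f \<in> growth_space w" for f
  proof (rule closed_shift_invariant_limit[OF csi(1) f])
    fix e :: real assume "e > 0"
    then obtain r where r: "0 < r" "r < 1" "\<And>z. norm z < 1 \<Longrightarrow> w (1 - norm z) * norm (f z - f (of_real r * z)) \<le> e"
      using growth_space_dilate_approx[OF f] by blast
    have "f holomorphic_on unit_disc" using f by (simp add: growth_space_def)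
    from closed_shift_invariant_dilate[OF csi(1) one holomorphic_on_dilate[OF this r(1,2)]] r
    have "(\<lambda>z. f (of_real r * z)) \<in> generated_subspace w g" by simp
    then show "\<exists>k\<in>generated_subspace w g. \<forall>z. norm z < 1 \<longrightarrow> w (1 - norm z) * norm (f z - k z) \<le> e"
      using r(3) by (intro bexI[of _ "\<lambda>z. f (of_real r * z)"]) auto
  qed
  then show ?thesis unfolding cyclic_in_growth_space_def using gG csi(3) by blast
qed

end

section \<open>Blaschke products\<close>

lemma blaschke_denominator: "norm a < 1 \<Longrightarrow> norm z \<le> 1 \<Longrightarrow> 1 - cnj a * z \<noteq> (0::complex)"
proof
  assume "norm a < 1" "norm z \<le> 1" "1 - cnj a * z = 0"
  then have "norm (cnj a * z) = 1" by simp
  then have "norm a * norm z = 1" by (simp add: norm_mult)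
  moreover have "norm a * norm z \<le> norm a * 1" using \<open>norm z \<le> 1\<close> by (intro mult_left_mono) auto
  ultimately show False using \<open>norm a < 1\<close> by simp
qed

lemma blaschke_factor_holomorphic [holomorphic_intros]:
  "norm a < 1 \<Longrightarrow> A \<subseteq> unit_disc \<Longrightarrow> blaschke_factor a holomorphic_on A"
proof -
  assume a: "norm a < 1" "A \<subseteq> unit_disc"
  have "1 - cnj a * z \<noteq> 0" if "z \<in> A" for z using blaschke_denominator[OF a(1), of z] a(2) that by force
  then have "(\<lambda>z. of_real (norm a) / a * ((a - z) / (1 - cnj a * z))) holomorphic_on A"
    by (intro holomorphic_intros) auto
  then show ?thesis by (cases "a = 0") (simp_all add: blaschke_factor_def[abs_def] holomorphic_on_ident)
qed

lemma blaschke_factor_continuous: "norm a < 1 \<Longrightarrow> continuous_on (cball 0 1) (blaschke_factor a)"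
proof -
  assume a: "norm a < 1"
  have "1 - cnj a * z \<noteq> 0" if "z \<in> cball 0 1" for z using blaschke_denominator[OF a, of z] that by force
  then have "continuous_on (cball 0 1) (\<lambda>z. of_real (norm a) / a * ((a - z) / (1 - cnj a * z)))"
    if "a \<noteq> 0" using that by (intro continuous_intros) auto
  then show ?thesis by (cases "a = 0") (simp_all add: blaschke_factor_def[abs_def] continuous_on_id)
qed

lemma blaschke_factor_norm_sq:
  assumes a: "norm a < 1" "a \<noteq> 0" and z: "norm z \<le> 1"
  shows "1 - (norm (blaschke_factor a z))\<^sup>2 = (1 - (norm a)\<^sup>2) * (1 - (norm z)\<^sup>2) / (norm (1 - cnj a * z))\<^sup>2"
proof -
  have nz: "(norm (1 - cnj a * z))\<^sup>2 \<noteq> 0" using blaschke_denominator[OF a(1) z] by simp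
  have "norm (blaschke_factor a z) = norm (a - z) / norm (1 - cnj a * z)"
    using a by (simp add: blaschke_factor_def norm_mult norm_divide)
  then have "(norm (blaschke_factor a z))\<^sup>2 = (norm (a - z))\<^sup>2 / (norm (1 - cnj a * z))\<^sup>2"
    by (simp add: power_divide)
  then have "1 - (norm (blaschke_factor a z))\<^sup>2 = ((norm (1 - cnj a * z))\<^sup>2 - (norm (a - z))\<^sup>2) / (norm (1 - cnj a * z))\<^sup>2"
    using nz by (simp only: diff_divide_distrib divide_self_if if_False)
  also have "(norm (1 - cnj a * z))\<^sup>2 - (norm (a - z))\<^sup>2 = (1 - (norm a)\<^sup>2) * (1 - (norm z)\<^sup>2)"
    unfolding cmod_power2 by (simp add: algebra_simps power2_eq_square)
  finally show ?thesis .
qed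

lemma blaschke_factor_circle: "norm a < 1 \<Longrightarrow> norm z = 1 \<Longrightarrow> norm (blaschke_factor a z) = 1"
proof (cases "a = 0")
  case False
  assume "norm a < 1" "norm z = 1"
  then have "(norm (blaschke_factor a z))\<^sup>2 = 1" using blaschke_factor_norm_sq[of a z] False by simp
  then show ?thesis by (simp add: power2_eq_1_iff) (metis norm_ge_zero le_minus_one_simps(3))
qed (simp add: blaschke_factor_def)

lemma blaschke_factor_le_1:
  assumes "norm a < 1" "norm z < 1" shows "norm (blaschke_factor a z) \<le> 1"
proof (cases "a = 0")
  case False
  have "0 \<le> (1 - (norm a)\<^sup>2) * (1 - (norm z)\<^sup>2) / (norm (1 - cnj a * z))\<^sup>2"
    using assms by (intro divide_nonneg_nonneg mult_nonneg_nonneg) (auto simp: power_le_one)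
  then have "(norm (blaschke_factor a z))\<^sup>2 \<le> 1\<^sup>2" using blaschke_factor_norm_sq[of a z] False assms by simp
  then show ?thesis by (rule power2_le_imp_le) simp
qed (use assms in \<open>simp add: blaschke_factor_def\<close>)

lemma blaschke_factor_eq_0_iff:
  assumes "norm a < 1" "norm z < 1" shows "blaschke_factor a z = 0 \<longleftrightarrow> z = a"
  using blaschke_denominator[of a z] assms by (auto simp: blaschke_factor_def)

text \<open>For \<open>a \<noteq> 0\<close> the normalizing factor \<open>norm a / a\<close> makes
  \<open>1 - blaschke_factor a z\<close> equal to
  \<open>(1 - norm a) * (a + norm a * z) / (a * (1 - cnj a * z))\<close>, so the deviation from 1 is
  summable along a Blaschke sequence.\<close>

lemma blaschke_factor_minus_1:
  assumes a: "norm a < 1" and z: "norm z < 1"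
  shows "norm (blaschke_factor a z - 1) \<le> 2 / (1 - norm z) * (1 - norm a)"
proof (cases "a = 0")
  case True
  have "norm (z - 1) \<le> 2" using norm_triangle_ineq4[of z 1] z by simp
  also have "2 \<le> 2 / (1 - norm z)" using z by (simp add: field_simps)
  finally show ?thesis using True by (simp add: blaschke_factor_def)
next
  case False
  have nz: "1 - cnj a * z \<noteq> 0" using blaschke_denominator[OF a, of z] z by simp
  have aa: "cnj a * a = of_real (norm a) * of_real (norm a)"
    by (metis complex_norm_square mult.commute of_real_mult power2_eq_square)
  have "(1 - blaschke_factor a z) * (a * (1 - cnj a * z)) = a * (1 - cnj a * z) - of_real (norm a) * (a - z)"
    using False nz by (simp add: blaschke_factor_def field_simps)
  also have "\<dots> = a - (cnj a * a) * z - of_real (norm a) * (a - z)" by (simp add: algebra_simps)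
  also have "\<dots> = (1 - of_real (norm a)) * (a + of_real (norm a) * z)" unfolding aa by (simp add: algebra_simps)
  finally have e: "norm (1 - blaschke_factor a z) * (norm a * norm (1 - cnj a * z)) = norm (1 - of_real (norm a) :: complex) * norm (a + of_real (norm a) * z)"
    by (metis norm_mult)
  have "norm (1 - of_real (norm a) :: complex) = 1 - norm a"
    using a by (metis abs_of_pos diff_gt_0_iff_gt norm_of_real of_real_1 of_real_diff)
  moreover have "norm (a + of_real (norm a) * z) \<le> norm a * 2"
  proof -
    have "norm (a + of_real (norm a) * z) \<le> norm a + norm a * norm z" by (rule order_trans[OF norm_triangle_ineq]) (simp add: norm_mult)
    also have "\<dots> \<le> norm a + norm a * 1" using z by (intro add_left_mono mult_left_mono) auto
    finally show ?thesis by simp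
  qed
  ultimately have "norm (1 - blaschke_factor a z) * (norm a * norm (1 - cnj a * z)) \<le> (1 - norm a) * (norm a * 2)"
    unfolding e using a by (metis diff_ge_0_iff_ge less_imp_le mult_left_mono)
  then have "norm a * (norm (1 - blaschke_factor a z) * norm (1 - cnj a * z)) \<le> norm a * ((1 - norm a) * 2)"
    by (simp add: mult_ac)
  then have 1: "norm (1 - blaschke_factor a z) * norm (1 - cnj a * z) \<le> (1 - norm a) * 2"
    using False by (simp add: mult_le_cancel_left_pos)
  have "1 - norm z \<le> norm (1 - cnj a * z)"
  proof -
    have "1 - norm (cnj a * z) \<le> norm (1 - cnj a * z)" using norm_triangle_ineq2[of 1 "cnj a * z"] by simp
    moreover have "norm (cnj a * z) \<le> 1 * norm z" unfolding norm_mult using a by (intro mult_right_mono) auto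
    ultimately show ?thesis by simp
  qed
  then have "norm (1 - blaschke_factor a z) * (1 - norm z) \<le> (1 - norm a) * 2"
    using 1 mult_left_mono[of "1 - norm z" "norm (1 - cnj a * z)" "norm (1 - blaschke_factor a z)"] by simp
  then show ?thesis using z by (simp add: norm_minus_commute field_simps)
qed

lemma prodinf_minus_1_le:
  fixes f :: "nat \<Rightarrow> complex"
  assumes "summable (\<lambda>n. norm (f n - 1))"
  shows "norm (prodinf f - 1) \<le> exp (\<Sum>n. norm (f n - 1)) - 1"
proof -
  have "convergent_prod f"
    using assms summable_imp_abs_convergent_prod abs_convergent_prod_imp_convergent_prod by blast
  then have "(\<lambda>n. \<Prod>i\<le>n. f i) \<longlonglongrightarrow> prodinf f" by (rule convergent_prod_LIMSEQ)
  then have lim: "(\<lambda>n. norm ((\<Prod>i\<le>n. f i) - 1)) \<longlonglongrightarrow> norm (prodinf f - 1)" by (intro tendsto_intros)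
  have "norm ((\<Prod>i\<le>n. f i) - 1) \<le> exp (\<Sum>n. norm (f n - 1)) - 1" for n
  proof -
    have "norm ((\<Prod>i\<le>n. f i) - 1) \<le> (\<Prod>i\<le>n. 1 + norm (f i - 1)) - 1"
      using norm_prod_minus1_le_prod_minus1[of "\<lambda>i. f i - 1" "{..n}"] by simp
    also have "(\<Prod>i\<le>n. 1 + norm (f i - 1)) \<le> exp (\<Sum>i\<le>n. norm (f i - 1))" by (rule prod_le_exp_sum) simp
    also have "\<dots> \<le> exp (\<Sum>n. norm (f n - 1))" using assms by (auto intro!: sum_le_suminf)
    finally show ?thesis by simp
  qed
  then show ?thesis by (intro LIMSEQ_le_const2[OF lim]) auto
qed

lemma blaschke_sequence_subset: "blaschke_sequence I \<Lambda> \<Longrightarrow> J \<subseteq> I \<Longrightarrow> blaschke_sequence J \<Lambda>"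
  unfolding blaschke_sequence_def using summable_on_subset_banach by blast

context
  fixes I :: "nat set" and \<Lambda> :: "nat \<Rightarrow> complex"
  assumes bs: "blaschke_sequence I \<Lambda>"
begin

lemma blaschke_point: "n \<in> I \<Longrightarrow> norm (\<Lambda> n) < 1"
  using bs by (auto simp: blaschke_sequence_def)

lemma blaschke_summable: "summable (\<lambda>n. if n \<in> I then 1 - norm (\<Lambda> n) else 0)"
proof -
  have "(\<lambda>n. if n \<in> I then 1 - norm (\<Lambda> n) else 0) summable_on UNIV \<longleftrightarrow> (\<lambda>n. 1 - norm (\<Lambda> n)) summable_on I"
    by (rule summable_on_cong_neutral) auto
  then have "(\<lambda>n. if n \<in> I then 1 - norm (\<Lambda> n) else 0) summable_on UNIV"
    using bs by (simp add: blaschke_sequence_def)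
  then show ?thesis by (rule summable_on_imp_summable)
qed

lemma blaschke_term_le:
  assumes "norm z < 1"
  shows "norm ((if n \<in> I then blaschke_factor (\<Lambda> n) z else 1) - 1) \<le> 2 / (1 - norm z) * (if n \<in> I then 1 - norm (\<Lambda> n) else 0)"
  using blaschke_factor_minus_1[OF blaschke_point assms] by auto

lemma blaschke_term_summable:
  "norm z < 1 \<Longrightarrow> summable (\<lambda>n. norm ((if n \<in> I then blaschke_factor (\<Lambda> n) z else 1) - 1))"
  by (rule summable_comparison_test'[OF summable_mult[OF blaschke_summable, of "2 / (1 - norm z)"], of 0])
     (simp only: real_norm_def abs_norm_cancel, rule blaschke_term_le)

lemma blaschke_convergent:
  "norm z < 1 \<Longrightarrow> convergent_prod (\<lambda>n. if n \<in> I then blaschke_factor (\<Lambda> n) z else 1)"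
  by (intro abs_convergent_prod_imp_convergent_prod summable_imp_abs_convergent_prod blaschke_term_summable)

lemma blaschke_partial_lim:
  "norm z < 1 \<Longrightarrow> (\<lambda>N. c * (\<Prod>n<N. if n \<in> I then blaschke_factor (\<Lambda> n) z else 1)) \<longlonglongrightarrow> blaschke_product c I \<Lambda> z"
  unfolding blaschke_product_def
  using convergent_prod_LIMSEQ[OF blaschke_convergent]
  by (intro tendsto_intros) (simp flip: LIMSEQ_lessThan_iff_atMost)

lemma blaschke_norm_le: "norm z < 1 \<Longrightarrow> norm c = 1 \<Longrightarrow> norm (blaschke_product c I \<Lambda> z) \<le> 1"
proof -
  assume z: "norm z < 1" and c: "norm c = 1"
  have "norm (c * (\<Prod>n<N. if n \<in> I then blaschke_factor (\<Lambda> n) z else 1)) \<le> 1" for N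
    unfolding norm_mult prod_norm[symmetric] using c blaschke_factor_le_1[OF blaschke_point z] by (auto intro!: prod_le_1)
  then show ?thesis by (intro LIMSEQ_le_const2[OF tendsto_norm[OF blaschke_partial_lim[OF z]]]) auto
qed

lemma blaschke_holomorphic: "blaschke_product c I \<Lambda> holomorphic_on unit_disc"
proof (rule holomorphic_uniform_sequence[of _ "\<lambda>N z. c * (\<Prod>n<N. if n \<in> I then blaschke_factor (\<Lambda> n) z else 1)"])
  show "(\<lambda>z. c * (\<Prod>n<N. if n \<in> I then blaschke_factor (\<Lambda> n) z else 1)) holomorphic_on unit_disc" for N
  proof (intro holomorphic_intros)
    fix n show "(\<lambda>z. if n \<in> I then blaschke_factor (\<Lambda> n) z else 1) holomorphic_on unit_disc"
      using blaschke_factor_holomorphic[OF blaschke_point] by (cases "n \<in> I") auto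
  qed
  fix x :: complex assume "x \<in> unit_disc"
  then have x: "norm x < 1" by simp
  define d where "d = (1 - norm x) / 2"
  have d: "d > 0" using x by (simp add: d_def)
  have nz: "norm z \<le> 1 - d" if "z \<in> cball x d" for z
  proof -
    have "norm z \<le> norm x + d" using that norm_triangle_ineq2[of z x] by (simp add: dist_norm norm_minus_commute)
    also have "norm x + d = 1 - d" by (simp add: d_def field_simps)
    finally show ?thesis .
  qed
  have sub: "cball x d \<subseteq> unit_disc" using nz d by fastforce
  have "uniformly_convergent_on (cball x d) (\<lambda>N z. \<Prod>n<N. 1 + ((if n \<in> I then blaschke_factor (\<Lambda> n) z else 1) - 1))"
  proof (rule uniformly_convergent_on_prod)
    fix n
    have "continuous_on (cball x d) (blaschke_factor (\<Lambda> n))" if "n \<in> I"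
      by (rule continuous_on_subset[OF blaschke_factor_continuous[OF blaschke_point[OF that]]]) (use sub in auto)
    then show "continuous_on (cball x d) (\<lambda>z. (if n \<in> I then blaschke_factor (\<Lambda> n) z else 1) - 1)"
      by (cases "n \<in> I") (auto intro!: continuous_intros)
  next
    show "uniformly_convergent_on (cball x d) (\<lambda>N z. \<Sum>n<N. norm ((if n \<in> I then blaschke_factor (\<Lambda> n) z else 1) - 1))"
    proof (rule Weierstrass_m_test'[OF _ summable_mult[OF blaschke_summable, of "2 / d"]])
      fix n z assume z: "z \<in> cball x d"
      have z1: "norm z < 1" using nz[OF z] d by simp
      have "2 / (1 - norm z) * (if n \<in> I then 1 - norm (\<Lambda> n) else 0) \<le> 2 / d * (if n \<in> I then 1 - norm (\<Lambda> n) else 0)"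
        using nz[OF z] z1 d blaschke_point[of n] by (intro mult_right_mono divide_left_mono) auto
      then show "norm (norm ((if n \<in> I then blaschke_factor (\<Lambda> n) z else 1) - 1)) \<le> 2 / d * (if n \<in> I then 1 - norm (\<Lambda> n) else 0)"
        using blaschke_term_le[OF z1, of n] unfolding real_norm_def abs_norm_cancel by (rule order_trans[rotated])
    qed
  qed simp
  then have "uniformly_convergent_on (cball x d) (\<lambda>N z. \<Prod>n<N. if n \<in> I then blaschke_factor (\<Lambda> n) z else 1)" by simp
  then obtain L where L: "uniform_limit (cball x d) (\<lambda>N z. \<Prod>n<N. if n \<in> I then blaschke_factor (\<Lambda> n) z else 1) L sequentially"
    by (auto simp: uniformly_convergent_on_def)
  have ul: "uniform_limit (cball x d) (\<lambda>N z. c * (\<Prod>n<N. if n \<in> I then blaschke_factor (\<Lambda> n) z else 1)) (\<lambda>z. c * L z) sequentially"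
    by (intro uniform_limit_intros L)
  have "c * L z = blaschke_product c I \<Lambda> z" if z: "z \<in> cball x d" for z
  proof -
    have "norm z < 1" using nz[OF z] d by simp
    from LIMSEQ_unique[OF tendsto_uniform_limitI[OF ul z] blaschke_partial_lim[OF this]] show ?thesis .
  qed
  then have "uniform_limit (cball x d) (\<lambda>N z. c * (\<Prod>n<N. if n \<in> I then blaschke_factor (\<Lambda> n) z else 1)) (blaschke_product c I \<Lambda>) sequentially"
    by (intro iffD1[OF uniform_limit_cong' ul]) auto
  then show "\<exists>d>0. cball x d \<subseteq> unit_disc \<and> uniform_limit (cball x d) (\<lambda>N z. c * (\<Prod>n<N. if n \<in> I then blaschke_factor (\<Lambda> n) z else 1)) (blaschke_product c I \<Lambda>) sequentially"
    using sub d by blast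
qed simp

lemma blaschke_nonzero:
  assumes z: "norm z < 1" and c: "c \<noteq> 0" and nz: "\<And>n. n \<in> I \<Longrightarrow> \<Lambda> n \<noteq> z"
  shows "blaschke_product c I \<Lambda> z \<noteq> 0"
proof -
  have "(if n \<in> I then blaschke_factor (\<Lambda> n) z else 1) \<noteq> 0" for n
    using nz[of n] blaschke_factor_eq_0_iff[OF blaschke_point z, of n] by auto
  then have "prodinf (\<lambda>n. if n \<in> I then blaschke_factor (\<Lambda> n) z else 1) \<noteq> 0"
    by (intro prodinf_nonzero blaschke_convergent z)
  then show ?thesis using c by (simp add: blaschke_product_def)
qed

end

section \<open>Splitting, rearranging and cancelling Blaschke products\<close>

lemma blaschke_product_split:
  assumes bs: "blaschke_sequence I \<Lambda>" and z: "norm z < 1" and J: "J \<subseteq> I"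
  shows "blaschke_product c I \<Lambda> z = blaschke_product c J \<Lambda> z * blaschke_product 1 (I - J) \<Lambda> z"
proof -
  have "(\<Prod>n. if n \<in> J then blaschke_factor (\<Lambda> n) z else 1) * (\<Prod>n. if n \<in> I - J then blaschke_factor (\<Lambda> n) z else 1) =
     (\<Prod>n. (if n \<in> J then blaschke_factor (\<Lambda> n) z else 1) * (if n \<in> I - J then blaschke_factor (\<Lambda> n) z else 1))"
    by (intro prodinf_mult blaschke_convergent blaschke_sequence_subset[OF bs] z) (use J in auto)
  also have "\<dots> = (\<Prod>n. if n \<in> I then blaschke_factor (\<Lambda> n) z else 1)"
    by (rule prodinf_cong) (use J in auto)
  finally show ?thesis by (simp add: blaschke_product_def)
qed

lemma blaschke_product_finite:
  "finite J \<Longrightarrow> blaschke_product c J \<Lambda> z = c * (\<Prod>n\<in>J. blaschke_factor (\<Lambda> n) z)"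
  unfolding blaschke_product_def by (subst prodinf_finite[of J]) auto

lemma blaschke_product_scale: "blaschke_product c I \<Lambda> z = c * blaschke_product 1 I \<Lambda> z"
  by (simp add: blaschke_product_def)

lemma blaschke_product_minus_1:
  assumes bs: "blaschke_sequence I \<Lambda>" and z: "norm z < 1"
  shows "norm (blaschke_product 1 I \<Lambda> z - 1) \<le> exp (2 / (1 - norm z) * (\<Sum>n. if n \<in> I then 1 - norm (\<Lambda> n) else 0)) - 1"
proof -
  have "norm (blaschke_product 1 I \<Lambda> z - 1) \<le> exp (\<Sum>n. norm ((if n \<in> I then blaschke_factor (\<Lambda> n) z else 1) - 1)) - 1"
    unfolding blaschke_product_def using prodinf_minus_1_le[OF blaschke_term_summable[OF bs z]] by simp
  also have "(\<Sum>n. norm ((if n \<in> I then blaschke_factor (\<Lambda> n) z else 1) - 1)) \<le>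
      (\<Sum>n. 2 / (1 - norm z) * (if n \<in> I then 1 - norm (\<Lambda> n) else 0))"
    by (intro suminf_le blaschke_term_le[OF bs z] blaschke_term_summable[OF bs z] summable_mult blaschke_summable[OF bs])
  also have "\<dots> = 2 / (1 - norm z) * (\<Sum>n. if n \<in> I then 1 - norm (\<Lambda> n) else 0)"
    by (intro suminf_mult blaschke_summable[OF bs])
  finally show ?thesis by simp
qed

text \<open>A single \<open>N\<close> serves all index sets beyond it at once; both the independence
  of the order of the factors and the passage to the limit in \<open>blaschke_product_divide\<close>
  rely on this uniformity.\<close>

lemma blaschke_tail_small:
  assumes bs: "blaschke_sequence I \<Lambda>" and z: "norm z < 1" and e: "e > 0"
  obtains N where "\<And>J. J \<subseteq> I \<Longrightarrow> J \<inter> {..<N} = {} \<Longrightarrow> norm (blaschke_product 1 J \<Lambda> z - 1) < e"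
proof -
  let ?a = "\<lambda>n. if n \<in> I then 1 - norm (\<Lambda> n) else 0"
  \<comment> \<open>Chosen so that the exponent in \<open>blaschke_product_minus_1\<close> stays
    below \<open>ln (1 + e)\<close>.\<close>
  define \<delta> where "\<delta> = ln (1 + e) * (1 - norm z) / 2"
  have \<delta>: "\<delta> > 0" using e z by (simp add: \<delta>_def)
  obtain N where N: "\<And>n. n \<ge> N \<Longrightarrow> norm (\<Sum>i. ?a (i + n)) < \<delta>" using suminf_exist_split[OF \<delta> blaschke_summable[OF bs]] by blast
  show ?thesis
  proof (rule that[of N])
    fix J assume J: "J \<subseteq> I" "J \<inter> {..<N} = {}"
    have bJ: "blaschke_sequence J \<Lambda>" by (rule blaschke_sequence_subset[OF bs J(1)])
    let ?b = "\<lambda>n. if n \<in> J then 1 - norm (\<Lambda> n) else 0"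
    have sb: "summable ?b" by (rule blaschke_summable[OF bJ])
    have "(\<Sum>n. ?b n) = (\<Sum>n. ?b (n + N)) + (\<Sum>n<N. ?b n)" by (rule suminf_split_initial_segment[OF sb])
    also have "(\<Sum>n<N. ?b n) = 0" using J by (intro sum.neutral) auto
    also have "(\<Sum>n. ?b (n + N)) \<le> (\<Sum>n. ?a (n + N))"
      by (intro suminf_le summable_ignore_initial_segment[OF sb] summable_ignore_initial_segment[OF blaschke_summable[OF bs]])
         (use J blaschke_point[OF bs] in \<open>force simp: less_imp_le\<close>)
    also have "\<dots> < \<delta>" using N[of N] by simp
    finally have "(\<Sum>n. ?b n) < \<delta>" by simp
    then have "2 / (1 - norm z) * (\<Sum>n. ?b n) < 2 / (1 - norm z) * \<delta>" using z by (intro mult_strict_left_mono) auto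
    also have "\<dots> = ln (1 + e)" using z by (simp add: \<delta>_def)
    finally have "exp (2 / (1 - norm z) * (\<Sum>n. ?b n)) < 1 + e" using e by (metis add_pos_pos exp_less_mono exp_ln zero_less_one)
    then show "norm (blaschke_product 1 J \<Lambda> z - 1) < e" using blaschke_product_minus_1[OF bJ z] by simp
  qed
qed

text \<open>A finite product is continuous up to the circle and unimodular there, and the
  complementary tail is close to 1 at the origin, as \<open>radially_unimodular_limit\<close>
  requires.\<close>

lemma blaschke_radially_unimodular:
  assumes bs: "blaschke_sequence I \<Lambda>" and c: "norm c = 1"
  shows "radially_unimodular (blaschke_product c I \<Lambda>)"
proof (rule radially_unimodular_limit)
  fix e :: real assume e: "e > 0"
  obtain N where N: "\<And>J. J \<subseteq> I \<Longrightarrow> J \<inter> {..<N} = {} \<Longrightarrow> norm (blaschke_product 1 J \<Lambda> 0 - 1) < e"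
    using blaschke_tail_small[OF bs _ e, of 0] by auto
  define J where "J = I \<inter> {..<N}"
  have J: "J \<subseteq> I" "finite J" by (auto simp: J_def)
  have bJ: "blaschke_sequence J \<Lambda>" "blaschke_sequence (I - J) \<Lambda>" by (intro blaschke_sequence_subset[OF bs]; auto simp: J_def)+
  have "I - J \<subseteq> I" "(I - J) \<inter> {..<N} = {}" by (auto simp: J_def)
  then have "\<bar>Re (blaschke_product 1 (I - J) \<Lambda> 0 - 1)\<bar> < e"
    using N[of "I - J"] abs_Re_le_cmod[of "blaschke_product 1 (I - J) \<Lambda> 0 - 1"] by linarith
  then have re: "Re (blaschke_product 1 (I - J) \<Lambda> 0) \<ge> 1 - e" by simp
  have "\<exists>l. norm l = 1 \<and> ((\<lambda>r. blaschke_product c J \<Lambda> (of_real r * \<zeta>)) \<longlongrightarrow> l) (at_left 1)" if \<zeta>: "norm \<zeta> = 1" for \<zeta>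
  proof (intro exI conjI)
    have bl: "((\<lambda>r. blaschke_factor (\<Lambda> n) (of_real r * \<zeta>)) \<longlongrightarrow> blaschke_factor (\<Lambda> n) \<zeta>) (at_left 1)" if "n \<in> J" for n
    proof -
      have "continuous_on {0..1} (\<lambda>r. blaschke_factor (\<Lambda> n) (of_real r * \<zeta>))"
        by (rule continuous_on_compose2[OF blaschke_factor_continuous[OF blaschke_point[OF bJ(1) that]]])
           (use \<zeta> in \<open>auto intro!: continuous_intros simp: norm_mult\<close>)
      then have "((\<lambda>r. blaschke_factor (\<Lambda> n) (of_real r * \<zeta>)) \<longlongrightarrow> blaschke_factor (\<Lambda> n) (of_real 1 * \<zeta>)) (at 1 within {0..1})"
        unfolding continuous_on_def by (rule bspec) simp
      then show ?thesis by (simp add: at_within_Icc_at_left)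
    qed
    show "((\<lambda>r. blaschke_product c J \<Lambda> (of_real r * \<zeta>)) \<longlongrightarrow> c * (\<Prod>n\<in>J. blaschke_factor (\<Lambda> n) \<zeta>)) (at_left 1)"
      unfolding blaschke_product_finite[OF J(2)] by (intro tendsto_intros bl)
    show "norm (c * (\<Prod>n\<in>J. blaschke_factor (\<Lambda> n) \<zeta>)) = 1"
      using c blaschke_factor_circle[OF blaschke_point[OF bJ(1)] \<zeta>] by (simp add: norm_mult prod_norm[symmetric])
  qed
  then have u: "radially_unimodular (blaschke_product c J \<Lambda>)"
    unfolding radially_unimodular_def by (intro AE_I2) auto
  show "\<exists>f g. (\<forall>z. norm z < 1 \<longrightarrow> blaschke_product c I \<Lambda> z = f z * g z \<and> norm (f z) \<le> 1 \<and> norm (g z) \<le> 1) \<and>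
      radially_unimodular f \<and> g holomorphic_on unit_disc \<and> Re (g 0) \<ge> 1 - e"
    using blaschke_product_split[OF bs _ J(1)] blaschke_norm_le[OF bJ(1) _ c] blaschke_norm_le[OF bJ(2), of _ 1]
      u re blaschke_holomorphic[OF bJ(2)]
    by (intro exI[of _ "blaschke_product c J \<Lambda>"] exI[of _ "blaschke_product 1 (I - J) \<Lambda>"]) auto
qed

lemma blaschke_finite_fiber:
  assumes bs: "blaschke_sequence I \<Lambda>"
  shows "finite {n \<in> I. \<Lambda> n = a}"
proof (cases "{n \<in> I. \<Lambda> n = a} = {}")
  case False
  then have a: "norm a < 1" using blaschke_point[OF bs] by auto
  have "(\<lambda>n. if n \<in> I then 1 - norm (\<Lambda> n) else 0) \<longlonglongrightarrow> 0" by (rule summable_LIMSEQ_zero[OF blaschke_summable[OF bs]])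
  then have "eventually (\<lambda>n. (if n \<in> I then 1 - norm (\<Lambda> n) else 0) < 1 - norm a) sequentially"
    using a by (intro order_tendstoD(2)) auto
  then obtain N where "\<And>n. n \<ge> N \<Longrightarrow> (if n \<in> I then 1 - norm (\<Lambda> n) else 0) < 1 - norm a" by (auto simp: eventually_sequentially)
  then have "n < N" if "n \<in> I" "\<Lambda> n = a" for n using that by (metis less_irrefl not_le)
  then have "{n \<in> I. \<Lambda> n = a} \<subseteq> {..<N}" by auto
  then show ?thesis by (rule finite_subset) simp
qed (simp only: finite.emptyI)

text \<open>The infinite product is defined in the order of the indices;
  \<open>blaschke_divisor\<close> compares different enumerations of the same zeros and needs a
  limit that does not depend on the order.\<close>

lemma blaschke_unordered_limit:
  assumes bs: "blaschke_sequence I \<Lambda>" and z: "norm z < 1"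
  shows "((\<lambda>F. \<Prod>n\<in>F. blaschke_factor (\<Lambda> n) z) \<longlongrightarrow> blaschke_product 1 I \<Lambda> z) (finite_subsets_at_top I)"
proof (rule tendstoI)
  fix e :: real assume e: "e > 0"
  obtain N where N: "\<And>J. J \<subseteq> I \<Longrightarrow> J \<inter> {..<N} = {} \<Longrightarrow> norm (blaschke_product 1 J \<Lambda> z - 1) < e/2"
    using blaschke_tail_small[OF bs z half_gt_zero[OF e]] by blast
  define J where "J = I \<inter> {..<N}"
  have J: "J \<subseteq> I" "finite J" by (auto simp: J_def)
  have bJ: "blaschke_sequence J \<Lambda>" by (rule blaschke_sequence_subset[OF bs J(1)])
  let ?B = "\<lambda>J. blaschke_product 1 J \<Lambda> z"
  have close: "norm (?B F - ?B J) \<le> e/2" if F: "F \<subseteq> I" "J \<subseteq> F" "?B F = ?B J * ?B (F - J)" for F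
  proof -
    have "?B F - ?B J = ?B J * (?B (F - J) - 1)" using F(3) by (simp add: algebra_simps)
    then have "norm (?B F - ?B J) = norm (?B J) * norm (?B (F - J) - 1)" by (simp add: norm_mult)
    also have "\<dots> \<le> 1 * (e/2)"
    proof (intro mult_mono)
      have "F - J \<subseteq> I" "(F - J) \<inter> {..<N} = {}" using F by (auto simp: J_def)
      then show "norm (?B (F - J) - 1) \<le> e/2" using N less_imp_le by blast
    qed (use blaschke_norm_le[OF bJ z, of 1] e in auto)
    finally show ?thesis by simp
  qed
  have I: "norm (?B I - ?B J) \<le> e/2" by (rule close[OF _ J(1) blaschke_product_split[OF bs z J(1)]]) simp
  have ev: "eventually (\<lambda>F. finite F \<and> J \<subseteq> F \<and> F \<subseteq> I) (finite_subsets_at_top I)"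
    unfolding eventually_finite_subsets_at_top using J by (intro exI[of _ J]) auto
  have strict: "norm (?B F - ?B J) < e/2" if F: "F \<subseteq> I" "J \<subseteq> F" "finite F" for F
  proof -
    have "?B F = ?B J * ?B (F - J)" by (rule blaschke_product_split[OF blaschke_sequence_subset[OF bs F(1)] z F(2)])
    then have "?B F - ?B J = ?B J * (?B (F - J) - 1)" by (simp add: algebra_simps)
    then have "norm (?B F - ?B J) = norm (?B J) * norm (?B (F - J) - 1)" by (simp add: norm_mult)
    also have "\<dots> \<le> 1 * norm (?B (F - J) - 1)"
      using blaschke_norm_le[OF bJ z, of 1] by (intro mult_right_mono) auto
    also have "\<dots> < e/2"
    proof -
      have "F - J \<subseteq> I" "(F - J) \<inter> {..<N} = {}" using F by (auto simp: J_def)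
      then show ?thesis using N by simp
    qed
    finally show ?thesis .
  qed
  show "eventually (\<lambda>F. dist (\<Prod>n\<in>F. blaschke_factor (\<Lambda> n) z) (?B I) < e) (finite_subsets_at_top I)"
    using ev
  proof eventually_elim
    case (elim F)
    have "(\<Prod>n\<in>F. blaschke_factor (\<Lambda> n) z) = ?B F" using blaschke_product_finite[of F 1 \<Lambda> z] elim by simp
    then have "dist (\<Prod>n\<in>F. blaschke_factor (\<Lambda> n) z) (?B I) = norm ((?B F - ?B J) - (?B I - ?B J))" by (simp add: dist_norm)
    also have "\<dots> \<le> norm (?B F - ?B J) + norm (?B I - ?B J)" by (rule norm_triangle_ineq4)
    also have "\<dots> < e" using strict[of F] elim I by auto
    finally show ?case .
  qed
qed

text \<open>The fibres over the individual zeros are finite, so the inequalities of cardinalities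
  give injections between them; these glue to an injection of \<open>I\<close> into
  \<open>I'\<close>, and \<open>J\<close> is its image.\<close>

lemma blaschke_divisor:
  assumes bs: "blaschke_sequence I \<Lambda>" and bs': "blaschke_sequence I' \<Lambda>'"
    and card: "\<And>a. norm a < 1 \<Longrightarrow> card {n \<in> I. \<Lambda> n = a} \<le> card {n \<in> I'. \<Lambda>' n = a}"
  obtains J where "J \<subseteq> I'" "\<And>z. norm z < 1 \<Longrightarrow> blaschke_product 1 J \<Lambda>' z = blaschke_product 1 I \<Lambda> z"
proof -
  have "\<exists>\<phi>. inj_on \<phi> {n \<in> I. \<Lambda> n = a} \<and> \<phi> ` {n \<in> I. \<Lambda> n = a} \<subseteq> {n \<in> I'. \<Lambda>' n = a}" for a
  proof (cases "norm a < 1")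
    case True
    then show ?thesis
      using card_le_inj[OF blaschke_finite_fiber[OF bs] blaschke_finite_fiber[OF bs'] card[OF True]] by blast
  next
    case False
    then have e: "{n \<in> I. \<Lambda> n = a} = {}" using blaschke_point[OF bs] by auto
    show ?thesis unfolding e by (intro exI[of _ id]) auto
  qed
  then have "\<exists>\<phi>. \<forall>a. inj_on (\<phi> a) {n \<in> I. \<Lambda> n = a} \<and> \<phi> a ` {n \<in> I. \<Lambda> n = a} \<subseteq> {n \<in> I'. \<Lambda>' n = a}"
    by (intro choice allI)
  then obtain \<phi> where "\<forall>a. inj_on (\<phi> a) {n \<in> I. \<Lambda> n = a} \<and> \<phi> a ` {n \<in> I. \<Lambda> n = a} \<subseteq> {n \<in> I'. \<Lambda>' n = a}" ..
  then have \<phi>: "\<And>a. inj_on (\<phi> a) {n \<in> I. \<Lambda> n = a}" "\<And>a. \<phi> a ` {n \<in> I. \<Lambda> n = a} \<subseteq> {n \<in> I'. \<Lambda>' n = a}"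
    by simp_all
  define \<pi> where "\<pi> n = \<phi> (\<Lambda> n) n" for n
  have \<pi>: "\<pi> n \<in> I'" "\<Lambda>' (\<pi> n) = \<Lambda> n" if "n \<in> I" for n using \<phi>(2)[of "\<Lambda> n"] that by (auto simp: \<pi>_def)
  have inj: "inj_on \<pi> I"
  proof (rule inj_onI)
    fix m n assume mn: "m \<in> I" "n \<in> I" "\<pi> m = \<pi> n"
    then have "\<Lambda> m = \<Lambda> n" using \<pi>(2) by metis
    then show "m = n" using inj_onD[OF \<phi>(1)[of "\<Lambda> n"], of m n] mn by (auto simp: \<pi>_def)
  qed
  define J where "J = \<pi> ` I"
  have J: "J \<subseteq> I'" using \<pi> by (auto simp: J_def)
  show ?thesis
  proof (rule that[OF J])
    fix z :: complex assume z: "norm z < 1"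
    have "((\<lambda>F. \<Prod>n\<in>F. blaschke_factor (\<Lambda>' n) z) \<longlongrightarrow> blaschke_product 1 J \<Lambda>' z) (filtermap ((`) \<pi>) (finite_subsets_at_top I))"
      using blaschke_unordered_limit[OF blaschke_sequence_subset[OF bs' J] z]
      by (simp add: J_def filtermap_image_finite_subsets_at_top[OF inj])
    then have "((\<lambda>F. \<Prod>n\<in>\<pi> ` F. blaschke_factor (\<Lambda>' n) z) \<longlongrightarrow> blaschke_product 1 J \<Lambda>' z) (finite_subsets_at_top I)"
      by (simp add: filterlim_filtermap)
    moreover have "eventually (\<lambda>F. (\<Prod>n\<in>\<pi> ` F. blaschke_factor (\<Lambda>' n) z) = (\<Prod>n\<in>F. blaschke_factor (\<Lambda> n) z)) (finite_subsets_at_top I)"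
      unfolding eventually_finite_subsets_at_top
    proof (intro exI[of _ "{}"] conjI allI impI)
      fix F assume F: "finite F \<and> {} \<subseteq> F \<and> F \<subseteq> I"
      then have "(\<Prod>n\<in>\<pi> ` F. blaschke_factor (\<Lambda>' n) z) = (\<Prod>n\<in>F. blaschke_factor (\<Lambda>' (\<pi> n)) z)"
        using inj_on_subset[OF inj] by (subst prod.reindex) auto
      also have "\<dots> = (\<Prod>n\<in>F. blaschke_factor (\<Lambda> n) z)" using F \<pi>(2) by (intro prod.cong refl) auto
      finally show "(\<Prod>n\<in>\<pi> ` F. blaschke_factor (\<Lambda>' n) z) = (\<Prod>n\<in>F. blaschke_factor (\<Lambda> n) z)" .
    qed auto
    ultimately have "((\<lambda>F. \<Prod>n\<in>F. blaschke_factor (\<Lambda> n) z) \<longlongrightarrow> blaschke_product 1 J \<Lambda>' z) (finite_subsets_at_top I)"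
      by (rule Lim_transform_eventually)
    then show "blaschke_product 1 J \<Lambda>' z = blaschke_product 1 I \<Lambda> z"
      using blaschke_unordered_limit[OF bs z] tendsto_unique finite_subsets_at_top_neq_bot by blast
  qed
qed

text \<open>The modulus of a Blaschke factor tends to 1 uniformly at the circle. On circles of
  radius close to 1 the quotient is therefore bounded by nearly \<open>M\<close>, and the maximum
  principle carries this inside.\<close>

lemma blaschke_factor_divide:
  assumes f: "f holomorphic_on unit_disc" and a: "norm a < 1"
    and le: "\<And>z. norm z < 1 \<Longrightarrow> norm (f z * blaschke_factor a z) \<le> M" and z: "norm z < 1"
  shows "norm (f z) \<le> M"
proof -
  have "norm (f z) * (1 - e) \<le> M" if e: "0 < e" "e < 1" for e
  proof -
    have "uniformly_continuous_on (cball 0 1) (blaschke_factor a)"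
      by (rule compact_uniformly_continuous[OF blaschke_factor_continuous[OF a]]) simp
    then obtain \<delta> where \<delta>: "\<delta> > 0" "\<And>x y. norm x \<le> 1 \<Longrightarrow> norm y \<le> 1 \<Longrightarrow> norm (y - x) < \<delta> \<Longrightarrow> norm (blaschke_factor a y - blaschke_factor a x) < e"
      using e(1) unfolding uniformly_continuous_on_def by (auto simp: dist_norm)
    have "max (norm z) (1 - \<delta>) < 1" using z \<delta> by auto
    then obtain r where r: "max (norm z) (1 - \<delta>) < r" "r < 1" using dense by blast
    then have r': "norm z < r" "1 - \<delta> < r" "r > 0" by (auto intro: le_less_trans[OF norm_ge_zero[of z]])
    have bd: "norm (f u) \<le> M / (1 - e)" if u: "norm u = r" for u
    proof -
      define \<xi> where "\<xi> = u / of_real r"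
      have \<xi>: "norm \<xi> = 1" using u r' by (simp add: \<xi>_def norm_divide)
      have "u - \<xi> = of_real (r - 1) * \<xi>" using r' by (simp add: \<xi>_def field_simps)
      then have "norm (u - \<xi>) = 1 - r" using \<xi> r by (simp add: norm_mult del: of_real_diff)
      then have "norm (blaschke_factor a u - blaschke_factor a \<xi>) < e" using \<delta>(2)[of \<xi> u] \<xi> u r r' by auto
      moreover have "norm (blaschke_factor a \<xi>) = 1" by (rule blaschke_factor_circle[OF a \<xi>])
      ultimately have b: "1 - e \<le> norm (blaschke_factor a u)"
        using norm_triangle_ineq2[of "blaschke_factor a \<xi>" "blaschke_factor a u"] by (simp add: norm_minus_commute)
      have "norm (f u) * (1 - e) \<le> norm (f u) * norm (blaschke_factor a u)" by (intro mult_left_mono b) simp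
      also have "\<dots> \<le> M" using le[of u] u r by (simp add: norm_mult)
      finally show ?thesis using e by (simp add: field_simps)
    qed
    have "norm (f z) \<le> M / (1 - e)"
    proof (rule maximum_modulus_frontier[of f "cball 0 r"])
      show "f holomorphic_on interior (cball 0 r)" by (rule holomorphic_on_subset[OF f]) (use r in auto)
      show "continuous_on (closure (cball 0 r)) f"
        by (rule continuous_on_subset[OF holomorphic_on_imp_continuous_on[OF f]]) (use r in auto)
    qed (use bd r' in auto)
    then show ?thesis using e by (simp add: field_simps)
  qed
  then have "eventually (\<lambda>e. norm (f z) * (1 - e) \<le> M) (at_right (0::real))"
    using eventually_at_right_real[of 0 "1::real"] by (auto elim!: eventually_mono)
  moreover have "((\<lambda>e. norm (f z) * (1 - e)) \<longlongrightarrow> norm (f z) * (1 - 0)) (at_right (0::real))"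
    by (intro tendsto_intros)
  ultimately show ?thesis
    using tendsto_upperbound[of "\<lambda>e. norm (f z) * (1 - e)" "norm (f z) * (1 - 0)" "at_right (0::real)" M] by simp
qed

text \<open>The first \<open>N\<close> factors are cancelled one at a time without loss in the
  bound; at the fixed point \<open>z\<close> the remaining tail tends to 1 in modulus as
  \<open>N\<close> grows.\<close>

lemma blaschke_product_divide:
  assumes f: "f holomorphic_on unit_disc" and bs: "blaschke_sequence I \<Lambda>" and c: "norm c = 1"
    and le: "\<And>z. norm z < 1 \<Longrightarrow> norm (f z * blaschke_product c I \<Lambda> z) \<le> M" and z: "norm z < 1"
  shows "norm (f z) \<le> M"
proof -
  have fin: "norm (f z * blaschke_product c (I - {..<N}) \<Lambda> z) \<le> M" if "norm z < 1" for z N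
    using that
  proof (induction N arbitrary: z)
    case 0
    then show ?case using le by simp
  next
    case (Suc N)
    show ?case
    proof (cases "N \<in> I")
      case False
      then have "I - {..<Suc N} = I - {..<N}" by (auto simp: less_Suc_eq)
      then show ?thesis using Suc by simp
    next
      case True
      have bJ: "blaschke_sequence (I - {..<Suc N}) \<Lambda>" "blaschke_sequence (I - {..<N}) \<Lambda>" by (rule blaschke_sequence_subset[OF bs]; auto)+
      show ?thesis
      proof (rule blaschke_factor_divide[OF _ blaschke_point[OF bs True] _ Suc.prems])
        show "(\<lambda>z. f z * blaschke_product c (I - {..<Suc N}) \<Lambda> z) holomorphic_on unit_disc"
          by (intro holomorphic_intros f blaschke_holomorphic[OF bJ(1)])
        fix u :: complex assume u: "norm u < 1"
        have e: "I - {..<N} - {N} = I - {..<Suc N}" by (auto simp: less_Suc_eq)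
        have "blaschke_product c (I - {..<N}) \<Lambda> u = blaschke_product c {N} \<Lambda> u * blaschke_product 1 (I - {..<Suc N}) \<Lambda> u"
          using blaschke_product_split[OF bJ(2) u, of "{N}" c] True unfolding e by simp
        then have "blaschke_product c (I - {..<N}) \<Lambda> u = blaschke_product c (I - {..<Suc N}) \<Lambda> u * blaschke_factor (\<Lambda> N) u"
          by (simp add: blaschke_product_finite[of "{N}"] blaschke_product_scale[of c "I - {..<Suc N}"] mult_ac)
        then show "norm (f u * blaschke_product c (I - {..<Suc N}) \<Lambda> u * blaschke_factor (\<Lambda> N) u) \<le> M"
          using Suc.IH[OF u] by (simp add: mult.assoc)
      qed
    qed
  qed
  have "norm (f z) * (1 - e) \<le> M" if e: "0 < e" for e
  proof -
    obtain N where N: "\<And>J. J \<subseteq> I \<Longrightarrow> J \<inter> {..<N} = {} \<Longrightarrow> norm (blaschke_product 1 J \<Lambda> z - 1) < e"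
      using blaschke_tail_small[OF bs z e] by blast
    let ?b = "blaschke_product 1 (I - {..<N}) \<Lambda> z"
    have "norm (?b - 1) < e" by (rule N) auto
    then have "1 - e \<le> norm ?b" using norm_triangle_ineq2[of 1 ?b] by (simp add: norm_minus_commute)
    then have "norm (f z) * (1 - e) \<le> norm (f z) * norm ?b" by (intro mult_left_mono) auto
    also have "\<dots> = norm (f z * blaschke_product c (I - {..<N}) \<Lambda> z)"
      using c by (simp add: blaschke_product_def norm_mult)
    also have "\<dots> \<le> M" by (rule fin[OF z])
    finally show ?thesis .
  qed
  then have "eventually (\<lambda>e. norm (f z) * (1 - e) \<le> M) (at_right (0::real))"
    using eventually_at_right_real[of 0 "1::real"] by (auto elim!: eventually_mono)
  moreover have "((\<lambda>e. norm (f z) * (1 - e)) \<longlongrightarrow> norm (f z) * (1 - 0)) (at_right (0::real))"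
    by (intro tendsto_intros)
  ultimately show ?thesis
    using tendsto_upperbound[of "\<lambda>e. norm (f z) * (1 - e)" "norm (f z) * (1 - 0)" "at_right (0::real)" M] by simp
qed

lemma blaschke_factor_linear:
  assumes a: "norm a < 1"
  obtains q where "q holomorphic_on unit_disc" "\<And>z. norm z < 1 \<Longrightarrow> blaschke_factor a z = (z - a) * q z"
    "\<And>z. norm z < 1 \<Longrightarrow> q z \<noteq> 0"
proof (cases "a = 0")
  case True
  then show ?thesis using that[of "\<lambda>_. 1"] by (simp add: blaschke_factor_def)
next
  case False
  have nz: "1 - cnj a * z \<noteq> 0" if "norm z < 1" for z using blaschke_denominator[OF a, of z] that by simp
  have alg: "p * (- x / d) = x * (- p / d)" for p x d :: complex by simp
  show ?thesis
  proof (rule that[of "\<lambda>z. - (of_real (norm a) / a) / (1 - cnj a * z)"])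
    show "(\<lambda>z. - (of_real (norm a) / a) / (1 - cnj a * z)) holomorphic_on unit_disc"
      using nz False by (intro holomorphic_intros) auto
    show "blaschke_factor a z = (z - a) * (- (of_real (norm a) / a) / (1 - cnj a * z))" if "norm z < 1" for z
      using False alg[of "of_real (norm a) / a" "z - a" "1 - cnj a * z"]
      by (simp only: blaschke_factor_def if_False minus_diff_eq)
    show "- (of_real (norm a) / a) / (1 - cnj a * z) \<noteq> 0" if "norm z < 1" for z using nz[OF that] False by simp
  qed
qed

lemma blaschke_product_order:
  assumes bs: "blaschke_sequence I \<Lambda>" and c: "c \<noteq> 0" and a: "norm a < 1"
  obtains q where "q holomorphic_on unit_disc" "q a \<noteq> 0"
    "\<And>z. norm z < 1 \<Longrightarrow> blaschke_product c I \<Lambda> z = (z - a) ^ card {n \<in> I. \<Lambda> n = a} * q z"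
proof -
  let ?J = "{n \<in> I. \<Lambda> n = a}"
  have fJ: "finite ?J" by (rule blaschke_finite_fiber[OF bs])
  have JI: "?J \<subseteq> I" by auto
  have bR: "blaschke_sequence (I - ?J) \<Lambda>" by (rule blaschke_sequence_subset[OF bs]) auto
  obtain q where q: "q holomorphic_on unit_disc" "\<And>z. norm z < 1 \<Longrightarrow> blaschke_factor a z = (z - a) * q z"
    "\<And>z. norm z < 1 \<Longrightarrow> q z \<noteq> 0" using blaschke_factor_linear[OF a] by blast
  define Q where "Q z = c * q z ^ card ?J * blaschke_product 1 (I - ?J) \<Lambda> z" for z
  show ?thesis
  proof (rule that[of Q])
    show "Q holomorphic_on unit_disc" unfolding Q_def by (intro holomorphic_intros q(1) blaschke_holomorphic[OF bR])
    have "blaschke_product 1 (I - ?J) \<Lambda> a \<noteq> 0" by (rule blaschke_nonzero[OF bR a]) auto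
    then show "Q a \<noteq> 0" using c q(3)[OF a] by (simp add: Q_def)
    fix z :: complex assume z: "norm z < 1"
    have "blaschke_product c ?J \<Lambda> z = c * (\<Prod>n\<in>?J. blaschke_factor a z)"
      unfolding blaschke_product_finite[OF fJ] by (intro arg_cong[of _ _ "(*) c"] prod.cong) auto
    then have "blaschke_product c ?J \<Lambda> z = c * ((z - a) * q z) ^ card ?J" using q(2)[OF z] by simp
    then show "blaschke_product c I \<Lambda> z = (z - a) ^ card ?J * Q z"
      unfolding blaschke_product_split[OF bs z JI] Q_def by (simp add: power_mult_distrib)
  qed
qed

section \<open>Singular and outer factors\<close>

lemma singular_circle_finite: "singular_circle_measure \<mu> \<Longrightarrow> circle_finite \<mu>"
  by (simp add: singular_circle_measure_def circle_finite_def)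

lemma measure_density_indicator:
  assumes "circle_finite \<mu>" "K \<in> sets circle_borel"
  shows "circle_finite (density \<mu> (indicator K))"
    "\<And>A. A \<in> sets circle_borel \<Longrightarrow> emeasure (density \<mu> (indicator K)) A = emeasure \<mu> (A \<inter> K)"
proof -
  interpret finite_measure \<mu> using circle_finiteD[OF assms(1)] by simp
  have K: "K \<in> sets \<mu>" using assms circle_finiteD[OF assms(1)] by simp
  show e: "emeasure (density \<mu> (indicator K)) A = emeasure \<mu> (A \<inter> K)" if "A \<in> sets circle_borel" for A
  proof -
    have "A \<in> sets \<mu>" using that circle_finiteD[OF assms(1)] by simp
    then have "emeasure (density \<mu> (indicator K)) A = (\<integral>\<^sup>+x. indicator K x * indicator A x \<partial>\<mu>)"
      using K by (intro emeasure_density) auto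
    also have "\<dots> = (\<integral>\<^sup>+x. indicator (A \<inter> K) x \<partial>\<mu>)"
      by (intro nn_integral_cong) (simp split: split_indicator)
    finally show ?thesis using \<open>A \<in> sets \<mu>\<close> K by simp
  qed
  have "emeasure (density \<mu> (indicator K)) unit_circle \<noteq> \<infinity>"
    using e[of unit_circle] by (simp add: sets_circle_borel_iff emeasure_finite)
  then show "circle_finite (density \<mu> (indicator K))"
    unfolding circle_finite_def using circle_finiteD[OF assms(1)] by (auto intro!: finite_measureI)
qed

lemma singular_inner_split:
  assumes \<mu>: "circle_finite \<mu>" and K: "K \<in> sets circle_borel" and z: "norm z < 1"
  shows "singular_inner \<mu> z = singular_inner (density \<mu> (indicator K)) z * singular_inner (density \<mu> (indicator (unit_circle - K))) z"
proof -
  have K': "unit_circle - K \<in> sets circle_borel" using K by (metis sets.compl_sets space_circle_borel)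
  note d1 = measure_density_indicator[OF \<mu> K] and d2 = measure_density_indicator[OF \<mu> K']
  show ?thesis
  proof (rule singular_inner_add[OF \<mu> d1(1) d2(1) _ z])
    fix A assume A: "A \<in> sets circle_borel"
    have "emeasure \<mu> A = emeasure \<mu> ((A \<inter> K) \<union> (A \<inter> (unit_circle - K)))"
      using A by (intro arg_cong2[of _ _ _ _ emeasure]) (auto simp: sets_circle_borel_iff)
    also have "\<dots> = emeasure \<mu> (A \<inter> K) + emeasure \<mu> (A \<inter> (unit_circle - K))"
      using A K K' circle_finiteD[OF \<mu>] by (intro plus_emeasure[symmetric]) auto
    finally show "emeasure \<mu> A = emeasure (density \<mu> (indicator K)) A + emeasure (density \<mu> (indicator (unit_circle - K))) A"
      using d1(2)[OF A] d2(2)[OF A] by simp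
  qed
qed

text \<open>Away from \<open>K\<close> the kernel stays bounded up to the circle and is purely
  imaginary on it. The Herglotz integral therefore has a radial limit \<open>H\<close> with
  \<open>Re H = 0\<close>.\<close>

lemma singular_inner_radial_off_support:
  assumes \<mu>: "circle_finite \<mu>" and K: "closed K" "K \<subseteq> unit_circle" and \<zeta>: "norm \<zeta> = 1" "\<zeta> \<notin> K"
  shows "\<exists>l. norm l = 1 \<and> ((\<lambda>r. singular_inner (density \<mu> (indicator K)) (of_real r * \<zeta>)) \<longlongrightarrow> l) (at_left 1)"
proof -
  have KS: "K \<in> sets circle_borel" using K by (simp add: sets_circle_borel_iff)
  have ind: "indicator K = (\<lambda>x::complex. ennreal (indicator K x))" by (auto simp: indicator_def)
  have iK: "integrable \<mu> (indicator K :: complex \<Rightarrow> real)"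
    using KS by (intro integrable_bounded_circle[OF \<mu>, of _ 1]) auto
  obtain d where d: "d > 0" "\<And>\<xi>. \<xi> \<in> K \<Longrightarrow> d \<le> norm (\<xi> - \<zeta>)"
    using separate_point_closed[OF K(1) \<zeta>(2)] by (auto simp: dist_norm norm_minus_commute)
  define g where "g z \<xi> = (\<xi> + z) / (\<xi> - z) * of_real (indicator K \<xi>)" for z \<xi> :: complex
  have gm: "g z \<in> borel_measurable circle_borel" for z
  proof -
    have [measurable]: "(\<lambda>\<xi>. \<xi>) \<in> borel_measurable circle_borel" by (rule measurable_circle_borel_borel)
    have [measurable]: "K \<in> sets circle_borel" by (rule KS)
    show ?thesis unfolding g_def by measurable
  qed
  define H where "H = (\<integral>\<xi>. g \<zeta> \<xi> \<partial>\<mu>)"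
  have gb: "norm (g \<zeta> \<xi>) \<le> 2 / d" if "norm \<xi> = 1" for \<xi>
  proof (cases "\<xi> \<in> K")
    case True
    have "norm (\<xi> + \<zeta>) \<le> 2" using norm_triangle_ineq[of \<xi> \<zeta>] that \<zeta> by simp
    then show ?thesis using d(2)[OF True] d(1) True by (auto simp: g_def norm_divide intro!: frac_le)
  qed (use d in \<open>simp add: g_def\<close>)
  have gi: "integrable \<mu> (g \<zeta>)" by (rule integrable_bounded_circle[OF \<mu> gm, of _ "2/d"]) (use gb in auto)
  have "Re (g \<zeta> \<xi>) = 0" if "norm \<xi> = 1" for \<xi>
  proof -
    have "Re ((\<xi> + \<zeta>) / (\<xi> - \<zeta>)) = Re ((\<xi> + \<zeta>) * cnj (\<xi> - \<zeta>)) / (norm (\<xi> - \<zeta>))\<^sup>2"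
      by (subst complex_div_cnj) (simp add: Re_divide_of_real flip: of_real_power)
    also have "Re ((\<xi> + \<zeta>) * cnj (\<xi> - \<zeta>)) = (norm \<xi>)\<^sup>2 - (norm \<zeta>)\<^sup>2"
      by (simp only: cmod_power2) (simp add: algebra_simps power2_eq_square)
    finally have "Re ((\<xi> + \<zeta>) / (\<xi> - \<zeta>)) = 0" using that \<zeta> by simp
    then show ?thesis by (cases "\<xi> \<in> K") (simp_all add: g_def)
  qed
  then have "(\<integral>\<xi>. Re (g \<zeta> \<xi>) \<partial>\<mu>) = (\<integral>\<xi>. 0 \<partial>\<mu>)"
    by (intro Bochner_Integration.integral_cong) (auto simp: circle_finiteD[OF \<mu>])
  then have ReH: "Re H = 0" using gi by (simp add: H_def)
  have near: "norm (herglotz (density \<mu> (indicator K)) (of_real r * \<zeta>) - H) \<le> 4 * (1 - r) / d\<^sup>2 * measure \<mu> unit_circle"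
    if r: "0 < r" "r < 1" "1 - r \<le> d / 2" for r
  proof -
    let ?z = "of_real r * \<zeta>"
    have z: "norm ?z < 1" by (rule radial_in_disc[OF \<zeta>(1) r(1,2)])
    have gzi: "integrable \<mu> (g ?z)"
    proof (rule integrable_bounded_circle[OF \<mu> gm, of _ "2 / (1 - norm ?z)"])
      fix \<xi> assume "\<xi> \<in> unit_circle"
      then have \<xi>: "norm \<xi> = 1" by simp
      have "norm (\<xi> + ?z) \<le> 2" using norm_triangle_ineq[of \<xi> ?z] z \<xi> by simp
      then show "norm (g ?z \<xi>) \<le> 2 / (1 - norm ?z)"
        using circle_disc_dist[OF \<xi> z] by (auto simp: g_def norm_divide indicator_def intro!: frac_le)
    qed
    have "herglotz (density \<mu> (indicator K)) ?z = (\<integral>\<xi>. g ?z \<xi> \<partial>\<mu>)"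
      unfolding g_def ind using herglotz_density[OF \<mu> iK _ z] by simp
    then have "herglotz (density \<mu> (indicator K)) ?z - H = (\<integral>\<xi>. g ?z \<xi> - g \<zeta> \<xi> \<partial>\<mu>)"
      using gi gzi by (simp add: H_def)
    also have "norm \<dots> \<le> 4 * (1 - r) / d\<^sup>2 * measure \<mu> unit_circle"
    proof (rule norm_circle_integral_le[OF \<mu>])
      show "(\<lambda>\<xi>. g ?z \<xi> - g \<zeta> \<xi>) \<in> borel_measurable circle_borel" using gm by (intro borel_measurable_diff)
      fix \<xi> :: complex assume \<xi>: "norm \<xi> = 1"
      show "norm (g ?z \<xi> - g \<zeta> \<xi>) \<le> 4 * (1 - r) / d\<^sup>2"
      proof (cases "\<xi> \<in> K")
        case True
        have d1: "d \<le> norm (\<xi> - \<zeta>)" by (rule d(2)[OF True])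
        have zz: "norm (?z - \<zeta>) = 1 - r"
        proof -
          have "?z - \<zeta> = of_real (r - 1) * \<zeta>" by (simp add: algebra_simps)
          then show ?thesis using r \<zeta> by (simp add: norm_mult del: of_real_diff)
        qed
        have "norm (\<xi> - \<zeta>) \<le> norm (\<xi> - ?z) + norm (?z - \<zeta>)" using norm_triangle_ineq[of "\<xi> - ?z" "?z - \<zeta>"] by simp
        then have d2: "d / 2 \<le> norm (\<xi> - ?z)" using d1 zz r by simp
        have nz: "\<xi> - ?z \<noteq> 0" "\<xi> - \<zeta> \<noteq> 0" using d1 d2 d(1) by auto
        have "(\<xi> + ?z) / (\<xi> - ?z) - (\<xi> + \<zeta>) / (\<xi> - \<zeta>) = 2 * \<xi> * (?z - \<zeta>) / ((\<xi> - ?z) * (\<xi> - \<zeta>))"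
          using nz by (simp add: divide_simps) (simp add: algebra_simps)
        then have "norm (g ?z \<xi> - g \<zeta> \<xi>) = 2 * (1 - r) / (norm (\<xi> - ?z) * norm (\<xi> - \<zeta>))"
          using True \<xi> zz by (simp add: g_def norm_mult norm_divide)
        also have "\<dots> \<le> 2 * (1 - r) / ((d / 2) * d)"
          using d1 d2 d(1) r by (intro divide_left_mono mult_mono mult_pos_pos) auto
        finally show ?thesis by (simp add: power2_eq_square)
      qed (use r in \<open>simp add: g_def\<close>)
    qed
    finally show ?thesis .
  qed
  have "((\<lambda>r. herglotz (density \<mu> (indicator K)) (of_real r * \<zeta>)) \<longlongrightarrow> H) (at_left 1)"
  proof (rule tendsto_norm_zero_cancel[OF _, THEN LIM_zero_cancel])
    show "((\<lambda>r. norm (herglotz (density \<mu> (indicator K)) (of_real r * \<zeta>) - H)) \<longlongrightarrow> 0) (at_left 1)"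
    proof (rule tendsto_sandwich[OF _ _ tendsto_const])
      show "((\<lambda>r. 4 * (1 - r) / d\<^sup>2 * measure \<mu> unit_circle) \<longlongrightarrow> 0) (at_left 1)"
        by (auto intro!: tendsto_eq_intros simp: d(1) less_imp_neq[OF d(1), symmetric])
      have "max 0 (1 - d/2) < 1" using d by simp
      from eventually_at_left_real[OF this]
      show "eventually (\<lambda>r. norm (herglotz (density \<mu> (indicator K)) (of_real r * \<zeta>) - H) \<le> 4 * (1 - r) / d\<^sup>2 * measure \<mu> unit_circle) (at_left 1)"
        by eventually_elim (rule near, auto)
    qed auto
  qed
  then have "((\<lambda>r. singular_inner (density \<mu> (indicator K)) (of_real r * \<zeta>)) \<longlongrightarrow> exp (- H)) (at_left 1)"
    unfolding singular_inner_herglotz by (intro tendsto_intros)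
  then show ?thesis using ReH by (intro exI[of _ "exp (- H)"]) simp
qed

text \<open>The measure lives on a null set, and a compact subset \<open>K\<close> of it carries all
  of the mass up to \<open>e\<close>. The part on \<open>K\<close> has unimodular limits off
  \<open>K\<close>, hence almost everywhere; the rest has value at least \<open>1 - e\<close> at the
  origin because \<open>exp (- t) \<ge> 1 - t\<close>.\<close>

lemma singular_inner_radially_unimodular:
  assumes "singular_circle_measure \<mu>"
  shows "radially_unimodular (singular_inner \<mu>)"
proof (rule radially_unimodular_limit)
  fix e :: real assume e: "e > 0"
  have \<mu>: "circle_finite \<mu>" using assms by (rule singular_circle_finite)
  interpret finite_measure \<mu> using circle_finiteD[OF \<mu>] by simp
  obtain A where A: "A \<in> sets circle_borel" "emeasure circle_measure A = 0" "emeasure \<mu> (unit_circle - A) = 0"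
    using assms circle_finiteD[OF \<mu>] by (auto simp: singular_circle_measure_def mutually_singular_def)
  have AB: "A \<in> sets borel" "A \<subseteq> unit_circle" using A by (auto simp: sets_circle_borel_iff)
  define M where "M = distr \<mu> borel (\<lambda>\<zeta>. \<zeta>)"
  have idm: "(\<lambda>\<zeta>. \<zeta>) \<in> \<mu> \<rightarrow>\<^sub>M borel"
    using measurable_circle_borel_borel by (simp add: borel_measurable_circle_finite[OF \<mu>])
  have eM: "emeasure M B = emeasure \<mu> (B \<inter> unit_circle)" if "B \<in> sets borel" for B
    unfolding M_def using idm that by (subst emeasure_distr) (auto simp: circle_finiteD[OF \<mu>])
  have sup: "emeasure M A = (SUP K \<in> {K. K \<subseteq> A \<and> compact K}. emeasure M K)"
  proof (rule inner_regular)
    show "sets M = sets borel" by (simp add: M_def)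
    show "emeasure M (space M) \<noteq> \<infinity>" using eM[of "space M"] by (simp add: M_def emeasure_finite)
  qed (rule AB)
  obtain K where K: "K \<subseteq> A" "compact K" "emeasure M A \<le> emeasure M K + ennreal e"
  proof (cases "emeasure M A \<le> ennreal e")
    case True
    then show ?thesis by (intro that[of "{}"]) auto
  next
    case False
    define a where "a = measure \<mu> A"
    have a: "emeasure M A = ennreal a" using eM[OF AB(1)] AB(2) by (simp add: a_def Int_absorb2 emeasure_eq_measure)
    then have "e < a" using False e by (simp add: ennreal_le_iff2 not_le)
    then have "ennreal (a - e) < emeasure M A" unfolding a using e by (intro ennreal_lessI) auto
    then obtain K where "K \<subseteq> A" "compact K" "ennreal (a - e) < emeasure M K" unfolding sup less_SUP_iff by auto
    moreover have "ennreal a = ennreal (a - e) + ennreal e" using e \<open>e < a\<close> by (simp flip: ennreal_plus)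
    ultimately show ?thesis by (intro that[of K]) (auto simp: a intro!: add_right_mono)
  qed
  have Kc: "closed K" "K \<subseteq> unit_circle" "K \<in> sets borel" using K AB by (auto simp: compact_imp_closed)
  have KS: "K \<in> sets circle_borel" using Kc by (simp add: sets_circle_borel_iff)
  have KS': "unit_circle - K \<in> sets circle_borel" using KS by (metis sets.compl_sets space_circle_borel)
  let ?f = "singular_inner (density \<mu> (indicator K))" and ?g = "singular_inner (density \<mu> (indicator (unit_circle - K)))"
  note d1 = measure_density_indicator[OF \<mu> KS] and d2 = measure_density_indicator[OF \<mu> KS']
  have "emeasure circle_measure K \<le> emeasure circle_measure A" using K A by (intro emeasure_mono) auto
  then have K0: "K \<in> null_sets circle_measure" using A KS by (auto simp: null_sets_def)
  have u: "radially_unimodular ?f"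
    unfolding radially_unimodular_def
  proof (rule AE_I'[OF K0])
    show "{\<zeta> \<in> space circle_measure. \<not> (\<exists>l. norm l = 1 \<and> ((\<lambda>r. ?f (of_real r * \<zeta>)) \<longlongrightarrow> l) (at_left 1))} \<subseteq> K"
      using singular_inner_radial_off_support[OF \<mu> Kc(1,2)] by auto
  qed
  have "measure (density \<mu> (indicator (unit_circle - K))) unit_circle \<le> e"
  proof -
    have "measure \<mu> A \<le> measure \<mu> K + e"
      using K(3) eM[OF AB(1)] eM[OF Kc(3)] AB Kc e by (simp add: Int_absorb2 emeasure_eq_measure flip: ennreal_plus)
    moreover have "measure \<mu> (unit_circle - K) = measure \<mu> ((unit_circle - A) \<union> (A - K))"
      using K AB by (intro arg_cong2[of _ _ _ _ measure]) auto
    moreover have "\<dots> \<le> measure \<mu> (unit_circle - A) + measure \<mu> (A - K)"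
      using A KS circle_finiteD[OF \<mu>] by (intro measure_Un_le) (auto simp: sets_circle_borel_iff)
    moreover have "measure \<mu> (unit_circle - A) = 0" using A by (simp add: measure_def)
    moreover have "measure \<mu> (A - K) = measure \<mu> A - measure \<mu> K"
      using A KS K circle_finiteD[OF \<mu>] by (intro finite_measure_Diff) auto
    moreover have "measure (density \<mu> (indicator (unit_circle - K))) unit_circle = measure \<mu> (unit_circle - K)"
      using d2(2)[of unit_circle] by (simp add: measure_def sets_circle_borel_iff Int_absorb1)
    ultimately show ?thesis by linarith
  qed
  then have "1 - e \<le> exp (- measure (density \<mu> (indicator (unit_circle - K))) unit_circle)"
    using exp_ge_add_one_self[of "- measure (density \<mu> (indicator (unit_circle - K))) unit_circle"] by linarith
  also have "\<dots> = Re (?g 0)"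
    unfolding singular_inner_herglotz herglotz_0[OF d2(1)] by (metis Re_complex_of_real exp_of_real of_real_minus)
  finally have "1 - e \<le> Re (?g 0)" .
  then show "\<exists>f g. (\<forall>z. norm z < 1 \<longrightarrow> singular_inner \<mu> z = f z * g z \<and> norm (f z) \<le> 1 \<and> norm (g z) \<le> 1) \<and>
      radially_unimodular f \<and> g holomorphic_on unit_disc \<and> Re (g 0) \<ge> 1 - e"
    using u singular_inner_split[OF \<mu> KS] norm_singular_inner_le[OF d1(1)] norm_singular_inner_le[OF d2(1)]
      singular_inner_holomorphic[OF d2(1)]
    by (intro exI[of _ ?f] exI[of _ ?g]) auto
qed

text \<open>The absolutely continuous counterpart of \<open>herglotz\<close> for densities of either
  sign, as they occur in the logarithm of an outer function.\<close>

definition herglotz_real :: "(complex \<Rightarrow> real) \<Rightarrow> complex \<Rightarrow> complex" where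
  "herglotz_real u z = (\<integral>\<zeta>. (\<zeta> + z) / (\<zeta> - z) * of_real (u \<zeta>) \<partial>circle_measure)"

lemma outer_factor_herglotz_real: "outer_factor f z = exp (herglotz_real (\<lambda>\<zeta>. ln (norm (boundary_value f \<zeta>))) z)"
  by (simp add: outer_factor_def herglotz_real_def)

lemma herglotz_real_integrable:
  assumes u: "integrable circle_measure u" and z: "norm z < 1"
  shows "integrable circle_measure (\<lambda>\<zeta>. (\<zeta> + z) / (\<zeta> - z) * complex_of_real (u \<zeta>))"
proof -
  have c: "continuous_on unit_circle (\<lambda>\<zeta>. (\<zeta> + z) / (\<zeta> - z))" by (rule continuous_on_herglotz_kernel[OF z])
  obtain B where B: "\<And>\<zeta>. norm \<zeta> = 1 \<Longrightarrow> norm ((\<zeta> + z) / (\<zeta> - z)) \<le> B" using circle_continuous_bounded[OF c] by blast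
  have m: "(\<lambda>\<zeta>. (\<zeta> + z) / (\<zeta> - z)) \<in> borel_measurable circle_measure"
    using measurable_circle_continuous[OF c] by (simp add: borel_measurable_circle_finite)
  have um: "u \<in> borel_measurable circle_measure" using u by simp
  show ?thesis
  proof (rule Bochner_Integration.integrable_bound[OF integrable_norm[OF integrable_mult_right[OF u, of B]]])
    show "(\<lambda>\<zeta>. (\<zeta> + z) / (\<zeta> - z) * complex_of_real (u \<zeta>)) \<in> borel_measurable circle_measure"
      using m measurable_compose[OF um borel_measurable_of_real] by (intro borel_measurable_times) auto
    have B0: "B \<ge> 0" using B[of 1] norm_ge_zero order_trans by (metis norm_one)
    show "AE \<zeta> in circle_measure. norm ((\<zeta> + z) / (\<zeta> - z) * complex_of_real (u \<zeta>)) \<le> norm (norm (B * u \<zeta>))"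
    proof (intro AE_I2)
      fix \<zeta> :: complex assume "\<zeta> \<in> space circle_measure"
      then have "norm ((\<zeta> + z) / (\<zeta> - z)) * \<bar>u \<zeta>\<bar> \<le> B * \<bar>u \<zeta>\<bar>" using B by (intro mult_right_mono) auto
      then show "norm ((\<zeta> + z) / (\<zeta> - z) * complex_of_real (u \<zeta>)) \<le> norm (norm (B * u \<zeta>))"
        unfolding norm_mult using B0 by (simp add: abs_mult)
    qed
  qed
qed

lemma Re_herglotz_real:
  assumes u: "integrable circle_measure u" and z: "norm z < 1"
  shows "Re (herglotz_real u z) = (\<integral>\<zeta>. poisson_kernel z \<zeta> * u \<zeta> \<partial>circle_measure)"
    and "integrable circle_measure (\<lambda>\<zeta>. poisson_kernel z \<zeta> * u \<zeta>)"
proof -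
  have e: "Re ((\<zeta> + z) / (\<zeta> - z) * complex_of_real (u \<zeta>)) = poisson_kernel z \<zeta> * u \<zeta>" if "norm \<zeta> = 1" for \<zeta>
  proof -
    have "Re (x * complex_of_real y) = Re x * y" for x y by simp
    then show ?thesis using Re_herglotz_kernel[OF that z] by (simp only:)
  qed
  have "Re (herglotz_real u z) = (\<integral>\<zeta>. Re ((\<zeta> + z) / (\<zeta> - z) * complex_of_real (u \<zeta>)) \<partial>circle_measure)"
    unfolding herglotz_real_def by (rule integral_Re[symmetric, OF herglotz_real_integrable[OF assms]])
  also have "\<dots> = (\<integral>\<zeta>. poisson_kernel z \<zeta> * u \<zeta> \<partial>circle_measure)"
    by (intro Bochner_Integration.integral_cong refl e) simp
  finally show "Re (herglotz_real u z) = (\<integral>\<zeta>. poisson_kernel z \<zeta> * u \<zeta> \<partial>circle_measure)" .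
  have "integrable circle_measure (\<lambda>\<zeta>. Re ((\<zeta> + z) / (\<zeta> - z) * complex_of_real (u \<zeta>)))"
    by (intro integrable_Re herglotz_real_integrable assms)
  then show "integrable circle_measure (\<lambda>\<zeta>. poisson_kernel z \<zeta> * u \<zeta>)"
    by (rule Bochner_Integration.integrable_cong[THEN iffD1, OF refl, rotated]) (rule e, simp)
qed

lemma Re_herglotz_real_mono:
  assumes "integrable circle_measure u" "integrable circle_measure v" "norm z < 1"
    and "\<And>\<zeta>. norm \<zeta> = 1 \<Longrightarrow> u \<zeta> \<le> v \<zeta>"
  shows "Re (herglotz_real u z) \<le> Re (herglotz_real v z)"
  unfolding Re_herglotz_real(1)[OF assms(1,3)] Re_herglotz_real(1)[OF assms(2,3)]
  using assms(4) less_imp_le[OF poisson_kernel_pos[OF _ assms(3)]]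
  by (intro integral_mono Re_herglotz_real(2) assms(1-3)) (auto intro: mult_left_mono)

lemma Re_herglotz_real_le:
  assumes u: "integrable circle_measure u" and z: "norm z < 1" and B: "\<And>\<zeta>. norm \<zeta> = 1 \<Longrightarrow> u \<zeta> \<le> B"
  shows "Re (herglotz_real u z) \<le> B"
proof -
  have "Re (herglotz_real u z) \<le> Re (herglotz_real (\<lambda>_. B) z)"
    by (rule Re_herglotz_real_mono[OF u _ z B]) simp
  also have "\<dots> = B" using integral_poisson_kernel[OF z] by (simp add: Re_herglotz_real[OF _ z])
  finally show ?thesis .
qed

lemma herglotz_real_density:
  assumes u: "integrable circle_measure u" "\<And>\<zeta>. norm \<zeta> = 1 \<Longrightarrow> 0 \<le> u \<zeta>" and z: "norm z < 1"
  shows "herglotz_real u z = herglotz (density circle_measure (\<lambda>\<zeta>. ennreal (u \<zeta>))) z"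
  using herglotz_density[OF circle_finite_circle_measure u z] by (simp add: herglotz_real_def)

lemma herglotz_real_diff:
  assumes "integrable circle_measure u" "integrable circle_measure v" and z: "norm z < 1"
  shows "herglotz_real (\<lambda>\<zeta>. u \<zeta> - v \<zeta>) z = herglotz_real u z - herglotz_real v z"
  unfolding herglotz_real_def
  using herglotz_real_integrable[OF assms(1) z] herglotz_real_integrable[OF assms(2) z]
  by (simp add: right_diff_distrib)

lemma herglotz_real_holomorphic:
  assumes u: "integrable circle_measure u"
  shows "herglotz_real u holomorphic_on unit_disc"
proof -
  have i: "integrable circle_measure (\<lambda>\<zeta>. max 0 (u \<zeta>))" "integrable circle_measure (\<lambda>\<zeta>. max 0 (- u \<zeta>))"
    using u by (auto intro!: integrable_max)
  let ?A = "density circle_measure (\<lambda>\<zeta>. ennreal (max 0 (u \<zeta>)))" and ?B = "density circle_measure (\<lambda>\<zeta>. ennreal (max 0 (- u \<zeta>)))"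
  have "(\<lambda>z. herglotz ?A z - herglotz ?B z) holomorphic_on unit_disc"
    by (intro holomorphic_intros herglotz_holomorphic circle_finite_density i circle_finite_circle_measure) auto
  then show ?thesis
  proof (rule holomorphic_transform)
    fix z :: complex assume "z \<in> unit_disc"
    then have z: "norm z < 1" by simp
    have "herglotz_real u z = herglotz_real (\<lambda>\<zeta>. max 0 (u \<zeta>) - max 0 (- u \<zeta>)) z"
      by (intro arg_cong2[of _ _ _ _ herglotz_real]) (auto simp: max_def)
    then show "herglotz ?A z - herglotz ?B z = herglotz_real u z"
      using i z by (simp add: herglotz_real_diff herglotz_real_density)
  qed
qed

section \<open>Approximate inversion of outer functions\<close>

context growth_weight
begin

text \<open>Near the circle the weight beats the trivial bound 2. At distance more than
  \<open>\<delta>\<close> from it the Herglotz integral is at most \<open>2 / \<delta>\<close> times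
  the mass, hence at most \<open>k / 2\<close>. The threshold is the same for all measures, so it
  applies to truncated outer functions and to the remainders of the grating alike.\<close>

lemma small_mass:
  assumes e: "e > 0"
  obtains \<eta> where "\<eta> > 0"
    "\<And>\<nu> z. circle_finite \<nu> \<Longrightarrow> measure \<nu> unit_circle \<le> \<eta> \<Longrightarrow> norm z < 1 \<Longrightarrow> w (1 - norm z) * norm (1 - singular_inner \<nu> z) \<le> e"
proof -
  obtain \<delta> where \<delta>: "0 < \<delta>" "\<And>t. 0 \<le> t \<Longrightarrow> t \<le> \<delta> \<Longrightarrow> w t < e / 2" using w_small[OF half_gt_zero[OF e]] by blast
  have "continuous (at 0) (exp :: complex \<Rightarrow> complex)" by (intro continuous_intros)
  then obtain k where k: "k > 0" "\<And>x::complex. norm x < k \<Longrightarrow> norm (exp x - 1) < e"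
    using e unfolding continuous_at_eps_delta by (auto simp: dist_norm dest: spec[of _ e])
  show ?thesis
  proof (rule that[of "k * \<delta> / 4"])
    show "k * \<delta> / 4 > 0" using k \<delta> by simp
    fix \<nu> and z :: complex assume \<nu>: "circle_finite \<nu>" "measure \<nu> unit_circle \<le> k * \<delta> / 4" and z: "norm z < 1"
    show "w (1 - norm z) * norm (1 - singular_inner \<nu> z) \<le> e"
    proof (cases "1 - norm z \<le> \<delta>")
      case True
      have "norm (1 - singular_inner \<nu> z) \<le> 2"
        using norm_triangle_ineq4[of 1 "singular_inner \<nu> z"] norm_singular_inner_le[OF \<nu>(1) z] by simp
      then have "w (1 - norm z) * norm (1 - singular_inner \<nu> z) \<le> (e / 2) * 2"
        using \<delta>(2)[OF _ True] z w_disc[OF z] by (intro mult_mono) auto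
      then show ?thesis by simp
    next
      case False
      have "norm (herglotz \<nu> z) \<le> 2 / \<delta> * measure \<nu> unit_circle"
        unfolding herglotz_def
      proof (rule norm_circle_integral_le[OF \<nu>(1)])
        fix \<zeta> :: complex assume \<zeta>: "norm \<zeta> = 1"
        have "norm (\<zeta> + z) \<le> 2" using norm_triangle_ineq[of \<zeta> z] z \<zeta> by simp
        then show "norm ((\<zeta> + z) / (\<zeta> - z)) \<le> 2 / \<delta>"
          using circle_disc_dist[OF \<zeta> z] False \<delta> by (auto simp: norm_divide intro!: frac_le)
      qed (intro measurable_circle_continuous continuous_on_herglotz_kernel z)
      also have "\<dots> \<le> 2 / \<delta> * (k * \<delta> / 4)" using \<nu>(2) \<delta> by (intro mult_left_mono) auto
      also have "\<dots> < k" using \<delta> k by simp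
      finally have "norm (exp (- herglotz \<nu> z) - 1) < e" by (intro k(2)) simp
      then have "norm (1 - singular_inner \<nu> z) \<le> e" by (simp add: singular_inner_herglotz norm_minus_commute)
      then have "w (1 - norm z) * norm (1 - singular_inner \<nu> z) \<le> 1 * e" using w_disc[OF z] by (intro mult_mono) auto
      then show ?thesis by simp
    qed
  qed
qed

text \<open>Cutting \<open>u\<close> off below at \<open>- n\<close> leaves a density
  \<open>b\<close> for which \<open>exp (- herglotz_real b z)\<close> is bounded. Its product with
  the outer function is \<open>singular_inner\<close> of the absolutely continuous measure with
  density \<open>v n\<close>, whose mass tends to 0.\<close>

lemma outer_cyclic:
  assumes u: "integrable circle_measure u" and e: "e > 0"
  obtains h where "h \<in> H_infinity" "\<And>z. norm z < 1 \<Longrightarrow> w (1 - norm z) * norm (1 - h z * exp (herglotz_real u z)) \<le> e"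
proof -
  obtain \<eta> where \<eta>: "\<eta> > 0"
    "\<And>\<nu> z. circle_finite \<nu> \<Longrightarrow> measure \<nu> unit_circle \<le> \<eta> \<Longrightarrow> norm z < 1 \<Longrightarrow> w (1 - norm z) * norm (1 - singular_inner \<nu> z) \<le> e"
    using small_mass[OF e] by blast
  define v where "v n \<zeta> = max 0 (- u \<zeta> - real n)" for n \<zeta>
  have vi: "integrable circle_measure (v n)" for n
    unfolding v_def using u by (intro integrable_max Bochner_Integration.integrable_diff) auto
  have "(\<lambda>n. \<integral>\<zeta>. v n \<zeta> \<partial>circle_measure) \<longlonglongrightarrow> (\<integral>\<zeta>. 0 \<partial>circle_measure)"
  proof (rule integral_dominated_convergence[where w = "\<lambda>\<zeta>. \<bar>u \<zeta>\<bar>"])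
    show "AE \<zeta> in circle_measure. (\<lambda>n. v n \<zeta>) \<longlonglongrightarrow> 0"
    proof (intro AE_I2)
      fix \<zeta>
      obtain N where N: "- u \<zeta> \<le> real N" using real_arch_simple by blast
      have "eventually (\<lambda>n. v n \<zeta> = 0) sequentially"
        using eventually_ge_at_top[of N] by eventually_elim (use N in \<open>auto simp: v_def\<close>)
      then show "(\<lambda>n. v n \<zeta>) \<longlonglongrightarrow> 0" by (rule tendsto_eventually)
    qed
  qed (use u vi in \<open>auto simp: v_def\<close>)
  then have "eventually (\<lambda>n. (\<integral>\<zeta>. v n \<zeta> \<partial>circle_measure) < \<eta>) sequentially"
    using \<eta>(1) by (intro order_tendstoD(2)) auto
  then obtain n where n: "(\<integral>\<zeta>. v n \<zeta> \<partial>circle_measure) < \<eta>" using eventually_happens by force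
  let ?V = "density circle_measure (\<lambda>\<zeta>. ennreal (v n \<zeta>))"
  have V: "circle_finite ?V" by (rule circle_finite_density[OF circle_finite_circle_measure vi]) (simp add: v_def)
  have "emeasure ?V unit_circle = (\<integral>\<^sup>+\<zeta>. ennreal (v n \<zeta>) \<partial>circle_measure)"
    using vi by (subst emeasure_density) (auto simp: sets_circle_borel_iff intro!: nn_integral_cong)
  also have "\<dots> = ennreal (\<integral>\<zeta>. v n \<zeta> \<partial>circle_measure)" by (rule nn_integral_eq_integral[OF vi]) (simp add: v_def)
  finally have mV: "measure ?V unit_circle \<le> \<eta>"
    using n \<eta>(1) by (simp add: measure_def v_def Bochner_Integration.integral_nonneg)
  define b where "b \<zeta> = u \<zeta> + v n \<zeta>" for \<zeta>
  have bi: "integrable circle_measure b" unfolding b_def using u vi by simp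
  have bh: "herglotz_real b z = herglotz_real u z + herglotz ?V z" if z: "norm z < 1" for z
  proof -
    have "(\<lambda>\<zeta>. b \<zeta> - v n \<zeta>) = u" by (simp add: b_def)
    moreover have "herglotz_real (v n) z = herglotz ?V z"
      by (rule herglotz_real_density[OF vi _ z]) (simp add: v_def)
    ultimately show ?thesis using herglotz_real_diff[OF bi vi[of n] z] by simp
  qed
  define h where "h z = exp (- herglotz_real b z)" for z
  show ?thesis
  proof (rule that[of h])
    show "h \<in> H_infinity" unfolding H_infinity_iff
    proof (intro conjI exI[of _ "exp (real n)"] allI impI)
      show "h holomorphic_on unit_disc" unfolding h_def by (intro holomorphic_intros herglotz_real_holomorphic bi)
      fix z :: complex assume z: "norm z < 1"
      have "Re (herglotz_real (\<lambda>\<zeta>. 0 - b \<zeta>) z) \<le> real n"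
        by (rule Re_herglotz_real_le[OF Bochner_Integration.integrable_diff[OF _ bi] z]) (auto simp: b_def v_def)
      then have "- Re (herglotz_real b z) \<le> real n" using herglotz_real_diff[of "\<lambda>_. 0" b z] bi z by (simp add: herglotz_real_def)
      then show "norm (h z) \<le> exp (real n)" by (simp add: h_def)
    qed auto
    fix z :: complex assume z: "norm z < 1"
    have "h z * exp (herglotz_real u z) = singular_inner ?V z"
      by (simp add: h_def bh[OF z] singular_inner_herglotz flip: exp_add)
    then show "w (1 - norm z) * norm (1 - h z * exp (herglotz_real u z)) \<le> e" using \<eta>(2)[OF V mV z] by simp
  qed
qed

end

section \<open>The dyadic grating and distances along the circle\<close>

definition circle_arc :: "nat \<Rightarrow> nat \<Rightarrow> complex set" where
  "circle_arc n j = cis ` {2 * pi * real j / 2 ^ n ..< 2 * pi * (real j + 1) / 2 ^ n}"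

lemma Arg2pi_cis: "0 \<le> x \<Longrightarrow> x < 2 * pi \<Longrightarrow> Arg2pi (cis x) = x"
  by (rule Arg2pi_unique[of 1]) (auto simp: cis_conv_exp)

lemma circle_arc_angle:
  assumes "j < 2 ^ n" "x \<in> {2 * pi * real j / 2 ^ n ..< 2 * pi * (real j + 1) / 2 ^ n}"
  shows "0 \<le> x" "x < 2 * pi"
proof -
  have "0 \<le> 2 * pi * real j / 2 ^ n" by simp
  then show "0 \<le> x" by (rule order_trans) (use assms(2) in auto)
  have "real j + 1 \<le> 2 ^ n" using assms(1) by (metis Suc_leI of_nat_Suc of_nat_le_iff of_nat_numeral of_nat_power add.commute)
  then have "2 * pi * (real j + 1) \<le> 2 * pi * 2 ^ n" by (intro mult_left_mono) auto
  then have "2 * pi * (real j + 1) / 2 ^ n \<le> 2 * pi" by (simp add: pos_divide_le_eq)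
  then show "x < 2 * pi" by (rule less_le_trans[rotated]) (use assms(2) in auto)
qed

lemma circle_arc_subset: "circle_arc n j \<subseteq> unit_circle"
  by (auto simp: circle_arc_def)

lemma circle_arc_sets: "circle_arc n j \<in> sets circle_borel"
proof -
  define a b where "a = 2 * pi * real j / 2 ^ n" and "b = 2 * pi * (real j + 1) / 2 ^ n"
  have "cis ` {a..<b} = (\<Union>k. cis ` {a..b - 1 / real (Suc k)})"
  proof (intro set_eqI iffI)
    fix z assume "z \<in> cis ` {a..<b}"
    then obtain x where x: "z = cis x" "a \<le> x" "x < b" by auto
    obtain k where "1 / real (Suc k) < b - x" using x nat_approx_posE[of "b - x"] by auto
    then have "z \<in> cis ` {a..b - 1 / real (Suc k)}" using x by (intro image_eqI[of _ _ x]) auto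
    then show "z \<in> (\<Union>k. cis ` {a..b - 1 / real (Suc k)})" by blast
  next
    fix z assume "z \<in> (\<Union>k. cis ` {a..b - 1 / real (Suc k)})"
    then obtain k x where x: "z = cis x" "a \<le> x" "x \<le> b - 1 / real (Suc k)" by auto
    have "1 / real (Suc k) > 0" by simp
    then have "x < b" using x(3) by linarith
    then show "z \<in> cis ` {a..<b}" using x by auto
  qed
  moreover have "cis ` {a..b - 1 / real (Suc k)} \<in> sets borel" for k
    by (intro borel_compact compact_continuous_image continuous_intros) auto
  ultimately have "cis ` {a..<b} \<in> sets borel" by auto
  then show ?thesis using circle_arc_subset[of n j] by (simp add: sets_circle_borel_iff circle_arc_def a_def b_def)
qed

lemma circle_arc_cover: "norm \<zeta> = 1 \<Longrightarrow> \<exists>j<2 ^ n. \<zeta> \<in> circle_arc n j"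
proof -
  assume \<zeta>: "norm \<zeta> = 1"
  define t where "t = Arg2pi \<zeta> * 2 ^ n / (2 * pi)"
  have A: "0 \<le> Arg2pi \<zeta>" "Arg2pi \<zeta> < 2 * pi" by (simp_all add: Arg2pi_ge_0 Arg2pi_lt_2pi)
  have c: "\<zeta> = cis (Arg2pi \<zeta>)" using Arg2pi_eq[of \<zeta>] \<zeta> by (simp add: cis_conv_exp)
  have t: "0 \<le> t" "t < 2 ^ n" using A by (auto simp: t_def field_simps)
  define j where "j = nat \<lfloor>t\<rfloor>"
  have j: "real j \<le> t" "t < real j + 1" using t(1) by (auto simp: j_def)
  have "real j < 2 ^ n" using j(1) t(2) by linarith
  then have "j < 2 ^ n" by (metis of_nat_less_iff of_nat_numeral of_nat_power)
  moreover have "\<zeta> \<in> circle_arc n j"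
    unfolding circle_arc_def
    by (subst c, rule imageI) (use j in \<open>auto simp: t_def field_simps\<close>)
  ultimately show ?thesis by blast
qed

lemma circle_arc_disjoint:
  assumes "i < 2 ^ n" "j < 2 ^ n" "i \<noteq> j"
  shows "circle_arc n i \<inter> circle_arc n j = {}"
proof (rule ccontr)
  assume "circle_arc n i \<inter> circle_arc n j \<noteq> {}"
  then obtain z where z: "z \<in> circle_arc n i" "z \<in> circle_arc n j" by blast
  obtain x where x: "z = cis x" "x \<in> {2 * pi * real i / 2 ^ n ..< 2 * pi * (real i + 1) / 2 ^ n}"
    using z(1) unfolding circle_arc_def by (rule imageE)
  obtain y where y: "z = cis y" "y \<in> {2 * pi * real j / 2 ^ n ..< 2 * pi * (real j + 1) / 2 ^ n}"
    using z(2) unfolding circle_arc_def by (rule imageE)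
  note xy = trans[OF x(1)[symmetric] y(1)] x(2) y(2)
  have "x = y" using Arg2pi_cis circle_arc_angle[OF assms(1) xy(2)] circle_arc_angle[OF assms(2) xy(3)] xy(1) by metis
  define t where "t = x * 2 ^ n / (2 * pi)"
  have "real i \<le> t" "t < real i + 1" "real j \<le> t" "t < real j + 1"
    using xy(2,3) \<open>x = y\<close> by (auto simp: t_def field_simps)
  then show False using assms(3) by linarith
qed

text \<open>The arcs partition the circle, so a step function has one nonzero term at each point;
  naming its index allows evaluation.\<close>

lemma circle_arc_indicator_sum:
  assumes "norm \<zeta> = 1"
  shows "(\<Sum>j<2 ^ n. c j * indicator (circle_arc n j) \<zeta>) = (c (THE j. j < 2 ^ n \<and> \<zeta> \<in> circle_arc n j) :: real)"
    "(THE j. j < 2 ^ n \<and> \<zeta> \<in> circle_arc n j) < 2 ^ n"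
    "\<zeta> \<in> circle_arc n (THE j. j < 2 ^ n \<and> \<zeta> \<in> circle_arc n j)"
proof -
  obtain i where i: "i < 2 ^ n" "\<zeta> \<in> circle_arc n i" using circle_arc_cover[OF assms] by blast
  have u: "j = i" if "j < 2 ^ n" "\<zeta> \<in> circle_arc n j" for j using circle_arc_disjoint[of i n j] i that by blast
  have the: "(THE j. j < 2 ^ n \<and> \<zeta> \<in> circle_arc n j) = i"
    by (rule the_equality, rule conjI[OF i], erule conjE, rule u)
  have "(\<Sum>j<2 ^ n. c j * indicator (circle_arc n j) \<zeta>) = (\<Sum>j<2 ^ n. if j = i then c j else 0)"
  proof (intro sum.cong refl)
    fix j :: nat assume "j \<in> {..<2 ^ n}"
    then have "\<zeta> \<in> circle_arc n j \<longleftrightarrow> j = i" using u[of j] i(2) by blast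
    then show "c j * indicator (circle_arc n j) \<zeta> = (if j = i then c j else 0)" by (simp add: indicator_def)
  qed
  also have "\<dots> = c i" using i by simp
  finally show "(\<Sum>j<2 ^ n. c j * indicator (circle_arc n j) \<zeta>) = (c (THE j. j < 2 ^ n \<and> \<zeta> \<in> circle_arc n j) :: real)"
    by (simp only: the)
  show "(THE j. j < 2 ^ n \<and> \<zeta> \<in> circle_arc n j) < 2 ^ n"
    "\<zeta> \<in> circle_arc n (THE j. j < 2 ^ n \<and> \<zeta> \<in> circle_arc n j)" using i by (simp_all only: the)
qed

lemma circle_arc_diameter:
  assumes "\<xi> \<in> circle_arc n j" "\<xi>' \<in> circle_arc n j"
  shows "norm (\<xi> - \<xi>') \<le> 7 / 2 ^ n"
proof -
  obtain x where x: "\<xi> = cis x" "x \<in> {2 * pi * real j / 2 ^ n ..< 2 * pi * (real j + 1) / 2 ^ n}"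
    using assms(1) unfolding circle_arc_def by (rule imageE)
  obtain y where y: "\<xi>' = cis y" "y \<in> {2 * pi * real j / 2 ^ n ..< 2 * pi * (real j + 1) / 2 ^ n}"
    using assms(2) unfolding circle_arc_def by (rule imageE)
  note xy = x(1) y(1) x(2) y(2)
  have "2 * pi * (real j + 1) / 2 ^ n = 2 * pi * real j / 2 ^ n + 2 * pi / 2 ^ n" by (simp add: add_divide_distrib distrib_left)
  then have "\<bar>x - y\<bar> \<le> 2 * pi / 2 ^ n" using xy(3,4) by auto
  also have "\<dots> \<le> 7 / 2 ^ n" using pi_approx by (intro divide_right_mono) auto
  finally show ?thesis using norm_cis_diff_le[of x y] xy by simp
qed

lemma measure_circle_arc:
  assumes "j < 2 ^ n"
  shows "measure circle_measure (circle_arc n j) \<ge> 1 / 2 ^ n"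
proof -
  let ?a = "2 * pi * real j / 2 ^ n" and ?b = "2 * pi * (real j + 1) / 2 ^ n"
  have mA: "{x. cis x \<in> circle_arc n j} \<in> sets borel"
    using measurable_sets[OF measurable_cis circle_arc_sets[of n j]] by (simp add: vimage_def)
  have "{?a..<?b} \<subseteq> {x \<in> {0..<2*pi}. cis x \<in> circle_arc n j}"
    using circle_arc_angle[OF assms] by (auto simp: circle_arc_def)
  moreover have "{x \<in> {0..<2*pi}. cis x \<in> circle_arc n j} = {0..<2*pi} \<inter> {x. cis x \<in> circle_arc n j}" by auto
  ultimately have "emeasure lborel {?a..<?b} \<le> emeasure lborel {x \<in> {0..<2*pi}. cis x \<in> circle_arc n j}"
    using mA by (intro emeasure_mono) auto
  moreover have "?a \<le> ?b" by (intro divide_right_mono mult_left_mono) auto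
  moreover have "?b - ?a = 2 * pi / 2 ^ n" by (simp add: add_divide_distrib distrib_left)
  ultimately have "ennreal (2 * pi / 2 ^ n) \<le> emeasure lborel {x \<in> {0..<2*pi}. cis x \<in> circle_arc n j}" by simp
  then have "ennreal (2 * pi / 2 ^ n) / ennreal (2*pi) \<le> emeasure circle_measure (circle_arc n j)"
    unfolding emeasure_circle_measure[OF circle_arc_sets] by (rule divide_right_mono_ennreal)
  moreover have "ennreal (2 * pi / 2 ^ n) / ennreal (2*pi) = ennreal (1 / 2 ^ n)" by (subst divide_ennreal) auto
  ultimately show ?thesis by (simp add: circle.emeasure_eq_measure)
qed

text \<open>At distance \<open>2\<^sup>-\<^sup>n\<close> from the circle the Poisson kernel is comparable on each arc of level \<open>n\<close>.\<close>

lemma herglotz_one_scale: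
  assumes \<nu>: "circle_finite \<nu>" and A: "\<And>j. j < 2 ^ n \<Longrightarrow> measure \<nu> (circle_arc n j) \<le> A / 2 ^ n"
    and z: "norm z \<le> 1 - 1 / 2 ^ n"
  shows "Re (herglotz \<nu> z) \<le> 64 * A"
proof -
  interpret finite_measure \<nu> using circle_finiteD[OF \<nu>] by simp
  have z1: "norm z < 1" using z by (smt (verit) divide_pos_pos zero_less_power zero_less_numeral)
  let ?p = "poisson_kernel z"
  have pi: "integrable M ?p" if "circle_finite M" for M by (rule integrable_poisson_kernel[OF that z1])
  have arcM: "circle_arc n j \<in> sets M" if "circle_finite M" for M j using circle_arc_sets circle_finiteD[OF that] by simp
  have pim: "integrable circle_measure (\<lambda>\<xi>. ?p \<xi> * indicator (circle_arc n j) \<xi>)" for j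
    using integrable_real_mult_indicator[OF arcM pi] by simp
  \<comment> \<open>The arc has diameter at most \<open>7 / 2 ^ n\<close>, which is at most
    \<open>7 * norm (\<xi> - z)\<close>. Distances to \<open>z\<close> thus differ by a factor of at
    most 8 and the kernels by its square.\<close>
  have comp: "?p \<xi> \<le> 64 * ?p \<xi>'" if "\<xi> \<in> circle_arc n j" "\<xi>' \<in> circle_arc n j" for \<xi> \<xi>' j
  proof -
    have u: "norm \<xi> = 1" "norm \<xi>' = 1" using that circle_arc_subset by force+
    have "7 / 2 ^ n \<le> 7 * (1 - norm z)" using z by (simp add: field_simps)
    also have "\<dots> \<le> 7 * norm (\<xi> - z)" using circle_disc_dist[OF u(1) z1] by simp
    finally have "norm (\<xi>' - \<xi>) \<le> 7 * norm (\<xi> - z)" using circle_arc_diameter[OF that(2,1)] by simp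
    then have le: "norm (\<xi>' - z) \<le> 8 * norm (\<xi> - z)" using norm_triangle_ineq[of "\<xi>' - \<xi>" "\<xi> - z"] by simp
    have pos: "0 < norm (\<xi> - z)" "0 < norm (\<xi>' - z)" using circle_disc_dist[OF u(1) z1] circle_disc_dist[OF u(2) z1] by linarith+
    have "(norm (\<xi>' - z))\<^sup>2 \<le> (8 * norm (\<xi> - z))\<^sup>2" using le by (intro power_mono) auto
    then have "(norm (\<xi>' - z))\<^sup>2 \<le> 64 * (norm (\<xi> - z))\<^sup>2" by (simp add: power_mult_distrib)
    then have "(1 - (norm z)\<^sup>2) * (norm (\<xi>' - z))\<^sup>2 \<le> (1 - (norm z)\<^sup>2) * (64 * (norm (\<xi> - z))\<^sup>2)"
      using z1 by (intro mult_left_mono) (auto simp: power_le_one)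
    then show ?thesis using pos by (simp add: poisson_kernel_def field_simps)
  qed
  \<comment> \<open>Up to the factor 64 this bounds the kernel on an arc by its average there;
    summed against masses \<open>A / 2 ^ n\<close> it returns the integral of the kernel over the
    whole circle, which is 1.\<close>
  define K where "K j = 64 * 2 ^ n * (\<integral>\<xi>'. ?p \<xi>' * indicator (circle_arc n j) \<xi>' \<partial>circle_measure)" for j
  have pK: "?p \<xi> \<le> K j" if j: "j < 2 ^ n" and \<xi>: "\<xi> \<in> circle_arc n j" for j \<xi>
  proof -
    have p0: "0 \<le> ?p \<xi>" using poisson_kernel_pos[of \<xi> z] z1 circle_arc_subset \<xi> by (force intro: less_imp_le)
    have "?p \<xi> * (1 / 2 ^ n) \<le> ?p \<xi> * measure circle_measure (circle_arc n j)"
      using measure_circle_arc[OF j] p0 by (intro mult_left_mono)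
    also have "\<dots> = (\<integral>\<xi>'. ?p \<xi> * indicator (circle_arc n j) \<xi>' \<partial>circle_measure)"
      using circle_arc_sets by (simp add: sets.Int_space_eq2 circle.emeasure_finite circle_arc_subset Int_absorb2)
    also have "\<dots> \<le> (\<integral>\<xi>'. 64 * (?p \<xi>' * indicator (circle_arc n j) \<xi>') \<partial>circle_measure)"
    proof (intro integral_mono)
      show "integrable circle_measure (\<lambda>\<xi>'. ?p \<xi> * indicator (circle_arc n j) \<xi>')"
        using circle_arc_sets[of n j] by (intro integrable_mult_right integrable_real_indicator) (auto simp: circle.emeasure_eq_measure)
      show "integrable circle_measure (\<lambda>\<xi>'. 64 * (?p \<xi>' * indicator (circle_arc n j) \<xi>'))" using pim by (intro integrable_mult_right)
      fix \<xi>'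
      show "?p \<xi> * indicator (circle_arc n j) \<xi>' \<le> 64 * (?p \<xi>' * indicator (circle_arc n j) \<xi>')"
        using comp[OF \<xi>, of \<xi>'] by (auto simp: indicator_def)
    qed
    also have "\<dots> = K j / 2 ^ n" by (simp add: K_def)
    finally show ?thesis by (simp add: field_simps)
  qed
  have K0: "0 \<le> K j" for j unfolding K_def
    using poisson_kernel_pos[OF _ z1]
    by (intro mult_nonneg_nonneg Bochner_Integration.integral_nonneg_AE AE_I2) (auto simp: less_imp_le)
  have "Re (herglotz \<nu> z) = (\<integral>\<xi>. ?p \<xi> \<partial>\<nu>)" by (rule Re_herglotz[OF \<nu> z1])
  also have "\<dots> \<le> (\<integral>\<xi>. (\<Sum>j<2 ^ n. K j * indicator (circle_arc n j) \<xi>) \<partial>\<nu>)"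
  proof (intro integral_mono pi[OF \<nu>])
    show "integrable \<nu> (\<lambda>\<xi>. \<Sum>j<2 ^ n. K j * indicator (circle_arc n j) \<xi>)"
      using arcM[OF \<nu>] by (intro Bochner_Integration.integrable_sum integrable_mult_right integrable_real_indicator) (auto simp: emeasure_eq_measure)
    fix \<xi> assume "\<xi> \<in> space \<nu>"
    then have \<xi>: "norm \<xi> = 1" using circle_finiteD[OF \<nu>] by simp
    show "?p \<xi> \<le> (\<Sum>j<2 ^ n. K j * indicator (circle_arc n j) \<xi>)"
      unfolding circle_arc_indicator_sum(1)[OF \<xi>] by (rule pK[OF circle_arc_indicator_sum(2,3)[OF \<xi>]])
  qed
  also have "\<dots> = (\<Sum>j<2 ^ n. K j * measure \<nu> (circle_arc n j))"
    using arcM[OF \<nu>] circle_arc_subset circle_finiteD[OF \<nu>]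
    by (subst Bochner_Integration.integral_sum) (auto simp: emeasure_eq_measure Int_absorb2 intro!: integrable_mult_right integrable_real_indicator)
  also have "\<dots> \<le> (\<Sum>j<2 ^ n. K j * (A / 2 ^ n))" using A K0 by (intro sum_mono mult_left_mono) auto
  also have "\<dots> = 64 * A * (\<Sum>j<2 ^ n. \<integral>\<xi>'. ?p \<xi>' * indicator (circle_arc n j) \<xi>' \<partial>circle_measure)"
    by (simp add: K_def sum_distrib_left mult_ac)
  also have "(\<Sum>j<2 ^ n. \<integral>\<xi>'. ?p \<xi>' * indicator (circle_arc n j) \<xi>' \<partial>circle_measure) =
     (\<integral>\<xi>'. (\<Sum>j<2 ^ n. ?p \<xi>' * indicator (circle_arc n j) \<xi>') \<partial>circle_measure)"
    using pim by (intro Bochner_Integration.integral_sum[symmetric])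
  also have "\<dots> = (\<integral>\<xi>'. ?p \<xi>' \<partial>circle_measure)"
  proof (intro Bochner_Integration.integral_cong refl)
    fix \<xi> :: complex assume "\<xi> \<in> space circle_measure"
    then have "norm \<xi> = 1" by simp
    then show "(\<Sum>j<2 ^ n. ?p \<xi> * indicator (circle_arc n j) \<xi>) = ?p \<xi>" by (rule circle_arc_indicator_sum(1))
  qed
  also have "\<dots> = 1" by (rule integral_poisson_kernel[OF z1])
  finally show ?thesis by simp
qed

text \<open>Step \<open>k\<close> removes mass \<open>a k\<close> from every arc of level \<open>n k\<close>, or all of the remaining mass if
  there is less; \<open>grating\<close> is the density of what is left.\<close>

primrec grating :: "complex measure \<Rightarrow> (nat \<Rightarrow> nat) \<Rightarrow> (nat \<Rightarrow> real) \<Rightarrow> nat \<Rightarrow> complex \<Rightarrow> real" where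
  "grating \<mu> n a 0 \<zeta> = 1"
| "grating \<mu> n a (Suc k) \<zeta> = grating \<mu> n a k \<zeta> *
     (\<Sum>j<2 ^ n k. (let R = (\<integral>\<xi>. grating \<mu> n a k \<xi> * indicator (circle_arc (n k) j) \<xi> \<partial>\<mu>)
        in if R \<le> a k then 0 else 1 - a k / R) * indicator (circle_arc (n k) j) \<zeta>)"

declare grating.simps(2) [simp del]

text \<open>Only these arcs keep mass after step \<open>k\<close>, and each loses exactly
  \<open>a k\<close>. Their number is therefore controlled by the mass lost in the step, see
  \<open>grating_mass\<close>.\<close>

definition heavy_arcs :: "complex measure \<Rightarrow> (nat \<Rightarrow> nat) \<Rightarrow> (nat \<Rightarrow> real) \<Rightarrow> nat \<Rightarrow> nat set" where
  "heavy_arcs \<mu> n a k =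
     {j. j < 2 ^ n k \<and> a k < (\<integral>\<xi>. grating \<mu> n a k \<xi> * indicator (circle_arc (n k) j) \<xi> \<partial>\<mu>)}"

context
  fixes \<mu> :: "complex measure" and n :: "nat \<Rightarrow> nat" and a :: "nat \<Rightarrow> real"
  assumes \<mu>: "circle_finite \<mu>" and a: "\<And>k. a k > 0"
begin

abbreviation (input) "\<rho> \<equiv> grating \<mu> n a"

lemma grating_measurable: "\<rho> k \<in> borel_measurable circle_borel"
proof (induction k)
  case (Suc k)
  note Suc[measurable] circle_arc_sets[measurable]
  show ?case unfolding grating.simps by measurable
qed (simp add: grating.simps)

lemma grating_bounds: "norm \<zeta> = 1 \<Longrightarrow> 0 \<le> \<rho> k \<zeta> \<and> \<rho> k \<zeta> \<le> 1"
proof (induction k)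
  case (Suc k)
  let ?c = "\<lambda>j. (let R = (\<integral>\<xi>. grating \<mu> n a k \<xi> * indicator (circle_arc (n k) j) \<xi> \<partial>\<mu>)
        in if R \<le> a k then 0 else 1 - a k / R)"
  have c: "0 \<le> ?c j \<and> ?c j \<le> 1" for j using a[of k] by (auto simp: Let_def field_simps)
  show ?case unfolding grating.simps circle_arc_indicator_sum(1)[OF Suc.prems, of ?c]
    using Suc c by (auto intro: mult_le_one)
qed simp

lemma grating_integrable: "integrable \<mu> (\<rho> k)"
  by (rule integrable_bounded_circle[OF \<mu> grating_measurable, of _ 1]) (use grating_bounds in auto)

lemma grating_arc_integrable: "integrable \<mu> (\<lambda>\<xi>. \<rho> k \<xi> * indicator (circle_arc m j) \<xi>)"
  using integrable_real_mult_indicator[OF _ grating_integrable, of "circle_arc m j" k] circle_arc_sets circle_finiteD[OF \<mu>] by simp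

lemma grating_on_arc:
  assumes j: "j < 2 ^ n k" and \<zeta>: "\<zeta> \<in> circle_arc (n k) j"
  shows "\<rho> (Suc k) \<zeta> = \<rho> k \<zeta> * (let R = (\<integral>\<xi>. \<rho> k \<xi> * indicator (circle_arc (n k) j) \<xi> \<partial>\<mu>)
        in if R \<le> a k then 0 else 1 - a k / R)"
proof -
  have u: "norm \<zeta> = 1" using circle_arc_subset \<zeta> by force
  have the: "(THE i. i < 2 ^ n k \<and> \<zeta> \<in> circle_arc (n k) i) = j"
    using circle_arc_indicator_sum(2,3)[OF u, of "n k"] circle_arc_disjoint[of _ "n k" j] j \<zeta> by blast
  show ?thesis unfolding grating.simps circle_arc_indicator_sum(1)[OF u] the ..
qed

lemma grating_Suc_le: "norm \<zeta> = 1 \<Longrightarrow> \<rho> (Suc k) \<zeta> \<le> \<rho> k \<zeta>"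
proof -
  assume u: "norm \<zeta> = 1"
  obtain j where j: "j < 2 ^ n k" "\<zeta> \<in> circle_arc (n k) j" using circle_arc_cover[OF u] by blast
  show ?thesis unfolding grating_on_arc[OF j] using grating_bounds[OF u, of k] a[of k]
    by (auto simp: Let_def field_simps intro!: mult_left_le)
qed

lemma grating_step:
  assumes j: "j < 2 ^ n k"
  shows "(\<integral>\<xi>. (\<rho> k \<xi> - \<rho> (Suc k) \<xi>) * indicator (circle_arc (n k) j) \<xi> \<partial>\<mu>) \<le> a k"
    "j \<in> heavy_arcs \<mu> n a k \<Longrightarrow> (\<integral>\<xi>. (\<rho> k \<xi> - \<rho> (Suc k) \<xi>) * indicator (circle_arc (n k) j) \<xi> \<partial>\<mu>) = a k"
proof -
  define R where "R = (\<integral>\<xi>. \<rho> k \<xi> * indicator (circle_arc (n k) j) \<xi> \<partial>\<mu>)"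
  define t where "t = (if R \<le> a k then 0 else 1 - a k / R)"
  have "(\<integral>\<xi>. (\<rho> k \<xi> - \<rho> (Suc k) \<xi>) * indicator (circle_arc (n k) j) \<xi> \<partial>\<mu>) =
    (\<integral>\<xi>. (1 - t) * (\<rho> k \<xi> * indicator (circle_arc (n k) j) \<xi>) \<partial>\<mu>)"
  proof (intro Bochner_Integration.integral_cong refl)
    fix \<xi>
    show "(\<rho> k \<xi> - \<rho> (Suc k) \<xi>) * indicator (circle_arc (n k) j) \<xi> = (1 - t) * (\<rho> k \<xi> * indicator (circle_arc (n k) j) \<xi>)"
    proof (cases "\<xi> \<in> circle_arc (n k) j")
      case True
      have "\<rho> (Suc k) \<xi> = \<rho> k \<xi> * t" using grating_on_arc[OF j True] by (simp only: t_def R_def Let_def)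
      then show ?thesis by (simp add: algebra_simps)
    qed simp
  qed
  also have "\<dots> = (1 - t) * R" by (simp add: R_def)
  finally have e: "(\<integral>\<xi>. (\<rho> k \<xi> - \<rho> (Suc k) \<xi>) * indicator (circle_arc (n k) j) \<xi> \<partial>\<mu>) = (1 - t) * R" .
  show "(\<integral>\<xi>. (\<rho> k \<xi> - \<rho> (Suc k) \<xi>) * indicator (circle_arc (n k) j) \<xi> \<partial>\<mu>) \<le> a k"
    unfolding e t_def using a[of k] by auto
  show "(\<integral>\<xi>. (\<rho> k \<xi> - \<rho> (Suc k) \<xi>) * indicator (circle_arc (n k) j) \<xi> \<partial>\<mu>) = a k" if "j \<in> heavy_arcs \<mu> n a k"
    unfolding e t_def using that a[of k] by (auto simp: heavy_arcs_def R_def[symmetric])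
qed

lemma grating_support:
  assumes "norm \<zeta> = 1" "\<rho> (Suc k) \<zeta> \<noteq> 0"
  shows "\<exists>j\<in>heavy_arcs \<mu> n a k. \<zeta> \<in> circle_arc (n k) j"
proof -
  obtain j where j: "j < 2 ^ n k" "\<zeta> \<in> circle_arc (n k) j" using circle_arc_cover[OF assms(1)] by blast
  have "j \<in> heavy_arcs \<mu> n a k"
    using assms(2) unfolding grating_on_arc[OF j] by (auto simp: heavy_arcs_def Let_def j(1) split: if_splits)
  then show ?thesis using j by blast
qed

lemma grating_mass:
  "real (card (heavy_arcs \<mu> n a k)) * a k \<le> (\<integral>\<xi>. \<rho> k \<xi> \<partial>\<mu>) - (\<integral>\<xi>. \<rho> (Suc k) \<xi> \<partial>\<mu>)"
proof -
  let ?d = "\<lambda>\<xi>. \<rho> k \<xi> - \<rho> (Suc k) \<xi>"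
  have H: "heavy_arcs \<mu> n a k \<subseteq> {..<2 ^ n k}" by (auto simp: heavy_arcs_def)
  have di: "integrable \<mu> (\<lambda>\<xi>. ?d \<xi> * indicator (circle_arc (n k) j) \<xi>)" for j
    using grating_arc_integrable[of k "n k" j] grating_arc_integrable[of "Suc k" "n k" j] by (simp add: left_diff_distrib del: grating.simps)
  have "real (card (heavy_arcs \<mu> n a k)) * a k = (\<Sum>j\<in>heavy_arcs \<mu> n a k. a k)" by simp
  also have "\<dots> = (\<Sum>j\<in>heavy_arcs \<mu> n a k. \<integral>\<xi>. ?d \<xi> * indicator (circle_arc (n k) j) \<xi> \<partial>\<mu>)"
    by (intro sum.cong refl grating_step(2)[symmetric]) (auto simp: heavy_arcs_def)
  also have "\<dots> \<le> (\<Sum>j<2 ^ n k. \<integral>\<xi>. ?d \<xi> * indicator (circle_arc (n k) j) \<xi> \<partial>\<mu>)"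
    using H grating_Suc_le
    by (intro sum_mono2 Bochner_Integration.integral_nonneg_AE AE_I2) (auto simp: circle_finiteD[OF \<mu>] simp del: grating.simps)
  also have "\<dots> = (\<integral>\<xi>. (\<Sum>j<2 ^ n k. ?d \<xi> * indicator (circle_arc (n k) j) \<xi>) \<partial>\<mu>)"
    using di by (intro Bochner_Integration.integral_sum[symmetric])
  also have "\<dots> = (\<integral>\<xi>. ?d \<xi> \<partial>\<mu>)"
  proof (intro Bochner_Integration.integral_cong refl)
    fix \<xi> assume "\<xi> \<in> space \<mu>"
    then have "norm \<xi> = 1" using circle_finiteD[OF \<mu>] by simp
    then show "(\<Sum>j<2 ^ n k. ?d \<xi> * indicator (circle_arc (n k) j) \<xi>) = ?d \<xi>" by (rule circle_arc_indicator_sum(1))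
  qed
  also have "\<dots> = (\<integral>\<xi>. \<rho> k \<xi> \<partial>\<mu>) - (\<integral>\<xi>. \<rho> (Suc k) \<xi> \<partial>\<mu>)"
    by (intro Bochner_Integration.integral_diff grating_integrable)
  finally show ?thesis .
qed

end

section \<open>Distance along the circle against chordal distance\<close>

lemma arc_dist_eq:
  assumes "norm \<zeta> = 1" "norm \<xi> = 1"
  shows "arc_dist \<zeta> \<xi> = arcsin (norm (\<zeta> - \<xi>) / 2) / pi"
    "norm (\<zeta> - \<xi>) / (2 * pi) \<le> arc_dist \<zeta> \<xi>" "arc_dist \<zeta> \<xi> \<le> norm (\<zeta> - \<xi>) / pi"
proof -
  define t where "t = Arg (\<zeta> / \<xi>)"
  have t: "\<bar>t\<bar> \<le> pi" using Arg_bounded[of "\<zeta> / \<xi>"] by (auto simp: t_def)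
  have nz: "\<xi> \<noteq> 0" using assms by auto
  have "norm (\<zeta> / \<xi>) = 1" using assms by (simp add: norm_divide)
  then have "cis t = \<zeta> / \<xi>" using cis_Arg[of "\<zeta> / \<xi>"] by (simp add: t_def sgn_div_norm scaleR_conv_of_real) (metis sgn_div_norm norm_eq_zero inverse_1 scaleR_one zero_neq_one cis_Arg)
  then have "\<zeta> - \<xi> = \<xi> * (cis t - cis 0)" using nz by (simp add: algebra_simps)
  then have n: "norm (\<zeta> - \<xi>) = norm (cis t - cis 0)" using assms by (simp add: norm_mult)
  have ad: "arc_dist \<zeta> \<xi> = \<bar>t\<bar> / (2 * pi)" by (simp add: arc_dist_def t_def)
  have "\<bar>sin (t / 2)\<bar> = sin (\<bar>t\<bar> / 2)"
  proof (cases "t \<ge> 0")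
    case True
    then show ?thesis using t sin_ge_zero[of "t / 2"] by simp
  next
    case False
    then have "sin (- t / 2) \<ge> 0" using t by (intro sin_ge_zero) auto
    then show ?thesis using False by simp
  qed
  then have "norm (\<zeta> - \<xi>) / 2 = sin (\<bar>t\<bar> / 2)" using n norm_cis_diff[of t 0] by simp
  moreover have "arcsin (sin (\<bar>t\<bar> / 2)) = \<bar>t\<bar> / 2" using t by (intro arcsin_sin) auto
  ultimately have as: "arcsin (norm (\<zeta> - \<xi>) / 2) = \<bar>t\<bar> / 2" by (simp only:)
  show "arc_dist \<zeta> \<xi> = arcsin (norm (\<zeta> - \<xi>) / 2) / pi" unfolding ad as by simp
  show "norm (\<zeta> - \<xi>) / (2 * pi) \<le> arc_dist \<zeta> \<xi>"
    unfolding ad n using norm_cis_diff_le[of t 0] by (intro divide_right_mono) auto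
  show "arc_dist \<zeta> \<xi> \<le> norm (\<zeta> - \<xi>) / pi"
    unfolding ad n using norm_cis_diff_ge[of t 0] t by (simp add: field_simps)
qed

text \<open>Arc distance is an increasing function of the chord, so the nearest point of
  \<open>E\<close> in the plane is also the nearest one along the circle.\<close>

lemma arc_setdist_eq:
  assumes E: "closed E" "E \<subseteq> unit_circle" "E \<noteq> {}" and \<zeta>: "norm \<zeta> = 1"
  shows "arc_setdist \<zeta> E = arcsin (infdist \<zeta> E / 2) / pi"
    "infdist \<zeta> E / (2 * pi) \<le> arc_setdist \<zeta> E" "arc_setdist \<zeta> E \<le> infdist \<zeta> E / pi"
    "infdist \<zeta> E \<le> 2"
proof -
  obtain \<xi> where \<xi>: "\<xi> \<in> E" "infdist \<zeta> E = dist \<zeta> \<xi>" using infdist_attains_inf[OF E(1,3)] by blast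
  have \<xi>1: "norm \<xi> = 1" using \<xi> E by auto
  have min: "arc_dist \<zeta> \<xi> \<le> arc_dist \<zeta> \<xi>'" if "\<xi>' \<in> E" for \<xi>'
  proof -
    have u: "norm \<xi>' = 1" using that E by auto
    have "dist \<zeta> \<xi> \<le> dist \<zeta> \<xi>'" using infdist_le[OF that, of \<zeta>] \<xi> by simp
    moreover have "norm (\<zeta> - \<xi>') \<le> 2" using norm_triangle_ineq4[of \<zeta> \<xi>'] u \<zeta> by simp
    ultimately have "arcsin (norm (\<zeta> - \<xi>) / 2) \<le> arcsin (norm (\<zeta> - \<xi>') / 2)"
      by (intro arcsin_le_arcsin) (auto simp: dist_norm intro: order_trans[OF _ norm_ge_zero])
    then show ?thesis unfolding arc_dist_eq(1)[OF \<zeta> \<xi>1] arc_dist_eq(1)[OF \<zeta> u] by (intro divide_right_mono) auto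
  qed
  have e: "arc_setdist \<zeta> E = arc_dist \<zeta> \<xi>"
    unfolding arc_setdist_def
  proof (rule antisym)
    have "bdd_below (arc_dist \<zeta> ` E)" by (rule bdd_belowI2[OF min])
    then show "(INF \<xi>\<in>E. arc_dist \<zeta> \<xi>) \<le> arc_dist \<zeta> \<xi>" using \<xi>(1) by (rule cINF_lower)
    show "arc_dist \<zeta> \<xi> \<le> (INF \<xi>\<in>E. arc_dist \<zeta> \<xi>)" using E(3) min by (rule cINF_greatest)
  qed
  show "arc_setdist \<zeta> E = arcsin (infdist \<zeta> E / 2) / pi"
    "infdist \<zeta> E / (2 * pi) \<le> arc_setdist \<zeta> E" "arc_setdist \<zeta> E \<le> infdist \<zeta> E / pi"
    unfolding e \<xi>(2) dist_norm using arc_dist_eq[OF \<zeta> \<xi>1] by simp_all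
  show "infdist \<zeta> E \<le> 2" unfolding \<xi>(2) dist_norm using norm_triangle_ineq4[of \<zeta> \<xi>] \<zeta> \<xi>1 by simp
qed

lemma arc_setdist_continuous:
  assumes E: "closed E" "E \<subseteq> unit_circle" "E \<noteq> {}"
  shows "continuous_on unit_circle (\<lambda>\<zeta>. arc_setdist \<zeta> E)"
proof -
  have "continuous_on unit_circle (\<lambda>\<zeta>. arcsin (infdist \<zeta> E / 2) / pi)"
    using arc_setdist_eq(4)[OF E]
    by (intro continuous_intros) (auto intro: order_trans[OF _ infdist_nonneg])
  then show ?thesis by (rule continuous_on_cong[THEN iffD1, rotated 2]) (auto simp: arc_setdist_eq(1)[OF E])
qed

lemma arc_setdist_range:
  assumes E: "closed E" "E \<subseteq> unit_circle" "E \<noteq> {}" and \<zeta>: "norm \<zeta> = 1"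
  shows "0 \<le> arc_setdist \<zeta> E" "arc_setdist \<zeta> E \<le> 1"
proof -
  have "0 \<le> infdist \<zeta> E / (2 * pi)" by (simp add: infdist_nonneg)
  then show "0 \<le> arc_setdist \<zeta> E" using arc_setdist_eq(2)[OF assms] by linarith
  have "infdist \<zeta> E / pi \<le> 1" using arc_setdist_eq(4)[OF assms] pi_gt3 by simp
  then show "arc_setdist \<zeta> E \<le> 1" using arc_setdist_eq(3)[OF assms] by linarith
qed

context growth_weight
begin

lemma entropy_measurable:
  assumes E: "closed E" "E \<subseteq> unit_circle" "E \<noteq> {}"
  shows "(\<lambda>\<zeta>. ln (w (arc_setdist \<zeta> E))) \<in> borel_measurable circle_borel"
proof -
  have "continuous_on unit_circle (\<lambda>\<zeta>. w (arc_setdist \<zeta> E))"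
    by (rule continuous_on_compose2[OF w_cont arc_setdist_continuous[OF E]]) (use arc_setdist_range[OF E] in auto)
  from measurable_circle_continuous[OF this] show ?thesis by (rule borel_measurable_ln)
qed

end

section \<open>Cyclicity of the singular factor\<close>

text \<open>\<open>w_square\<close> keeps the half of the comparability that limits the growth of
  \<open>- ln w\<close>, and \<open>w_linear\<close> says that \<open>w\<close> decays at most like
  a power. Both are derived in \<open>majorant_entropy_weight\<close>.\<close>

locale entropy_weight = growth_weight +
  fixes c L :: real
  assumes c_ge_1: "c \<ge> 1" and L_pos: "L > 0"
    and w_lt_1: "\<And>t. 0 < t \<Longrightarrow> t < 1 \<Longrightarrow> w t < 1"
    and w_square: "\<And>t. 0 < t \<Longrightarrow> t < 1 \<Longrightarrow> - ln (w (t\<^sup>2)) \<le> c * - ln (w t)"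
    and w_linear: "\<And>n::nat. n \<ge> 1 \<Longrightarrow> - ln (w ((1/2) ^ n)) \<le> L * real n"
begin

text \<open>Squaring the argument of \<open>w\<close> doubles the dyadic level, so the comparability
  becomes the doubling condition \<open>psi_double\<close>.\<close>

definition psi :: "nat \<Rightarrow> real" where "psi n = - ln (w ((1/2) ^ n))"

lemma half_power_range: "0 < (1/2 :: real) ^ n" "(1/2 :: real) ^ n \<le> 1"
  by (auto intro: power_le_one)

lemma w_psi: "w ((1/2) ^ n) = exp (- psi n)"
  using w_pos[OF half_power_range] by (simp add: psi_def)

lemma psi_pos: "n \<ge> 1 \<Longrightarrow> psi n > 0"
proof -
  assume "n \<ge> 1"
  then have "(1/2 :: real) ^ n < 1" by (simp add: power_less_one_iff)
  then have "w ((1/2) ^ n) < 1" using half_power_range by (intro w_lt_1)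
  then show ?thesis unfolding psi_def using w_pos[OF half_power_range, of n] by simp
qed

lemma psi_double: "n \<ge> 1 \<Longrightarrow> psi (2 * n) \<le> c * psi n"
proof -
  assume "n \<ge> 1"
  then have "(1/2 :: real) ^ n < 1" by (simp add: power_less_one_iff)
  from w_square[OF half_power_range(1) this] show ?thesis
    by (simp add: psi_def power_mult[symmetric] mult.commute)
qed

lemma psi_unbounded: "\<exists>N. \<forall>n\<ge>N. B < psi n"
proof -
  obtain \<delta> where \<delta>: "0 < \<delta>" "\<And>t. 0 \<le> t \<Longrightarrow> t \<le> \<delta> \<Longrightarrow> w t < exp (- B)" using w_small[of "exp (- B)"] by auto
  obtain N where N: "(1/2 :: real) ^ N < \<delta>" using real_arch_pow_inv[OF \<delta>(1), of "1/2"] by auto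
  have "B < psi n" if "n \<ge> N" for n
  proof -
    have "(1/2 :: real) ^ n \<le> (1/2) ^ N" using that by (intro power_decreasing) auto
    then have "w ((1/2) ^ n) < exp (- B)" using N half_power_range[of n] by (intro \<delta>(2)) linarith+
    then show ?thesis unfolding w_psi by simp
  qed
  then show ?thesis by blast
qed

text \<open>One doubling of the level multiplies \<open>psi\<close> by at most \<open>c\<close>.
  Hence the first repeated doubling that reaches \<open>2 * psi n\<close> overshoots at most to
  \<open>2 * c * psi n\<close>; it exists because \<open>psi\<close> is unbounded.\<close>

lemma scale_next:
  assumes n: "n \<ge> 1"
  shows "\<exists>m\<ge>n. n dvd m \<and> 2 * psi n \<le> psi m \<and> psi m \<le> 2 * c * psi n"
proof -
  obtain N where N: "\<And>k. k \<ge> N \<Longrightarrow> 2 * psi n < psi k" using psi_unbounded by blast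
  have "N \<le> 2 ^ N * 1" by (simp add: less_imp_le)
  also have "\<dots> \<le> 2 ^ N * n" using n by (intro mult_le_mono2)
  finally have "N \<le> 2 ^ N * n" .
  then have "2 * psi n \<le> psi (2 ^ N * n)" using N less_imp_le by blast
  define j where "j = (LEAST j. 2 * psi n \<le> psi (2 ^ j * n))"
  have j: "2 * psi n \<le> psi (2 ^ j * n)" unfolding j_def
    by (rule LeastI[of "\<lambda>j. 2 * psi n \<le> psi (2 ^ j * n)" N]) fact
  have "j \<noteq> 0"
  proof
    assume "j = 0"
    then show False using j psi_pos[OF n] by simp
  qed
  then obtain i where i: "j = Suc i" by (cases j) auto
  have "psi (2 ^ i * n) < 2 * psi n"
    using not_less_Least[of i "\<lambda>j. 2 * psi n \<le> psi (2 ^ j * n)"] i by (simp add: j_def not_le)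
  moreover have "psi (2 ^ j * n) \<le> c * psi (2 ^ i * n)"
    using psi_double[of "2 ^ i * n"] n i by (simp add: mult.assoc)
  moreover have "c * psi (2 ^ i * n) \<le> c * (2 * psi n)" using calculation(1) c_ge_1 by (intro mult_left_mono) auto
  ultimately show ?thesis using j by (intro exI[of _ "2 ^ j * n"]) auto
qed

text \<open>The lower factor 2 lets the bounds of the successive inverses absorb each other, and the
  upper factor \<open>2 * c\<close> keeps the entropy of the surviving set finite. Divisibility by
  the initial level, taken as \<open>4 * q\<close>, keeps all levels in the form that
  \<open>one_step_inverse\<close> needs.\<close>

lemma scale_sequence:
  assumes n0: "n0 \<ge> 1"
  obtains n :: "nat \<Rightarrow> nat" where "n 0 = n0" "\<And>k. n0 dvd n k" "\<And>k. n0 \<le> n k"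
    "\<And>k. 2 * psi (n k) \<le> psi (n (Suc k))" "\<And>k. psi (n (Suc k)) \<le> 2 * c * psi (n k)"
proof -
  have "\<exists>n. \<forall>k. (n k \<ge> n0 \<and> n0 dvd n k \<and> (k = 0 \<longrightarrow> n k = n0)) \<and> (2 * psi (n k) \<le> psi (n (Suc k)) \<and> psi (n (Suc k)) \<le> 2 * c * psi (n k))"
  proof (rule dependent_nat_choice)
    show "\<exists>x\<ge>n0. n0 dvd x \<and> (0 = 0 \<longrightarrow> x = n0)" by auto
    fix x k :: nat assume x: "n0 \<le> x \<and> n0 dvd x \<and> (k = 0 \<longrightarrow> x = n0)"
    then obtain m where "m \<ge> x" "x dvd m" "2 * psi x \<le> psi m" "psi m \<le> 2 * c * psi x"
      using scale_next[of x] n0 by auto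
    then show "\<exists>y. (n0 \<le> y \<and> n0 dvd y \<and> (Suc k = 0 \<longrightarrow> y = n0)) \<and> 2 * psi x \<le> psi y \<and> psi y \<le> 2 * c * psi x"
      using x by (intro exI[of _ m]) (auto intro: dvd_trans)
  qed
  then show ?thesis using that by blast
qed

lemma scale_growth:
  fixes n :: "nat \<Rightarrow> nat"
  assumes "\<And>k. 2 * psi (n k) \<le> psi (n (Suc k))" "psi (n 0) > 0"
  shows "real (Suc k) * psi (n 0) \<le> psi (n k)"
proof (induction k)
  case (Suc k)
  have "real (Suc (Suc k)) * psi (n 0) \<le> 2 * (real (Suc k) * psi (n 0))"
    using assms(2) by (simp add: algebra_simps)
  then show ?case using Suc assms(1)[of k] by linarith
qed simp

text \<open>Roberts' argument: what survives all the steps of the grating lives on a set of finite entropy.\<close>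

lemma grating_mass_tendsto_0:
  assumes \<mu>: "circle_finite \<mu>" and nc: "\<And>E. finite_entropy w E \<Longrightarrow> emeasure \<mu> E = 0"
    and b: "b > 0" and n1: "\<And>k. 1 \<le> n k"
    and n2: "\<And>k. 2 * psi (n k) \<le> psi (n (Suc k))" and n3: "\<And>k. psi (n (Suc k)) \<le> 2 * c * psi (n k)"
  defines "a \<equiv> \<lambda>k. b * psi (n k) / 2 ^ n k"
  shows "(\<lambda>k. \<integral>\<xi>. grating \<mu> n a k \<xi> \<partial>\<mu>) \<longlonglongrightarrow> 0"
proof -
  interpret finite_measure \<mu> using circle_finiteD[OF \<mu>] by simp
  have psip: "psi (n k) > 0" for k by (rule psi_pos[OF n1])
  have ap: "a k > 0" for k using b psip by (simp add: a_def)
  note g = grating_measurable[OF \<mu>, of a n] grating_bounds[OF \<mu>, of a _ n] grating_support[OF \<mu>, of a _ n] grating_mass[OF \<mu>, of a n]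
    grating_integrable[OF \<mu>, of a n] grating_Suc_le[OF \<mu>, of a _ n]
  define H where "H k = heavy_arcs \<mu> n a k" for k
  have fH: "finite (H k)" for k by (rule finite_subset[of _ "{..<2 ^ n k}"]) (auto simp: H_def heavy_arcs_def)
  define p where "p k j = cis (2 * pi * real j / 2 ^ n k)" for k j
  have p1: "norm (p k j) = 1" for k j by (simp add: p_def)
  have parc: "p k j \<in> circle_arc (n k) j" for k j
    unfolding circle_arc_def p_def by (rule imageI) (auto simp: divide_strict_right_mono)
  \<comment> \<open>An arc of level \<open>n k\<close> has diameter at most
    \<open>7 / 2 ^ n k\<close>, so closed discs of this radius about left endpoints contain the
    heavy arcs. The doubled radius in \<open>N k\<close> keeps points outside it at distance at
    least \<open>7 / 2 ^ n k\<close> from \<open>E\<close>.\<close>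
  define F where "F k = (\<Union>j\<in>H k. cball (p k j) (7 / 2 ^ n k) \<inter> unit_circle)" for k
  define N where "N k = (\<Union>j\<in>H k. cball (p k j) (14 / 2 ^ n k) \<inter> unit_circle)" for k
  define E where "E = (\<Inter>k. F k)"
  define r where "r k = (\<integral>\<xi>. grating \<mu> n a k \<xi> \<partial>\<mu>)" for k
  have Fc: "closed (F k)" for k unfolding F_def using fH by (intro closed_UN) auto
  have Ec: "closed E" unfolding E_def using Fc by (intro closed_INT) auto
  have EU: "E \<subseteq> unit_circle" by (auto simp: E_def F_def)
  have Ns: "N k \<in> sets circle_borel" for k unfolding N_def using fH circle_ball_borel by (intro sets.finite_UN) auto
  have ES: "E \<in> sets circle_borel" using Ec EU by (simp add: sets_circle_borel_iff)
  have heavyF: "\<zeta> \<in> F k" if \<zeta>: "norm \<zeta> = 1" "grating \<mu> n a (Suc k) \<zeta> \<noteq> 0" for \<zeta> k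
  proof -
    obtain j where j: "j \<in> H k" "\<zeta> \<in> circle_arc (n k) j" using g(3)[OF ap \<zeta>] by (auto simp: H_def)
    have "norm (p k j - \<zeta>) \<le> 7 / 2 ^ n k" by (rule circle_arc_diameter[OF parc j(2)])
    then show ?thesis using j \<zeta> by (auto simp: F_def dist_norm)
  qed
  have r_mono: "r (Suc k) \<le> r k" for k
    unfolding r_def using g(6)[OF ap] by (intro integral_mono g(5) ap) (auto simp: circle_finiteD[OF \<mu>])
  have r0: "0 \<le> r k" for k
    unfolding r_def using g(2)[OF ap] by (intro Bochner_Integration.integral_nonneg_AE AE_I2) (auto simp: circle_finiteD[OF \<mu>])
  have "decseq r" using r_mono by (intro decseq_SucI)
  moreover have "\<forall>k. 0 \<le> r k" using r0 by blast
  ultimately obtain l where l: "r \<longlonglongrightarrow> l" by (rule decseq_convergent)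
  have rsum: "summable (\<lambda>k. r k - r (Suc k))" using telescope_sums'[OF l] by (rule sums_summable)
  \<comment> \<open>The number of discs times \<open>a k\<close> is at most the mass lost in the
    step, by \<open>grating_mass\<close>; the losses telescope.\<close>
  have mN: "measure circle_measure (N k) \<le> 14 / (b * psi (n k)) * (r k - r (Suc k))" for k
  proof -
    have "measure circle_measure (N k) \<le> (\<Sum>j\<in>H k. measure circle_measure (cball (p k j) (14 / 2 ^ n k) \<inter> unit_circle))"
      unfolding N_def using circle_ball_borel fH by (intro circle.finite_measure_subadditive_finite) auto
    also have "\<dots> \<le> (\<Sum>j\<in>H k. 14 / 2 ^ n k)"
    proof (rule sum_mono)
      fix j assume "j \<in> H k"
      show "measure circle_measure (cball (p k j) (14 / 2 ^ n k) \<inter> unit_circle) \<le> 14 / 2 ^ n k"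
        using emeasure_circle_cball_le[OF p1, of "14 / 2 ^ n k" k j] by (simp add: circle.emeasure_eq_measure)
    qed
    also have "\<dots> = 14 / (b * psi (n k)) * (real (card (H k)) * a k)" using b psip[of k] by (simp add: a_def)
    also have "\<dots> \<le> 14 / (b * psi (n k)) * (r k - r (Suc k))"
      using g(4)[OF ap, of k] b psip[of k] unfolding r_def H_def by (intro mult_left_mono) auto
    finally show ?thesis .
  qed
  \<comment> \<open>Points of \<open>N k\<close> will be charged \<open>psi\<close> of the next
    level; \<open>n3\<close> compares it with level \<open>k\<close>, so the charge is again a
    multiple of the lost mass.\<close>
  have mN2: "psi (n (Suc k)) * measure circle_measure (N k) \<le> 28 * c / b * (r k - r (Suc k))" for k
  proof -
    have "psi (n (Suc k)) * measure circle_measure (N k) \<le> (2 * c * psi (n k)) * (14 / (b * psi (n k)) * (r k - r (Suc k)))"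
      using n3[of k] mN[of k] c_ge_1 psip[of k] by (intro mult_mono) auto
    also have "\<dots> = 28 * c / b * (r k - r (Suc k))" using psip[of k] b by (simp add: field_simps)
    finally show ?thesis .
  qed
  have mN3: "measure circle_measure (N k) \<le> 14 / (b * psi (n 0)) * (r k - r (Suc k))" for k
  proof -
    have "1 * psi (n 0) \<le> real (Suc k) * psi (n 0)" using psip[of 0] by (intro mult_right_mono) auto
    also have "\<dots> \<le> psi (n k)" by (rule scale_growth[of n k, OF n2 psip])
    finally have "psi (n 0) \<le> psi (n k)" by simp
    then have "14 / (b * psi (n k)) \<le> 14 / (b * psi (n 0))" using b psip by (intro divide_left_mono mult_left_mono mult_pos_pos) auto
    then have "14 / (b * psi (n k)) * (r k - r (Suc k)) \<le> 14 / (b * psi (n 0)) * (r k - r (Suc k))"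
      using r_mono by (intro mult_right_mono) auto
    then show ?thesis using mN[of k] by linarith
  qed
  have sN: "summable (\<lambda>k. measure circle_measure (N k))"
    by (rule summable_comparison_test'[OF summable_mult[OF rsum, of "14 / (b * psi (n 0))"], of 0]) (use mN3 in simp)
  have E0: "emeasure \<mu> E = 0"
  proof (cases "E = {}")
    case False
    have "finite_entropy w E" unfolding finite_entropy_def
    proof (intro conjI Ec EU False)
      have "E \<subseteq> N k" for k
      proof -
        have "F k \<subseteq> N k" unfolding F_def N_def by (intro UN_mono Int_mono subset_cball) (auto intro: divide_right_mono)
        then show ?thesis by (auto simp: E_def)
      qed
      then have "measure circle_measure E \<le> measure circle_measure (N k)" for k
        using Ns by (intro circle.finite_measure_mono) auto
      then have "measure circle_measure E \<le> 0"
        by (intro LIMSEQ_le_const[OF summable_LIMSEQ_zero[OF sN]]) auto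
      then show "emeasure circle_measure E = 0" by (simp add: circle.emeasure_eq_measure measure_le_0_iff)
      define v where "v \<zeta> = - ln (w (arc_setdist \<zeta> E))" for \<zeta>
      have v_le: "v \<zeta> \<le> psi (n k)" if \<zeta>: "norm \<zeta> = 1" "\<zeta> \<notin> N k" for \<zeta> k
      proof -
        obtain \<xi> where \<xi>: "\<xi> \<in> E" "infdist \<zeta> E = dist \<zeta> \<xi>" using infdist_attains_inf[OF Ec False] by blast
        then have "\<xi> \<in> F k" by (auto simp: E_def)
        then obtain j where j: "j \<in> H k" "norm (p k j - \<xi>) \<le> 7 / 2 ^ n k" by (auto simp: F_def dist_norm)
        have "\<not> norm (p k j - \<zeta>) \<le> 14 / 2 ^ n k" using \<zeta> j(1) by (auto simp: N_def dist_norm)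
        moreover have "norm (p k j - \<zeta>) \<le> norm (p k j - \<xi>) + norm (\<zeta> - \<xi>)"
          using norm_triangle_ineq4[of "p k j - \<xi>" "\<zeta> - \<xi>"] by simp
        ultimately have "7 / 2 ^ n k \<le> infdist \<zeta> E" using j(2) \<xi>(2) by (simp add: dist_norm)
        then have "7 / 2 ^ n k / (2 * pi) \<le> arc_setdist \<zeta> E"
          using arc_setdist_eq(2)[OF Ec EU False \<zeta>(1)] by (meson divide_right_mono order_trans pi_ge_zero mult_nonneg_nonneg zero_le_numeral)
        \<comment> \<open>This uses \<open>7 > 2 * pi\<close>, the factor between chord and
          normalized arc length.\<close>
        moreover have "(1/2) ^ n k \<le> 7 / 2 ^ n k / (2 * pi)"
          using pi_approx by (simp add: power_divide field_simps)
        ultimately have "(1/2) ^ n k \<le> arc_setdist \<zeta> E" by linarith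
        then have "w ((1/2) ^ n k) \<le> w (arc_setdist \<zeta> E)"
          using arc_setdist_range[OF Ec EU False \<zeta>(1)] by (intro w_le) auto
        then show ?thesis unfolding v_def psi_def using w_pos[OF half_power_range, of "n k"] by simp
      qed
      have vm: "v \<in> borel_measurable circle_measure"
        unfolding v_def using entropy_measurable[OF Ec EU False] by (simp add: borel_measurable_circle_finite)
      have v0: "0 \<le> v \<zeta>" if "norm \<zeta> = 1" for \<zeta>
      proof -
        have "0 \<le> w (arc_setdist \<zeta> E)" "w (arc_setdist \<zeta> E) \<le> 1"
          using w_bounds arc_setdist_range[OF Ec EU False that] by auto
        then show ?thesis by (cases "w (arc_setdist \<zeta> E) = 0") (auto simp: v_def)
      qed
      have "AE \<zeta> in circle_measure. eventually (\<lambda>k. \<zeta> \<in> space circle_measure - N k) sequentially"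
        by (rule borel_cantelli_AE1) (use Ns sN in \<open>auto simp: circle.emeasure_eq_measure\<close>)
      \<comment> \<open>Almost every point leaves the sets \<open>N k\<close>. At the first
        \<open>k\<close> with \<open>\<zeta>\<close> outside \<open>N k\<close> one has
        \<open>v \<zeta> \<le> psi (n k)\<close>, and if \<open>k > 0\<close> the preceding set
        contains \<open>\<zeta>\<close> and contributes just this amount to the series.\<close>
      then have le: "AE \<zeta> in circle_measure. ennreal (v \<zeta>) \<le> ennreal (psi (n 0)) + (\<Sum>k. ennreal (psi (n (Suc k))) * indicator (N k) \<zeta>)"
      proof eventually_elim
        case (elim \<zeta>)
        then obtain k0 where k0: "norm \<zeta> = 1" "\<zeta> \<notin> N k0" by (auto simp: eventually_sequentially)
        define k where "k = (LEAST k. \<zeta> \<notin> N k)"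
        have k: "\<zeta> \<notin> N k" unfolding k_def by (rule LeastI[of "\<lambda>k. \<zeta> \<notin> N k", OF k0(2)])
        show ?case
        proof (cases k)
          case 0
          then have "ennreal (v \<zeta>) \<le> ennreal (psi (n 0))" using v_le[OF k0(1) k] by (intro ennreal_leI) simp
          also have "\<dots> \<le> ennreal (psi (n 0)) + (\<Sum>k. ennreal (psi (n (Suc k))) * indicator (N k) \<zeta>)" by simp
          finally show ?thesis .
        next
          case (Suc i)
          then have iN: "\<zeta> \<in> N i" using not_less_Least[of i "\<lambda>k. \<zeta> \<notin> N k"] by (simp add: k_def)
          have "ennreal (v \<zeta>) \<le> ennreal (psi (n (Suc i))) * indicator (N i) \<zeta>"
            using v_le[OF k0(1) k] iN Suc by (simp add: ennreal_leI)
          also have "\<dots> = (\<Sum>k\<in>{i}. ennreal (psi (n (Suc k))) * indicator (N k) \<zeta>)"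
            by (simp only: sum.insert[OF finite.emptyI] sum.empty empty_iff not_False_eq_True add_0_right)
          also have "\<dots> \<le> (\<Sum>k. ennreal (psi (n (Suc k))) * indicator (N k) \<zeta>)" by (intro sum_le_suminf) auto
          also have "\<dots> \<le> ennreal (psi (n 0)) + (\<Sum>k. ennreal (psi (n (Suc k))) * indicator (N k) \<zeta>)" by simp
          finally show ?thesis .
        qed
      qed
      have Nm: "N k \<in> sets circle_measure" for k using Ns by simp
      have "(\<integral>\<^sup>+\<zeta>. ennreal (v \<zeta>) \<partial>circle_measure) \<le> (\<integral>\<^sup>+\<zeta>. ennreal (psi (n 0)) + (\<Sum>k. ennreal (psi (n (Suc k))) * indicator (N k) \<zeta>) \<partial>circle_measure)"
        by (rule nn_integral_mono_AE[OF le])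
      also have "\<dots> = ennreal (psi (n 0)) + (\<Sum>k. ennreal (psi (n (Suc k))) * emeasure circle_measure (N k))"
        using Nm by (subst nn_integral_add) (auto simp: nn_integral_suminf nn_integral_cmult emeasure_circle_measure_UNIV)
      also have "\<dots> \<le> ennreal (psi (n 0)) + (\<Sum>k. ennreal (28 * c / b * (r k - r (Suc k))))"
      proof (intro add_left_mono suminf_le)
        fix k
        have "ennreal (psi (n (Suc k))) * emeasure circle_measure (N k) = ennreal (psi (n (Suc k)) * measure circle_measure (N k))"
          using psip[of "Suc k"] by (simp add: circle.emeasure_eq_measure ennreal_mult less_imp_le)
        also have "\<dots> \<le> ennreal (28 * c / b * (r k - r (Suc k)))" by (intro ennreal_leI mN2)
        finally show "ennreal (psi (n (Suc k))) * emeasure circle_measure (N k) \<le> ennreal (28 * c / b * (r k - r (Suc k)))" .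
      qed auto
      also have "(\<Sum>k. ennreal (28 * c / b * (r k - r (Suc k)))) = ennreal (\<Sum>k. 28 * c / b * (r k - r (Suc k)))"
        using r_mono c_ge_1 b by (intro suminf_ennreal2 summable_mult rsum) auto
      also have "ennreal (psi (n 0)) + ennreal (\<Sum>k. 28 * c / b * (r k - r (Suc k))) < \<infinity>" by simp
      finally have "integrable circle_measure v"
        using v0 by (intro integrableI_nonneg[OF vm]) auto
      then have "integrable circle_measure (\<lambda>\<zeta>. - v \<zeta>)" by simp
      then show "integrable circle_measure (\<lambda>\<zeta>. ln (w (arc_setdist \<zeta> E)))" by (simp add: v_def)
    qed
    then show ?thesis by (rule nc)
  qed simp
  have "(\<lambda>k. \<integral>\<xi>. grating \<mu> n a k \<xi> \<partial>\<mu>) \<longlonglongrightarrow> (\<integral>\<xi>. 0 \<partial>\<mu>)"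
  proof (rule integral_dominated_convergence[where w = "\<lambda>_. 1"])
    show "AE \<xi> in \<mu>. (\<lambda>k. grating \<mu> n a k \<xi>) \<longlonglongrightarrow> 0"
    proof (rule AE_I'[of E])
      show "E \<in> null_sets \<mu>" using E0 ES circle_finiteD[OF \<mu>] by (auto simp: null_sets_def)
      show "{\<xi> \<in> space \<mu>. \<not> (\<lambda>k. grating \<mu> n a k \<xi>) \<longlonglongrightarrow> 0} \<subseteq> E"
      proof
        fix \<xi> assume "\<xi> \<in> {\<xi> \<in> space \<mu>. \<not> (\<lambda>k. grating \<mu> n a k \<xi>) \<longlonglongrightarrow> 0}"
        then have \<xi>: "norm \<xi> = 1" "\<not> (\<lambda>k. grating \<mu> n a k \<xi>) \<longlonglongrightarrow> 0" using circle_finiteD[OF \<mu>] by auto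
        show "\<xi> \<in> E"
        proof (rule ccontr)
          assume "\<xi> \<notin> E"
          then obtain k where "\<xi> \<notin> F k" by (auto simp: E_def)
          then have z: "grating \<mu> n a (Suc k) \<xi> = 0" using heavyF[OF \<xi>(1)] by blast
          have "grating \<mu> n a m \<xi> = 0" if "m \<ge> Suc k" for m
            using that
          proof (induction m rule: dec_induct)
            case (step m)
            then show ?case by (simp only: grating.simps(2) mult_zero_left)
          qed (rule z)
          then have "eventually (\<lambda>m. grating \<mu> n a m \<xi> = 0) sequentially" by (auto simp: eventually_sequentially)
          then have "(\<lambda>k. grating \<mu> n a k \<xi>) \<longlonglongrightarrow> 0" by (rule tendsto_eventually)
          with \<xi>(2) show False by (rule notE)
        qed
      qed
    qed
    show "AE \<xi> in \<mu>. norm (grating \<mu> n a k \<xi>) \<le> 1" for k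
      using g(2)[OF ap] by (intro AE_I2) (auto simp: circle_finiteD[OF \<mu>])
    show "grating \<mu> n a k \<in> borel_measurable \<mu>" for k using g(1)[OF ap] by (simp add: borel_measurable_circle_finite[OF \<mu>])
  qed auto
  then show ?thesis by simp
qed

text \<open>The approximate inverse is the reciprocal of the singular inner function, dilated by \<open>1 - 2\<^sup>-\<^sup>n\<close>
  with \<open>n = 4 q\<close>. Where \<open>1 - |z| < 2\<^sup>-\<^sup>q\<close> the weight is small, elsewhere the dilation error is.\<close>

lemma one_step_inverse:
  assumes \<nu>: "circle_finite \<nu>" and q: "q \<ge> 1" and M: "measure \<nu> unit_circle \<le> M" "2 * M \<le> 4 ^ q"
    and arcs: "\<And>j. j < 2 ^ (4 * q) \<Longrightarrow> measure \<nu> (circle_arc (4 * q) j) \<le> (s / 64) * psi (4 * q) / 2 ^ (4 * q)"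
    and s: "s > 0" and b: "b \<le> 1 / c\<^sup>2" "b \<le> ln 2 / (2 * L)"
  obtains h where "h \<in> H_infinity" "\<And>z. norm z < 1 \<Longrightarrow> norm (h z) \<le> exp (s * psi (4 * q))"
    "\<And>z. norm z < 1 \<Longrightarrow> w (1 - norm z) * norm (singular_inner \<nu> z * h z - 1) \<le> (2 + 6 * M) * exp ((s - b) * psi (4 * q))"
proof -
  define n where "n = 4 * q"
  define \<rho> :: real where "\<rho> = 1 - 1 / 2 ^ n"
  have n1: "n \<ge> 1" using q by (simp add: n_def)
  have M0: "M \<ge> 0" using M(1) measure_nonneg order_trans by blast
  have "(2::real) ^ n > 1" using n1 by (simp add: one_less_power)
  then have \<rho>: "0 < \<rho>" "\<rho> < 1" by (auto simp: \<rho>_def)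
  have \<rho>z: "norm (of_real \<rho> * z) \<le> \<rho>" "norm (of_real \<rho> * z) \<le> norm z" if "norm z < 1" for z :: complex
    using that \<rho> mult_left_mono[of "norm z" 1 \<rho>] mult_right_mono[of \<rho> 1 "norm z"] by (auto simp: norm_mult)
  define h where "h z = exp (herglotz \<nu> (of_real \<rho> * z))" for z
  have hle: "norm (h z) \<le> exp (s * psi n)" if z: "norm z < 1" for z
  proof -
    \<comment> \<open>The divisor 64 in the hypothesis on the arcs cancels the constant of
      \<open>herglotz_one_scale\<close>.\<close>
    have "Re (herglotz \<nu> (of_real \<rho> * z)) \<le> 64 * ((s / 64) * psi n)"
      using \<rho>z(1)[OF z] arcs by (intro herglotz_one_scale[OF \<nu>, of n]) (auto simp: \<rho>_def n_def)
    then show ?thesis by (simp add: h_def)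
  qed
  have hol: "h holomorphic_on unit_disc"
  proof -
    have "(\<lambda>z. herglotz \<nu> (of_real \<rho> * z)) holomorphic_on ball 0 (1 / \<rho>)"
      by (rule holomorphic_on_dilate[OF herglotz_holomorphic[OF \<nu>] \<rho>])
    then have "(\<lambda>z. herglotz \<nu> (of_real \<rho> * z)) holomorphic_on unit_disc"
    proof (rule holomorphic_on_subset)
      have "1 < 1 / \<rho>" using \<rho> by simp
      then show "unit_disc \<subseteq> ball 0 (1 / \<rho>)" by (intro subset_ball) simp
    qed
    then show ?thesis unfolding h_def by (intro holomorphic_intros)
  qed
  have psip: "psi n > 0" by (rule psi_pos[OF n1])
  have main: "w (1 - norm z) * norm (singular_inner \<nu> z * h z - 1) \<le> (2 + 6 * M) * exp ((s - b) * psi n)" if z: "norm z < 1" for z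
  proof (cases "1 - norm z < (1/2) ^ q")
    case True
    have "w (1 - norm z) \<le> w ((1/2) ^ q)" using True z half_power_range[of q] by (intro w_le) auto
    also have "\<dots> = exp (- psi q)" by (rule w_psi)
    also have "\<dots> \<le> exp (- (b * psi n))"
    proof -
      \<comment> \<open>Level \<open>n = 4 * q\<close> is two doublings above \<open>q\<close>;
        hence the condition \<open>b \<le> 1 / c\<^sup>2\<close>.\<close>
      have "psi n \<le> c * psi (2 * q)" using psi_double[of "2 * q"] q by (simp add: n_def)
      also have "\<dots> \<le> c * (c * psi q)" using psi_double[OF q] c_ge_1 by (intro mult_left_mono) auto
      finally have "psi n \<le> c\<^sup>2 * psi q" by (simp add: power2_eq_square mult.assoc)
      then have "1 / c\<^sup>2 * psi n \<le> psi q" using c_ge_1 by (simp add: pos_divide_le_eq mult.commute)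
      moreover have "b * psi n \<le> 1 / c\<^sup>2 * psi n" using b(1) psip by (intro mult_right_mono) auto
      ultimately show ?thesis by simp
    qed
    finally have w1: "w (1 - norm z) \<le> exp (- (b * psi n))" .
    have e1: "1 \<le> exp (s * psi n)" using s psip by simp
    have "norm (singular_inner \<nu> z * h z - 1) \<le> norm (singular_inner \<nu> z * h z) + 1"
      using norm_triangle_ineq4[of "singular_inner \<nu> z * h z" 1] by simp
    also have "norm (singular_inner \<nu> z * h z) \<le> 1 * exp (s * psi n)"
      unfolding norm_mult using hle[OF z] norm_singular_inner_le[OF \<nu> z] by (intro mult_mono) auto
    finally have "norm (singular_inner \<nu> z * h z - 1) \<le> 2 * exp (s * psi n)" using e1 by linarith
    then have "w (1 - norm z) * norm (singular_inner \<nu> z * h z - 1) \<le> exp (- (b * psi n)) * (2 * exp (s * psi n))"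
      using w1 w_disc[OF z] by (intro mult_mono) auto
    also have "\<dots> = 2 * exp ((s - b) * psi n)" by (simp add: left_diff_distrib exp_diff exp_minus field_simps)
    also have "\<dots> \<le> (2 + 6 * M) * exp ((s - b) * psi n)" using M0 by (intro mult_right_mono) auto
    finally show ?thesis .
  next
    case False
    have d: "norm z \<le> 1 - (1/2) ^ q" "norm (of_real \<rho> * z) \<le> 1 - (1/2) ^ q" using False \<rho>z(2)[OF z] by linarith+
    let ?x = "herglotz \<nu> (of_real \<rho> * z) - herglotz \<nu> z"
    \<comment> \<open>The dilation moves \<open>z\<close> by at most \<open>1 / 2 ^ (4 * q)\<close>,
      while the Lipschitz constant at distance \<open>(1/2) ^ q\<close> from the circle is
      \<open>2 * 4 ^ q\<close> times the mass; a factor \<open>1 / 4 ^ q\<close> remains.\<close>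
    have "norm ?x \<le> 2 * norm (of_real \<rho> * z - z) / ((1/2) ^ q)\<^sup>2 * measure \<nu> unit_circle"
      by (rule herglotz_diff_bound[OF \<nu> d(2,1) half_power_range(1)])
    also have "norm (of_real \<rho> * z - z) \<le> 1 / 2 ^ n"
    proof -
      have "of_real \<rho> * z - z = of_real (\<rho> - 1) * z" by (simp add: algebra_simps)
      then have "norm (of_real \<rho> * z - z) = (1 - \<rho>) * norm z" using \<rho> by (simp add: norm_mult del: of_real_diff)
      also have "\<dots> \<le> (1 - \<rho>) * 1" using \<rho> z by (intro mult_left_mono) auto
      finally show ?thesis by (simp add: \<rho>_def)
    qed
    then have "2 * norm (of_real \<rho> * z - z) / ((1/2) ^ q)\<^sup>2 * measure \<nu> unit_circle \<le> 2 * (1 / 2 ^ n) / ((1/2) ^ q)\<^sup>2 * M"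
      using M(1) M0 by (intro mult_mono divide_right_mono mult_left_mono) auto
    also have "\<dots> = 2 * M / 4 ^ q"
    proof -
      have "(2::real) ^ n = 4 ^ q * 4 ^ q" by (simp add: n_def power_mult flip: power_mult_distrib)
      moreover have "((1/2 :: real) ^ q)\<^sup>2 = 1 / 4 ^ q"
        by (simp add: power_divide power2_eq_square flip: power_mult_distrib)
      ultimately show ?thesis by simp
    qed
    finally have x: "norm ?x \<le> 2 * M / 4 ^ q" .
    have x1: "norm ?x \<le> 1" using x M(2) by (smt (verit) divide_le_eq_1_pos zero_less_power)
    have "singular_inner \<nu> z * h z = exp ?x" by (simp add: singular_inner_herglotz h_def flip: exp_add)
    then have "norm (singular_inner \<nu> z * h z - 1) \<le> exp (norm ?x) * norm ?x"
      using Taylor_exp_field[of ?x 0] by simp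
    also have "\<dots> \<le> 3 * (2 * M / 4 ^ q)"
    proof (rule mult_mono)
      have "exp (norm ?x) \<le> exp 1" using x1 by simp
      then show "exp (norm ?x) \<le> 3" using exp_le by linarith
    qed (use x in auto)
    also have "\<dots> = 6 * M * (1 / 4 ^ q)" by simp
    also have "\<dots> \<le> 6 * M * exp (- (b * psi n))"
    proof (intro mult_left_mono)
      \<comment> \<open>By \<open>w_linear\<close>, \<open>psi (4 * q)\<close> is at most
        \<open>4 * q * L\<close>; the second condition on \<open>b\<close> turns this into
        \<open>b * psi n \<le> q * ln 4\<close>, so the dilation error is also controlled by
        \<open>psi\<close>.\<close>
      have "b * psi n \<le> ln 2 / (2 * L) * (L * real n)"
        using b(2) w_linear[OF n1] psip L_pos by (intro mult_mono) (auto simp: psi_def)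
      also have "\<dots> = real q * ln 4"
      proof -
        have "ln (4::real) = 2 * ln 2" using ln_realpow[of 2 2] by simp
        then show ?thesis using L_pos by (simp add: n_def)
      qed
      finally have "exp (- (real q * ln 4)) \<le> exp (- (b * psi n))" by simp
      moreover have "exp (- (real q * ln 4)) = 1 / 4 ^ q"
        by (simp add: exp_minus exp_of_nat_mult divide_inverse)
      ultimately show "1 / 4 ^ q \<le> exp (- (b * psi n))" by simp
    qed (use M0 in simp)
    also have "\<dots> \<le> (2 + 6 * M) * exp ((s - b) * psi n)"
      using M0 s psip by (intro mult_mono) (auto simp: algebra_simps)
    finally have "norm (singular_inner \<nu> z * h z - 1) \<le> (2 + 6 * M) * exp ((s - b) * psi n)" .
    then have "w (1 - norm z) * norm (singular_inner \<nu> z * h z - 1) \<le> 1 * ((2 + 6 * M) * exp ((s - b) * psi n))"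
      using w_disc[OF z] by (intro mult_mono) auto
    then show ?thesis by simp
  qed
  show ?thesis
  proof (rule that[of h])
    show "h \<in> H_infinity" unfolding H_infinity_iff using hol hle by (intro conjI exI[of _ "exp (s * psi n)"]) auto
  qed (use hle main in \<open>auto simp: n_def\<close>)
qed

text \<open>The approximate inverses of the removed parts are multiplied. Before step
  \<open>k\<close> the partial product is at most \<open>exp (s * psi (n k))\<close>, and the new
  factor adds a weighted error of at most \<open>C * exp ((s - b) * psi (n k))\<close>. With
  \<open>s = b / 4\<close> the increments are dominated by a geometric series, and the remaining
  mass is handled by \<open>small_mass\<close>.\<close>

lemma singular_cyclic:
  assumes \<mu>: "circle_finite \<mu>" and nc: "\<And>E. finite_entropy w E \<Longrightarrow> emeasure \<mu> E = 0" and e: "e > 0"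
  obtains h where "h \<in> H_infinity" "\<And>z. norm z < 1 \<Longrightarrow> w (1 - norm z) * norm (1 - h z * singular_inner \<mu> z) \<le> e"
proof -
  interpret finite_measure \<mu> using circle_finiteD[OF \<mu>] by simp
  define M where "M = measure \<mu> unit_circle"
  have M0: "M \<ge> 0" by (simp add: M_def)
  define b where "b = min (1 / c\<^sup>2) (ln 2 / (2 * L))"
  have b: "b > 0" "b \<le> 1 / c\<^sup>2" "b \<le> ln 2 / (2 * L)" using c_ge_1 L_pos by (auto simp: b_def)
  define s where "s = b / 4"
  have s: "s > 0" using b by (simp add: s_def)
  define C where "C = 2 + 6 * M"
  have C: "C > 0" using M0 by (simp add: C_def)
  \<comment> \<open>With ratio at most 1/2 the geometric series is at most 2; the other bound then
    makes the total error \<open>2 * C * x\<close> at most \<open>e / 2\<close>.\<close>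
  define x0 where "x0 = min (1/2) (e / (4 * C))"
  have x0: "x0 > 0" using e C by (simp add: x0_def)
  obtain N1 where N1: "\<And>n. n \<ge> N1 \<Longrightarrow> - ln x0 * 2 / b < psi n" using psi_unbounded by blast
  obtain N2 where N2: "2 * M < 4 ^ N2" using real_arch_pow[of 4 "2 * M"] by auto
  \<comment> \<open>\<open>N1\<close> brings the ratio \<open>x\<close> below \<open>x0\<close>, and
    \<open>N2\<close> supplies the condition \<open>2 * M \<le> 4 ^ q\<close> of
    \<open>one_step_inverse\<close>.\<close>
  define q where "q = max 1 (max N1 N2)"
  have q: "q \<ge> 1" "q \<ge> N1" "q \<ge> N2" by (auto simp: q_def)
  have "4 * q \<ge> 1" using q by simp
  then obtain n where n: "n 0 = 4 * q" "\<And>k. 4 * q dvd n k" "\<And>k. 4 * q \<le> n k"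
    "\<And>k. 2 * psi (n k) \<le> psi (n (Suc k))" "\<And>k. psi (n (Suc k)) \<le> 2 * c * psi (n k)"
    using scale_sequence by blast
  have n1: "1 \<le> n k" for k using n(3)[of k] q by simp
  have psip: "psi (n k) > 0" for k by (rule psi_pos[OF n1])
  define x where "x = exp (- (b / 2 * psi (n 0)))"
  have x: "0 < x" "x \<le> x0"
  proof -
    have "- ln x0 * 2 / b < psi (n 0)" unfolding n(1) using q by (intro N1) auto
    then have "- ln x0 < b / 2 * psi (n 0)" using b by (simp add: field_simps)
    then have "exp (- (b / 2 * psi (n 0))) \<le> exp (ln x0)" by simp
    then show "x \<le> x0" using x0 by (simp add: x_def)
  qed (simp add: x_def)
  define a where "a = (\<lambda>k. (s / 64) * psi (n k) / 2 ^ n k)"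
  have ap: "a k > 0" for k using s psip by (simp add: a_def)
  let ?\<rho> = "grating \<mu> n a"
  note gb = grating_bounds[OF \<mu>, of a _ n, OF ap] and gi = grating_integrable[OF \<mu>, of a n, OF ap]
    and gS = grating_Suc_le[OF \<mu>, of a _ n, OF ap] and gst = grating_step(1)[OF \<mu>, of a _ n, OF ap]
  have r0: "(\<lambda>k. \<integral>\<xi>. ?\<rho> k \<xi> \<partial>\<mu>) \<longlonglongrightarrow> 0"
    unfolding a_def by (rule grating_mass_tendsto_0[where n = n and b = "s / 64", OF \<mu> nc _ n1 n(4) n(5)]) (use s in auto)
  \<comment> \<open>\<open>\<nu> k\<close> is the mass removed by step \<open>k\<close> and
    \<open>\<tau> k\<close> the mass present before it, so that \<open>\<tau> k\<close> is the sum
    of \<open>\<nu> k\<close> and \<open>\<tau> (Suc k)\<close>.\<close>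
  define \<nu> where "\<nu> k = density \<mu> (\<lambda>\<xi>. ennreal (?\<rho> k \<xi> - ?\<rho> (Suc k) \<xi>))" for k
  define \<tau> where "\<tau> k = density \<mu> (\<lambda>\<xi>. ennreal (?\<rho> k \<xi>))" for k
  have di: "integrable \<mu> (\<lambda>\<xi>. ?\<rho> k \<xi> - ?\<rho> (Suc k) \<xi>)" for k by (intro Bochner_Integration.integrable_diff gi)
  have d0: "0 \<le> ?\<rho> k \<xi> - ?\<rho> (Suc k) \<xi>" if "norm \<xi> = 1" for k \<xi> using gS[OF that, of k] by simp
  have \<nu>f: "circle_finite (\<nu> k)" for k unfolding \<nu>_def by (rule circle_finite_density[OF \<mu> di d0])
  have \<tau>f: "circle_finite (\<tau> k)" for k unfolding \<tau>_def by (rule circle_finite_density[OF \<mu> gi]) (use gb in blast)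
  have emd: "emeasure (density \<mu> (\<lambda>\<xi>. ennreal (g \<xi>))) A = ennreal (\<integral>\<xi>. g \<xi> * indicator A \<xi> \<partial>\<mu>)"
    if "integrable \<mu> g" "\<And>\<xi>. norm \<xi> = 1 \<Longrightarrow> 0 \<le> g \<xi>" "A \<in> sets circle_borel" for g A
  proof -
    have A: "A \<in> sets \<mu>" using that circle_finiteD[OF \<mu>] by simp
    have "emeasure (density \<mu> (\<lambda>\<xi>. ennreal (g \<xi>))) A = (\<integral>\<^sup>+\<xi>. ennreal (g \<xi>) * indicator A \<xi> \<partial>\<mu>)"
      using that A by (intro emeasure_density) auto
    also have "\<dots> = (\<integral>\<^sup>+\<xi>. ennreal (g \<xi> * indicator A \<xi>) \<partial>\<mu>)"
      by (intro nn_integral_cong) (auto simp: indicator_def)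
    also have "\<dots> = ennreal (\<integral>\<xi>. g \<xi> * indicator A \<xi> \<partial>\<mu>)"
      using that A integrable_real_mult_indicator[OF A that(1)]
      by (intro nn_integral_eq_integral) (auto simp: circle_finiteD[OF \<mu>])
    finally show ?thesis .
  qed
  have md: "measure (density \<mu> (\<lambda>\<xi>. ennreal (g \<xi>))) A = (\<integral>\<xi>. g \<xi> * indicator A \<xi> \<partial>\<mu>)"
    if "integrable \<mu> g" "\<And>\<xi>. norm \<xi> = 1 \<Longrightarrow> 0 \<le> g \<xi>" "A \<in> sets circle_borel" for g A
  proof -
    have "0 \<le> (\<integral>\<xi>. g \<xi> * indicator A \<xi> \<partial>\<mu>)"
      using that(2) by (intro Bochner_Integration.integral_nonneg_AE AE_I2) (auto simp: circle_finiteD[OF \<mu>])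
    then show ?thesis using emd[OF that] by (simp only: measure_def enn2real_ennreal)
  qed
  have UC: "unit_circle \<in> sets circle_borel" by (simp add: sets_circle_borel_iff)
  have intU: "(\<integral>\<xi>. g \<xi> * indicator unit_circle \<xi> \<partial>\<mu>) = (\<integral>\<xi>. g \<xi> \<partial>\<mu>)" for g :: "complex \<Rightarrow> real"
    by (intro Bochner_Integration.integral_cong refl) (simp add: circle_finiteD[OF \<mu>])
  have g1: "?\<rho> k \<xi> \<le> 1" "0 \<le> ?\<rho> k \<xi>" if "norm \<xi> = 1" for k \<xi> using gb[OF that] by auto
  have \<tau>m: "measure (\<tau> k) unit_circle = (\<integral>\<xi>. ?\<rho> k \<xi> \<partial>\<mu>)" for k
    unfolding \<tau>_def using md[of "?\<rho> k", OF gi g1(2) UC] intU[of "?\<rho> k"] by (rule trans)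
  have \<nu>m: "measure (\<nu> k) unit_circle \<le> M" for k
  proof -
    have "measure (\<nu> k) unit_circle = (\<integral>\<xi>. ?\<rho> k \<xi> - ?\<rho> (Suc k) \<xi> \<partial>\<mu>)"
      unfolding \<nu>_def using md[of "\<lambda>\<xi>. ?\<rho> k \<xi> - ?\<rho> (Suc k) \<xi>", OF di d0 UC] intU by (rule trans)
    also have "\<dots> \<le> (\<integral>\<xi>. 1 \<partial>\<mu>)"
    proof (intro integral_mono di)
      fix \<xi> assume "\<xi> \<in> space \<mu>"
      then have "norm \<xi> = 1" by (simp add: circle_finiteD[OF \<mu>])
      from g1(1)[OF this, of k] g1(2)[OF this, of "Suc k"]
      show "?\<rho> k \<xi> - ?\<rho> (Suc k) \<xi> \<le> 1" by linarith
    qed simp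
    finally show ?thesis by (simp add: M_def circle_finiteD[OF \<mu>])
  qed
  have \<nu>arc: "measure (\<nu> k) (circle_arc (n k) j) \<le> (s / 64) * psi (n k) / 2 ^ n k" if j: "j < 2 ^ n k" for k j
  proof -
    have "measure (\<nu> k) (circle_arc (n k) j) = (\<integral>\<xi>. (?\<rho> k \<xi> - ?\<rho> (Suc k) \<xi>) * indicator (circle_arc (n k) j) \<xi> \<partial>\<mu>)"
      unfolding \<nu>_def by (rule md[OF di d0 circle_arc_sets])
    also have "\<dots> \<le> a k" by (rule gst[OF j])
    finally show ?thesis by (simp add: a_def)
  qed
  have "\<exists>h. h \<in> H_infinity \<and> (\<forall>z. norm z < 1 \<longrightarrow> norm (h z) \<le> exp (s * psi (n k)) \<and>
      w (1 - norm z) * norm (singular_inner (\<nu> k) z * h z - 1) \<le> C * exp ((s - b) * psi (n k)))" for k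
  proof -
    obtain q' where q': "n k = 4 * q'" using n(2)[of k] by (metis dvd_def mult.assoc)
    have qq: "q \<le> q'" using n(3)[of k] q' by simp
    have "2 * M \<le> 4 ^ q'"
    proof -
      have "(4::real) ^ N2 \<le> 4 ^ q'" using q qq by (intro power_increasing) auto
      then show ?thesis using N2 by linarith
    qed
    moreover have "q' \<ge> 1" using qq q by simp
    ultimately obtain h where "h \<in> H_infinity" "\<And>z. norm z < 1 \<Longrightarrow> norm (h z) \<le> exp (s * psi (4 * q'))"
      "\<And>z. norm z < 1 \<Longrightarrow> w (1 - norm z) * norm (singular_inner (\<nu> k) z * h z - 1) \<le> (2 + 6 * M) * exp ((s - b) * psi (4 * q'))"
      using one_step_inverse[OF \<nu>f[of k] _ \<nu>m[of k], of q' s b] \<nu>arc[of _ k] s b unfolding q' by blast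
    then show ?thesis unfolding q' C_def by blast
  qed
  then obtain h where h: "\<And>k. h k \<in> H_infinity" "\<And>k z. norm z < 1 \<Longrightarrow> norm (h k z) \<le> exp (s * psi (n k))"
    "\<And>k z. norm z < 1 \<Longrightarrow> w (1 - norm z) * norm (singular_inner (\<nu> k) z * h k z - 1) \<le> C * exp ((s - b) * psi (n k))" by metis
  define P where "P k z = (\<Prod>j<k. singular_inner (\<nu> j) z * h j z)" for k z
  define H where "H k z = (\<Prod>j<k. h j z)" for k z
  have HI: "H k \<in> H_infinity" for k
  proof (induction k)
    case (Suc k)
    have "(\<lambda>z. H k z * h k z) \<in> H_infinity" by (rule H_infinity_mult[OF Suc h(1)])
    then show ?case by (simp add: H_def[abs_def])
  qed (simp add: H_def[abs_def])
  have Pn: "norm (P k z) \<le> exp (s * psi (n k))" if z: "norm z < 1" for k z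
  proof (induction k)
    case 0
    then show ?case using s psip[of 0] by (simp add: P_def)
  next
    case (Suc k)
    have "norm (P (Suc k) z) = norm (P k z) * (norm (singular_inner (\<nu> k) z) * norm (h k z))" by (simp add: P_def norm_mult)
    also have "\<dots> \<le> exp (s * psi (n k)) * (1 * exp (s * psi (n k)))"
      using Suc h(2)[OF z] norm_singular_inner_le[OF \<nu>f z] by (intro mult_mono) auto
    \<comment> \<open>The partial product and the new factor have the same bound, so the doubling of
      \<open>psi\<close> from level to level closes the induction.\<close>
    also have "\<dots> = exp (s * (2 * psi (n k)))" by (simp flip: exp_add)
    also have "\<dots> \<le> exp (s * psi (n (Suc k)))" using n(4)[of k] s by simp
    finally show ?case .
  qed
  have Pd: "w (1 - norm z) * norm (P k z - 1) \<le> (\<Sum>j<k. C * x ^ Suc j)" if z: "norm z < 1" for k z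
  proof (induction k)
    case 0
    then show ?case by (simp add: P_def)
  next
    case (Suc k)
    have "P (Suc k) z - 1 = P k z * (singular_inner (\<nu> k) z * h k z - 1) + (P k z - 1)"
      by (simp add: P_def algebra_simps)
    then have "norm (P (Suc k) z - 1) \<le> norm (P k z) * norm (singular_inner (\<nu> k) z * h k z - 1) + norm (P k z - 1)"
      by (metis norm_mult norm_triangle_ineq)
    then have "w (1 - norm z) * norm (P (Suc k) z - 1) \<le> w (1 - norm z) * (norm (P k z) * norm (singular_inner (\<nu> k) z * h k z - 1) + norm (P k z - 1))"
      using w_disc[OF z] by (intro mult_left_mono) auto
    also have "\<dots> = norm (P k z) * (w (1 - norm z) * norm (singular_inner (\<nu> k) z * h k z - 1)) + w (1 - norm z) * norm (P k z - 1)"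
      by (simp add: algebra_simps)
    also have "norm (P k z) * (w (1 - norm z) * norm (singular_inner (\<nu> k) z * h k z - 1)) \<le> exp (s * psi (n k)) * (C * exp ((s - b) * psi (n k)))"
      by (rule mult_mono[OF Pn[OF z] h(3)[OF z]]) (use w_disc[OF z] in auto)
    \<comment> \<open>The exponents add up to \<open>2 * s - b = - b / 2\<close>.\<close>
    also have "\<dots> = C * exp (- (b / 2 * psi (n k)))" by (simp add: s_def algebra_simps flip: exp_add)
    also have "\<dots> \<le> C * x ^ Suc k"
    proof -
      have "b / 2 * (real (Suc k) * psi (n 0)) \<le> b / 2 * psi (n k)"
        using scale_growth[of n k, OF n(4) psip] b by (intro mult_left_mono) auto
      then have "exp (- (b / 2 * psi (n k))) \<le> exp (real (Suc k) * - (b / 2 * psi (n 0)))" by (simp add: algebra_simps)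
      also have "\<dots> = x ^ Suc k" unfolding x_def by (rule exp_of_nat_mult)
      finally show ?thesis using C by (intro mult_left_mono) auto
    qed
    finally show ?case using Suc by simp
  qed
  have geo: "(\<Sum>j<k. C * x ^ Suc j) \<le> e / 2" for k
  proof -
    have x2: "x \<le> 1/2" "x \<le> e / (4 * C)" using x(2) by (auto simp: x0_def)
    have "(\<Sum>j<k. x ^ j) \<le> (\<Sum>j. x ^ j)" using x x2 by (intro sum_le_suminf summable_geometric) auto
    also have "\<dots> = 1 / (1 - x)" using x x2 by (intro suminf_geometric) auto
    also have "\<dots> \<le> 2" using x2 by (simp add: field_simps)
    finally have "C * x * (\<Sum>j<k. x ^ j) \<le> C * x * 2" using C x by (intro mult_left_mono) auto
    also have "\<dots> \<le> e / 2" using x2(2) C by (simp add: field_simps)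
    finally show ?thesis by (simp add: sum_distrib_left mult.assoc)
  qed
  have fac: "H k z * singular_inner \<mu> z = P k z * singular_inner (\<tau> k) z" if z: "norm z < 1" for k z
  proof -
    have "singular_inner \<mu> z = (\<Prod>j<k. singular_inner (\<nu> j) z) * singular_inner (\<tau> k) z"
    proof (induction k)
      case 0
      have "\<tau> 0 = \<mu>" by (simp add: \<tau>_def density_1)
      then show ?case by simp
    next
      case (Suc k)
      have "singular_inner (\<tau> k) z = singular_inner (\<nu> k) z * singular_inner (\<tau> (Suc k)) z"
      proof (rule singular_inner_add[OF \<tau>f \<nu>f \<tau>f _ z])
        fix A assume A: "A \<in> sets circle_borel"
        have AM: "A \<in> sets \<mu>" using A circle_finiteD[OF \<mu>] by simp
        have "(\<integral>\<xi>. ?\<rho> k \<xi> * indicator A \<xi> \<partial>\<mu>) = (\<integral>\<xi>. (?\<rho> k \<xi> - ?\<rho> (Suc k) \<xi>) * indicator A \<xi> \<partial>\<mu>) + (\<integral>\<xi>. ?\<rho> (Suc k) \<xi> * indicator A \<xi> \<partial>\<mu>)"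
          using integrable_real_mult_indicator[OF AM gi] integrable_real_mult_indicator[OF AM di]
          by (subst Bochner_Integration.integral_add[symmetric]) (auto simp: algebra_simps)
        moreover have "0 \<le> (\<integral>\<xi>. (?\<rho> k \<xi> - ?\<rho> (Suc k) \<xi>) * indicator A \<xi> \<partial>\<mu>)" "0 \<le> (\<integral>\<xi>. ?\<rho> (Suc k) \<xi> * indicator A \<xi> \<partial>\<mu>)"
          using d0 g1 by (auto intro!: Bochner_Integration.integral_nonneg_AE AE_I2 simp: circle_finiteD[OF \<mu>])
        moreover have "emeasure (\<tau> m) A = ennreal (\<integral>\<xi>. ?\<rho> m \<xi> * indicator A \<xi> \<partial>\<mu>)" for m
          unfolding \<tau>_def by (rule emd[OF gi g1(2) A])
        moreover have "emeasure (\<nu> k) A = ennreal (\<integral>\<xi>. (?\<rho> k \<xi> - ?\<rho> (Suc k) \<xi>) * indicator A \<xi> \<partial>\<mu>)"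
          unfolding \<nu>_def by (rule emd[OF di d0 A])
        ultimately show "emeasure (\<tau> k) A = emeasure (\<nu> k) A + emeasure (\<tau> (Suc k)) A"
          by (simp flip: ennreal_plus)
      qed
      then show ?case using Suc by (simp add: mult.assoc)
    qed
    then show ?thesis by (simp add: H_def P_def prod.distrib mult_ac)
  qed
  obtain \<eta> where \<eta>: "\<eta> > 0"
    "\<And>\<nu> z. circle_finite \<nu> \<Longrightarrow> measure \<nu> unit_circle \<le> \<eta> \<Longrightarrow> norm z < 1 \<Longrightarrow> w (1 - norm z) * norm (1 - singular_inner \<nu> z) \<le> e / 2"
    using small_mass[OF half_gt_zero[OF e]] by blast
  have "eventually (\<lambda>k. (\<integral>\<xi>. ?\<rho> k \<xi> \<partial>\<mu>) < \<eta>) sequentially" using r0 \<eta>(1) by (rule order_tendstoD(2))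
  then obtain k where k: "measure (\<tau> k) unit_circle \<le> \<eta>" using eventually_happens \<tau>m by (metis less_imp_le trivial_limit_sequentially)
  show ?thesis
  proof (rule that[OF HI[of k]])
    fix z :: complex assume z: "norm z < 1"
    have "1 - H k z * singular_inner \<mu> z = (1 - singular_inner (\<tau> k) z) - singular_inner (\<tau> k) z * (P k z - 1)"
      unfolding fac[OF z] by (simp add: algebra_simps)
    then have "norm (1 - H k z * singular_inner \<mu> z) \<le> norm (1 - singular_inner (\<tau> k) z) + norm (singular_inner (\<tau> k) z) * norm (P k z - 1)"
      by (metis norm_mult norm_triangle_ineq4)
    also have "\<dots> \<le> norm (1 - singular_inner (\<tau> k) z) + 1 * norm (P k z - 1)"
      using norm_singular_inner_le[OF \<tau>f z] by (intro add_left_mono mult_right_mono) auto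
    finally have "w (1 - norm z) * norm (1 - H k z * singular_inner \<mu> z) \<le> w (1 - norm z) * (norm (1 - singular_inner (\<tau> k) z) + norm (P k z - 1))"
      using w_disc[OF z] by (intro mult_left_mono) auto
    then show "w (1 - norm z) * norm (1 - H k z * singular_inner \<mu> z) \<le> e"
      using \<eta>(2)[OF \<tau>f k z] Pd[OF z, of k] geo[of k] by (simp add: distrib_left)
  qed
qed

end

section \<open>Permanence\<close>

text \<open>\<open>poisson_domination\<close> compares two measures, and the larger one is here the
  singular measure of \<open>h\<close> together with an absolutely continuous error.\<close>

definition sum_measure :: "complex measure \<Rightarrow> complex measure \<Rightarrow> complex measure" where
  "sum_measure \<alpha> \<beta> = measure_of unit_circle (sets circle_borel) (\<lambda>A. emeasure \<alpha> A + emeasure \<beta> A)"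

lemma sum_measure:
  assumes "circle_finite \<alpha>" "circle_finite \<beta>"
  shows "circle_finite (sum_measure \<alpha> \<beta>)"
    "\<And>A. A \<in> sets circle_borel \<Longrightarrow> emeasure (sum_measure \<alpha> \<beta>) A = emeasure \<alpha> A + emeasure \<beta> A"
proof -
  interpret A: finite_measure \<alpha> using circle_finiteD[OF assms(1)] by simp
  interpret B: finite_measure \<beta> using circle_finiteD[OF assms(2)] by simp
  note sa = circle_finiteD(2)[OF assms(1)] and sb = circle_finiteD(2)[OF assms(2)]
  have sig: "sigma_algebra unit_circle (sets circle_borel)" using sets.sigma_algebra_axioms[of circle_borel] by simp
  have s: "sets (sum_measure \<alpha> \<beta>) = sets circle_borel"
    unfolding sum_measure_def using sigma_algebra.sets_measure_of_eq[OF sig] by simp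
  show em: "emeasure (sum_measure \<alpha> \<beta>) A = emeasure \<alpha> A + emeasure \<beta> A" if "A \<in> sets circle_borel" for A
    unfolding sum_measure_def
  proof (rule emeasure_measure_of_sigma[OF sig _ _ that])
    show "positive (sets circle_borel) (\<lambda>A. emeasure \<alpha> A + emeasure \<beta> A)" by (simp add: positive_def)
    show "countably_additive (sets circle_borel) (\<lambda>A. emeasure \<alpha> A + emeasure \<beta> A)"
    proof (rule countably_additiveI)
      fix F :: "nat \<Rightarrow> complex set" assume F: "range F \<subseteq> sets circle_borel" "disjoint_family F"
      then have "(\<Sum>i. emeasure \<alpha> (F i)) = emeasure \<alpha> (\<Union>i. F i)" "(\<Sum>i. emeasure \<beta> (F i)) = emeasure \<beta> (\<Union>i. F i)"
        by (auto intro!: suminf_emeasure simp: sa sb)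
      then show "(\<Sum>i. emeasure \<alpha> (F i) + emeasure \<beta> (F i)) = emeasure \<alpha> (\<Union>i. F i) + emeasure \<beta> (\<Union>i. F i)"
        by (subst suminf_add[symmetric]) auto
    qed
  qed
  have "space (sum_measure \<alpha> \<beta>) = unit_circle" using sets_eq_imp_space_eq[OF s] by simp
  moreover have "unit_circle \<in> sets circle_borel" by (simp add: sets_circle_borel_iff)
  ultimately show "circle_finite (sum_measure \<alpha> \<beta>)"
    unfolding circle_finite_def using s em[of unit_circle] by (auto intro!: finite_measureI simp: A.emeasure_finite B.emeasure_finite)
qed

lemma finite_entropyD:
  assumes "finite_entropy w E"
  shows "closed E" "E \<subseteq> unit_circle" "E \<noteq> {}" "emeasure circle_measure E = 0"
    "integrable circle_measure (\<lambda>\<zeta>. - ln (w (arc_setdist \<zeta> E)))" "E \<in> sets circle_borel"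
  using assms by (auto simp: finite_entropy_def sets_circle_borel_iff)

text \<open>By \<open>poisson_kernel_le\<close> the kernel at a point of \<open>E\<close> is at most
  \<open>2 * (1 - norm z) / (infdist z E)\<^sup>2\<close>, which is at most 2 in this
  region.\<close>

lemma Re_herglotz_off_support:
  assumes \<mu>: "circle_finite \<mu>" and E: "closed E" "E \<subseteq> unit_circle" "E \<noteq> {}"
    and z: "norm z < 1" and far: "1 - norm z \<le> (infdist z E)\<^sup>2"
  shows "Re (herglotz (density \<mu> (indicator E)) z) \<le> 2 * measure \<mu> unit_circle"
proof -
  have ES: "E \<in> sets circle_borel" using E by (simp add: sets_circle_borel_iff)
  note d = measure_density_indicator[OF \<mu> ES]
  interpret finite_measure \<mu> using circle_finiteD[OF \<mu>] by simp
  have pos: "0 < infdist z E"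
    using far z infdist_nonneg[of z E] by (cases "infdist z E = 0") auto
  have pk: "poisson_kernel z \<xi> \<le> 2" if "\<xi> \<in> E" for \<xi>
  proof -
    have \<xi>: "norm \<xi> = 1" using that E by auto
    have "infdist z E \<le> norm (\<xi> - z)" using infdist_le[OF that, of z] by (simp add: dist_norm norm_minus_commute)
    then have "poisson_kernel z \<xi> \<le> 2 * (1 - norm z) / (infdist z E)\<^sup>2" by (rule poisson_kernel_le[OF z \<xi> pos])
    also have "\<dots> \<le> 2" using far pos by (simp add: divide_le_eq)
    finally show ?thesis .
  qed
  have "AE \<xi> in density \<mu> (indicator E). \<xi> \<in> E"
    using ES by (subst AE_density)
      (auto simp: circle_finiteD[OF \<mu>] borel_measurable_circle_finite[OF \<mu>] indicator_def intro!: AE_I2 split: if_splits)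
  then have "(\<integral>\<xi>. poisson_kernel z \<xi> \<partial>density \<mu> (indicator E)) \<le> (\<integral>\<xi>. 2 \<partial>density \<mu> (indicator E))"
    using pk z integrable_poisson_kernel[OF d(1)] integrable_continuous_circle[OF d(1), of "\<lambda>_. 2::real"]
    by (intro integral_mono_AE) (auto elim: eventually_mono)
  also have "\<dots> = 2 * measure (density \<mu> (indicator E)) unit_circle" by (simp add: circle_finiteD[OF d(1)] circle_finiteD[OF \<mu>])
  also have "measure (density \<mu> (indicator E)) unit_circle \<le> measure \<mu> unit_circle"
  proof -
    have "unit_circle \<in> sets circle_borel" by (simp add: sets_circle_borel_iff)
    then have "emeasure (density \<mu> (indicator E)) unit_circle \<le> emeasure \<mu> unit_circle"
      using d(2) circle_finiteD[OF \<mu>] by (auto intro!: emeasure_mono)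
    then show ?thesis by (simp add: measure_def enn2real_mono emeasure_finite less_top[symmetric])
  qed
  finally show ?thesis using Re_herglotz[OF d(1) z] by simp
qed

context entropy_weight
begin

text \<open>Near \<open>E\<close>, that is for \<open>dist(z, E)\<^sup>2 \<le> 1 - |z|\<close>, the Poisson integral of the
  entropy density dominates the logarithm of the weight; the comparability of \<open>w(t)\<close> and
  \<open>w(t\<^sup>2)\<close> enters here.\<close>

lemma entropy_poisson_bound:
  assumes E: "finite_entropy w E" and z: "norm z < 1" and near: "(infdist z E)\<^sup>2 \<le> 1 - norm z"
  shows "- ln (w (1 - norm z)) \<le> 4 * pi * c * Re (herglotz_real (\<lambda>\<zeta>. - ln (w (arc_setdist \<zeta> E))) z)"
proof -
  note Ef = finite_entropyD[OF E]
  define d where "d = 1 - norm z"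
  have d: "0 < d" "d \<le> 1" using z by (auto simp: d_def)
  define \<zeta>0 where "\<zeta>0 = (if z = 0 then 1 else z / of_real (norm z))"
  have \<zeta>0: "norm \<zeta>0 = 1" by (simp add: \<zeta>0_def norm_divide)
  have "z = of_real (norm z) * \<zeta>0" by (simp add: \<zeta>0_def)
  then have "norm (\<zeta>0 - z) = norm ((1 - of_real (norm z)) * \<zeta>0)" by (metis left_diff_distrib mult_1)
  also have "\<dots> = d" using \<zeta>0 z by (simp add: norm_mult d_def) (metis abs_of_pos diff_gt_0_iff_gt norm_of_real of_real_1 of_real_diff)
  finally have z0: "norm (\<zeta>0 - z) = d" .
  \<comment> \<open>The part of the circle within distance \<open>d\<close> of the radial projection
    of \<open>z\<close>. Its measure is at least \<open>d / pi\<close>, the Poisson kernel on it is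
    at least \<open>1 / (4 * d)\<close>, and off \<open>E\<close> the entropy density is at least
    \<open>l / c\<close>; the product gives the constant \<open>4 * pi * c\<close>.\<close>
  define J where "J = cball \<zeta>0 d \<inter> unit_circle"
  have JS: "J \<in> sets circle_borel" unfolding J_def by (rule circle_ball_borel)
  have mJ: "d / pi \<le> measure circle_measure J"
    using emeasure_circle_cball_ge[OF \<zeta>0, of d] d pi_gt3 by (simp add: J_def circle.emeasure_eq_measure)
  define l where "l = - ln (w d)"
  have l0: "l \<ge> 0" unfolding l_def using w_bounds[of d] w_pos[of d] d by simp
  let ?v = "\<lambda>\<zeta>. - ln (w (arc_setdist \<zeta> E))"
  have sq: "0 < sqrt d" "sqrt d \<le> 1" "d \<le> sqrt d" using d by (auto intro: real_le_rsqrt simp: power2_eq_square mult_left_le)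
  \<comment> \<open>\<open>w_square\<close> is applied at \<open>sqrt d\<close>. It excludes the
    argument 1, so the centre of the disc is treated separately.\<close>
  have lsq: "l / c \<le> - ln (w (sqrt d))"
  proof (cases "d = 1")
    case True
    have "l / c \<le> l" using mult_left_mono[OF c_ge_1 l0] c_ge_1 by (simp add: divide_le_eq)
    then show ?thesis using True by (simp add: l_def)
  next
    case False
    then have "sqrt d < 1" using d by simp
    from w_square[OF sq(1) this] show ?thesis using d c_ge_1 by (simp add: l_def field_simps)
  qed
  have vJ: "l / c \<le> ?v \<zeta>" if \<zeta>: "\<zeta> \<in> J" "\<zeta> \<notin> E" for \<zeta>
  proof -
    have \<zeta>1: "norm \<zeta> = 1" "norm (\<zeta> - \<zeta>0) \<le> d" using \<zeta> by (auto simp: J_def dist_norm norm_minus_commute)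
    have "norm (\<zeta> - z) \<le> 2 * d" using norm_triangle_ineq[of "\<zeta> - \<zeta>0" "\<zeta>0 - z"] \<zeta>1(2) z0 by simp
    moreover have "infdist \<zeta> E \<le> infdist z E + dist \<zeta> z" by (rule infdist_triangle)
    moreover have "infdist z E \<le> sqrt d" using near by (intro real_le_rsqrt) (simp add: d_def)
    \<comment> \<open>Here \<open>2 * d + sqrt d \<le> 3 * sqrt d\<close>. The factor 3 is below
      \<open>pi\<close> and disappears on passing to \<open>arc_setdist\<close>, so the weight is
      compared at \<open>sqrt d\<close> itself.\<close>
    ultimately have "infdist \<zeta> E \<le> 3 * sqrt d" using sq by (simp add: dist_norm)
    then have "infdist \<zeta> E / pi \<le> sqrt d"
    proof -
      assume "infdist \<zeta> E \<le> 3 * sqrt d"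
      also have "3 * sqrt d \<le> pi * sqrt d" using pi_gt3 sq by (intro mult_right_mono) auto
      finally show ?thesis by (simp add: field_simps)
    qed
    then have 1: "arc_setdist \<zeta> E \<le> sqrt d" using arc_setdist_eq(3)[OF Ef(1-3) \<zeta>1(1)] by linarith
    have "0 < infdist \<zeta> E" using in_closed_iff_infdist_zero[OF Ef(1,3), of \<zeta>] \<zeta>(2) infdist_nonneg[of \<zeta> E] by linarith
    then have "0 < infdist \<zeta> E / (2 * pi)" by simp
    then have 2: "0 < arc_setdist \<zeta> E" using arc_setdist_eq(2)[OF Ef(1-3) \<zeta>1(1)] by linarith
    have 3: "arc_setdist \<zeta> E \<le> 1" using 1 sq(2) by linarith
    have "w (arc_setdist \<zeta> E) \<le> w (sqrt d)" using 1 2 sq by (intro w_le) auto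
    moreover have "0 < w (arc_setdist \<zeta> E)" using 2 3 by (intro w_pos) auto
    ultimately have "ln (w (arc_setdist \<zeta> E)) \<le> ln (w (sqrt d))" using w_pos[OF sq(1,2)] by simp
    then show ?thesis using lsq by linarith
  qed
  have pkJ: "1 / (4 * d) \<le> poisson_kernel z \<zeta>" if \<zeta>: "\<zeta> \<in> J" for \<zeta>
  proof -
    have \<zeta>1: "norm \<zeta> = 1" "norm (\<zeta> - \<zeta>0) \<le> d" using \<zeta> by (auto simp: J_def dist_norm norm_minus_commute)
    have "norm (\<zeta> - z) \<le> 2 * d" using norm_triangle_ineq[of "\<zeta> - \<zeta>0" "\<zeta>0 - z"] \<zeta>1(2) z0 by simp
    then have "(norm (\<zeta> - z))\<^sup>2 \<le> (2 * d)\<^sup>2" by (intro power_mono) auto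
    moreover have "0 < (norm (\<zeta> - z))\<^sup>2" using circle_disc_dist[OF \<zeta>1(1) z] by (auto simp del: diff_gt_0_iff_gt)
    moreover have "d \<le> 1 - (norm z)\<^sup>2"
      using z mult_left_mono[of "norm z" 1 "norm z"] by (simp add: d_def power2_eq_square)
    ultimately have "d / (2 * d)\<^sup>2 \<le> poisson_kernel z \<zeta>"
      unfolding poisson_kernel_def using d by (intro frac_le) auto
    then show ?thesis using d by (simp add: power2_eq_square)
  qed
  have vi: "integrable circle_measure ?v" by (rule Ef(5))
  have ae: "AE \<zeta> in circle_measure. \<zeta> \<notin> E"
    using Ef(4,6) by (intro AE_not_in) (auto simp: null_sets_def)
  have v0: "0 \<le> ?v \<zeta>" if "norm \<zeta> = 1" for \<zeta>
  proof -
    have "0 \<le> w (arc_setdist \<zeta> E)" "w (arc_setdist \<zeta> E) \<le> 1"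
      using w_bounds arc_setdist_range[OF Ef(1-3) that] by auto
    then show ?thesis by (cases "w (arc_setdist \<zeta> E) = 0") auto
  qed
  have "l / c * (1 / (4 * pi)) = 1 / (4 * d) * (l / c) * (d / pi)" using d by simp
  also have "\<dots> \<le> 1 / (4 * d) * (l / c) * measure circle_measure J"
    using mJ d l0 c_ge_1 by (intro mult_left_mono) auto
  also have "\<dots> = (\<integral>\<zeta>. 1 / (4 * d) * (l / c) * indicator J \<zeta> \<partial>circle_measure)"
    using JS by (simp add: J_def Int_absorb2)
  also have "\<dots> \<le> (\<integral>\<zeta>. poisson_kernel z \<zeta> * ?v \<zeta> \<partial>circle_measure)"
  proof (rule integral_mono_AE)
    show "integrable circle_measure (\<lambda>\<zeta>. 1 / (4 * d) * (l / c) * indicator J \<zeta>)"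
      using JS by (intro integrable_mult_right integrable_real_indicator) (auto simp: circle.emeasure_eq_measure)
    show "integrable circle_measure (\<lambda>\<zeta>. poisson_kernel z \<zeta> * ?v \<zeta>)" by (rule Re_herglotz_real(2)[OF vi z])
    show "AE \<zeta> in circle_measure. 1 / (4 * d) * (l / c) * indicator J \<zeta> \<le> poisson_kernel z \<zeta> * ?v \<zeta>"
      using ae AE_space
    proof eventually_elim
      case (elim \<zeta>)
      then have \<zeta>1: "norm \<zeta> = 1" by simp
      show ?case
      proof (cases "\<zeta> \<in> J")
        case True
        have "1 / (4 * d) * (l / c) \<le> poisson_kernel z \<zeta> * ?v \<zeta>"
          using pkJ[OF True] vJ[OF True elim(1)] d l0 c_ge_1 by (intro mult_mono) (auto intro: order_trans[rotated])
        then show ?thesis using True by simp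
      next
        case False
        have "0 \<le> poisson_kernel z \<zeta> * ?v \<zeta>" using poisson_kernel_pos[OF \<zeta>1 z] v0[OF \<zeta>1] by (intro mult_nonneg_nonneg) auto
        then show ?thesis using False by simp
      qed
    qed
  qed
  also have "\<dots> = Re (herglotz_real ?v z)" by (rule Re_herglotz_real(1)[OF vi z, symmetric])
  finally have "l / c * (1 / (4 * pi)) \<le> Re (herglotz_real ?v z)" .
  then have "l \<le> 4 * pi * c * Re (herglotz_real ?v z)" using c_ge_1 by (simp add: field_simps)
  then show ?thesis by (simp add: l_def d_def)
qed

text \<open>Maximum principle on the region \<open>dist(z, E)\<^sup>2 \<le> 1 - |z|\<close>. The power \<open>G\<^sup>\<epsilon>\<close> of the entropy
  outer function \<open>G\<close> removes the part of the boundary on the circle.\<close>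

lemma entropy_max_principle:
  assumes E: "finite_entropy w E" and f: "f holomorphic_on unit_disc" and B: "\<And>z. norm z < 1 \<Longrightarrow> norm (f z) \<le> B"
    and M: "M > 0" "\<And>z. norm z < 1 \<Longrightarrow> (infdist z E)\<^sup>2 = 1 - norm z \<Longrightarrow> norm (f z) \<le> M"
    and z: "norm z < 1" "(infdist z E)\<^sup>2 \<le> 1 - norm z"
  shows "norm (f z) \<le> M"
proof -
  let ?V = "herglotz_real (\<lambda>\<zeta>. - ln (w (arc_setdist \<zeta> E)))"
  note Ef = finite_entropyD[OF E]
  define K where "K = 4 * pi * c"
  have K: "K > 0" using c_ge_1 by (simp add: K_def)
  have V0: "0 \<le> Re (?V u)" if u: "norm u < 1" for u
  proof -
    have "Re (herglotz_real (\<lambda>_. 0) u) \<le> Re (?V u)"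
    proof (rule Re_herglotz_real_mono[OF _ Ef(5) u])
      fix \<zeta> :: complex assume "norm \<zeta> = 1"
      then have "0 \<le> w (arc_setdist \<zeta> E)" "w (arc_setdist \<zeta> E) \<le> 1"
        using w_bounds arc_setdist_range[OF Ef(1-3)] by auto
      then show "0 \<le> - ln (w (arc_setdist \<zeta> E))" by (cases "w (arc_setdist \<zeta> E) = 0") auto
    qed simp
    then show ?thesis by (simp add: herglotz_real_def)
  qed
  have eps: "norm (f z) * exp (- (e * K * Re (?V z))) \<le> M" if e: "e > 0" for e
  proof -
    define F where "F u = f u * exp (- (of_real (e * K) * ?V u))" for u
    have Fn: "norm (F u) = norm (f u) * exp (- (e * K * Re (?V u)))" for u
      by (simp add: F_def norm_mult)
    have Fh: "F holomorphic_on unit_disc" unfolding F_def by (intro holomorphic_intros f herglotz_real_holomorphic Ef(5))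
    \<comment> \<open>Damping by \<open>exp (- (e * T))\<close> reduces the bound
      \<open>max B M\<close> to \<open>M\<close>.\<close>
    define T where "T = ln (max B M / M) / e"
    obtain \<delta> where \<delta>: "0 < \<delta>" "\<delta> < 1" "\<And>t. 0 \<le> t \<Longrightarrow> t \<le> \<delta> \<Longrightarrow> w t < exp (- T)" using w_small[of "exp (- T)"] by auto
    \<comment> \<open>On the circle of radius \<open>1 - \<eta>\<close> the weight is below
      \<open>exp (- T)\<close>, which makes \<open>K * Re (?V u)\<close> at least \<open>T\<close>;
      the minimum keeps \<open>z\<close> inside the truncated region.\<close>
    define \<eta> where "\<eta> = min \<delta> (1 - norm z)"
    have \<eta>: "0 < \<eta>" "\<eta> \<le> \<delta>" "\<eta> < 1 \<or> norm z = 0" "\<eta> \<le> 1 - norm z" using \<delta> z by (auto simp: \<eta>_def)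
    define S where "S = {u. norm u \<le> 1 - \<eta> \<and> (infdist u E)\<^sup>2 \<le> 1 - norm u}"
    have Sc: "closed S" unfolding S_def by (intro closed_Collect_conj closed_Collect_le continuous_intros)
    have SD: "S \<subseteq> unit_disc" using \<eta> by (auto simp: S_def)
    have Sb: "bounded S" by (rule bounded_subset[of unit_disc]) (use SD in auto)
    have "norm (F z) \<le> M"
    proof (rule maximum_modulus_frontier[of F S])
      show "F holomorphic_on interior S" by (rule holomorphic_on_subset[OF Fh]) (use SD interior_subset in blast)
      show "continuous_on (closure S) F"
        using continuous_on_subset[OF holomorphic_on_imp_continuous_on[OF Fh] SD] Sc by simp
      show "bounded S" by (rule Sb)
      show "z \<in> S" using z \<eta> by (auto simp: S_def)
      fix u assume u: "u \<in> frontier S"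
      have "u \<in> S" using u Sc by (simp add: frontier_def)
      then have u1: "norm u < 1" "norm u \<le> 1 - \<eta>" "(infdist u E)\<^sup>2 \<le> 1 - norm u" using SD by (auto simp: S_def)
      have eV: "exp (- (e * K * Re (?V u))) \<le> 1" using e K V0[OF u1(1)] by simp
      \<comment> \<open>The frontier of \<open>S\<close> consists of points of the curve, where the
        hypothesis applies, and of points with \<open>norm u = 1 - \<eta>\<close>: where both
        inequalities are strict the point is interior.\<close>
      show "norm (F u) \<le> M"
      proof (cases "(infdist u E)\<^sup>2 = 1 - norm u")
        case True
        have "norm (F u) \<le> norm (f u) * 1" unfolding Fn using eV by (intro mult_left_mono) auto
        then show ?thesis using M(2)[OF u1(1) True] by simp
      next
        case False
        have "norm u = 1 - \<eta>"
        proof (rule ccontr)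
          assume "norm u \<noteq> 1 - \<eta>"
          then have "u \<in> {u. norm u < 1 - \<eta>} \<inter> {u. (infdist u E)\<^sup>2 < 1 - norm u}" using u1 False by auto
          moreover have "open ({u. norm u < 1 - \<eta>} \<inter> {u::complex. (infdist u E)\<^sup>2 < 1 - norm u})"
            by (intro open_Int open_Collect_less continuous_intros)
          moreover have "{u. norm u < 1 - \<eta>} \<inter> {u. (infdist u E)\<^sup>2 < 1 - norm u} \<subseteq> S" by (auto simp: S_def)
          ultimately have "u \<in> interior S" using interior_maximal by blast
          then show False using u by (simp add: frontier_def)
        qed
        then have "1 - norm u \<le> \<delta>" using \<eta> by simp
        then have "w (1 - norm u) < exp (- T)" using u1 by (intro \<delta>(3)) auto
        then have "ln (w (1 - norm u)) < - T" using w_disc[OF u1(1)] by (metis ln_exp ln_less_cancel_iff exp_gt_zero)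
        then have "T \<le> K * Re (?V u)" using entropy_poisson_bound[OF E u1(1,3)] by (simp add: K_def)
        then have "e * T \<le> e * K * Re (?V u)" using e by (simp add: mult.assoc)
        then have "exp (- (e * K * Re (?V u))) \<le> exp (- (e * T))" by simp
        also have "e * T = ln (max B M / M)" using e by (simp add: T_def)
        also have "exp (- ln (max B M / M)) = M / max B M" using M by (simp add: exp_minus max_def)
        finally have "norm (F u) \<le> max B M * (M / max B M)"
          unfolding Fn using B[OF u1(1)] M(1) by (intro mult_mono) auto
        then show ?thesis using M(1) by (simp add: max_def split: if_splits)
      qed
    qed
    then show ?thesis by (simp add: Fn)
  qed
  \<comment> \<open>As \<open>e\<close> tends to 0 the damping factor at the fixed point
    \<open>z\<close> tends to 1.\<close>
  have "((\<lambda>e. norm (f z) * exp (- (e * K * Re (?V z)))) \<longlongrightarrow> norm (f z) * exp (- (0 * K * Re (?V z)))) (at_right 0)"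
    by (intro tendsto_intros)
  moreover have "eventually (\<lambda>e. norm (f z) * exp (- (e * K * Re (?V z))) \<le> M) (at_right 0)"
    using eventually_at_right_less[of 0] by eventually_elim (rule eps)
  ultimately show ?thesis
    using tendsto_upperbound[of "\<lambda>e. norm (f z) * exp (- (e * K * Re (?V z)))" "norm (f z) * exp (- (0 * K * Re (?V z)))" "at_right 0" M] by simp
qed

text \<open>The order of the quantifiers is the point: \<open>M\<close> is chosen before
  \<open>e\<close>. The multipliers \<open>p\<close> may be unbounded as \<open>e\<close> shrinks,
  but the weighted products stay within distance 1 of \<open>h\<close>.\<close>

lemma generated_pointwise_bound:
  assumes \<Theta>: "\<Theta> \<in> growth_space w" and h: "h \<in> generated_subspace w \<Theta>"
  obtains M where "M > 0"
    "\<And>e. e > 0 \<Longrightarrow> \<exists>p\<in>H_infinity. \<forall>z. norm z < 1 \<longrightarrow> w (1 - norm z) * norm (p z * \<Theta> z) \<le> M \<and> w (1 - norm z) * norm (h z - p z * \<Theta> z) \<le> e"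
proof -
  have hG: "h \<in> growth_space w" using h closed_shift_invariant_generated(3)[OF \<Theta>] by blast
  obtain M where M: "M > 0" "\<And>z. norm z < 1 \<Longrightarrow> w (1 - norm z) * norm (h z) \<le> M" using growth_space_bounded[OF hG] by blast
  show ?thesis
  proof (rule that[of "M + 1"])
    fix e :: real assume "e > 0"
    then have e1: "min e 1 > 0" by simp
    obtain p where p: "p \<in> H_infinity" "\<And>z. norm z < 1 \<Longrightarrow> w (1 - norm z) * norm (h z - p z * \<Theta> z) \<le> min e 1"
      using generated_subspace_approx[OF \<Theta> h e1] by blast
    show "\<exists>p\<in>H_infinity. \<forall>z. norm z < 1 \<longrightarrow> w (1 - norm z) * norm (p z * \<Theta> z) \<le> M + 1 \<and> w (1 - norm z) * norm (h z - p z * \<Theta> z) \<le> e"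
    proof (intro bexI[OF _ p(1)] allI impI conjI)
      fix z :: complex assume z: "norm z < 1"
      have "norm (p z * \<Theta> z) \<le> norm (h z) + norm (h z - p z * \<Theta> z)"
        using norm_triangle_ineq4[of "h z" "h z - p z * \<Theta> z"] by simp
      then have "w (1 - norm z) * norm (p z * \<Theta> z) \<le> w (1 - norm z) * (norm (h z) + norm (h z - p z * \<Theta> z))"
        using w_disc[OF z] by (intro mult_left_mono) auto
      also have "\<dots> \<le> M + 1" using M(2)[OF z] p(2)[OF z] by (simp add: distrib_left)
      finally show "w (1 - norm z) * norm (p z * \<Theta> z) \<le> M + 1" .
      show "w (1 - norm z) * norm (h z - p z * \<Theta> z) \<le> e" using p(2)[OF z] by simp
    qed
  qed (use M in simp)
qed

lemma singular_permanence:
  assumes E: "finite_entropy w E" and \<mu>: "circle_finite \<mu>" and b: "b \<in> H_infinity" "\<And>z. norm z < 1 \<Longrightarrow> norm (b z) \<le> 1"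
    and h: "h \<in> generated_subspace w (\<lambda>z. b z * singular_inner \<mu> z)"
    and \<sigma>: "circle_finite \<sigma>" and bs: "blaschke_sequence I \<Lambda>" and c0: "norm c0 = 1" and u: "integrable circle_measure u"
    and h_eq: "\<And>z. norm z < 1 \<Longrightarrow> h z = exp (herglotz_real u z) * singular_inner \<sigma> z * blaschke_product c0 I \<Lambda> z"
    and A: "A \<in> sets circle_borel"
  shows "emeasure \<mu> (A \<inter> E) \<le> emeasure \<sigma> (A \<inter> E)"
proof -
  note Ef = finite_entropyD[OF E]
  let ?v = "\<lambda>\<zeta>. - ln (w (arc_setdist \<zeta> E))"
  let ?V = "herglotz_real ?v"
  define K where "K = 4 * pi * c"
  have K: "K > 0" using c_ge_1 by (simp add: K_def)
  have ES': "unit_circle - E \<in> sets circle_borel" using Ef(6) by (metis sets.compl_sets space_circle_borel)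
  let ?S = "singular_inner (density \<mu> (indicator E))" and ?S' = "singular_inner (density \<mu> (indicator (unit_circle - E)))"
  note d1 = measure_density_indicator[OF \<mu> Ef(6)] and d2 = measure_density_indicator[OF \<mu> ES']
  have SS: "singular_inner \<mu> z = ?S z * ?S' z" if "norm z < 1" for z by (rule singular_inner_split[OF \<mu> Ef(6) that])
  define m where "m = measure \<mu> unit_circle"
  have m0: "m \<ge> 0" by (simp add: m_def)
  have v0: "0 \<le> ?v \<zeta>" if "norm \<zeta> = 1" for \<zeta>
  proof -
    have "0 \<le> w (arc_setdist \<zeta> E)" "w (arc_setdist \<zeta> E) \<le> 1"
      using w_bounds arc_setdist_range[OF Ef(1-3) that] by auto
    then show ?thesis by (cases "w (arc_setdist \<zeta> E) = 0") auto
  qed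
  have V0: "0 \<le> Re (?V z)" if z: "norm z < 1" for z
    using Re_herglotz_real_mono[OF _ Ef(5) z, of "\<lambda>_. 0"] v0 by (simp add: herglotz_real_def)
  have far: "exp (- (2 * m)) \<le> norm (?S z)" if "norm z < 1" "1 - norm z \<le> (infdist z E)\<^sup>2" for z
    using Re_herglotz_off_support[OF \<mu> Ef(1-3) that] by (simp add: norm_singular_inner m_def)
  have SH: "singular_inner \<mu> \<in> H_infinity"
    unfolding H_infinity_iff using singular_inner_holomorphic[OF \<mu>] norm_singular_inner_le[OF \<mu>] by (auto intro!: exI[of _ 1])
  have TG: "(\<lambda>z. b z * singular_inner \<mu> z) \<in> growth_space w" by (intro H_infinity_subset H_infinity_mult b SH)
  have Gw: "exp (- (K * Re (?V z))) \<le> w (1 - norm z)" if z: "norm z < 1" "(infdist z E)\<^sup>2 \<le> 1 - norm z" for z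
  proof -
    have "- (K * Re (?V z)) \<le> ln (w (1 - norm z))" using entropy_poisson_bound[OF E z] by (simp add: K_def)
    then have "exp (- (K * Re (?V z))) \<le> exp (ln (w (1 - norm z)))" by simp
    then show ?thesis using w_disc[OF z(1)] by simp
  qed
  obtain M where M: "M > 0"
    "\<And>e. e > 0 \<Longrightarrow> \<exists>p\<in>H_infinity. \<forall>z. norm z < 1 \<longrightarrow> w (1 - norm z) * norm (p z * (b z * singular_inner \<mu> z)) \<le> M \<and>
        w (1 - norm z) * norm (h z - p z * (b z * singular_inner \<mu> z)) \<le> e"
    using generated_pointwise_bound[OF TG h] by blast
  define M' where "M' = M * exp (2 * m)"
  have M': "M' > 0" using M by (simp add: M'_def)
  have near: "exp (- (K * Re (?V z))) * norm (h z) \<le> M' * norm (?S z)" if z: "norm z < 1" "(infdist z E)\<^sup>2 \<le> 1 - norm z" for z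
  proof (rule field_le_epsilon)
    fix e :: real assume e: "e > 0"
    let ?w = "w (1 - norm z)"
    obtain p where p: "p \<in> H_infinity"
      "\<And>z. norm z < 1 \<Longrightarrow> w (1 - norm z) * norm (p z * (b z * singular_inner \<mu> z)) \<le> M"
      "\<And>z. norm z < 1 \<Longrightarrow> w (1 - norm z) * norm (h z - p z * (b z * singular_inner \<mu> z)) \<le> e"
      using M(2)[OF e] by blast
    obtain B where B: "\<And>z. norm z < 1 \<Longrightarrow> norm (p z) \<le> B" and ph: "p holomorphic_on unit_disc" and B0: "B > 0"
      using p(1) unfolding H_infinity_iff by blast
    \<comment> \<open>The approximant, damped by the entropy outer function and divided by
      \<open>?S\<close>. On the separating curve \<open>norm (?S u)\<close> is at least
      \<open>exp (- (2 * m))\<close>, whence \<open>M' = M * exp (2 * m)\<close>; the bound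
      \<open>B\<close> depends on \<open>p\<close> and enters only as the a priori bound of
      \<open>entropy_max_principle\<close>.\<close>
    define F where "F u = exp (- (of_real K * ?V u)) * p u * b u * ?S' u" for u
    have Gn: "norm (exp (- (of_real K * ?V u))) = exp (- (K * Re (?V u)))" for u by simp
    have Fh: "F holomorphic_on unit_disc"
      unfolding F_def using b(1) by (intro holomorphic_intros herglotz_real_holomorphic Ef(5) ph singular_inner_holomorphic d2(1)) (simp add: H_infinity_iff)
    have FB: "norm (F u) \<le> B" if u: "norm u < 1" for u
    proof -
      have "norm (F u) = exp (- (K * Re (?V u))) * norm (p u) * norm (b u) * norm (?S' u)" by (simp only: F_def norm_mult Gn)
      also have "\<dots> \<le> 1 * B * 1 * 1"
        using V0[OF u] K B[OF u] b(2)[OF u] norm_singular_inner_le[OF d2(1) u] B0 by (intro mult_mono) auto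
      finally show ?thesis by simp
    qed
    have FS: "norm (F u) * norm (?S u) = exp (- (K * Re (?V u))) * norm (p u * (b u * singular_inner \<mu> u))" if "norm u < 1" for u
      unfolding F_def norm_mult Gn SS[OF that] by (simp only: mult_ac)
    have FM: "norm (F u) \<le> M'" if u: "norm u < 1" "(infdist u E)\<^sup>2 = 1 - norm u" for u
    proof -
      have "norm (F u) * exp (- (2 * m)) \<le> norm (F u) * norm (?S u)" using far[of u] u by (intro mult_left_mono) auto
      also have "\<dots> \<le> w (1 - norm u) * norm (p u * (b u * singular_inner \<mu> u))"
        unfolding FS[OF u(1)] using Gw[of u] u by (intro mult_right_mono) auto
      also have "\<dots> \<le> M" by (rule p(2)[OF u(1)])
      finally show ?thesis by (simp add: M'_def exp_minus field_simps)
    qed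
    have "norm (F z) \<le> M'" by (rule entropy_max_principle[OF E Fh FB M' FM z])
    then have 1: "exp (- (K * Re (?V z))) * norm (p z * (b z * singular_inner \<mu> z)) \<le> M' * norm (?S z)"
      unfolding FS[OF z(1), symmetric] by (intro mult_right_mono) auto
    have "exp (- (K * Re (?V z))) * norm (h z - p z * (b z * singular_inner \<mu> z)) \<le> e"
      by (rule order_trans[OF mult_right_mono[OF Gw[OF z]] p(3)[OF z(1)]]) simp
    moreover have "norm (h z) \<le> norm (p z * (b z * singular_inner \<mu> z)) + norm (h z - p z * (b z * singular_inner \<mu> z))"
      using norm_triangle_ineq[of "p z * (b z * singular_inner \<mu> z)" "h z - p z * (b z * singular_inner \<mu> z)"] by simp
    then have "exp (- (K * Re (?V z))) * norm (h z) \<le> exp (- (K * Re (?V z))) * (norm (p z * (b z * singular_inner \<mu> z)) + norm (h z - p z * (b z * singular_inner \<mu> z)))"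
      by (intro mult_left_mono) auto
    ultimately show "exp (- (K * Re (?V z))) * norm (h z) \<le> M' * norm (?S z) + e"
      using 1 by (simp add: distrib_left)
  qed
  \<comment> \<open>The outer factor is bounded below through the negative part of \<open>u\<close>
    alone. The corresponding exponential has modulus at most 1, so \<open>Q\<close> is bounded also
    in the region far from \<open>E\<close>, where no estimate of \<open>h\<close> is at
    hand.\<close>
  let ?um = "\<lambda>\<zeta>. max 0 (- u \<zeta>)"
  have umi: "integrable circle_measure ?um" using u by (intro integrable_max) auto
  \<comment> \<open>After taking logarithms, boundedness of \<open>Q\<close> is the inequality
    between Poisson integrals that is sought. As a holomorphic function it allows the Blaschke
    product to be divided out.\<close>
  define Q where "Q z = exp (- (of_real K * ?V z) - herglotz_real ?um z - herglotz \<sigma> z + herglotz (density \<mu> (indicator E)) z)" for z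
  have Qn: "norm (Q z) = exp (- (K * Re (?V z)) - Re (herglotz_real ?um z) - Re (herglotz \<sigma> z) + Re (herglotz (density \<mu> (indicator E)) z))" for z
    by (simp add: Q_def)
  have Qh: "Q holomorphic_on unit_disc"
    unfolding Q_def by (intro holomorphic_intros herglotz_real_holomorphic herglotz_holomorphic Ef(5) umi \<sigma> d1(1))
  define M2 where "M2 = max M' (exp (2 * m))"
  have M2: "M2 \<ge> 1" using m0 by (simp add: M2_def le_max_iff_disj)
  have um0: "0 \<le> Re (herglotz_real ?um z)" if "norm z < 1" for z
    using Re_herglotz_real_mono[OF _ umi that, of "\<lambda>_. 0"] by (simp add: herglotz_real_def)
  have QB: "norm (Q z * blaschke_product c0 I \<Lambda> z) \<le> M2" if z: "norm z < 1" for z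
  proof (cases "(infdist z E)\<^sup>2 \<le> 1 - norm z")
    case True
    have le: "- Re (herglotz_real ?um z) \<le> Re (herglotz_real u z)"
    proof -
      have "Re (herglotz_real (\<lambda>\<zeta>. 0 - ?um \<zeta>) z) \<le> Re (herglotz_real u z)"
        by (rule Re_herglotz_real_mono[OF Bochner_Integration.integrable_diff[OF _ umi] u z]) auto
      then show ?thesis using herglotz_real_diff[of "\<lambda>_. 0" ?um z] umi z by (simp add: herglotz_real_def)
    qed
    have "norm (Q z) * norm (?S z) = exp (- (K * Re (?V z))) * exp (- Re (herglotz_real ?um z)) * norm (singular_inner \<sigma> z)"
      unfolding Qn norm_singular_inner by (simp flip: exp_add)
    also have "\<dots> \<le> exp (- (K * Re (?V z))) * exp (Re (herglotz_real u z)) * norm (singular_inner \<sigma> z)"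
      using le by (intro mult_right_mono mult_left_mono) auto
    finally have "norm (Q z) * norm (?S z) * norm (blaschke_product c0 I \<Lambda> z) \<le>
       exp (- (K * Re (?V z))) * exp (Re (herglotz_real u z)) * norm (singular_inner \<sigma> z) * norm (blaschke_product c0 I \<Lambda> z)"
      by (intro mult_right_mono) auto
    also have "\<dots> = exp (- (K * Re (?V z))) * norm (h z)" by (simp add: h_eq[OF z] norm_mult)
    also have "\<dots> \<le> M' * norm (?S z)" by (rule near[OF z True])
    finally have "norm (?S z) * norm (Q z * blaschke_product c0 I \<Lambda> z) \<le> norm (?S z) * M'" by (simp add: norm_mult mult_ac)
    then have "norm (Q z * blaschke_product c0 I \<Lambda> z) \<le> M'" by (rule mult_left_le_imp_le) simp
    then show ?thesis by (simp add: M2_def)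
  next
    case False
    have "Re (herglotz (density \<mu> (indicator E)) z) \<le> 2 * m"
      unfolding m_def by (rule Re_herglotz_off_support[OF \<mu> Ef(1-3) z]) (use False in simp)
    moreover have "0 \<le> K * Re (?V z)" using K V0[OF z] by simp
    moreover have "0 \<le> Re (herglotz \<sigma> z)" by (rule Re_herglotz_nonneg[OF \<sigma> z])
    ultimately have "norm (Q z) \<le> exp (2 * m)" unfolding Qn using um0[OF z] by simp
    moreover have "norm (blaschke_product c0 I \<Lambda> z) \<le> 1" by (rule blaschke_norm_le[OF bs z c0])
    ultimately have "norm (Q z * blaschke_product c0 I \<Lambda> z) \<le> exp (2 * m) * 1"
      unfolding norm_mult by (intro mult_mono) auto
    then show ?thesis by (simp add: M2_def)
  qed
  have Qle: "norm (Q z) \<le> M2" if "norm z < 1" for z by (rule blaschke_product_divide[OF Qh bs c0 QB that])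
  \<comment> \<open>A constant is its own Poisson integral, so \<open>ln M2\<close> can be absorbed
    into the density; it is nonnegative because \<open>M2 \<ge> 1\<close>.\<close>
  define g where "g \<zeta> = K * ?v \<zeta> + ?um \<zeta> + ln M2" for \<zeta>
  have gi: "integrable circle_measure g" unfolding g_def
    using Ef(5) umi by (intro Bochner_Integration.integrable_add integrable_mult_right) auto
  have g0: "0 \<le> g \<zeta>" if "norm \<zeta> = 1" for \<zeta> unfolding g_def
    using v0[OF that] K M2 by (intro add_nonneg_nonneg mult_nonneg_nonneg) auto
  let ?G = "density circle_measure (\<lambda>\<zeta>. ennreal (g \<zeta>))"
  have Gf: "circle_finite ?G" by (rule circle_finite_density[OF circle_finite_circle_measure gi g0])
  note sm = sum_measure[OF \<sigma> Gf]
  have Rg: "Re (herglotz ?G z) = K * Re (?V z) + Re (herglotz_real ?um z) + ln M2" if z: "norm z < 1" for z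
  proof -
    have "Re (herglotz ?G z) = (\<integral>\<zeta>. poisson_kernel z \<zeta> * g \<zeta> \<partial>circle_measure)"
      using herglotz_real_density[OF gi g0 z] Re_herglotz_real(1)[OF gi z] by simp
    also have "\<dots> = (\<integral>\<zeta>. K * (poisson_kernel z \<zeta> * ?v \<zeta>) + poisson_kernel z \<zeta> * ?um \<zeta> + ln M2 * poisson_kernel z \<zeta> \<partial>circle_measure)"
      by (intro Bochner_Integration.integral_cong refl) (simp add: g_def algebra_simps)
    also have "\<dots> = K * (\<integral>\<zeta>. poisson_kernel z \<zeta> * ?v \<zeta> \<partial>circle_measure) + (\<integral>\<zeta>. poisson_kernel z \<zeta> * ?um \<zeta> \<partial>circle_measure) + ln M2 * (\<integral>\<zeta>. poisson_kernel z \<zeta> \<partial>circle_measure)"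
      using Re_herglotz_real(2)[OF Ef(5) z] Re_herglotz_real(2)[OF umi z] integrable_poisson_kernel[OF circle_finite_circle_measure z]
      by (simp del: mult_minus_right)
    finally show ?thesis using Re_herglotz_real(1)[OF Ef(5) z] Re_herglotz_real(1)[OF umi z] integral_poisson_kernel[OF z] by simp
  qed
  have dom: "Re (herglotz (density \<mu> (indicator E)) z) \<le> Re (herglotz (sum_measure \<sigma> ?G) z)" if z: "norm z < 1" for z
  proof -
    have "exp (- (K * Re (?V z)) - Re (herglotz_real ?um z) - Re (herglotz \<sigma> z) + Re (herglotz (density \<mu> (indicator E)) z)) \<le> exp (ln M2)"
      using Qle[OF z] M2 unfolding Qn by simp
    then have "- (K * Re (?V z)) - Re (herglotz_real ?um z) - Re (herglotz \<sigma> z) + Re (herglotz (density \<mu> (indicator E)) z) \<le> ln M2" by simp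
    moreover have "herglotz (sum_measure \<sigma> ?G) z = herglotz \<sigma> z + herglotz ?G z"
      by (rule herglotz_add[OF sm(1) \<sigma> Gf sm(2) z])
    ultimately show ?thesis using Rg[OF z] by simp
  qed
  have AE: "A \<inter> E \<in> sets circle_borel" using A Ef(6) by auto
  have "emeasure \<mu> (A \<inter> E) = emeasure (density \<mu> (indicator E)) (A \<inter> E)" using d1(2)[OF AE] by (simp add: Int_assoc)
  also have "\<dots> \<le> emeasure (sum_measure \<sigma> ?G) (A \<inter> E)" by (rule poisson_domination[OF d1(1) sm(1) dom AE])
  also have "\<dots> = emeasure \<sigma> (A \<inter> E) + emeasure ?G (A \<inter> E)" by (rule sm(2)[OF AE])
  \<comment> \<open>The error measure has a density, and \<open>E\<close> is a Lebesgue null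
    set.\<close>
  also have "emeasure ?G (A \<inter> E) = 0"
  proof -
    have "emeasure circle_measure (A \<inter> E) \<le> emeasure circle_measure E" using Ef(6) by (intro emeasure_mono) auto
    then have "A \<inter> E \<in> null_sets circle_measure" using Ef(4) AE by (auto simp: null_sets_def)
    then have "A \<inter> E \<in> null_sets ?G"
      by (rule absolutely_continuousI_density[THEN absolutely_continuous_def[THEN iffD1], THEN subsetD, rotated]) (use gi in simp)
    then show ?thesis by (simp add: null_sets_def)
  qed
  finally show ?thesis by simp
qed

text \<open>The inequalities on the single sets add up after the sets have been made disjoint, and
  \<open>\<mu>\<close> has no mass outside their union.\<close>

lemma singular_permanence_countable:
  assumes \<mu>: "circle_finite \<mu>" and b: "b \<in> H_infinity" "\<And>z. norm z < 1 \<Longrightarrow> norm (b z) \<le> 1"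
    and \<E>: "countable \<E>" "\<And>E. E \<in> \<E> \<Longrightarrow> finite_entropy w E" "emeasure \<mu> (unit_circle - \<Union>\<E>) = 0"
    and h: "h \<in> generated_subspace w (\<lambda>z. b z * singular_inner \<mu> z)"
    and \<sigma>: "circle_finite \<sigma>" and bs: "blaschke_sequence I \<Lambda>" and c0: "norm c0 = 1" and u: "integrable circle_measure u"
    and h_eq: "\<And>z. norm z < 1 \<Longrightarrow> h z = exp (herglotz_real u z) * singular_inner \<sigma> z * blaschke_product c0 I \<Lambda> z"
    and A: "A \<in> sets circle_borel"
  shows "emeasure \<mu> A \<le> emeasure \<sigma> A"
proof -
  have perm: "emeasure \<mu> (A \<inter> E) \<le> emeasure \<sigma> (A \<inter> E)" if "E \<in> \<E>" "A \<in> sets circle_borel" for A E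
    by (rule singular_permanence[OF \<E>(2)[OF that(1)] \<mu> b h \<sigma> bs c0 u h_eq that(2)])
  have Am: "A \<in> sets \<mu>" "A \<in> sets \<sigma>" using A circle_finiteD[OF \<mu>] circle_finiteD[OF \<sigma>] by auto
  have AU: "A \<subseteq> unit_circle" using A by (simp add: sets_circle_borel_iff)
  show ?thesis
  proof (cases "\<E> = {}")
    case True
    have "emeasure \<mu> A \<le> emeasure \<mu> (unit_circle - \<Union>\<E>)"
      using AU True circle_finiteD[OF \<mu>] by (intro emeasure_mono) (auto simp: sets_circle_borel_iff)
    then show ?thesis using \<E>(3) by simp
  next
    case False
    define E where "E = from_nat_into \<E>"
    have rE: "range E = \<E>" unfolding E_def using range_from_nat_into[OF False \<E>(1)] .
    have Es: "E k \<in> sets circle_borel" for k using finite_entropyD(6)[OF \<E>(2)] rE by blast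
    have ds: "disjointed E k \<in> sets circle_borel" for k
      using sets.range_disjointed_sets[of E circle_borel] Es by auto
    define X where "X k = A \<inter> disjointed E k" for k
    have Xs: "X k \<in> sets circle_borel" for k unfolding X_def using A ds by auto
    have dis: "disjoint_family X" unfolding X_def using disjoint_family_disjointed[of E] by (auto simp: disjoint_family_on_def)
    have UX: "(\<Union>k. X k) = A \<inter> \<Union>\<E>" unfolding X_def using UN_disjointed_eq[of E] rE by auto
    have UE: "\<Union>\<E> \<in> sets circle_borel" using Es rE \<E>(1) by (intro sets.countable_Union) auto
    have le: "emeasure \<mu> (X k) \<le> emeasure \<sigma> (X k)" for k
    proof -
      have "X k \<inter> E k = X k" using disjointed_subset[of E k] by (auto simp: X_def)
      moreover have "E k \<in> \<E>" using rE by blast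
      ultimately show ?thesis using perm[OF _ Xs, of "E k" k] by simp
    qed
    have "emeasure \<mu> A = emeasure \<mu> ((A \<inter> \<Union>\<E>) \<union> (A - \<Union>\<E>))" by (intro arg_cong2[of _ _ _ _ emeasure]) auto
    also have "\<dots> \<le> emeasure \<mu> (A \<inter> \<Union>\<E>) + emeasure \<mu> (A - \<Union>\<E>)"
      using Am UE circle_finiteD[OF \<mu>] by (intro emeasure_subadditive) auto
    also have "emeasure \<mu> (A - \<Union>\<E>) \<le> emeasure \<mu> (unit_circle - \<Union>\<E>)"
      using AU UE circle_finiteD[OF \<mu>] sets.compl_sets[OF UE] by (intro emeasure_mono) auto
    also have "\<dots> = 0" by (rule \<E>(3))
    finally have "emeasure \<mu> A \<le> emeasure \<mu> (\<Union>k. X k)" using UX by simp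
    also have "\<dots> = (\<Sum>k. emeasure \<mu> (X k))"
      using Xs dis circle_finiteD[OF \<mu>] by (intro suminf_emeasure[symmetric]) auto
    also have "\<dots> \<le> (\<Sum>k. emeasure \<sigma> (X k))" by (intro suminf_le le) auto
    also have "\<dots> = emeasure \<sigma> (\<Union>k. X k)"
      using Xs dis circle_finiteD[OF \<sigma>] by (intro suminf_emeasure) auto
    also have "\<dots> \<le> emeasure \<sigma> A" unfolding UX using Am by (intro emeasure_mono) auto
    finally show ?thesis .
  qed
qed

text \<open>The approximants have the form \<open>(z - a) ^ m * g z\<close>. On a small circle about
  \<open>a\<close> the uniform bound \<open>M\<close> controls \<open>g\<close>, and by the maximum
  principle also inside, with a constant \<open>C\<close> independent of the accuracy. In the limit
  \<open>norm (h z) \<le> C * norm (z - a) ^ m\<close>, which excludes a zero of smaller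
  order.\<close>

lemma zero_permanence:
  assumes bs: "blaschke_sequence I \<Lambda>" and c0: "c0 \<noteq> 0" and S: "S \<in> H_infinity"
    and TG: "(\<lambda>z. blaschke_product c0 I \<Lambda> z * S z) \<in> growth_space w"
    and h: "h \<in> generated_subspace w (\<lambda>z. blaschke_product c0 I \<Lambda> z * S z)"
    and bs': "blaschke_sequence I' \<Lambda>'" and c1: "c1 \<noteq> 0"
    and f: "f holomorphic_on unit_disc" "\<And>z. norm z < 1 \<Longrightarrow> f z \<noteq> 0"
    and h_eq: "\<And>z. norm z < 1 \<Longrightarrow> h z = f z * blaschke_product c1 I' \<Lambda>' z" and a: "norm a < 1"
  shows "card {n \<in> I. \<Lambda> n = a} \<le> card {n \<in> I'. \<Lambda>' n = a}"
proof (rule ccontr)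
  define m k where "m = card {n \<in> I. \<Lambda> n = a}" and "k = card {n \<in> I'. \<Lambda>' n = a}"
  assume "\<not> ?thesis"
  then have mk: "k < m" by (simp add: m_def k_def)
  obtain q where q: "q holomorphic_on unit_disc" "\<And>z. norm z < 1 \<Longrightarrow> blaschke_product c0 I \<Lambda> z = (z - a) ^ m * q z"
    using blaschke_product_order[OF bs c0 a] unfolding m_def by blast
  obtain r where r: "r holomorphic_on unit_disc" "r a \<noteq> 0" "\<And>z. norm z < 1 \<Longrightarrow> blaschke_product c1 I' \<Lambda>' z = (z - a) ^ k * r z"
    using blaschke_product_order[OF bs' c1 a] unfolding k_def by blast
  obtain M where M: "M > 0"
    "\<And>e. e > 0 \<Longrightarrow> \<exists>p\<in>H_infinity. \<forall>z. norm z < 1 \<longrightarrow> w (1 - norm z) * norm (p z * (blaschke_product c0 I \<Lambda> z * S z)) \<le> M \<and>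
        w (1 - norm z) * norm (h z - p z * (blaschke_product c0 I \<Lambda> z * S z)) \<le> e"
    using generated_pointwise_bound[OF TG h] by blast
  define \<rho> where "\<rho> = (1 - norm a) / 2"
  have \<rho>: "\<rho> > 0" using a by (simp add: \<rho>_def)
  define w0 where "w0 = w \<rho>"
  have "\<rho> \<le> 1" unfolding \<rho>_def using norm_ge_zero[of a] by (simp add: divide_le_eq del: norm_ge_zero)
  then have w0: "w0 > 0" unfolding w0_def using \<rho> by (intro w_pos)
  have inD: "norm z < 1 \<and> w0 \<le> w (1 - norm z)" if "z \<in> cball a \<rho>" for z
  proof -
    have "norm z \<le> norm a + \<rho>" using that norm_triangle_ineq2[of z a] by (simp add: dist_norm norm_minus_commute)
    then have "\<rho> \<le> 1 - norm z" by (simp add: \<rho>_def field_simps)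
    then show ?thesis using \<rho> unfolding w0_def by (auto intro!: w_le)
  qed
  define C where "C = M / w0 / \<rho> ^ m"
  have hle: "norm (h z) \<le> C * norm (z - a) ^ m" if z: "z \<in> cball a \<rho>" for z
  proof (rule field_le_epsilon)
    fix e :: real assume e: "e > 0"
    have "e * w0 > 0" using e w0 by simp
    then obtain p where p: "p \<in> H_infinity"
      "\<And>z. norm z < 1 \<Longrightarrow> w (1 - norm z) * norm (p z * (blaschke_product c0 I \<Lambda> z * S z)) \<le> M"
      "\<And>z. norm z < 1 \<Longrightarrow> w (1 - norm z) * norm (h z - p z * (blaschke_product c0 I \<Lambda> z * S z)) \<le> e * w0"
      using M(2) by blast
    define g where "g z = p z * q z * S z" for z
    have gh: "g holomorphic_on unit_disc" unfolding g_def using p(1) S q(1) by (intro holomorphic_intros) (auto simp: H_infinity_iff)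
    have pg: "p z * (blaschke_product c0 I \<Lambda> z * S z) = (z - a) ^ m * g z" if "norm z < 1" for z
      using q(2)[OF that] by (simp add: g_def)
    have "norm (g z) \<le> C"
    proof (rule maximum_modulus_frontier[of g "cball a \<rho>"])
      show "g holomorphic_on interior (cball a \<rho>)" by (rule holomorphic_on_subset[OF gh]) (use inD in auto)
      show "continuous_on (closure (cball a \<rho>)) g"
        by (rule continuous_on_subset[OF holomorphic_on_imp_continuous_on[OF gh]]) (use inD in auto)
      fix u assume "u \<in> frontier (cball a \<rho>)"
      then have u: "norm (u - a) = \<rho>" using \<rho> by (simp add: dist_norm norm_minus_commute)
      then have uc: "u \<in> cball a \<rho>" by (simp add: dist_norm norm_minus_commute)
      have "w0 * norm ((u - a) ^ m * g u) \<le> w (1 - norm u) * norm ((u - a) ^ m * g u)" using inD[OF uc] by (intro mult_right_mono) auto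
      also have "\<dots> \<le> M" using p(2)[of u] inD[OF uc] pg by simp
      finally have "w0 * (\<rho> ^ m * norm (g u)) \<le> M" using u by (simp add: norm_mult norm_power)
      then show "norm (g u) \<le> C" using w0 \<rho> by (simp add: C_def field_simps)
    qed (use z in auto)
    then have 1: "norm ((z - a) ^ m * g z) \<le> C * norm (z - a) ^ m"
      unfolding norm_mult norm_power mult.commute[of C] by (intro mult_left_mono) auto
    have "w0 * norm (h z - (z - a) ^ m * g z) \<le> w (1 - norm z) * norm (h z - (z - a) ^ m * g z)" using inD[OF z] by (intro mult_right_mono) auto
    also have "\<dots> \<le> w0 * e" using p(3)[of z] inD[OF z] pg by (simp add: mult.commute)
    finally have "norm (h z - (z - a) ^ m * g z) \<le> e" using w0 by simp
    then show "norm (h z) \<le> C * norm (z - a) ^ m + e"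
      using 1 norm_triangle_ineq[of "h z - (z - a) ^ m * g z" "(z - a) ^ m * g z"] by simp
  qed
  have fr: "norm (f z * r z) \<le> C * norm (z - a) ^ (m - k)" if z: "z \<in> cball a \<rho>" "z \<noteq> a" for z
  proof -
    have "norm (h z) = norm (z - a) ^ k * norm (f z * r z)"
      using h_eq[of z] r(3)[of z] inD[OF z(1)] by (simp add: norm_mult norm_power)
    then have "norm (z - a) ^ k * norm (f z * r z) \<le> C * norm (z - a) ^ m" using hle[OF z(1)] by simp
    also have "norm (z - a) ^ m = norm (z - a) ^ k * norm (z - a) ^ (m - k)" using mk by (simp flip: power_add)
    finally have "norm (z - a) ^ k * norm (f z * r z) \<le> norm (z - a) ^ k * (C * norm (z - a) ^ (m - k))" by (simp add: mult_ac)
    then show ?thesis using z(2) by (simp add: mult_le_cancel_left_pos)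
  qed
  have cont: "isCont (\<lambda>z. norm (f z * r z)) a"
  proof -
    have "continuous_on unit_disc (\<lambda>z. f z * r z)" using f(1) r(1) by (intro holomorphic_on_imp_continuous_on holomorphic_intros)
    then have "isCont (\<lambda>z. f z * r z) a" using a by (simp add: continuous_on_eq_continuous_at)
    then show ?thesis by (rule continuous_norm)
  qed
  have "((\<lambda>z. C * norm (z - a) ^ (m - k)) \<longlongrightarrow> C * norm (a - a) ^ (m - k)) (at a)" by (intro tendsto_intros)
  moreover have "((\<lambda>z. norm (f z * r z)) \<longlongrightarrow> norm (f a * r a)) (at a)" using cont by (simp add: isCont_def)
  moreover have "eventually (\<lambda>z. norm (f z * r z) \<le> C * norm (z - a) ^ (m - k)) (at a)"
    unfolding eventually_at using fr \<rho> by (intro exI[of _ \<rho>]) (auto simp: dist_commute)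
  ultimately have "norm (f a * r a) \<le> C * norm (a - a) ^ (m - k)" by (intro tendsto_le[of "at a"]) auto
  then show False using mk f(2)[OF a] r(2) by (simp add: power_0_left)
qed

end

section \<open>Boundary values\<close>

text \<open>A value \<open>w t = 1\<close> inside the interval would give
  \<open>w (t\<^sup>2) = 1\<close> by comparability, and iteration would contradict
  \<open>w 0 = 0\<close> by continuity; the intermediate value theorem then gives
  \<open>w < 1\<close>. Halving the argument repeatedly in the subadditive function
  \<open>w powr p\<close> shows that \<open>w\<close> decays at most like a power, which is the
  linear bound with \<open>L = - ln (w 1) + ln 2 / p\<close>.\<close>

lemma majorant_entropy_weight:
  assumes maj: "majorant w" and lsc: "log_square_comparable w"
  obtains c L where "entropy_weight w c L"
proof -
  from lsc obtain c0 where wpos: "\<And>t. 0 < t \<Longrightarrow> t \<le> 1 \<Longrightarrow> 0 < w t" and c0: "c0 > 0"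
    and cmp: "\<And>t. 0 < t \<Longrightarrow> t < 1 \<Longrightarrow> inverse c0 * ln (1 / w (t\<^sup>2)) \<le> ln (1 / w t) \<and> ln (1 / w t) \<le> c0 * ln (1 / w (t\<^sup>2))"
    by (auto simp: log_square_comparable_def)
  from maj obtain p where cont: "continuous_on {0..1} w" and mono: "mono_on {0..1} w" and w0: "w 0 = 0"
    and p: "p > 0" and sub: "\<And>s t. 0 \<le> s \<Longrightarrow> 0 \<le> t \<Longrightarrow> s + t \<le> 1 \<Longrightarrow> w (s + t) powr p \<le> w s powr p + w t powr p"
    unfolding majorant_def modulus_of_continuity_def by metis
  have tsq: "0 < t\<^sup>2" "t\<^sup>2 < 1" if "0 < t" "t < 1" for t :: real
    using that power_strict_mono[of t 1 2] by auto
  have sq1: "w (t\<^sup>2) = 1" if "0 < t" "t < 1" "w t = 1" for t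
  proof -
    have "inverse c0 * ln (1 / w (t\<^sup>2)) \<le> 0" "0 \<le> c0 * ln (1 / w (t\<^sup>2))" using cmp[OF that(1,2)] that(3) by auto
    then have "ln (1 / w (t\<^sup>2)) = 0" using c0 by (simp add: mult_le_0_iff zero_le_mult_iff)
    then show ?thesis using wpos[of "t\<^sup>2"] tsq[OF that(1,2)] by (simp add: ln_div)
  qed
  have no1: "w t \<noteq> 1" if t: "0 < t" "t < 1" for t
  proof
    assume "w t = 1"
    have "w (t ^ (2 ^ n)) = 1" for n
    proof (induction n)
      case 0 then show ?case using \<open>w t = 1\<close> by simp
    next
      case (Suc n)
      have "t ^ (2 ^ n) < 1" using t by (simp add: power_less_one_iff)
      then have "w ((t ^ (2 ^ n))\<^sup>2) = 1" using t Suc by (intro sq1) auto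
      then show ?case by (simp add: power_mult[symmetric] mult.commute)
    qed
    moreover have "(\<lambda>n. w (t ^ (2 ^ n))) \<longlonglongrightarrow> w 0"
    proof (rule continuous_on_tendsto_compose[OF cont])
      have "strict_mono (\<lambda>n. 2 ^ n :: nat)" by (auto intro!: strict_monoI)
      from LIMSEQ_subseq_LIMSEQ[OF LIMSEQ_realpow_zero[of t] this] t
      show "(\<lambda>n. t ^ (2 ^ n)) \<longlonglongrightarrow> 0" by (simp add: o_def)
      show "\<forall>\<^sub>F n in sequentially. t ^ 2 ^ n \<in> {0..1}" using t by (auto intro!: always_eventually power_le_one)
    qed auto
    ultimately show False using w0 by (simp add: LIMSEQ_const_iff)
  qed
  have ivt: "\<exists>s. 0 < s \<and> s \<le> t \<and> w s = 1" if "0 < t" "t \<le> 1" "w t \<ge> 1" for t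
  proof -
    have "continuous_on {0..t} w" using that by (intro continuous_on_subset[OF cont]) auto
    from IVT'[of w 0 1 t, OF _ that(3) _ this] w0 that obtain s where "0 \<le> s" "s \<le> t" "w s = 1" by auto
    then show ?thesis using w0 by (intro exI[of _ s]) (cases "s = 0"; auto)
  qed
  have lt1: "w t < 1" if "0 < t" "t < 1" for t
  proof (rule ccontr)
    assume "\<not> ?thesis"
    then have "\<exists>s>0. s \<le> t \<and> w s = 1" using ivt[of t] that by simp
    then show False using no1 that by fastforce
  qed
  have w1: "w 1 \<le> 1"
  proof (rule ccontr)
    assume *: "\<not> ?thesis"
    then obtain s where "0 < s" "s \<le> 1" "w s = 1" using ivt[of 1] by auto
    then show False using no1[of s] * by (cases "s = 1") auto
  qed
  have lnw: "ln (1 / w t) = - ln (w t)" if "0 < t" "t \<le> 1" for t using wpos[OF that] by (simp add: ln_div)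
  have square: "- ln (w (t\<^sup>2)) \<le> max 1 c0 * - ln (w t)" if t: "0 < t" "t < 1" for t
  proof -
    have "inverse c0 * - ln (w (t\<^sup>2)) \<le> - ln (w t)" using cmp[OF t] lnw[of t] lnw[of "t\<^sup>2"] tsq[OF t] t by simp
    then have "- ln (w (t\<^sup>2)) \<le> c0 * - ln (w t)" using c0 by (simp add: field_simps)
    also have "\<dots> \<le> max 1 c0 * - ln (w t)" using lt1[OF t] wpos[of t] t by (intro mult_right_mono) auto
    finally show ?thesis .
  qed
  define L where "L = - ln (w 1) + ln 2 / p"
  have lnw1: "0 \<le> - ln (w 1)" using w1 wpos[of 1] by simp
  have Lp: "L > 0" unfolding L_def by (rule add_nonneg_pos[OF lnw1]) (use p in simp)
  have pow: "w 1 powr p \<le> 2 ^ n * w ((1/2) ^ n) powr p" for n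
  proof (induction n)
    case (Suc n)
    have "(1/2 :: real) ^ n \<le> 1" by (simp add: power_le_one)
    then have "w ((1/2) ^ n) powr p \<le> 2 * w ((1/2) ^ Suc n) powr p" using sub[of "(1/2) ^ Suc n" "(1/2) ^ Suc n"] by simp
    then have "2 ^ n * w ((1/2) ^ n) powr p \<le> 2 ^ n * (2 * w ((1/2) ^ Suc n) powr p)" by (intro mult_left_mono) auto
    with Suc have "w 1 powr p \<le> 2 ^ n * (2 * w ((1/2) ^ Suc n) powr p)" by (rule order_trans)
    then show ?case by (simp only: power_Suc2[of 2 n] mult.assoc)
  qed simp
  have linear: "- ln (w ((1/2) ^ n)) \<le> L * real n" if n: "n \<ge> 1" for n
  proof -
    have pos: "0 < w ((1/2) ^ n)" by (intro wpos) (simp_all add: power_le_one)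
    have "ln (w 1 powr p) \<le> ln (2 ^ n * w ((1/2) ^ n) powr p)" by (subst ln_le_cancel_iff) (use pow[of n] wpos[of 1] pos in auto)
    then have "p * ln (w 1) \<le> real n * ln 2 + p * ln (w ((1/2) ^ n))"
      using wpos[of 1] pos by (simp add: ln_mult ln_realpow)
    then have "- ln (w ((1/2) ^ n)) \<le> - ln (w 1) + real n * (ln 2 / p)" using p by (simp add: field_simps)
    also have "- ln (w 1) \<le> real n * - ln (w 1)" using n lnw1 mult_right_mono[of 1 "real n" "- ln (w 1)"] by simp
    finally show ?thesis by (simp add: L_def algebra_simps)
  qed
  have "entropy_weight w (max 1 c0) L"
    by unfold_locales (use cont mono w0 wpos w1 lt1 square Lp linear in auto)
  then show ?thesis by (rule that)
qed

text \<open>Where the radial limit does not exist, \<open>Lim\<close> returns the fixed value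
  \<open>THE l. False\<close>; the bound has to cover this value too.\<close>

lemma boundary_value_bounded:
  assumes "\<And>z. norm z < 1 \<Longrightarrow> norm (f z) \<le> M"
  obtains B where "B > 0" "\<And>\<zeta>. norm \<zeta> = 1 \<Longrightarrow> norm (boundary_value f \<zeta>) \<le> B"
proof -
  have "norm (boundary_value f \<zeta>) \<le> max M (norm (THE l :: complex. False))" if \<zeta>: "norm \<zeta> = 1" for \<zeta>
  proof (cases "\<exists>l. ((\<lambda>r. f (of_real r * \<zeta>)) \<longlongrightarrow> l) (at_left 1)")
    case True
    then obtain l where l: "((\<lambda>r. f (of_real r * \<zeta>)) \<longlongrightarrow> l) (at_left 1)" by blast
    have "norm l \<le> M"
    proof (rule tendsto_upperbound[OF tendsto_norm[OF l]])
      show "\<forall>\<^sub>F r in at_left 1. norm (f (of_real r * \<zeta>)) \<le> M"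
        unfolding eventually_at_left_field using assms radial_in_disc[OF \<zeta>] by (intro exI[of _ 0]) auto
    qed simp
    then show ?thesis unfolding boundary_value_def using tendsto_Lim[OF _ l] by simp
  next
    case False
    then have "boundary_value f \<zeta> = (THE l. False)" by (simp add: boundary_value_def Lim_def t2_space_class.Lim_def)
    then show ?thesis by simp
  qed
  then show ?thesis by (intro that[of "max 1 (max M (norm (THE l :: complex. False)))"]) force+
qed

lemma radial_sequence: "filterlim (\<lambda>n. 1 - 1 / real (n + 2)) (at_left 1) sequentially"
  unfolding filterlim_at by (auto intro!: always_eventually) real_asymp

text \<open>By the Cauchy criterion the set of radial convergence is
  \<open>\<Inter>m. \<Union>n. A m n\<close>, where \<open>A m n\<close> is closed as an
  intersection of closed conditions over all pairs of radii. On this set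
  \<open>boundary_value\<close> is a limit of dilates; off it, it is the constant default value of
  \<open>Lim\<close>.\<close>

lemma borel_measurable_boundary_value:
  assumes k: "k holomorphic_on unit_disc"
  shows "boundary_value k \<in> borel_measurable circle_borel"
proof -
  have kc: "continuous_on unit_disc k" using k by (rule holomorphic_on_imp_continuous_on)
  define A where "A m n = {\<zeta> \<in> unit_circle. \<forall>r\<in>{1 - 1 / real (n + 2)<..<1}. \<forall>s\<in>{1 - 1 / real (n + 2)<..<1}.
      dist (k (of_real r * \<zeta>)) (k (of_real s * \<zeta>)) \<le> 1 / real (m + 1)}" for m n :: nat
  have pos: "0 < r" if "1 - 1 / real (n + 2) < r" for r n
  proof -
    have "1 / real (n + 2) \<le> 1" by simp
    then show ?thesis using that by linarith
  qed
  have "closed (A m n)" for m n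
  proof -
    have "A m n = unit_circle \<inter> (\<Inter>r\<in>{1 - 1 / real (n + 2)<..<1}. \<Inter>s\<in>{1 - 1 / real (n + 2)<..<1}.
       {\<zeta> \<in> unit_circle. dist (k (of_real r * \<zeta>)) (k (of_real s * \<zeta>)) \<le> 1 / real (m + 1)})"
      by (auto simp: A_def)
    also have "closed \<dots>"
    proof (intro closed_Int closed_INT ballI closed_sphere)
      fix r s :: real assume rs: "r \<in> {1 - 1 / real (n + 2)<..<1}" "s \<in> {1 - 1 / real (n + 2)<..<1}"
      have "continuous_on unit_circle (\<lambda>\<zeta>. k (of_real r * \<zeta>))" if "r \<in> {1 - 1 / real (n + 2)<..<1}" for r
        using that pos by (intro continuous_on_compose2[OF kc] continuous_intros) (auto intro!: radial_in_disc)
      then have "continuous_on unit_circle (\<lambda>\<zeta>. dist (k (of_real r * \<zeta>)) (k (of_real s * \<zeta>)))"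
        using rs by (intro continuous_on_dist)
      then show "closed {\<zeta> \<in> unit_circle. dist (k (of_real r * \<zeta>)) (k (of_real s * \<zeta>)) \<le> 1 / real (m + 1)}"
        by (intro continuous_on_closed_Collect_le) auto
    qed
    finally show ?thesis .
  qed
  then have "A m n \<in> sets circle_borel" for m n by (auto simp: sets_circle_borel_iff A_def[symmetric]) (auto simp: A_def)
  then have "(\<Union>n. A m n) \<in> sets circle_borel" for m by (intro sets.countable_UN) auto
  then have Am: "(\<Inter>m. \<Union>n. A m n) \<in> sets circle_borel" by (intro sets.countable_INT) auto
  have conv: "(\<exists>l. ((\<lambda>r. k (of_real r * \<zeta>)) \<longlongrightarrow> l) (at_left 1)) \<longleftrightarrow> \<zeta> \<in> (\<Inter>m. \<Union>n. A m n)" if \<zeta>: "norm \<zeta> = 1" for \<zeta>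
  proof
    assume "\<exists>l. ((\<lambda>r. k (of_real r * \<zeta>)) \<longlongrightarrow> l) (at_left 1)"
    then obtain l where l: "((\<lambda>r. k (of_real r * \<zeta>)) \<longlongrightarrow> l) (at_left 1)" by blast
    have "\<exists>n. \<zeta> \<in> A m n" for m
    proof -
      have "\<forall>\<^sub>F r in at_left 1. dist (k (of_real r * \<zeta>)) l < 1 / real (m + 1) / 2"
        using tendstoD[OF l, of "1 / real (m + 1) / 2"] by simp
      then obtain b where b: "b < 1" "\<And>r. b < r \<Longrightarrow> r < 1 \<Longrightarrow> dist (k (of_real r * \<zeta>)) l < 1 / real (m + 1) / 2"
        unfolding eventually_at_left_field by blast
      have "\<forall>\<^sub>F n in sequentially. b < 1 - 1 / real (n + 2)"
      proof (rule order_tendstoD(1)[OF _ b(1)])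
        show "(\<lambda>n. 1 - 1 / real (n + 2)) \<longlonglongrightarrow> 1" by real_asymp
      qed
      then obtain n where n: "b < 1 - 1 / real (n + 2)" by (auto simp: eventually_sequentially)
      have "dist (k (of_real r * \<zeta>)) (k (of_real s * \<zeta>)) \<le> 1 / real (m + 1)"
        if "1 - 1 / real (n + 2) < r" "r < 1" "1 - 1 / real (n + 2) < s" "s < 1" for r s
        using b(2)[of r] b(2)[of s] that n dist_triangle_half_l[of "k (of_real r * \<zeta>)" l "1 / real (m + 1)" "k (of_real s * \<zeta>)"] by simp
      then show ?thesis using \<zeta> by (intro exI[of _ n]) (auto simp: A_def)
    qed
    then show "\<zeta> \<in> (\<Inter>m. \<Union>n. A m n)" by blast
  next
    assume a: "\<zeta> \<in> (\<Inter>m. \<Union>n. A m n)"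
    have "cauchy_filter (filtermap (\<lambda>r. k (of_real r * \<zeta>)) (at_left (1::real)))"
      unfolding cauchy_filter_metric_filtermap
    proof (intro allI impI)
      fix e :: real assume "e > 0"
      then obtain m where m: "1 / real (m + 1) < e" using nat_approx_posE[of e] by (metis Suc_eq_plus1)
      obtain n where n: "\<zeta> \<in> A m n" using a by blast
      show "\<exists>P. eventually P (at_left (1::real)) \<and> (\<forall>x y. P x \<and> P y \<longrightarrow> dist (k (of_real x * \<zeta>)) (k (of_real y * \<zeta>)) < e)"
      proof (intro exI[of _ "\<lambda>r. r \<in> {1 - 1 / real (n + 2)<..<1}"] conjI allI impI)
        show "\<forall>\<^sub>F r in at_left 1. r \<in> {1 - 1 / real (n + 2)<..<1}"
          unfolding eventually_at_left_field by (intro exI[of _ "1 - 1 / real (n + 2)"]) auto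
        fix x y assume "x \<in> {1 - 1 / real (n + 2)<..<1} \<and> y \<in> {1 - 1 / real (n + 2)<..<1}"
        then have "dist (k (of_real x * \<zeta>)) (k (of_real y * \<zeta>)) \<le> 1 / real (m + 1)" using n unfolding A_def by blast
        then show "dist (k (of_real x * \<zeta>)) (k (of_real y * \<zeta>)) < e" using m by linarith
      qed
    qed
    then show "\<exists>l. ((\<lambda>r. k (of_real r * \<zeta>)) \<longlongrightarrow> l) (at_left 1)"
      unfolding filterlim_def convergent_filter_iff[symmetric] by (rule cauchy_filter_convergent)
  qed
  define F where "F n \<zeta> = (if \<zeta> \<in> (\<Inter>m. \<Union>n. A m n) then k (of_real (1 - 1 / real (n + 2)) * \<zeta>) else (THE l. False))" for n \<zeta>
  show ?thesis
  proof (rule borel_measurable_LIMSEQ_metric)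
    show "F n \<in> borel_measurable circle_borel" for n
    proof -
      have "continuous_on unit_circle (\<lambda>\<zeta>. k (of_real (1 - 1 / real (n + 2)) * \<zeta>))"
        by (intro continuous_on_compose2[OF kc] continuous_intros) (auto simp del: of_real_diff of_real_divide intro!: radial_in_disc)
      from measurable_circle_continuous[OF this] show ?thesis
        unfolding F_def using Am by (intro measurable_If_set sets.Int) (auto simp: sets_circle_borel_iff[of unit_circle])
    qed
    fix \<zeta> assume "\<zeta> \<in> space circle_borel"
    then have \<zeta>: "norm \<zeta> = 1" by simp
    show "(\<lambda>n. F n \<zeta>) \<longlonglongrightarrow> boundary_value k \<zeta>"
    proof (cases "\<zeta> \<in> (\<Inter>m. \<Union>n. A m n)")
      case True
      then obtain l where l: "((\<lambda>r. k (of_real r * \<zeta>)) \<longlongrightarrow> l) (at_left 1)" using conv[OF \<zeta>] by blast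
      then have "boundary_value k \<zeta> = l" by (simp add: boundary_value_def tendsto_Lim)
      then show ?thesis using filterlim_compose[OF l radial_sequence] True by (simp only: F_def if_True)
    next
      case False
      then have "\<nexists>l. ((\<lambda>r. k (of_real r * \<zeta>)) \<longlongrightarrow> l) (at_left 1)" using conv[OF \<zeta>] by blast
      then have "boundary_value k \<zeta> = (THE l. False)" by (simp add: boundary_value_def t2_space_class.Lim_def)
      moreover have "F n \<zeta> = (THE l. False)" for n using False by (simp only: F_def if_False)
      ultimately show ?thesis by simp
    qed
  qed
qed

text \<open>Where neither radial limit exists, both boundary values are the same junk value.\<close>

lemma norm_boundary_value_unimodular:
  assumes \<Theta>: "radially_unimodular \<Theta>" and h: "\<And>z. norm z < 1 \<Longrightarrow> h z = \<Theta> z * k z"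
  shows "AE \<zeta> in circle_measure. norm (boundary_value k \<zeta>) = norm (boundary_value h \<zeta>)"
proof -
  have "norm (boundary_value k \<zeta>) = norm (boundary_value h \<zeta>)"
    if \<zeta>: "norm \<zeta> = 1" and l: "norm l = 1" "((\<lambda>r. \<Theta> (of_real r * \<zeta>)) \<longlongrightarrow> l) (at_left 1)" for \<zeta> l
  proof -
    let ?K = "\<lambda>r. k (of_real r * \<zeta>)" and ?H = "\<lambda>r. h (of_real r * \<zeta>)" and ?T = "\<lambda>r. \<Theta> (of_real r * \<zeta>)"
    have disc: "\<forall>\<^sub>F r in at_left (1::real). norm (of_real r * \<zeta>) < 1"
      unfolding eventually_at_left_field using radial_in_disc[OF \<zeta>] by (intro exI[of _ 0]) auto
    have l0: "l \<noteq> 0" using l(1) by auto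
    have KH: "(?H \<longlongrightarrow> l * a) (at_left 1)" if "(?K \<longlongrightarrow> a) (at_left 1)" for a
      using tendsto_mult[OF l(2) that] by (rule Lim_transform_eventually) (use disc h in \<open>auto elim: eventually_mono\<close>)
    have HK: "(?K \<longlongrightarrow> a / l) (at_left 1)" if "(?H \<longlongrightarrow> a) (at_left 1)" for a
    proof (rule Lim_transform_eventually[OF tendsto_divide[OF that l(2) l0]])
      have "\<forall>\<^sub>F r in at_left 1. ?T r \<noteq> 0" using l(2) l0 by (rule tendsto_imp_eventually_ne)
      with disc show "\<forall>\<^sub>F r in at_left 1. ?H r / ?T r = ?K r" by eventually_elim (simp add: h)
    qed
    show ?thesis
    proof (cases "\<exists>a. (?K \<longlongrightarrow> a) (at_left 1)")
      case True
      then obtain a where a: "(?K \<longlongrightarrow> a) (at_left 1)" by blast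
      then have "boundary_value k \<zeta> = a" "boundary_value h \<zeta> = l * a"
        using KH[OF a] by (simp_all add: boundary_value_def tendsto_Lim)
      then show ?thesis using l(1) by (simp add: norm_mult)
    next
      case False
      then have "\<nexists>a. (?H \<longlongrightarrow> a) (at_left 1)" using HK by blast
      with False show ?thesis by (simp add: boundary_value_def t2_space_class.Lim_def)
    qed
  qed
  then have "AE \<zeta> in circle_measure. (\<exists>l. norm l = 1 \<and> ((\<lambda>r. \<Theta> (of_real r * \<zeta>)) \<longlongrightarrow> l) (at_left 1)) \<longrightarrow>
      norm (boundary_value k \<zeta>) = norm (boundary_value h \<zeta>)"
    by (intro AE_I2) auto
  with \<Theta>[unfolded radially_unimodular_def] show ?thesis by (rule AE_mp)
qed

text \<open>The positive part of \<open>ln (norm (k z))\<close> is dominated by the Poisson integral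
  of the positive part of \<open>u\<close>. This is harmonic, so its mean over every circle is its
  value at the origin.\<close>

lemma outer_times_bounded_nevanlinna:
  assumes k: "k holomorphic_on unit_disc" and u: "integrable circle_measure u"
    and le: "\<And>z. norm z < 1 \<Longrightarrow> norm (k z) \<le> exp (Re (herglotz_real u z))"
  shows "k \<in> nevanlinna_class"
proof -
  define v where "v \<zeta> = max 0 (u \<zeta>)" for \<zeta>
  have v: "integrable circle_measure v" "\<And>\<zeta>. 0 \<le> v \<zeta>" using u unfolding v_def by auto
  let ?V = "herglotz_real v"
  have hol: "?V holomorphic_on unit_disc" by (rule herglotz_real_holomorphic[OF v(1)])
  have V0: "0 \<le> Re (?V z)" if z: "norm z < 1" for z
    using herglotz_real_density[OF v(1) _ z] v(2) Re_herglotz_nonneg[OF circle_finite_density[OF circle_finite_circle_measure v(1)] z] by simp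
  have "(\<integral>\<zeta>. max 0 (ln (norm (k (of_real r * \<zeta>)))) \<partial>circle_measure) \<le> Re (?V 0)" if r: "0 < r" "r < 1" for r
  proof -
    have "continuous_on unit_circle (\<lambda>\<zeta>. ?V (of_real r * \<zeta>))"
      by (intro continuous_on_compose2[OF holomorphic_on_imp_continuous_on[OF hol]] continuous_intros)
        (auto intro!: radial_in_disc r)
    from integrable_continuous_circle[OF circle_finite_circle_measure this]
    have int: "integrable circle_measure (\<lambda>\<zeta>. ?V (of_real r * \<zeta>))" .
    have "(\<integral>\<zeta>. max 0 (ln (norm (k (of_real r * \<zeta>)))) \<partial>circle_measure) \<le> (\<integral>\<zeta>. Re (?V (of_real r * \<zeta>)) \<partial>circle_measure)"
    proof (rule integral_mono'[OF integrable_Re[OF int]])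
      fix \<zeta> assume "\<zeta> \<in> space circle_measure"
      then have z: "norm (of_real r * \<zeta>) < 1" using radial_in_disc[OF _ r] by simp
      show "0 \<le> Re (?V (of_real r * \<zeta>))" by (rule V0[OF z])
      show "max 0 (ln (norm (k (of_real r * \<zeta>)))) \<le> Re (?V (of_real r * \<zeta>))"
      proof (cases "k (of_real r * \<zeta>) = 0")
        case False
        have "ln (norm (k (of_real r * \<zeta>))) \<le> ln (exp (Re (herglotz_real u (of_real r * \<zeta>))))"
          using le[OF z] False by (subst ln_le_cancel_iff) auto
        also have "\<dots> \<le> Re (?V (of_real r * \<zeta>))" using Re_herglotz_real_mono[OF u v(1) z] by (simp add: v_def)
        finally show ?thesis using V0[OF z] by simp
      qed (use V0[OF z] in simp)
    qed
    also have "\<dots> = Re (\<integral>\<zeta>. ?V (of_real r * \<zeta>) \<partial>circle_measure)" by (rule integral_Re[OF int])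
    also have "\<dots> = Re (?V 0)" using circle_mean_value_disc[OF hol r] by simp
    finally show ?thesis .
  qed
  then have "bdd_above ((\<lambda>r. \<integral>\<zeta>. max 0 (ln (norm (k (of_real r * \<zeta>)))) \<partial>circle_measure) ` {0<..<1})"
    by (intro bdd_aboveI2) auto
  then show ?thesis using k by (simp add: nevanlinna_class_def)
qed

text \<open>The boundary moduli of \<open>h\<close> and \<open>k\<close> agree almost everywhere,
  which identifies the two Herglotz integrals; measurability of \<open>boundary_value k\<close> is
  what lets integrability pass from \<open>h\<close> to \<open>k\<close>.\<close>

lemma outer_factor_unimodular:
  assumes \<Theta>: "radially_unimodular \<Theta>" and h: "\<And>z. norm z < 1 \<Longrightarrow> h z = \<Theta> z * k z"
    and k: "k holomorphic_on unit_disc" and int: "integrable circle_measure (\<lambda>\<zeta>. ln (norm (boundary_value h \<zeta>)))"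
  shows "integrable circle_measure (\<lambda>\<zeta>. ln (norm (boundary_value k \<zeta>)))" "outer_factor k z = outer_factor h z"
proof -
  have bm: "borel_measurable circle_measure = borel_measurable circle_borel" by (simp add: borel_measurable_circle_finite)
  have m: "boundary_value k \<in> borel_measurable circle_measure" using borel_measurable_boundary_value[OF k] by (simp add: bm)
  have ae: "AE \<zeta> in circle_measure. ln (norm (boundary_value h \<zeta>)) = ln (norm (boundary_value k \<zeta>))"
    by (rule AE_mp[OF norm_boundary_value_unimodular[OF \<Theta>, of h k]]) (use h in auto)
  have mk: "(\<lambda>\<zeta>. ln (norm (boundary_value k \<zeta>))) \<in> borel_measurable circle_measure" using m by simp
  show "integrable circle_measure (\<lambda>\<zeta>. ln (norm (boundary_value k \<zeta>)))"
    by (rule Bochner_Integration.integrable_cong_AE_imp[OF int mk]) (use ae in \<open>auto elim: eventually_mono\<close>)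
  have km: "(\<lambda>\<zeta>. (\<zeta> + z) / (\<zeta> - z)) \<in> borel_measurable circle_measure"
    unfolding bm by (intro borel_measurable_divide borel_measurable_add borel_measurable_diff measurable_circle_borel_borel) auto
  have "(\<integral>\<zeta>. (\<zeta> + z) / (\<zeta> - z) * complex_of_real (ln (norm (boundary_value k \<zeta>))) \<partial>circle_measure) =
      (\<integral>\<zeta>. (\<zeta> + z) / (\<zeta> - z) * complex_of_real (ln (norm (boundary_value h \<zeta>))) \<partial>circle_measure)"
    by (rule Bochner_Integration.integral_cong_AE)
      (use ae mk borel_measurable_integrable[OF int] km in \<open>auto elim: eventually_mono\<close>)
  then show "outer_factor k z = outer_factor h z" by (simp add: outer_factor_def)
qed

section \<open>Inner factors and generated subspaces\<close>

text \<open>Both parts are dominated by \<open>\<nu>\<close>; this makes them finite and lets the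
  first one inherit a Lebesgue null carrier.\<close>

lemma entropy_decomposition_parts:
  assumes s: "singular_circle_measure \<nu>" and d: "entropy_decomposition w \<nu> \<nu>P \<nu>C"
  shows "circle_finite \<nu>P \<and> circle_finite \<nu>C \<and> singular_circle_measure \<nu>P \<and>
    (\<forall>A\<in>sets circle_borel. emeasure \<nu> A = emeasure \<nu>P A + emeasure \<nu>C A) \<and>
    (\<exists>\<E>. countable \<E> \<and> (\<forall>E\<in>\<E>. finite_entropy w E) \<and> emeasure \<nu>P (unit_circle - \<Union>\<E>) = 0) \<and>
    (\<forall>E. finite_entropy w E \<longrightarrow> emeasure \<nu>C E = 0)"
proof -
  note \<nu> = singular_circle_finite[OF s]
  have sets: "sets \<nu>P = sets circle_borel" "sets \<nu>C = sets circle_borel"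
    using d circle_finiteD(2)[OF \<nu>] by (auto simp: entropy_decomposition_def)
  have add: "emeasure \<nu> A = emeasure \<nu>P A + emeasure \<nu>C A" if "A \<in> sets circle_borel" for A
    using d that circle_finiteD(2)[OF \<nu>] by (auto simp: entropy_decomposition_def)
  have uc: "unit_circle \<in> sets circle_borel" by (simp add: sets_circle_borel_iff)
  have sp: "space \<nu>P = unit_circle" "space \<nu>C = unit_circle"
    using sets_eq_imp_space_eq[OF sets(1)] sets_eq_imp_space_eq[OF sets(2)] by auto
  have "emeasure \<nu> unit_circle \<noteq> \<infinity>" using finite_measure.emeasure_finite[OF circle_finiteD(1)[OF \<nu>]] by simp
  then have fin: "circle_finite \<nu>P" "circle_finite \<nu>C"
    using add[OF uc] by (auto simp: circle_finite_def sets sp intro!: finite_measureI)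
  obtain N where N: "N \<in> sets circle_borel" "emeasure circle_measure N = 0" "emeasure \<nu> (unit_circle - N) = 0"
    using s circle_finiteD[OF \<nu>] by (auto simp: singular_circle_measure_def mutually_singular_def)
  have "emeasure \<nu>P (unit_circle - N) = 0" using add[of "unit_circle - N"] N uc by auto
  then have "singular_circle_measure \<nu>P"
    unfolding singular_circle_measure_def mutually_singular_def
    using circle_finiteD(1)[OF fin(1)] sets sp N by auto
  then show ?thesis using fin add d sp by (auto simp: entropy_decomposition_def)
qed

lemma (in growth_weight) ln_boundary_value_le:
  assumes g: "g \<in> H_infinity"
  shows "\<exists>U. \<forall>\<zeta>. norm \<zeta> = 1 \<longrightarrow> ln (norm (boundary_value g \<zeta>)) \<le> U"
proof -
  obtain M where "\<And>z. norm z < 1 \<Longrightarrow> norm (g z) \<le> M" using g by (auto simp: H_infinity_iff)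
  then obtain B where B: "B > 0" "\<And>\<zeta>. norm \<zeta> = 1 \<Longrightarrow> norm (boundary_value g \<zeta>) \<le> B"
    using boundary_value_bounded[of g M] by blast
  \<comment> \<open>The maximum with 0 covers boundary value 0, where
    \<open>ln 0 = 0\<close>.\<close>
  have "ln (norm (boundary_value g \<zeta>)) \<le> max 0 (ln B)" if \<zeta>: "norm \<zeta> = 1" for \<zeta>
  proof (cases "boundary_value g \<zeta> = 0")
    case False
    then have "ln (norm (boundary_value g \<zeta>)) \<le> ln B" using B(2)[OF \<zeta>] B(1) by (subst ln_le_cancel_iff) auto
    then show ?thesis by simp
  qed simp
  then show ?thesis by blast
qed

context growth_weight
begin

text \<open>Elements are total functions, but the norm does not see values off the disc; closedness
  therefore identifies functions that agree on it.\<close>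

lemma closed_shift_invariant_cong:
  assumes S: "closed_shift_invariant w S" and g: "g \<in> S" and f: "f \<in> growth_space w"
    and eq: "\<And>z. norm z < 1 \<Longrightarrow> f z = g z"
  shows "f \<in> S"
  by (rule closed_shift_invariant_limit[OF S f]) (use g eq in \<open>auto intro!: bexI[of _ g] simp: less_imp_le\<close>)

lemma generated_subspace_eqI:
  assumes \<Theta>: "\<Theta> \<in> H_infinity" and F: "F \<in> H_infinity" and f: "f \<in> H_infinity"
    and eq: "\<And>z. norm z < 1 \<Longrightarrow> f z = \<Theta> z * F z"
    and ap: "\<And>e. e > 0 \<Longrightarrow> \<exists>h\<in>H_infinity. \<forall>z. norm z < 1 \<longrightarrow> w (1 - norm z) * norm (1 - h z * F z) \<le> e"
  shows "generated_subspace w f = generated_subspace w \<Theta>"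
proof
  have \<Theta>G: "\<Theta> \<in> growth_space w" and fG: "f \<in> growth_space w" using \<Theta> f by (auto intro: H_infinity_subset)
  note S\<Theta> = closed_shift_invariant_generated[OF \<Theta>G] and Sf = closed_shift_invariant_generated[OF fG]
  have "f \<in> generated_subspace w \<Theta>"
    by (rule closed_shift_invariant_cong[OF S\<Theta>(1) closed_shift_invariant_mult[OF S\<Theta>(1,2) F] fG]) (simp add: eq)
  then show "generated_subspace w f \<subseteq> generated_subspace w \<Theta>" by (rule generated_subspace_mono[OF \<Theta>G])
  obtain B where B: "B > 0" "\<And>z. norm z < 1 \<Longrightarrow> norm (\<Theta> z) \<le> B" using \<Theta> by (auto simp: H_infinity_iff)
  have "\<Theta> \<in> generated_subspace w f"
  proof (rule closed_shift_invariant_limit[OF Sf(1) \<Theta>G])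
    fix e :: real assume "e > 0"
    then obtain h where h: "h \<in> H_infinity" "\<forall>z. norm z < 1 \<longrightarrow> w (1 - norm z) * norm (1 - h z * F z) \<le> e / B"
      using ap[of "e / B"] B(1) by auto
    have "w (1 - norm z) * norm (\<Theta> z - h z * f z) \<le> e" if z: "norm z < 1" for z
    proof -
      have "\<Theta> z - h z * f z = \<Theta> z * (1 - h z * F z)" by (simp add: eq[OF z] algebra_simps)
      then have "w (1 - norm z) * norm (\<Theta> z - h z * f z) = norm (\<Theta> z) * (w (1 - norm z) * norm (1 - h z * F z))"
        by (simp add: norm_mult)
      also have "\<dots> \<le> B * (e / B)" using B h(2) z w_disc[OF z] by (intro mult_mono) auto
      finally show ?thesis using B(1) by simp
    qed
    then show "\<exists>g\<in>generated_subspace w f. \<forall>z. norm z < 1 \<longrightarrow> w (1 - norm z) * norm (\<Theta> z - g z) \<le> e"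
      using closed_shift_invariant_mult[OF Sf(1,2) h(1)] by (intro bexI[of _ "\<lambda>z. h z * f z"]) auto
  qed
  then show "generated_subspace w \<Theta> \<subseteq> generated_subspace w f" by (rule generated_subspace_mono[OF fG])
qed

lemma singular_inner_H_infinity: "circle_finite \<nu> \<Longrightarrow> singular_inner \<nu> \<in> H_infinity"
  using singular_inner_holomorphic norm_singular_inner_le by (auto simp: H_infinity_iff intro!: exI[of _ 1])

lemma blaschke_H_infinity:
  assumes "blaschke_sequence I \<Lambda>" "norm b = 1"
  shows "blaschke_product b I \<Lambda> \<in> H_infinity"
  using blaschke_holomorphic[OF assms(1)] blaschke_norm_le[OF assms(1) _ assms(2)]
  by (auto simp: H_infinity_iff intro!: exI[of _ 1])

lemma inner_H_infinity:
  assumes "blaschke_sequence I \<Lambda>" "norm b = 1" "circle_finite \<nu>"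
  shows "(\<lambda>z. blaschke_product b I \<Lambda> z * singular_inner \<nu> z) \<in> H_infinity"
  by (intro H_infinity_mult blaschke_H_infinity singular_inner_H_infinity assms)

lemma generated_subspace_scale:
  assumes g: "g \<in> growth_space w" and a: "a \<noteq> 0"
  shows "generated_subspace w (\<lambda>z. a * g z) = generated_subspace w g"
proof
  have scale: "(\<lambda>z. b * f z) \<in> generated_subspace w f" if "f \<in> growth_space w" for b f
    using closed_shift_invariant_generated[OF that] unfolding closed_shift_invariant_def by blast
  have ag: "(\<lambda>z. a * g z) \<in> growth_space w" using g by (rule growth_space_scale)
  show "generated_subspace w (\<lambda>z. a * g z) \<subseteq> generated_subspace w g"
    by (rule generated_subspace_mono[OF g scale[OF g]])
  show "generated_subspace w g \<subseteq> generated_subspace w (\<lambda>z. a * g z)"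
    using scale[OF ag, of "inverse a"] a by (intro generated_subspace_mono[OF ag]) (simp add: mult.assoc[symmetric])
qed

end

context entropy_weight
begin

lemma outer_singular_inverse:
  assumes u: "integrable circle_measure u" and U: "\<And>\<zeta>. norm \<zeta> = 1 \<Longrightarrow> u \<zeta> \<le> U"
    and \<mu>: "circle_finite \<mu>" "\<And>E. finite_entropy w E \<Longrightarrow> emeasure \<mu> E = 0" and e: "e > 0"
  shows "\<exists>h\<in>H_infinity. \<forall>z. norm z < 1 \<longrightarrow> w (1 - norm z) * norm (1 - h z * (exp (herglotz_real u z) * singular_inner \<mu> z)) \<le> e"
proof -
  let ?O = "\<lambda>z. exp (herglotz_real u z)"
  obtain h1 where h1: "h1 \<in> H_infinity" "\<And>z. norm z < 1 \<Longrightarrow> w (1 - norm z) * norm (1 - h1 z * ?O z) \<le> e / 2"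
    using outer_cyclic[OF u, of "e / 2"] e by auto
  obtain B where B: "B > 0" "\<And>z. norm z < 1 \<Longrightarrow> norm (h1 z) \<le> B" using h1(1) by (auto simp: H_infinity_iff)
  \<comment> \<open>Bounds \<open>h1\<close> times the outer factor. The inverse of the singular
    factor is chosen after \<open>h1\<close>, with the tolerance divided by this constant.\<close>
  define C where "C = B * exp U"
  have C: "C > 0" using B(1) by (simp add: C_def)
  then have "e / (2 * C) > 0" using e by simp
  then obtain h2 where h2: "h2 \<in> H_infinity" "\<And>z. norm z < 1 \<Longrightarrow> w (1 - norm z) * norm (1 - h2 z * singular_inner \<mu> z) \<le> e / (2 * C)"
    using singular_cyclic[OF \<mu>] by blast
  have "w (1 - norm z) * norm (1 - (h1 z * h2 z) * (?O z * singular_inner \<mu> z)) \<le> e" if z: "norm z < 1" for z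
  proof -
    have hO: "norm (h1 z * ?O z) \<le> C"
      using B(2)[OF z] Re_herglotz_real_le[OF u z U] B(1) unfolding C_def norm_mult norm_exp_eq_Re by (intro mult_mono) auto
    have "1 - (h1 z * h2 z) * (?O z * singular_inner \<mu> z) = (1 - h1 z * ?O z) + (h1 z * ?O z) * (1 - h2 z * singular_inner \<mu> z)"
      by (simp add: algebra_simps)
    then have "norm (1 - (h1 z * h2 z) * (?O z * singular_inner \<mu> z)) \<le>
        norm (1 - h1 z * ?O z) + norm (h1 z * ?O z) * norm (1 - h2 z * singular_inner \<mu> z)"
      by (metis norm_mult norm_triangle_ineq)
    also have "\<dots> \<le> norm (1 - h1 z * ?O z) + C * norm (1 - h2 z * singular_inner \<mu> z)"
      using hO by (intro add_left_mono mult_right_mono) auto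
    finally have "w (1 - norm z) * norm (1 - (h1 z * h2 z) * (?O z * singular_inner \<mu> z)) \<le>
        w (1 - norm z) * (norm (1 - h1 z * ?O z) + C * norm (1 - h2 z * singular_inner \<mu> z))"
      using w_disc[OF z] by (intro mult_left_mono) auto
    also have "\<dots> = w (1 - norm z) * norm (1 - h1 z * ?O z) + C * (w (1 - norm z) * norm (1 - h2 z * singular_inner \<mu> z))"
      by (simp add: algebra_simps)
    also have "\<dots> \<le> e / 2 + C * (e / (2 * C))" using h1(2)[OF z] h2(2)[OF z] C by (intro add_mono mult_left_mono) auto
    finally show ?thesis using C by simp
  qed
  then show ?thesis using H_infinity_mult[OF h1(1) h2(1)] by (intro bexI[of _ "\<lambda>z. h1 z * h2 z"]) auto
qed

section \<open>Divisibility by the inner factor\<close>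

context
  fixes I :: "nat set" and \<Lambda> :: "nat \<Rightarrow> complex" and c0 :: complex and \<mu> :: "complex measure" and \<E> :: "complex set set"
  assumes bs: "blaschke_sequence I \<Lambda>" and c0: "norm c0 = 1" and sing: "singular_circle_measure \<mu>"
    and \<E>: "countable \<E>" "\<And>E. E \<in> \<E> \<Longrightarrow> finite_entropy w E" "emeasure \<mu> (unit_circle - \<Union>\<E>) = 0"
begin

lemma inner_divides:
  assumes h: "h \<in> generated_subspace w (\<lambda>z. blaschke_product c0 I \<Lambda> z * singular_inner \<mu> z)"
    and \<sigma>: "circle_finite \<sigma>" and bs': "blaschke_sequence I' \<Lambda>'" and c1: "norm c1 = 1" and u: "integrable circle_measure u"
    and h_eq: "\<And>z. norm z < 1 \<Longrightarrow> h z = exp (herglotz_real u z) * singular_inner \<sigma> z * blaschke_product c1 I' \<Lambda>' z"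
  shows "A \<in> sets circle_borel \<Longrightarrow> emeasure \<mu> A \<le> emeasure \<sigma> A"
    and "norm a < 1 \<Longrightarrow> card {n \<in> I. \<Lambda> n = a} \<le> card {n \<in> I'. \<Lambda>' n = a}"
proof -
  note \<mu> = singular_circle_finite[OF sing]
  show "emeasure \<mu> A \<le> emeasure \<sigma> A" if "A \<in> sets circle_borel"
    by (rule singular_permanence_countable[OF \<mu> blaschke_H_infinity[OF bs c0] blaschke_norm_le[OF bs _ c0] \<E> h \<sigma> bs' c1 u h_eq that])
  have c: "c0 \<noteq> 0" "c1 \<noteq> 0" using c0 c1 by auto
  have hol: "(\<lambda>z. exp (herglotz_real u z) * singular_inner \<sigma> z) holomorphic_on unit_disc"
    using herglotz_real_holomorphic[OF u] singular_inner_holomorphic[OF \<sigma>] by (intro holomorphic_intros)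
  show "card {n \<in> I. \<Lambda> n = a} \<le> card {n \<in> I'. \<Lambda>' n = a}" if "norm a < 1"
    by (rule zero_permanence[OF bs c(1) singular_inner_H_infinity[OF \<mu>] H_infinity_subset[OF inner_H_infinity[OF bs c0 \<mu>]] h bs' c(2) hol _ h_eq that])
      auto
qed

lemma permanence:
  assumes h: "h \<in> generated_subspace w (\<lambda>z. blaschke_product c0 I \<Lambda> z * singular_inner \<mu> z)"
    and fac: "has_smirnov_factorization h \<sigma> c1 I' \<Lambda>'"
  shows "\<exists>k\<in>smirnov_class. \<forall>z\<in>unit_disc. h z = blaschke_product c0 I \<Lambda> z * singular_inner \<mu> z * k z"
proof -
  note \<mu> = singular_circle_finite[OF sing]
  let ?u = "\<lambda>\<zeta>. ln (norm (boundary_value h \<zeta>))"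
  from fac have u: "integrable circle_measure ?u" and sing': "singular_circle_measure \<sigma>" and c1: "norm c1 = 1"
    and bs': "blaschke_sequence I' \<Lambda>'"
    and fz: "\<And>z. norm z < 1 \<Longrightarrow> h z = outer_factor h z * singular_inner \<sigma> z * blaschke_product c1 I' \<Lambda>' z"
    by (auto simp: has_smirnov_factorization_def)
  note \<sigma> = singular_circle_finite[OF sing']
  have div: "A \<in> sets circle_borel \<Longrightarrow> emeasure \<mu> A \<le> emeasure \<sigma> A"
    "norm a < 1 \<Longrightarrow> card {n \<in> I. \<Lambda> n = a} \<le> card {n \<in> I'. \<Lambda>' n = a}" for A a
    by (rule inner_divides[OF h \<sigma> bs' c1 u]; simp add: fz outer_factor_herglotz_real)+
  \<comment> \<open>The singular measure left for the quotient: positive by the domination in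
    \<open>div(1)\<close>, and singular because it lies below \<open>\<sigma>\<close>.\<close>
  define \<sigma>' where "\<sigma>' = diff_measure \<sigma> \<mu>"
  have em: "emeasure \<sigma>' A = emeasure \<sigma> A - emeasure \<mu> A" if "A \<in> sets circle_borel" for A
    unfolding \<sigma>'_def by (rule emeasure_diff_measure) (use div(1) that circle_finiteD[OF \<sigma>] circle_finiteD[OF \<mu>] in auto)
  have s': "sets \<sigma>' = sets circle_borel" using circle_finiteD[OF \<sigma>] by (simp add: \<sigma>'_def)
  have le: "emeasure \<sigma>' A \<le> emeasure \<sigma> A" if "A \<in> sets circle_borel" for A using em[OF that] by (simp add: diff_le_self_ennreal)
  have uc: "unit_circle \<in> sets circle_borel" by (simp add: sets_circle_borel_iff)
  have fin': "finite_measure \<sigma>'"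
  proof (rule finite_measureI)
    have "emeasure \<sigma> unit_circle < \<infinity>" using finite_measure.emeasure_finite[OF circle_finiteD(1)[OF \<sigma>]] by (simp add: less_top)
    then show "emeasure \<sigma>' (space \<sigma>') \<noteq> \<infinity>" using le[OF uc] sets_eq_imp_space_eq[OF s'] by (auto simp: top_unique)
  qed
  have add: "emeasure \<sigma> A = emeasure \<mu> A + emeasure \<sigma>' A" if "A \<in> sets circle_borel" for A
    using em[OF that] div(1)[OF that] by (simp add: add_diff_inverse_ennreal)
  from sing' obtain N where N: "N \<in> sets circle_borel" "emeasure circle_measure N = 0" "emeasure \<sigma> (unit_circle - N) = 0"
    using circle_finiteD[OF \<sigma>] by (auto simp: singular_circle_measure_def mutually_singular_def)
  have "emeasure \<sigma>' (unit_circle - N) = 0" using le[of "unit_circle - N"] N uc by auto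
  then have sing'': "singular_circle_measure \<sigma>'" unfolding singular_circle_measure_def mutually_singular_def
    using fin' s' N sets_eq_imp_space_eq[OF s'] by auto
  note \<sigma>'f = singular_circle_finite[OF sing'']
  obtain J where J: "J \<subseteq> I'" "\<And>z. norm z < 1 \<Longrightarrow> blaschke_product 1 J \<Lambda>' z = blaschke_product 1 I \<Lambda> z"
    using blaschke_divisor[OF bs bs' div(2)] by blast
  have bs'': "blaschke_sequence (I' - J) \<Lambda>'" using bs' by (rule blaschke_sequence_subset) auto
  define c2 where "c2 = c1 / c0"
  have c2: "norm c2 = 1" using c0 c1 by (simp add: c2_def norm_divide)
  have c00: "c0 \<noteq> 0" using c0 by auto
  \<comment> \<open>The quotient is assembled from the complementary factors with the outer factor
    of \<open>h\<close>. That this is also the outer factor of \<open>k\<close> itself, as the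
    factorization demands, follows from \<open>outer_factor_unimodular\<close>.\<close>
  define k where "k z = outer_factor h z * singular_inner \<sigma>' z * blaschke_product c2 (I' - J) \<Lambda>' z" for z
  let ?\<Theta> = "\<lambda>z. blaschke_product c0 I \<Lambda> z * singular_inner \<mu> z"
  have hk: "h z = ?\<Theta> z * k z" if z: "norm z < 1" for z
  proof -
    have "blaschke_product c1 I' \<Lambda>' z = c1 * blaschke_product 1 I \<Lambda> z * blaschke_product 1 (I' - J) \<Lambda>' z"
      using blaschke_product_split[OF bs' z J(1), of c1] J(2)[OF z] blaschke_product_scale[of c1 J \<Lambda>' z] by simp
    moreover have "singular_inner \<sigma> z = singular_inner \<mu> z * singular_inner \<sigma>' z"
      by (rule singular_inner_add[OF \<sigma> \<mu> \<sigma>'f add z])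
    ultimately show ?thesis
      using fz[OF z] blaschke_product_scale[of c0 I \<Lambda> z] blaschke_product_scale[of c2 "I' - J" \<Lambda>' z] c00
      by (simp add: k_def c2_def)
  qed
  have khol: "k holomorphic_on unit_disc"
    unfolding k_def[abs_def] outer_factor_herglotz_real
    using herglotz_real_holomorphic[OF u] singular_inner_holomorphic[OF \<sigma>'f] blaschke_holomorphic[OF bs'']
    by (intro holomorphic_intros)
  have kN: "k \<in> nevanlinna_class"
  proof (rule outer_times_bounded_nevanlinna[OF khol u])
    fix z :: complex assume z: "norm z < 1"
    have "norm (k z) \<le> norm (outer_factor h z) * 1 * 1"
      unfolding k_def norm_mult using norm_singular_inner_le[OF \<sigma>'f z] blaschke_norm_le[OF bs'' z c2]
      by (intro mult_mono) auto
    then show "norm (k z) \<le> exp (Re (herglotz_real ?u z))" by (simp add: outer_factor_herglotz_real)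
  qed
  have ru: "radially_unimodular ?\<Theta>"
    by (rule radially_unimodular_mult[OF blaschke_radially_unimodular[OF bs c0] singular_inner_radially_unimodular[OF sing]])
  note out = outer_factor_unimodular[OF ru hk khol u]
  have "has_smirnov_factorization k \<sigma>' c2 (I' - J) \<Lambda>'"
    unfolding has_smirnov_factorization_def using out sing'' c2 bs'' by (simp add: k_def)
  then have "k \<in> smirnov_class" using kN unfolding smirnov_class_def by blast
  then show ?thesis using hk by auto
qed

text \<open>If the subspace were everything it would contain the constant 1, whose factorization has
  the zero measure and no zeros. Divisibility then forces \<open>\<mu> = 0\<close> and
  \<open>I = {}\<close>, so the inner function is constant.\<close>

lemma inner_proper:
  assumes nc: "\<not> (\<lambda>z. blaschke_product c0 I \<Lambda> z * singular_inner \<mu> z) constant_on unit_disc"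
  shows "generated_subspace w (\<lambda>z. blaschke_product c0 I \<Lambda> z * singular_inner \<mu> z) \<subset> growth_space w"
proof -
  note \<mu> = singular_circle_finite[OF sing]
  let ?\<Theta> = "\<lambda>z. blaschke_product c0 I \<Lambda> z * singular_inner \<mu> z"
  have "generated_subspace w ?\<Theta> \<noteq> growth_space w"
  proof
    assume eq: "generated_subspace w ?\<Theta> = growth_space w"
    have h: "(\<lambda>z. 1) \<in> generated_subspace w ?\<Theta>" unfolding eq by (rule const_in_growth_space)
    define \<sigma> :: "complex measure" where "\<sigma> = null_measure circle_borel"
    have \<sigma>: "circle_finite \<sigma>" unfolding circle_finite_def \<sigma>_def by (auto intro!: finite_measureI)
    have bs': "blaschke_sequence {} \<Lambda>" by (simp add: blaschke_sequence_def)
    have S1: "singular_inner \<sigma> z = 1" for z by (simp add: singular_inner_def \<sigma>_def)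
    have "1 = exp (herglotz_real (\<lambda>_. 0) z) * singular_inner \<sigma> z * blaschke_product 1 {} \<Lambda> z" for z
      by (simp add: S1 herglotz_real_def blaschke_product_finite)
    note div = inner_divides[OF h \<sigma> bs' norm_one integrable_zero this]
    have "emeasure \<mu> A = emeasure \<sigma> A" if "A \<in> sets circle_borel" for A using div(1)[OF that] by (simp add: \<sigma>_def)
    then have "\<mu> = \<sigma>" by (intro measure_eqI) (auto simp: circle_finiteD[OF \<mu>] circle_finiteD[OF \<sigma>])
    moreover have "I = {}"
    proof (rule ccontr)
      assume "I \<noteq> {}"
      then obtain n where n: "n \<in> I" by blast
      have "card {m \<in> I. \<Lambda> m = \<Lambda> n} \<le> 0" using div(2)[OF blaschke_point[OF bs n]] by simp
      then show False using blaschke_finite_fiber[OF bs, of "\<Lambda> n"] n by auto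
    qed
    ultimately have "?\<Theta> z = c0" for z by (simp add: S1 blaschke_product_finite)
    then have "?\<Theta> constant_on unit_disc" by (auto simp: constant_on_def)
    then show False using nc by contradiction
  qed
  then show ?thesis using closed_shift_invariant_generated(3)[OF H_infinity_subset[OF inner_H_infinity[OF bs c0 \<mu>]]] by blast
qed

end

end

text \<open>A constant \<open>\<Theta>\<^sub>0\<close> has modulus 1 and generates the whole space,
  hence the condition on properness. The last clause says that the subspace depends on the zeros and
  on \<open>\<mu>P\<close> alone: \<open>g\<close> may differ from \<open>f\<close> in the outer
  factor, in \<open>\<nu>C\<close> and in the unimodular constant.\<close>

theorem corollary1p2:
  fixes w :: "real \<Rightarrow> real"
    and \<mu> \<mu>P \<mu>C :: "complex measure"
    and f :: "complex \<Rightarrow> complex"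
    and c :: complex and I :: "nat set" and \<Lambda> :: "nat \<Rightarrow> complex"
  defines "\<Theta>\<^sub>0 \<equiv> \<lambda>z. blaschke_product c I \<Lambda> z * singular_inner \<mu>P z"
  assumes "majorant w"
    and "log_square_comparable w"
    and "singular_circle_measure \<mu>"
    and "entropy_decomposition w \<mu> \<mu>P \<mu>C"
    and "f \<in> H_infinity"
    and "has_smirnov_factorization f \<mu> c I \<Lambda>"
  shows "(\<not> \<Theta>\<^sub>0 constant_on unit_disc \<longrightarrow> generated_subspace w \<Theta>\<^sub>0 \<subset> growth_space w) \<and>
    generated_subspace w \<Theta>\<^sub>0 \<inter> smirnov_class \<subseteq>
      {h. \<exists>k\<in>smirnov_class. \<forall>z\<in>unit_disc. h z = \<Theta>\<^sub>0 z * k z} \<and>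
    cyclic_in_growth_space w (\<lambda>z. outer_factor f z * singular_inner \<mu>C z) \<and>
    generated_subspace w f = generated_subspace w \<Theta>\<^sub>0 \<and>
    (\<forall>g \<nu> \<nu>C c'. g \<in> H_infinity \<and> has_smirnov_factorization g \<nu> c' I \<Lambda> \<and>
       entropy_decomposition w \<nu> \<mu>P \<nu>C \<longrightarrow> generated_subspace w g = generated_subspace w f)"
proof -
  obtain K L where "entropy_weight w K L" using majorant_entropy_weight[OF \<open>majorant w\<close> \<open>log_square_comparable w\<close>] .
  then interpret entropy_weight w K L .
  \<comment> \<open>Stated for every bounded \<open>g\<close> with these zeros and this
    \<open>\<mu>P\<close>, so that it serves both \<open>f\<close> and the functions compared with
    it in the last clause.\<close>
  have fac: "cyclic_in_growth_space w (\<lambda>z. outer_factor g z * singular_inner \<nu>C z) \<and>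
      generated_subspace w g = generated_subspace w (\<lambda>z. blaschke_product b I \<Lambda> z * singular_inner \<mu>P z)"
    if g: "g \<in> H_infinity" "has_smirnov_factorization g \<nu> b I \<Lambda>" and d: "entropy_decomposition w \<nu> \<mu>P \<nu>C" for g \<nu> \<nu>C b
  proof -
    let ?u = "\<lambda>\<zeta>. ln (norm (boundary_value g \<zeta>))"
    from g(2) have u: "integrable circle_measure ?u" and sing: "singular_circle_measure \<nu>" and b: "norm b = 1"
      and bs: "blaschke_sequence I \<Lambda>"
      and fz: "\<And>z. norm z < 1 \<Longrightarrow> g z = outer_factor g z * singular_inner \<nu> z * blaschke_product b I \<Lambda> z"
      by (auto simp: has_smirnov_factorization_def)
    from entropy_decomposition_parts[OF sing d] have P: "circle_finite \<mu>P" and C: "circle_finite \<nu>C" and sP: "singular_circle_measure \<mu>P"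
      and add: "\<And>A. A \<in> sets circle_borel \<Longrightarrow> emeasure \<nu> A = emeasure \<mu>P A + emeasure \<nu>C A"
      and nC: "\<And>E. finite_entropy w E \<Longrightarrow> emeasure \<nu>C E = 0"
      by auto
    obtain U where U: "\<And>\<zeta>. norm \<zeta> = 1 \<Longrightarrow> ?u \<zeta> \<le> U" using ln_boundary_value_le[OF g(1)] by blast
    have O: "outer_factor g \<in> H_infinity"
      unfolding H_infinity_iff
    proof (intro conjI exI[of _ "exp U"] allI impI)
      have "(\<lambda>z. exp (herglotz_real ?u z)) holomorphic_on unit_disc"
        by (intro holomorphic_intros herglotz_real_holomorphic[OF u])
      then show "outer_factor g holomorphic_on unit_disc" by (simp add: outer_factor_herglotz_real[abs_def])
      show "norm (outer_factor g z) \<le> exp U" if "norm z < 1" for z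
        using Re_herglotz_real_le[OF u that U] by (simp add: outer_factor_herglotz_real)
    qed simp
    let ?F = "\<lambda>z. outer_factor g z * singular_inner \<nu>C z"
    have F: "?F \<in> H_infinity" by (rule H_infinity_mult[OF O singular_inner_H_infinity[OF C]])
    have ap: "\<exists>h\<in>H_infinity. \<forall>z. norm z < 1 \<longrightarrow> w (1 - norm z) * norm (1 - h z * ?F z) \<le> e" if "e > 0" for e
      using outer_singular_inverse[OF u U C nC that] by (simp add: outer_factor_herglotz_real)
    have gF: "g z = blaschke_product b I \<Lambda> z * singular_inner \<mu>P z * ?F z" if "norm z < 1" for z
      using fz[OF that] singular_inner_add[OF singular_circle_finite[OF sing] P C add that] by simp
    have \<Theta>: "(\<lambda>z. blaschke_product b I \<Lambda> z * singular_inner \<mu>P z) \<in> H_infinity"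
      by (rule inner_H_infinity[OF bs b P])
    show ?thesis using cyclic_criterion[OF F ap] generated_subspace_eqI[OF \<Theta> F g(1) gF ap] by blast
  qed
  from \<open>has_smirnov_factorization f \<mu> c I \<Lambda>\<close> have bs: "blaschke_sequence I \<Lambda>" and c: "norm c = 1"
    by (auto simp: has_smirnov_factorization_def)
  from entropy_decomposition_parts[OF \<open>singular_circle_measure \<mu>\<close> \<open>entropy_decomposition w \<mu> \<mu>P \<mu>C\<close>] obtain \<E>
    where sP: "singular_circle_measure \<mu>P"
      and E: "countable \<E>" "\<And>E. E \<in> \<E> \<Longrightarrow> finite_entropy w E" "emeasure \<mu>P (unit_circle - \<Union>\<E>) = 0"
    by auto
  have proper: "generated_subspace w \<Theta>\<^sub>0 \<subset> growth_space w" if "\<not> \<Theta>\<^sub>0 constant_on unit_disc"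
    using inner_proper[OF bs c sP E] that unfolding \<Theta>\<^sub>0_def by blast
  have perm: "\<exists>k\<in>smirnov_class. \<forall>z\<in>unit_disc. h z = \<Theta>\<^sub>0 z * k z"
    if h: "h \<in> generated_subspace w \<Theta>\<^sub>0" "h \<in> smirnov_class" for h
  proof (cases "\<forall>z\<in>unit_disc. h z = 0")
    case True
    \<comment> \<open>The zero function belongs to the class by convention and has no factorization,
      so its quotient is given directly.\<close>
    have "(\<lambda>z. 0) \<in> smirnov_class" by (auto simp: smirnov_class_def nevanlinna_class_def intro!: bdd_aboveI2)
    then show ?thesis using True by (intro bexI[of _ "\<lambda>z. 0"]) simp_all
  next
    case False
    then obtain \<sigma> c1 I' \<Lambda>' where "has_smirnov_factorization h \<sigma> c1 I' \<Lambda>'" using h(2) by (auto simp: smirnov_class_def)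
    from permanence[OF bs c sP E(1) E(2) E(3) h(1)[unfolded \<Theta>\<^sub>0_def] this] show ?thesis unfolding \<Theta>\<^sub>0_def by simp
  qed
  have same: "generated_subspace w g = generated_subspace w \<Theta>\<^sub>0"
    if g: "g \<in> H_infinity" "has_smirnov_factorization g \<nu> b I \<Lambda>" "entropy_decomposition w \<nu> \<mu>P \<nu>C" for g \<nu> \<nu>C b
  proof -
    \<comment> \<open>The unimodular constants \<open>b\<close> and \<open>c\<close> may differ;
      their ratio is a nonzero scalar, which does not change the generated subspace.\<close>
    from g(2) have "norm b = 1" by (simp add: has_smirnov_factorization_def)
    then have bc: "b / c \<noteq> 0" "c \<noteq> 0" using c by auto
    have "blaschke_product b I \<Lambda> z * singular_inner \<mu>P z = b / c * \<Theta>\<^sub>0 z" for z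
      using bc unfolding \<Theta>\<^sub>0_def blaschke_product_scale[of b I \<Lambda> z] blaschke_product_scale[of c I \<Lambda> z] by simp
    moreover have "\<Theta>\<^sub>0 \<in> growth_space w" unfolding \<Theta>\<^sub>0_def by (rule H_infinity_subset[OF inner_H_infinity[OF bs c singular_circle_finite[OF sP]]])
    ultimately show ?thesis using fac[OF g] generated_subspace_scale[OF _ bc(1), of \<Theta>\<^sub>0] by simp
  qed
  note f = \<open>f \<in> H_infinity\<close> \<open>has_smirnov_factorization f \<mu> c I \<Lambda>\<close> \<open>entropy_decomposition w \<mu> \<mu>P \<mu>C\<close>
  show ?thesis
    using proper perm fac[OF f] same[OF f] same by blast
qed

end
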